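(* Let $n,N\ge 1$ be integers, let $V$ be a nonnegative bounded function on $(\mathbb{Z}^n)^N$, and let $$\widetilde V(\xi_1,\dots,\xi_N)=\sum_{\nu_1,\dots,\nu_N\in\mathbb{Z}^n}V(\nu_1,\dots,\nu_N)\prod_{j=1}^N\mathbf 1_Q(\xi_j-\nu_j),\qquad (\xi_1,\dots,\xi_N)\in(\mathbb{R}^n)^N,$$ where $Q=[-1/2,1/2)^n$. Then the following hold. (1) If there exist $q_1,\dots,q_N,r\in(0,\infty]$ such that for every $\sigma\in S^{\widetilde V}_{0,0}(\mathbb{R}^n,N)$ the operator $T_\sigma$ is bounded from $(L^2,\ell^{q_1})\times\dots\times(L^2,\ell^{q_N})$ to $(L^2,\ell^r)$, then $V\in\mathcal B_N((\mathbb{Z}^n)^N)$. (2) Conversely, if $V\in\mathcal B_N((\mathbb{Z}^n)^N)$, then for every $\sigma\in S^{\widetilde V}_{0,0}(\mathbb{R}^n,N)$ the operator $T_\sigma$ is bounded from $(L^2,\ell^{q_1})\times\dots\times(L^2,\ell^{q_N})$ to $(L^2,\ell^r)$ for all $q_1,\dots,q_N,r\in(0,\infty]$ satisfying $1/q_1+\dots+1/q_N\ge 1/r$.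
   Context: Operators. For a bounded measurable function $\sigma=\sigma(x,\xi_1,\dots,\xi_N)$ on $(\mathbb{R}^n)^{N+1}$ and $f_1,\dots,f_N\in\mathcal S(\mathbb{R}^n)$ (Schwartz functions), $$T_\sigma(f_1,\dots,f_N)(x)=\frac1{(2\pi)^{Nn}}\int_{(\mathbb{R}^n)^N}e^{ix\cdot(\xi_1+\dots+\xi_N)}\sigma(x,\xi_1,\dots,\xi_N)\prod_{j=1}^N\widehat{f_j}(\xi_j)\,d\xi_1\cdots d\xi_N,$$ with $\widehat f(\xi)=\int e^{-ix\cdot\xi}f(x)\,dx$. Boundedness. For (quasi-)normed function spaces $X_1,\dots,X_N,Y$ on $\mathbb{R}^n$, "$T_\sigma$ is bounded from $X_1\times\dots\times X_N$ to $Y$" means that there is a constant $A$ with $\|T_\sigma(f_1,\dots,f_N)\|_Y\le A\prod_{j=1}^N\|f_j\|_{X_j}$ for all $f_j\in\mathcal S\cap X_j$, $j=1,\dots,N$. Symbol class. For a nonnegative function $W$ on $(\mathbb{R}^n)^N$, $S^W_{0,0}(\mathbb{R}^n,N)$ is the set of smooth functions $\sigma(x,\xi_1,\dots,\xi_N)$ on $(\mathbb{R}^n)^{N+1}$ such that for all multi-indices $\alpha,\beta_1,\dots,\beta_N\in\mathbb{N}_0^n$ there is a constant $C_{\alpha,\beta_1,\dots,\beta_N}$ with $|\partial_x^\alpha\partial_{\xi_1}^{\beta_1}\cdots\partial_{\xi_N}^{\beta_N}\sigma(x,\xi_1,\dots,\xi_N)|\le C_{\alpha,\beta_1,\dots,\beta_N}W(\xi_1,\dots,\xi_N)$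 everywhere. Class $\mathcal B_N$. $\mathcal B_N((\mathbb{Z}^n)^N)$ is the set of nonnegative functions $V$ on $(\mathbb{Z}^n)^N$ for which there is $c\in(0,\infty)$ such that $$\sum_{\nu_1,\dots,\nu_N\in\mathbb{Z}^n}V(\nu_1,\dots,\nu_N)A_0(\nu_1+\dots+\nu_N)\prod_{j=1}^NA_j(\nu_j)\le c\prod_{j=0}^N\|A_j\|_{\ell^2(\mathbb{Z}^n)}$$ for all nonnegative functions $A_0,A_1,\dots,A_N$ on $\mathbb{Z}^n$. Amalgam spaces. For $0<p,q\le\infty$, $(L^p,\ell^q)=(L^p,\ell^q)(\mathbb{R}^n)$ is the set of measurable $f$ on $\mathbb{R}^n$ with $\|f\|_{(L^p,\ell^q)}=\big\{\sum_{\nu\in\mathbb{Z}^n}\big(\int_Q|f(x+\nu)|^p\,dx\big)^{q/p}\big\}^{1/q}<\infty$ (usual modifications if $p$ or $q$ is $\infty$). *)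

theory Defs
  imports "HOL-Analysis.Analysis" "HOL-Probability.Essential_Supremum"
begin

section \<open>Partial derivatives, smooth functions and Schwartz functions\<close>

definition partial :: "'a::euclidean_space \<Rightarrow> ('a \<Rightarrow> complex) \<Rightarrow> 'a \<Rightarrow> complex" where
  "partial b f x = vector_derivative (\<lambda>t::real. f (x + t *\<^sub>R b)) (at 0)"

text \<open>All iterated partial derivatives, in every order of the coordinate directions, exist and are
  (Frechet) differentiable, hence continuous: this is $C^\infty$ on the whole space.\<close>

definition smooth :: "('a::euclidean_space \<Rightarrow> complex) \<Rightarrow> bool" where
  "smooth f \<longleftrightarrow> (\<forall>bs. set bs \<subseteq> Basis \<longrightarrow> (\<forall>x. (foldr partial bs f) differentiable (at x)))"

text \<open>A multi-index on a Euclidean space is a function \<open>\<alpha>\<close> assigning to each basis vector \<open>b\<close> the order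
  \<open>\<alpha> b\<close> of differentiation in direction \<open>b\<close>; values off the basis are ignored. The coordinate directions are
  taken in some fixed enumeration, which is immaterial for smooth functions.
  On the space \<open>(real ^ 'n) \<times> (real ^ 'n) ^ 'm\<close>, whose basis is the disjoint union of the coordinate
  directions of \<open>x\<close>, \<open>\<xi>\<^sub>1\<close>, \dots, \<open>\<xi>\<^sub>N\<close>, such an \<open>\<alpha>\<close> is exactly a tuple
  \<open>(\<alpha>, \<beta>\<^sub>1, \<dots>, \<beta>\<^sub>N)\<close> of multi-indices on $\mathbb{R}^n$.\<close>

definition basis_list :: "'a::euclidean_space list" where
  "basis_list = (SOME bs. set bs = Basis \<and> distinct bs)"

lemma basis_list: "set (basis_list :: 'a::euclidean_space list) = Basis"
    "distinct (basis_list :: 'a::euclidean_space list)"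
proof -
  have "set (basis_list :: 'a list) = Basis \<and> distinct (basis_list :: 'a list)"
    unfolding basis_list_def by (rule someI_ex) (rule finite_distinct_list[OF finite_Basis])
  then show "set (basis_list :: 'a list) = Basis" "distinct (basis_list :: 'a list)" by auto
qed

definition mderiv :: "('a::euclidean_space \<Rightarrow> nat) \<Rightarrow> ('a \<Rightarrow> complex) \<Rightarrow> 'a \<Rightarrow> complex" where
  "mderiv \<alpha> f = foldr (\<lambda>b. partial b ^^ \<alpha> b) basis_list f"

definition schwartz :: "('a::euclidean_space \<Rightarrow> complex) \<Rightarrow> bool" where
  "schwartz f \<longleftrightarrow> smooth f \<and>
     (\<forall>\<alpha> \<beta>. \<exists>C. \<forall>x. norm ((\<Prod>b\<in>Basis. (x \<bullet> b) ^ \<alpha> b) *\<^sub>R mderiv \<beta> f x) \<le> C)"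

section \<open>Multilinear pseudo-differential operators\<close>

definition fourier :: "('a::euclidean_space \<Rightarrow> complex) \<Rightarrow> 'a \<Rightarrow> complex" where
  "fourier f \<xi> = (LINT x|lborel. exp (- \<i> * of_real (x \<bullet> \<xi>)) * f x)"

text \<open>The number $N$ of arguments is \<open>CARD('m)\<close>, the dimension $n$ is \<open>CARD('n)\<close>.\<close>

definition pseudo_op ::
  "((real ^ 'n) \<times> ((real ^ 'n) ^ 'm) \<Rightarrow> complex) \<Rightarrow> ('m \<Rightarrow> real ^ 'n \<Rightarrow> complex) \<Rightarrow> real ^ 'n \<Rightarrow> complex" where
  "pseudo_op \<sigma> f x = 1 / (2 * of_real pi) ^ (CARD('m) * CARD('n)) *
     (LINT \<xi>|lborel. exp (\<i> * of_real (x \<bullet> (\<Sum>j\<in>UNIV. \<xi> $ j))) * \<sigma> (x, \<xi>) *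
        (\<Prod>j\<in>UNIV. fourier (f j) (\<xi> $ j)))"

definition symbol_class ::
  "((real ^ 'n) ^ 'm \<Rightarrow> real) \<Rightarrow> ((real ^ 'n) \<times> ((real ^ 'n) ^ 'm) \<Rightarrow> complex) set" where
  "symbol_class W = {\<sigma>. smooth \<sigma> \<and> (\<forall>\<alpha>. \<exists>C. \<forall>x \<xi>. norm (mderiv \<alpha> \<sigma> (x, \<xi>)) \<le> C * W \<xi>)}"

section \<open>Lebesgue, sequence and amalgam (quasi-)norms\<close>

definition epowr :: "ennreal \<Rightarrow> real \<Rightarrow> ennreal" where
  "epowr a r = (if a = top then top else ennreal (enn2real a powr r))"

text \<open>The $L^p$ (quasi-)norm, \<open>0 < p \<le> \<infinity>\<close>, of a nonnegative function. For counting measure it is the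
  $\ell^p$ (quasi-)norm.\<close>

definition Lp_norm :: "'a measure \<Rightarrow> ennreal \<Rightarrow> ('a \<Rightarrow> ennreal) \<Rightarrow> ennreal" where
  "Lp_norm M p f = (if p = top then esssup M f
     else epowr (\<integral>\<^sup>+ x. epowr (f x) (enn2real p) \<partial>M) (1 / enn2real p))"

definition unit_cube :: "(real ^ 'n) set" where
  "unit_cube = {x. \<forall>i. - 1 / 2 \<le> x $ i \<and> x $ i < 1 / 2}"

definition lattice_pt :: "int ^ 'n \<Rightarrow> real ^ 'n" where
  "lattice_pt \<nu> = (\<chi> i. of_int (\<nu> $ i))"

definition amalgam_norm :: "ennreal \<Rightarrow> ennreal \<Rightarrow> (real ^ 'n \<Rightarrow> complex) \<Rightarrow> ennreal" where
  "amalgam_norm p q f = Lp_norm (count_space (UNIV :: (int ^ 'n) set)) q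
     (\<lambda>\<nu>. Lp_norm (restrict_space lebesgue unit_cube) p (\<lambda>x. ennreal (norm (f (x + lattice_pt \<nu>)))))"

definition amalgam_space :: "ennreal \<Rightarrow> ennreal \<Rightarrow> (real ^ 'n \<Rightarrow> complex) set" where
  "amalgam_space p q = {f. f \<in> borel_measurable lebesgue \<and> amalgam_norm p q f < top}"

text \<open>Boundedness from $(L^{p_1},\ell^{q_1}) \times \dots \times (L^{p_N},\ell^{q_N})$ to $(L^p,\ell^r)$,
  tested on Schwartz functions.\<close>

definition amalgam_bounded ::
  "(('m::finite \<Rightarrow> real ^ 'n \<Rightarrow> complex) \<Rightarrow> real ^ 'n \<Rightarrow> complex) \<Rightarrow>
   ('m \<Rightarrow> ennreal) \<Rightarrow> ('m \<Rightarrow> ennreal) \<Rightarrow> ennreal \<Rightarrow> ennreal \<Rightarrow> bool" where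
  "amalgam_bounded T ps qs p r \<longleftrightarrow>
     (\<exists>A::real. \<forall>f. (\<forall>j. schwartz (f j) \<and> f j \<in> amalgam_space (ps j) (qs j)) \<longrightarrow>
        amalgam_norm p r (T f) \<le> ennreal A * (\<Prod>j\<in>UNIV. amalgam_norm (ps j) (qs j) (f j)))"

section \<open>The class \<open>\<B>\<^sub>N\<close> and the weight on $(\mathbb{R}^n)^N$\<close>

text \<open>Both sides are computed in \<open>[0, \<infinity>]\<close>. The convention \<open>0 * \<infinity> = 0\<close> on the right is harmless:
  if some \<open>A\<^sub>j\<close> has norm \<open>0\<close>, then it vanishes identically and so does the left-hand side.\<close>

definition B_class :: "((int ^ 'n) ^ 'm \<Rightarrow> real) set" where
  "B_class = {V. (\<forall>\<nu>. 0 \<le> V \<nu>) \<and>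
     (\<exists>c::real. 0 < c \<and>
       (\<forall>(A0 :: int ^ 'n \<Rightarrow> real) (A :: 'm \<Rightarrow> int ^ 'n \<Rightarrow> real).
          (\<forall>\<mu>. 0 \<le> A0 \<mu>) \<and> (\<forall>j \<mu>. 0 \<le> A j \<mu>) \<longrightarrow>
          (\<integral>\<^sup>+ \<nu>. ennreal (V \<nu> * A0 (\<Sum>j\<in>UNIV. \<nu> $ j) * (\<Prod>j\<in>UNIV. A j (\<nu> $ j))) \<partial>count_space UNIV)
          \<le> ennreal c * (Lp_norm (count_space UNIV) 2 (\<lambda>\<mu>. ennreal (A0 \<mu>)) *
              (\<Prod>j\<in>UNIV. Lp_norm (count_space UNIV) 2 (\<lambda>\<mu>. ennreal (A j \<mu>))))))}"

definition extend_weight :: "((int ^ 'n) ^ 'm \<Rightarrow> real) \<Rightarrow> (real ^ 'n) ^ 'm \<Rightarrow> real" where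
  "extend_weight V \<xi> =
     (\<Sum>\<^sub>\<infinity>\<nu>\<in>UNIV. V \<nu> * (\<Prod>j\<in>UNIV. indicator unit_cube (\<xi> $ j - lattice_pt (\<nu> $ j))))"

end

theory Submission
  imports Defs "HOL-Probability.Probability"
begin

text \<open>Sufficiency. Multiplying \<open>f\<^sub>j\<close> by a coordinate of \<open>y\<close> differentiates its Fourier transform, and integration
  by parts moves the derivative to \<open>e\<^bsup>ix\<xi>\<^esup>\<close>, which produces the same coordinate of \<open>x\<close>, and to the symbol.
  Hence, when \<open>T\<^sub>\<sigma>(f\<^sub>1,\<dots>,f\<^sub>N)\<close> is only looked at on the cube \<open>t + Q\<close>, each \<open>f\<^sub>j\<close> may be replaced by its
  product with any power of \<open>(1 + \<bar>t - y\<bar>)\<^sup>-\<^sup>1\<close>. The dependence of \<open>\<sigma>\<close> on \<open>x\<close> is removed by writing \<open>\<sigma>\<close> as an average of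
  the frozen symbols \<open>\<sigma>'(x - y, \<cdot>)\<close>. For a frozen symbol the condition \<open>V \<in> \<B>\<^sub>N\<close>, transferred from
  \<open>\<int>\<^sup>n\<close> to \<open>\<real>\<^sup>n\<close> by averaging over cells, and Plancherel's inequality give an \<open>L\<^sup>2\<close> bound. Summing over
  \<open>t \<in> \<int>\<^sup>n\<close> and using Hoelder's inequality for sequences yields the amalgam estimate.

  Necessity. The symbol equal to \<open>V(\<nu>)\<close> times a bump on the cell of each \<open>\<nu>\<close> is tested on sums of
  Gaussian wave packets \<open>\<Sum>\<^sub>\<kappa> A\<^sub>j(\<kappa>) e\<^bsup>i\<kappa>y\<^esup> e\<^bsup>-|y|\<^sup>2/2\<^esup>\<close>. Their amalgam norms are at most a constant times \<open>\<parallel>A\<^sub>j\<parallel>\<^sub>2\<close>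
  for every exponent, while the Gaussian weighted \<open>L\<^sup>2\<close> norm of the output dominates
  \<open>\<Sum>\<^sub>\<mu> (\<Sum>\<^bsub>\<nu>\<^sub>1+\<dots>+\<nu>\<^sub>N=\<mu>\<^esub> V(\<nu>) \<Prod>\<^sub>j A\<^sub>j(\<nu>\<^sub>j))\<^sup>2\<close>, which is the dual form of \<open>V \<in> \<B>\<^sub>N\<close>.\<close>

section \<open>Iterated partial derivatives\<close>

text \<open>Plancherel's inequality needs a frequency side free of x. The kernel
  \<open>exp_kernel\<close> is the fundamental solution of 1 + d/ds, so \<sigma>' is the product
  over i of 1 + d/dx_i applied to \<sigma>, again a symbol of the class. With z = x - y the symbol
  is frozen at z, and x survives only in the exponential and in the kernel at x - z; on a unit cube
  around t that kernel is dominated by a weight in t - z alone, after which x can be integrated over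
  the whole space. This is why every estimate is local in x. Small exponents are the second
  obstacle: the local L2 norms of f_j have to be summed against a decaying weight and bounded by a
  weighted l^q sum, which takes M \<ge> 1 + 2/q_j powers of the weight; they are acquired one factor
  at a time, each for one \<xi>-derivative of the symbol. For necessity the exponents are given and
  arbitrary, so the test functions must be controlled in every amalgam norm at once. As V jumps
  between cells while symbols are smooth, the bumps vanish near all cell boundaries.\<close>

lemma partial_eq_derivative:
  assumes "(f has_derivative D) (at x)"
  shows "partial b f x = D b"
proof -
  have "((\<lambda>t::real. x + t *\<^sub>R b) has_derivative (\<lambda>t. t *\<^sub>R b)) (at 0)"
    by (auto intro!: derivative_eq_intros)
  moreover have "(f has_derivative D) (at (x + 0 *\<^sub>R b))" using assms by simp
  ultimately have "((\<lambda>t::real. f (x + t *\<^sub>R b)) has_derivative (\<lambda>t. D (t *\<^sub>R b))) (at 0)"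
    by (rule has_derivative_compose)
  then have "((\<lambda>t::real. f (x + t *\<^sub>R b)) has_vector_derivative D b) (at 0)"
    unfolding has_vector_derivative_def
    using linear_scale[OF has_derivative_linear[OF assms]] by (simp add: scaleR_conv_of_real)
  then show ?thesis unfolding partial_def by (rule vector_derivative_at)
qed

lemma partial_eq_frechet:
  "f differentiable (at x) \<Longrightarrow> partial b f x = frechet_derivative f (at x) b"
  by (intro partial_eq_derivative) (simp add: frechet_derivative_works[symmetric])

lemma has_vector_derivative_along_line:
  assumes "\<And>x. f differentiable (at x)"
  shows "((\<lambda>t. f (x + t *\<^sub>R b)) has_vector_derivative partial b f (x + t *\<^sub>R b)) (at t within S)"
proof -
  let ?D = "frechet_derivative f (at (x + t *\<^sub>R b))"
  have d: "(f has_derivative ?D) (at (x + t *\<^sub>R b))"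
    using assms frechet_derivative_works by blast
  have "((\<lambda>t::real. x + t *\<^sub>R b) has_derivative (\<lambda>t. t *\<^sub>R b)) (at t)"
    by (auto intro!: derivative_eq_intros)
  then have "((\<lambda>t::real. f (x + t *\<^sub>R b)) has_derivative (\<lambda>t. ?D (t *\<^sub>R b))) (at t)"
    using d by (rule has_derivative_compose)
  then have "((\<lambda>t. f (x + t *\<^sub>R b)) has_vector_derivative partial b f (x + t *\<^sub>R b)) (at t)"
    unfolding has_vector_derivative_def partial_eq_derivative[OF d]
    using linear_scale[OF has_derivative_linear[OF d]] by simp
  then show ?thesis by (rule has_vector_derivative_at_within)
qed

lemma partial_add:
  assumes "f differentiable (at x)" "g differentiable (at x)"
  shows "partial b (\<lambda>x. f x + g x) x = partial b f x + partial b g x"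
  using partial_eq_derivative[OF has_derivative_add[OF
      assms[unfolded frechet_derivative_works]]] assms by (simp add: partial_eq_frechet)

lemma partial_mult:
  assumes "f differentiable (at x)" "g differentiable (at x)"
  shows "partial b (\<lambda>x. f x * g x) x = partial b f x * g x + f x * partial b g x"
  using partial_eq_derivative[OF has_derivative_mult[OF
      assms[unfolded frechet_derivative_works]]] assms by (simp add: partial_eq_frechet add.commute)

text \<open>Iterated derivatives are never computed: it suffices to name a family that contains the
  function and is stable under first partial derivatives. Later proofs of smoothness and decay only
  choose such a family.\<close>

lemma smooth_coinduct:
  assumes "f \<in> C" and "\<And>f x. f \<in> C \<Longrightarrow> f differentiable (at x)"
    and "\<And>f b. f \<in> C \<Longrightarrow> b \<in> Basis \<Longrightarrow> partial b f \<in> C"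
  shows "smooth f" and "set bs \<subseteq> Basis \<Longrightarrow> foldr partial bs f \<in> C"
proof -
  have *: "set bs \<subseteq> Basis \<Longrightarrow> foldr partial bs f \<in> C" for bs
    by (induction bs) (auto intro: assms)
  then show "smooth f" unfolding smooth_def using assms(2) by blast
  show "set bs \<subseteq> Basis \<Longrightarrow> foldr partial bs f \<in> C" by fact
qed

lemma smooth_differentiable: "smooth f \<Longrightarrow> f differentiable (at x)"
  unfolding smooth_def by (metis foldr_Nil id_apply empty_set empty_subsetI)

lemma smooth_foldr_partial:
  assumes "smooth f" "set bs \<subseteq> Basis"
  shows "smooth (foldr partial bs f)"
  unfolding smooth_def
proof (intro allI impI)
  fix cs x assume "set cs \<subseteq> (Basis :: 'a set)"
  then have "foldr partial (cs @ bs) f differentiable at x"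
    using assms unfolding smooth_def by (metis Un_least set_append)
  then show "foldr partial cs (foldr partial bs f) differentiable at x" by simp
qed

lemma smooth_partial: "smooth f \<Longrightarrow> b \<in> Basis \<Longrightarrow> smooth (partial b f)"
  using smooth_foldr_partial[of f "[b]"] by simp

lemma smooth_continuous: "smooth f \<Longrightarrow> continuous_on S f"
  by (meson continuous_at_imp_continuous_on differentiable_imp_continuous_within smooth_differentiable)

lemma smooth_measurable: "smooth f \<Longrightarrow> f \<in> borel_measurable borel"
  by (intro borel_measurable_continuous_onI smooth_continuous)

text \<open>The second difference of \<open>f\<close> over a square of side \<open>h\<close> is asymptotic to \<open>h\<^sup>2\<close> times either mixed
  derivative.\<close>

lemma second_difference:
  assumes f: "\<And>x. f differentiable (at x)" and fa: "partial a f differentiable (at x)"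
    and a: "norm a = 1" and b: "norm b = 1" and e: "0 < e"
  shows "\<exists>d>0. \<forall>h. 0 < h \<and> h < d \<longrightarrow>
    norm (f (x + h *\<^sub>R a + h *\<^sub>R b) - f (x + h *\<^sub>R a) - f (x + h *\<^sub>R b) + f x
      - (h^2) *\<^sub>R partial b (partial a f) x) \<le> e * h^2"
proof -
  let ?D = "frechet_derivative (partial a f) (at x)"
  have D: "(partial a f has_derivative ?D) (at x)" using fa frechet_derivative_works by blast
  have lin: "linear ?D" using D by (rule has_derivative_linear)
  have L: "partial b (partial a f) x = ?D b" by (rule partial_eq_derivative[OF D])
  \<comment> \<open>The third is spent below on two remainders, at displacements of norm at most 2h
    and h.\<close>
  obtain d where d: "d > 0" and
    r: "\<And>y. norm (y - x) < d \<Longrightarrow> norm (partial a f y - partial a f x - ?D (y - x)) \<le> (e/3) * norm (y - x)"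
    using D[unfolded has_derivative_at_alt, THEN conjunct2, rule_format, of "e/3"] e by auto
  show ?thesis
  proof (intro exI[of _ "d/2"] conjI allI impI)
    show "d/2 > 0" using d by simp
    fix h assume h: "0 < h \<and> h < d / 2"
    \<comment> \<open>\<open>p\<close> is the first difference in direction b with its linear
      prediction removed, followed along the segment in direction a. Its derivative
      \<open>p'\<close> is a difference of two remainders of \<open>partial a f\<close> at x, which
      the mean value inequality then integrates.\<close>
    define p where "p s = f (x + h *\<^sub>R b + s *\<^sub>R a) - f (x + s *\<^sub>R a) - s *\<^sub>R (h *\<^sub>R ?D b)" for s
    define p' where "p' s = partial a f (x + h *\<^sub>R b + s *\<^sub>R a) - partial a f (x + s *\<^sub>R a) - h *\<^sub>R ?D b" for s
    have bound: "norm (p h - p 0) \<le> (e * h) * norm (h - 0)"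
    proof (rule differentiable_bound[of "{0..h}" p "\<lambda>s t. t *\<^sub>R p' s"])
      fix s assume s: "s \<in> {0..h}"
      have "(p has_vector_derivative p' s) (at s within {0..h})"
        unfolding p_def p'_def
        by (intro has_vector_derivative_diff has_vector_derivative_along_line f)
          (auto intro!: derivative_eq_intros)
      then show "(p has_derivative (\<lambda>t. t *\<^sub>R p' s)) (at s within {0..h})"
        by (simp add: has_vector_derivative_def)
      have n1: "norm (h *\<^sub>R b + s *\<^sub>R a) \<le> 2 * h" using s h a b
        by (intro order.trans[OF norm_triangle_ineq]) simp
      have n2: "norm (s *\<^sub>R a) \<le> h" using s a by simp
      let ?r = "\<lambda>v. partial a f (x + v) - partial a f x - ?D v"
      have r': "norm (?r v) \<le> (e/3) * norm v" if "norm v < d" for v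
        using r[of "x + v"] that by simp
      have "p' s = ?r (h *\<^sub>R b + s *\<^sub>R a) - ?r (s *\<^sub>R a)"
        unfolding p'_def linear_add[OF lin] linear_scale[OF lin] by (simp add: add.assoc)
      then have "norm (p' s) \<le> norm (?r (h *\<^sub>R b + s *\<^sub>R a)) + norm (?r (s *\<^sub>R a))"
        by (simp only: norm_triangle_ineq4)
      also have "\<dots> \<le> (e/3) * (2 * h) + (e/3) * h"
        using n1 n2 h e
        by (intro add_mono order.trans[OF r'] mult_left_mono) auto
      also have "\<dots> = e * h" by (simp add: field_simps)
      finally have "norm (p' s) \<le> e * h" .
      then have "\<bar>t\<bar> * norm (p' s) \<le> e * h * \<bar>t\<bar>" for t :: real
        using mult_left_mono[of "norm (p' s)" "e * h" "\<bar>t\<bar>"] by (simp add: mult.commute)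
      then show "onorm (\<lambda>t. t *\<^sub>R p' s) \<le> e * h"
        using e h by (intro onorm_bound) auto
    qed (use h in auto)
    have eq: "p h - p 0 = f (x + h *\<^sub>R a + h *\<^sub>R b) - f (x + h *\<^sub>R a) - f (x + h *\<^sub>R b) + f x
      - (h^2) *\<^sub>R partial b (partial a f) x"
      unfolding p_def L by (simp add: power2_eq_square add.assoc add.commute[of "h *\<^sub>R b"])
    show "norm (f (x + h *\<^sub>R a + h *\<^sub>R b) - f (x + h *\<^sub>R a) - f (x + h *\<^sub>R b) + f x
      - (h^2) *\<^sub>R partial b (partial a f) x) \<le> e * h^2"
      using bound[unfolded eq] h by (simp add: power2_eq_square)
  qed
qed

text \<open>The second difference is symmetric in the two directions, so h^2 times either mixed
  derivative approximates the same number with error e h^2 / 2; dividing by h^2 leaves e.\<close>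

lemma partial_commute:
  assumes "smooth f" "a \<in> Basis" "b \<in> Basis"
  shows "partial a (partial b f) = partial b (partial a f)"
proof
  fix x
  have n: "norm a = 1" "norm b = 1" using assms by auto
  let ?A = "partial b (partial a f) x" and ?B = "partial a (partial b f) x"
  have "norm (?A - ?B) \<le> 0 + e" if e: "e > 0" for e
  proof -
    obtain d1 where d1: "d1 > 0" and *: "\<And>h. 0 < h \<and> h < d1 \<Longrightarrow>
      norm (f (x + h *\<^sub>R a + h *\<^sub>R b) - f (x + h *\<^sub>R a) - f (x + h *\<^sub>R b) + f x - (h^2) *\<^sub>R ?A) \<le> (e/2) * h^2"
      using second_difference[of f a x b "e/2"] assms n e
      by (auto simp: smooth_differentiable smooth_partial)
    obtain d2 where d2: "d2 > 0" and **: "\<And>h. 0 < h \<and> h < d2 \<Longrightarrow>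
      norm (f (x + h *\<^sub>R b + h *\<^sub>R a) - f (x + h *\<^sub>R b) - f (x + h *\<^sub>R a) + f x - (h^2) *\<^sub>R ?B) \<le> (e/2) * h^2"
      using second_difference[of f b x a "e/2"] assms n e
      by (auto simp: smooth_differentiable smooth_partial)
    define h where "h = min d1 d2 / 2"
    have h: "0 < h" "h < d1" "h < d2" using d1 d2 by (auto simp: h_def min_def)
    let ?S = "f (x + h *\<^sub>R a + h *\<^sub>R b) - f (x + h *\<^sub>R a) - f (x + h *\<^sub>R b) + f x"
    have S: "f (x + h *\<^sub>R b + h *\<^sub>R a) - f (x + h *\<^sub>R b) - f (x + h *\<^sub>R a) + f x = ?S"
      by (simp add: add_ac)
    have "h^2 * norm (?A - ?B) = norm ((?S - (h^2) *\<^sub>R ?B) - (?S - (h^2) *\<^sub>R ?A))"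
      by (simp add: scaleR_right_diff_distrib[symmetric])
    also have "\<dots> \<le> norm (?S - (h^2) *\<^sub>R ?B) + norm (?S - (h^2) *\<^sub>R ?A)"
      by (rule norm_triangle_ineq4)
    also have "\<dots> \<le> (e/2) * h^2 + (e/2) * h^2"
      using *[of h] **[of h] h by (intro add_mono) (auto simp: S)
    finally have "h^2 * norm (?A - ?B) \<le> h^2 * e" by (simp add: field_simps)
    then show ?thesis using h by simp
  qed
  then have "norm (?A - ?B) \<le> 0" by (rule field_le_epsilon)
  then show "?B = ?A" by simp
qed

lemma foldr_partial_commute:
  assumes "smooth f" "b \<in> Basis" "set bs \<subseteq> Basis"
  shows "foldr partial bs (partial b f) = partial b (foldr partial bs f)"
  using assms(3)
proof (induction bs)
  case (Cons c bs)
  then show ?case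
    using partial_commute[OF smooth_foldr_partial[OF assms(1)], of bs c b] assms(2) by simp
qed simp

lemma foldr_partial_mset:
  assumes "smooth f" "set bs \<subseteq> Basis" "mset bs = mset cs"
  shows "foldr partial bs f = foldr partial cs f"
  using assms(2,3)
proof (induction bs arbitrary: cs)
  case (Cons b bs)
  then obtain u v where cs: "cs = u @ b # v"
    by (metis list.set_intros(1) mset_eq_setD split_list)
  have sc: "set cs \<subseteq> Basis" using Cons.prems by (metis mset_eq_setD)
  have "foldr partial cs f = foldr partial u (partial b (foldr partial v f))" by (simp add: cs)
  also have "\<dots> = partial b (foldr partial (u @ v) f)"
    using sc assms(1) by (subst foldr_partial_commute) (auto simp: cs smooth_foldr_partial)
  also have "foldr partial (u @ v) f = foldr partial bs f"
    using Cons.prems by (intro Cons.IH[symmetric]) (auto simp: cs)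
  finally show ?case by simp
qed simp

lemma mderiv_eq_foldr:
  "mderiv \<alpha> f = foldr partial (concat (map (\<lambda>b. replicate (\<alpha> b) b) basis_list)) f"
proof -
  have "foldr (\<lambda>b. partial b ^^ \<alpha> b) L f = foldr partial (concat (map (\<lambda>b. replicate (\<alpha> b) b) L)) f" for L
  proof (induction L)
    case (Cons b L)
    have "foldr partial (replicate k b) g = (partial b ^^ k) g" for k and g :: "'a \<Rightarrow> complex"
      by (induction k) auto
    then show ?case using Cons by simp
  qed simp
  then show ?thesis unfolding mderiv_def .
qed

text \<open>Bridge between two descriptions of higher derivatives: lists of directions, convenient
  for induction, and multi-indices, used in the definitions. Only multiplicities matter because
  partial derivatives of smooth functions commute.\<close>

lemma foldr_partial_eq_mderiv:
  fixes f :: "'a::euclidean_space \<Rightarrow> complex"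
  assumes "smooth f" "set bs \<subseteq> Basis"
  shows "foldr partial bs f = mderiv (count (mset bs)) f"
  unfolding mderiv_eq_foldr
proof (rule foldr_partial_mset[OF assms])
  have c: "count (mset (concat (map (\<lambda>b. replicate (\<alpha> b) b) L))) x = (if x \<in> set L then \<alpha> x else 0)"
    if "distinct L" for L :: "'a list" and \<alpha> x
    using that by (induction L) auto
  show "mset bs = mset (concat (map (\<lambda>b. replicate (count (mset bs) b) b) basis_list))"
    using assms(2) by (intro multiset_eqI, subst c) (auto simp: basis_list count_eq_zero_iff)
qed

section \<open>Function classes stable under differentiation\<close>

text \<open>Schwartz functions, symbols, and functions of polynomial growth with all derivatives
  share this shape, with P built from \<open>rapid\<close>, \<open>dominated\<close> and
  \<open>slow\<close>. Closure properties are therefore proved once, for general P.\<close>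

definition derivs_in :: "('a::euclidean_space \<Rightarrow> complex) set \<Rightarrow> ('a \<Rightarrow> complex) set" where
  "derivs_in P = {f. smooth f \<and> (\<forall>bs. set bs \<subseteq> Basis \<longrightarrow> foldr partial bs f \<in> P)}"

lemma derivs_inD:
  assumes "f \<in> derivs_in P"
  shows "smooth f" "f \<in> P" "set bs \<subseteq> Basis \<Longrightarrow> foldr partial bs f \<in> P"
    "b \<in> Basis \<Longrightarrow> partial b f \<in> derivs_in P" "f differentiable (at x)"
proof -
  show 1: "smooth f" and *: "set bs \<subseteq> Basis \<Longrightarrow> foldr partial bs f \<in> P" for bs
    using assms by (auto simp: derivs_in_def)
  show "f \<in> P" using *[of "[]"] by simp
  show "f differentiable (at x)" using 1 by (rule smooth_differentiable)
  assume b: "b \<in> Basis"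
  have "foldr partial bs (partial b f) \<in> P" if "set bs \<subseteq> Basis" for bs
    using *[of "bs @ [b]"] that b by simp
  then show "partial b f \<in> derivs_in P" using 1 b by (auto simp: derivs_in_def smooth_partial)
qed

lemma derivs_in_coinduct:
  assumes "f \<in> C" and "\<And>f x. f \<in> C \<Longrightarrow> f differentiable (at x)"
    and "\<And>f b. f \<in> C \<Longrightarrow> b \<in> Basis \<Longrightarrow> partial b f \<in> C" and "C \<subseteq> P"
  shows "f \<in> derivs_in P"
  using smooth_coinduct[of f C, OF assms(1-3)] assms(4) by (auto simp: derivs_in_def)

text \<open>The derivative of a product is a sum of products, so a set of products is in general not
  stable under \<open>partial\<close>, but its closure under sums is. This replaces the Leibniz
  formula of higher order.\<close>

inductive_set sum_closure :: "('a \<Rightarrow> complex) set \<Rightarrow> ('a \<Rightarrow> complex) set" for S where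
  base: "f \<in> S \<Longrightarrow> f \<in> sum_closure S"
| add: "f \<in> sum_closure S \<Longrightarrow> g \<in> sum_closure S \<Longrightarrow> (\<lambda>x. f x + g x) \<in> sum_closure S"

lemma sum_closure_coinduct:
  assumes "\<And>f x. f \<in> S \<Longrightarrow> f differentiable (at x)"
    and "\<And>f b. f \<in> S \<Longrightarrow> b \<in> Basis \<Longrightarrow> partial b f \<in> sum_closure S" and "S \<subseteq> P"
    and "\<And>f g. f \<in> P \<Longrightarrow> g \<in> P \<Longrightarrow> (\<lambda>x. f x + g x) \<in> P"
    and "f \<in> sum_closure S"
  shows "f \<in> derivs_in P"
  using assms(5)
proof (rule derivs_in_coinduct)
  show d: "f differentiable (at x)" if "f \<in> sum_closure S" for f x
    using that by induction (auto intro: assms(1))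
  show "partial b f \<in> sum_closure S" if "f \<in> sum_closure S" "b \<in> Basis" for f b
    using that
  proof induction
    case (add f g)
    have "partial b (\<lambda>x. f x + g x) = (\<lambda>x. partial b f x + partial b g x)"
      by (rule ext) (intro partial_add d add.hyps)
    then show ?case using add by (auto intro: sum_closure.add)
  qed (auto intro: assms(2))
  show "sum_closure S \<subseteq> P"
  proof
    fix f assume "f \<in> sum_closure S"
    then show "f \<in> P" by induction (use assms in auto)
  qed
qed

lemma derivs_in_add:
  assumes "f \<in> derivs_in P" "g \<in> derivs_in P"
    and "\<And>f g. f \<in> P \<Longrightarrow> g \<in> P \<Longrightarrow> (\<lambda>x. f x + g x) \<in> P"
  shows "(\<lambda>x. f x + g x) \<in> derivs_in P"
proof (rule sum_closure_coinduct[of "derivs_in P"])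
  show "(\<lambda>x. f x + g x) \<in> sum_closure (derivs_in P)"
    using assms by (intro sum_closure.intros)
  show "h differentiable (at x)" if "h \<in> derivs_in P" for h :: "'a \<Rightarrow> complex" and x
    using that by (rule derivs_inD)
  show "partial b h \<in> sum_closure (derivs_in P)" if "h \<in> derivs_in P" "b \<in> Basis" for h :: "'a \<Rightarrow> complex" and b
    using that by (intro sum_closure.base derivs_inD(4))
  show "derivs_in P \<subseteq> P" using derivs_inD(2) by blast
qed (rule assms(3))

text \<open>By the product rule, sums of products of members of \<open>derivs_in P\<close> and
  \<open>derivs_in Q\<close> form a family stable under \<open>partial\<close>. The three conditions
  may differ, as in slow times rapid is rapid.\<close>

lemma derivs_in_mult:
  assumes "f \<in> derivs_in P" "g \<in> derivs_in Q"
    and add: "\<And>f g. f \<in> R \<Longrightarrow> g \<in> R \<Longrightarrow> (\<lambda>x. f x + g x) \<in> R"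
    and mult: "\<And>f g. f \<in> P \<Longrightarrow> g \<in> Q \<Longrightarrow> (\<lambda>x. f x * g x) \<in> R"
  shows "(\<lambda>x. f x * g x) \<in> derivs_in R"
proof -
  define S where "S = {\<lambda>x. f x * g x |f g. f \<in> derivs_in P \<and> g \<in> derivs_in Q}"
  show ?thesis
  proof (rule sum_closure_coinduct[of S])
    show "(\<lambda>x. f x * g x) \<in> sum_closure S" using assms by (auto simp: S_def intro!: sum_closure.base)
    show "h differentiable (at x)" if "h \<in> S" for h x
      using that by (auto simp: S_def dest: derivs_inD(5) intro!: differentiable_mult)
    show "partial b h \<in> sum_closure S" if "h \<in> S" "b \<in> Basis" for h b
    proof -
      obtain f g where h: "h = (\<lambda>x. f x * g x)" and fg: "f \<in> derivs_in P" "g \<in> derivs_in Q"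
        using \<open>h \<in> S\<close> by (auto simp: S_def)
      have "partial b h = (\<lambda>x. partial b f x * g x + f x * partial b g x)"
        unfolding h by (rule ext) (intro partial_mult derivs_inD(5)[OF fg(1)] derivs_inD(5)[OF fg(2)])
      moreover have "(\<lambda>x. partial b f x * g x) \<in> S" "(\<lambda>x. f x * partial b g x) \<in> S"
        using derivs_inD(4)[OF fg(1) that(2)] derivs_inD(4)[OF fg(2) that(2)] fg
        unfolding S_def by blast+
      ultimately show ?thesis by (auto intro: sum_closure.intros)
    qed
    show "S \<subseteq> R" using mult by (auto simp: S_def dest: derivs_inD(2))
  qed (rule add)
qed

definition dominated :: "('a \<Rightarrow> real) \<Rightarrow> ('a \<Rightarrow> complex) set" where
  "dominated W = {f. \<exists>C. \<forall>x. norm (f x) \<le> C * W x}"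

lemma dominated_add: "f \<in> dominated W \<Longrightarrow> g \<in> dominated W \<Longrightarrow> (\<lambda>x. f x + g x) \<in> dominated W"
proof -
  assume "f \<in> dominated W" "g \<in> dominated W"
  then obtain C D where "\<And>x. norm (f x) \<le> C * W x" "\<And>x. norm (g x) \<le> D * W x"
    by (auto simp: dominated_def)
  then have "norm (f x + g x) \<le> (C + D) * W x" for x
    by (metis add_mono distrib_right norm_triangle_le)
  then show ?thesis by (auto simp: dominated_def)
qed

lemma dominatedE:
  assumes "f \<in> dominated W" "\<And>x. 0 \<le> W x"
  obtains C where "0 \<le> C" "\<And>x. norm (f x) \<le> C * W x"
proof -
  obtain C where C: "\<And>x. norm (f x) \<le> C * W x" using assms(1) by (auto simp: dominated_def)
  have "norm (f x) \<le> \<bar>C\<bar> * W x" for x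
    using C[of x] assms(2)[of x] by (meson abs_ge_self mult_right_mono order.trans)
  then show ?thesis using that[of "\<bar>C\<bar>"] by simp
qed

text \<open>One direction turns a list of directions into a multi-index, the other unfolds a
  multi-index into a list. From here on estimates on symbols go through
  \<open>derivs_in\<close>.\<close>

lemma symbol_class_eq: "symbol_class W = derivs_in (dominated (\<lambda>(x, \<xi>). W \<xi>))"
proof -
  have "\<sigma> \<in> derivs_in (dominated (\<lambda>(x, \<xi>). W \<xi>))" if s: "smooth \<sigma>"
    and *: "\<And>\<alpha>. \<exists>C. \<forall>x \<xi>. norm (mderiv \<alpha> \<sigma> (x, \<xi>)) \<le> C * W \<xi>" for \<sigma>
    using * s by (auto simp: derivs_in_def dominated_def foldr_partial_eq_mderiv)
  moreover have "\<exists>C. \<forall>x \<xi>. norm (mderiv \<alpha> \<sigma> (x, \<xi>)) \<le> C * W \<xi>"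
    if "\<sigma> \<in> derivs_in (dominated (\<lambda>(x, \<xi>). W \<xi>))" for \<alpha> \<sigma>
  proof -
    have "set (concat (map (\<lambda>b. replicate (\<alpha> b) b) basis_list)) \<subseteq> Basis"
      by (auto simp: basis_list)
    from derivs_inD(3)[OF that this] show ?thesis
      unfolding mderiv_eq_foldr by (auto simp: dominated_def)
  qed
  ultimately show ?thesis unfolding symbol_class_def using derivs_inD(1) by blast
qed

section \<open>Lebesgue measure on spaces of vectors\<close>

lemma measurable_vec_lambda [measurable]:
  "(\<lambda>f. (\<chi> j. f j) :: 'a::euclidean_space ^ 'm) \<in> PiM UNIV (\<lambda>_. lborel) \<rightarrow>\<^sub>M borel"
  unfolding borel_measurable_euclidean_space[of "\<lambda>f. (\<chi> j. f j) :: 'a ^ 'm"]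
  by (auto simp: Basis_vec_def inner_axis)

lemma measurable_vec_nth [measurable]:
  "(\<lambda>x :: 'a::euclidean_space ^ 'm. x $ j) \<in> borel_measurable borel"
  by (intro borel_measurable_continuous_onI continuous_intros)

lemma prod_Basis_vec:
  "(\<Prod>b\<in>(Basis :: ('a::euclidean_space ^ 'm) set). g b) = (\<Prod>j\<in>UNIV. \<Prod>u\<in>Basis. g (axis j u))"
proof -
  have "(\<Prod>b\<in>(Basis :: ('a ^ 'm) set). g b) = (\<Prod>j\<in>UNIV. \<Prod>b\<in>(\<Union>u\<in>Basis. {axis j u}). g b)"
    unfolding Basis_vec_def by (intro prod.UNION_disjoint) (auto simp: axis_eq_axis)
  also have "\<dots> = (\<Prod>j\<in>UNIV. \<Prod>u\<in>Basis. g (axis j u))"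
    by (intro prod.cong refl, subst prod.UNION_disjoint) (auto simp: axis_eq_axis)
  finally show ?thesis .
qed

text \<open>Both measures give a box the product of its side lengths, since the basis of a vector of
  vectors is indexed by pairs (\<open>prod_Basis_vec\<close>). The product theorems of
  \<open>PiM\<close> thereby become available twice: for R^n over R and for (R^n)^N over
  R^n.\<close>

lemma lborel_vec:
  "(lborel :: ('a::euclidean_space ^ 'm) measure) = distr (PiM UNIV (\<lambda>_. lborel)) borel (\<lambda>f. \<chi> j. f j)"
proof (rule lborel_eqI)
  fix l u :: "'a ^ 'm"
  assume le: "\<And>b. b \<in> Basis \<Longrightarrow> l \<bullet> b \<le> u \<bullet> b"
  interpret product_sigma_finite "\<lambda>_::'m. lborel :: 'a measure"
    by (simp add: product_sigma_finite_def sigma_finite_lborel)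
  have "emeasure (distr (PiM UNIV (\<lambda>_. lborel)) borel (\<lambda>f. \<chi> j. f j)) (box l u)
      = emeasure (PiM UNIV (\<lambda>_. lborel)) (PiE UNIV (\<lambda>j. box (l $ j) (u $ j)))"
    by (subst emeasure_distr)
      (auto intro!: arg_cong2[where f=emeasure] simp: space_PiM box_def Basis_vec_def inner_axis PiE_def Pi_def)
  also have "\<dots> = (\<Prod>j\<in>UNIV. emeasure lborel (box (l $ j) (u $ j)))"
    by (subst emeasure_PiM) auto
  also have "\<dots> = (\<Prod>j\<in>UNIV. ennreal (\<Prod>b\<in>Basis. (u $ j - l $ j) \<bullet> b))"
  proof (intro prod.cong refl emeasure_lborel_box)
    fix j b assume "b \<in> (Basis :: 'a set)"
    then show "l $ j \<bullet> b \<le> u $ j \<bullet> b" using le[of "axis j b"] by (auto simp: Basis_vec_def inner_axis)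
  qed
  also have "\<dots> = ennreal (\<Prod>j\<in>UNIV. \<Prod>b\<in>Basis. (u $ j - l $ j) \<bullet> b)"
  proof (intro prod_ennreal prod_nonneg ballI)
    fix j b assume "b \<in> (Basis :: 'a set)"
    then show "0 \<le> (u $ j - l $ j) \<bullet> b" using le[of "axis j b"]
      by (auto simp: Basis_vec_def inner_axis inner_diff_left)
  qed
  also have "(\<Prod>j\<in>UNIV. \<Prod>b\<in>Basis. (u $ j - l $ j) \<bullet> b) = (\<Prod>b\<in>Basis. (u - l) \<bullet> b)"
    by (simp add: prod_Basis_vec inner_axis)
  finally show "emeasure (distr (PiM UNIV (\<lambda>_. lborel)) borel (\<lambda>f. \<chi> j. f j)) (box l u)
    = ennreal (\<Prod>b\<in>Basis. (u - l) \<bullet> b)" .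
qed simp

lemma product_sigma_finite_lborel: "product_sigma_finite (\<lambda>_. lborel)"
  by (simp add: product_sigma_finite_def sigma_finite_lborel)

lemma nn_integral_vec:
  fixes f :: "'a::euclidean_space ^ 'm \<Rightarrow> ennreal"
  assumes "f \<in> borel_measurable borel"
  shows "(\<integral>\<^sup>+x. f x \<partial>lborel) = (\<integral>\<^sup>+g. f (\<chi> j. g j) \<partial>PiM UNIV (\<lambda>_. lborel))"
  by (subst lborel_vec) (simp add: nn_integral_distr assms)

lemma nn_integral_vec_prod:
  fixes f :: "'m::finite \<Rightarrow> 'a::euclidean_space \<Rightarrow> ennreal"
  assumes [measurable]: "\<And>j. f j \<in> borel_measurable borel"
  shows "(\<integral>\<^sup>+x. (\<Prod>j\<in>UNIV. f j (x $ j)) \<partial>lborel) = (\<Prod>j\<in>UNIV. \<integral>\<^sup>+x. f j x \<partial>lborel)"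
  by (subst nn_integral_vec) (auto simp: product_sigma_finite.product_nn_integral_prod[OF product_sigma_finite_lborel])

lemma integral_vec_prod:
  fixes f :: "'m::finite \<Rightarrow> 'a::euclidean_space \<Rightarrow> complex"
  assumes "\<And>j. integrable lborel (f j)"
  shows "(\<integral>x. (\<Prod>j\<in>UNIV. f j (x $ j)) \<partial>lborel) = (\<Prod>j\<in>UNIV. \<integral>x. f j x \<partial>lborel)"
    and "integrable lborel (\<lambda>x. \<Prod>j\<in>UNIV. f j (x $ j))"
proof -
  have [measurable]: "f j \<in> borel_measurable borel" for j
    using borel_measurable_integrable[OF assms] by simp
  show "(\<integral>x. (\<Prod>j\<in>UNIV. f j (x $ j)) \<partial>lborel) = (\<Prod>j\<in>UNIV. \<integral>x. f j x \<partial>lborel)"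
    by (subst lborel_vec, subst integral_distr)
      (auto simp: product_sigma_finite.product_integral_prod[OF product_sigma_finite_lborel] assms)
  show "integrable lborel (\<lambda>x. \<Prod>j\<in>UNIV. f j (x $ j))"
    by (subst lborel_vec, subst integrable_distr_eq)
      (auto intro!: product_sigma_finite.product_integrable_prod[OF product_sigma_finite_lborel] assms)
qed

lemma nn_integral_lborel_shift:
  fixes f :: "'a::euclidean_space \<Rightarrow> ennreal"
  assumes [measurable]: "f \<in> borel_measurable borel"
  shows "(\<integral>\<^sup>+x. f (x + c) \<partial>lborel) = (\<integral>\<^sup>+x. f x \<partial>lborel)"
proof -
  have "(\<integral>\<^sup>+x. f x \<partial>lborel) = (\<integral>\<^sup>+x. f x \<partial>distr lborel borel ((+) c))"
    by (simp add: lborel_distr_plus)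
  also have "\<dots> = (\<integral>\<^sup>+x. f (c + x) \<partial>lborel)" by (rule nn_integral_distr) auto
  finally show ?thesis by (simp add: add.commute)
qed

lemma nn_integral_lborel_reflect:
  fixes f :: "'a::euclidean_space \<Rightarrow> ennreal"
  assumes [measurable]: "f \<in> borel_measurable borel"
  shows "(\<integral>\<^sup>+x. f (c - x) \<partial>lborel) = (\<integral>\<^sup>+x. f x \<partial>lborel)"
proof -
  have "distr lborel borel (\<lambda>x::'a. - x) = lborel"
  proof (rule lborel_eqI[symmetric])
    fix l u :: 'a assume le: "\<And>b. b \<in> Basis \<Longrightarrow> l \<bullet> b \<le> u \<bullet> b"
    have "emeasure (distr lborel borel (\<lambda>x::'a. - x)) (box l u) = emeasure lborel (box (-u) (-l))"
      by (subst emeasure_distr)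
        (auto intro!: arg_cong2[where f=emeasure] simp: box_def minus_less_iff less_minus_iff)
    also have "\<dots> = (\<Prod>b\<in>Basis. (u - l) \<bullet> b)"
      using le by (subst emeasure_lborel_box) (auto simp: inner_diff_left)
    finally show "emeasure (distr lborel borel (\<lambda>x::'a. - x)) (box l u) = (\<Prod>b\<in>Basis. (u - l) \<bullet> b)" .
  qed simp
  then have "(\<integral>\<^sup>+x. f x \<partial>lborel) = (\<integral>\<^sup>+x. f x \<partial>distr lborel borel (\<lambda>x::'a. - x))" by simp
  also have "\<dots> = (\<integral>\<^sup>+x. f (- x) \<partial>lborel)" by (rule nn_integral_distr) auto
  also have "\<dots> = (\<integral>\<^sup>+x. f (- (x + (- c))) \<partial>lborel)" by (rule nn_integral_lborel_shift[symmetric]) simp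
  finally show ?thesis by simp
qed

text \<open>\<open>D\<close> is a fundamental domain for the translations \<open>p k\<close>.\<close>

lemma nn_integral_tiling:
  fixes F :: "'a::euclidean_space \<Rightarrow> ennreal" and p :: "'k::countable \<Rightarrow> 'a"
  assumes [measurable]: "F \<in> borel_measurable borel" "D \<in> sets borel"
    and D: "\<And>x k. x - p k \<in> D \<longleftrightarrow> k = r x"
  shows "(\<integral>\<^sup>+x. F x \<partial>lborel) = (\<integral>\<^sup>+k. (\<integral>\<^sup>+x. indicator D x * F (x + p k) \<partial>lborel) \<partial>count_space UNIV)"
proof -
  have "(\<integral>\<^sup>+k. indicator D (x - p k) * F x \<partial>count_space UNIV) = F x" for x
  proof -
    have "(\<integral>\<^sup>+k. indicator D (x - p k) * F x \<partial>count_space UNIV)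
        = (\<integral>\<^sup>+k. F x * indicator {r x} k \<partial>count_space UNIV)"
      by (intro nn_integral_cong) (auto simp: D indicator_def)
    also have "\<dots> = F x" by (subst nn_integral_cmult_indicator) auto
    finally show ?thesis .
  qed
  then have "(\<integral>\<^sup>+x. F x \<partial>lborel) = (\<integral>\<^sup>+x. (\<integral>\<^sup>+k. indicator D (x - p k) * F x \<partial>count_space UNIV) \<partial>lborel)"
    by simp
  also have "\<dots> = (\<integral>\<^sup>+k. (\<integral>\<^sup>+x. indicator D (x - p k) * F x \<partial>lborel) \<partial>count_space UNIV)"
    by (rule nn_integral_count_space_nn_integral) auto
  also have "\<dots> = (\<integral>\<^sup>+k. (\<integral>\<^sup>+x. indicator D x * F (x + p k) \<partial>lborel) \<partial>count_space UNIV)"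
  proof (rule nn_integral_cong)
    fix k
    show "(\<integral>\<^sup>+x. indicator D (x - p k) * F x \<partial>lborel) = (\<integral>\<^sup>+x. indicator D x * F (x + p k) \<partial>lborel)"
      by (subst nn_integral_lborel_shift[symmetric, of _ "p k"]) auto
  qed
  finally show ?thesis .
qed

section \<open>Unit cells, lattice points and the extended weight\<close>

definition cell :: "real ^ 'n \<Rightarrow> int ^ 'n" where
  "cell x = (\<chi> i. \<lfloor>x $ i + 1 / 2\<rfloor>)"

lemma mem_unit_cube_iff: "x - lattice_pt k \<in> unit_cube \<longleftrightarrow> k = cell x"
proof -
  have "(- 1 / 2 \<le> x $ i - of_int (k $ i) \<and> x $ i - of_int (k $ i) < 1 / 2) \<longleftrightarrow> k $ i = \<lfloor>x $ i + 1 / 2\<rfloor>" for i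
    by linarith
  then show ?thesis
    by (simp add: unit_cube_def cell_def lattice_pt_def vec_eq_iff)
qed

lemma unit_cube_sets [measurable]: "unit_cube \<in> sets borel"
proof -
  have "unit_cube = (\<Inter>i. {x :: real ^ 'n. - 1/2 \<le> x $ i} \<inter> {x. x $ i < 1/2})"
    by (auto simp: unit_cube_def)
  also have "\<dots> \<in> sets borel" by measurable
  finally show ?thesis .
qed

lemma lattice_pt_sum: "lattice_pt (\<Sum>j\<in>S. f j) = (\<Sum>j\<in>S. lattice_pt (f j))"
  and lattice_pt_diff: "lattice_pt (a - b) = lattice_pt a - lattice_pt b"
  and lattice_pt_zero [simp]: "lattice_pt 0 = 0"
  by (auto simp: lattice_pt_def vec_eq_iff)

lemma emeasure_unit_cube: "emeasure lborel (unit_cube :: (real ^ 'n) set) = 1"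
proof -
  have "emeasure lborel (unit_cube :: (real ^ 'n) set) 
      = (\<integral>\<^sup>+x. indicator (unit_cube :: (real ^ 'n) set) x \<partial>lborel)" by simp
  also have "\<dots> = (\<integral>\<^sup>+x. (\<Prod>i\<in>UNIV. indicator {-1/2..<1/2} (x $ i)) \<partial>(lborel :: (real ^ 'n) measure))"
  proof (intro nn_integral_cong)
    fix x :: "real ^ 'n"
    show "indicator unit_cube x = (\<Prod>i\<in>UNIV. indicator {-1/2..<1/2} (x $ i) :: ennreal)"
      by (cases "x \<in> unit_cube") (auto simp: unit_cube_def indicator_def intro!: prod_zero[symmetric])
  qed
  also have "\<dots> = (\<Prod>i::'n\<in>UNIV. \<integral>\<^sup>+x. indicator {-1/2..<1/2} x \<partial>(lborel :: real measure))"
    by (rule nn_integral_vec_prod) simp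
  also have "\<dots> = 1" by simp
  finally show ?thesis .
qed

definition block_cube :: "((real ^ 'n) ^ 'm) set" where
  "block_cube = {\<xi>. \<forall>j. \<xi> $ j \<in> unit_cube}"

definition block_pt :: "(int ^ 'n) ^ 'm \<Rightarrow> (real ^ 'n) ^ 'm" where
  "block_pt \<nu> = (\<chi> j. lattice_pt (\<nu> $ j))"

definition block_cell :: "(real ^ 'n) ^ 'm \<Rightarrow> (int ^ 'n) ^ 'm" where
  "block_cell \<xi> = (\<chi> j. cell (\<xi> $ j))"

lemma mem_block_cube_iff: "\<xi> - block_pt \<nu> \<in> block_cube \<longleftrightarrow> \<nu> = block_cell \<xi>"
  by (auto simp: block_cube_def block_pt_def block_cell_def mem_unit_cube_iff vec_eq_iff)

lemma block_cube_sets [measurable]: "block_cube \<in> sets borel"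
proof -
  have "block_cube = (\<Inter>j. {\<xi> :: (real ^ 'n) ^ 'm. \<xi> $ j \<in> unit_cube})"
    by (auto simp: block_cube_def)
  also have "\<dots> \<in> sets borel" by measurable
  finally show ?thesis .
qed

lemma indicator_block_cube:
  "(indicator block_cube \<xi> :: ennreal) = (\<Prod>j\<in>UNIV. indicator unit_cube (\<xi> $ j))"
  by (cases "\<xi> \<in> block_cube") (auto simp: block_cube_def indicator_def intro!: prod_zero[symmetric])

text \<open>Half-open cells tile the space, so exactly one summand survives and the infinite sum
  becomes an evaluation at the cell of \<xi>.\<close>

lemma extend_weight_eq: "extend_weight V \<xi> = V (block_cell \<xi>)"
proof -
  have "V \<nu> * (\<Prod>j\<in>UNIV. indicator unit_cube (\<xi> $ j - lattice_pt (\<nu> $ j)))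
      = (if \<nu> = block_cell \<xi> then V \<nu> else 0)" for \<nu>
  proof (cases "\<nu> = block_cell \<xi>")
    case True
    then show ?thesis by (simp add: block_cell_def mem_unit_cube_iff)
  next
    case False
    then obtain j where "\<nu> $ j \<noteq> cell (\<xi> $ j)" by (auto simp: block_cell_def vec_eq_iff)
    then have "(\<Prod>j\<in>UNIV. indicator unit_cube (\<xi> $ j - lattice_pt (\<nu> $ j)) :: real) = 0"
      by (intro prod_zero bexI[of _ j]) (auto simp: mem_unit_cube_iff)
    then show ?thesis using False by simp
  qed
  then have "extend_weight V \<xi> = (\<Sum>\<^sub>\<infinity>\<nu>\<in>UNIV. if \<nu> = block_cell \<xi> then V \<nu> else 0)"
    by (simp add: extend_weight_def)
  also have "\<dots> = (\<Sum>\<^sub>\<infinity>\<nu>\<in>{block_cell \<xi>}. V \<nu>)"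
    by (intro infsum_cong_neutral) auto
  finally show ?thesis by simp
qed

section \<open>Gaussian regularisation\<close>

text \<open>The cancellation step of a self-improving estimate: finiteness of x is what allows
  dividing by it. It is applied to the square norm of a regularised density.\<close>

lemma ennreal_le_of_power2_le:
  fixes x a :: ennreal
  assumes "x\<^sup>2 \<le> a * x" "x < top"
  shows "x \<le> a"
proof (cases "x = 0 \<or> a = top")
  case False
  then have "x * x \<le> a * x" "x \<noteq> 0" "x \<noteq> top" using assms by (auto simp: power2_eq_square)
  then show ?thesis using ennreal_mult_le_mult_iff[of x x a] by (simp add: mult.commute)
qed auto

lemma ennreal_power2_le_cancel:
  fixes x a :: ennreal
  assumes "x\<^sup>2 \<le> a\<^sup>2"
  shows "x \<le> a"
  using assms
  by (cases a rule: ennreal_cases; cases x rule: ennreal_cases)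
    (auto simp: ennreal_power[symmetric] power2_eq_square ennreal_mult_eq_top_iff top_unique
      ennreal_mult[symmetric] intro!: ennreal_leI dest: power2_le_imp_le[unfolded power2_eq_square])

lemma integral_pair_mult:
  fixes f :: "'a \<Rightarrow> complex" and g :: "'b \<Rightarrow> complex"
  assumes "sigma_finite_measure M" "sigma_finite_measure N" and f: "integrable M f" and g: "integrable N g"
  shows "integrable (M \<Otimes>\<^sub>M N) (\<lambda>z. f (fst z) * g (snd z))"
    and "(\<integral>z. f (fst z) * g (snd z) \<partial>(M \<Otimes>\<^sub>M N)) = (\<integral>x. f x \<partial>M) * (\<integral>y. g y \<partial>N)"
proof -
  interpret pair_sigma_finite M N using assms by (simp add: pair_sigma_finite_def)
  have [measurable]: "f \<in> borel_measurable M" "g \<in> borel_measurable N" using f g by auto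
  show *: "integrable (M \<Otimes>\<^sub>M N) (\<lambda>z. f (fst z) * g (snd z))"
    using f g by (intro Fubini_integrable) (auto simp: norm_mult)
  show "(\<integral>z. f (fst z) * g (snd z) \<partial>(M \<Otimes>\<^sub>M N)) = (\<integral>x. f x \<partial>M) * (\<integral>y. g y \<partial>N)"
    using integral_fst'[OF *] by simp
qed

definition gauss :: "real \<Rightarrow> real ^ 'n \<Rightarrow> real" where
  "gauss e x = exp (- (e * (norm x)\<^sup>2) / 2)"

text \<open>The Fourier transform of \<open>gauss e\<close> in the normalisation of
  \<open>fourier\<close>, without a factor in front of the integral. Its total mass is (2 pi)^n for
  every e, so it is (2 pi)^n times an approximate identity as e tends to 0.\<close>

definition gauss_hat :: "real \<Rightarrow> real ^ 'n \<Rightarrow> real" where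
  "gauss_hat e x = sqrt (2 * pi / e) ^ CARD('n) * gauss (1 / e) x"

lemma gauss_pos: "0 < gauss e x" and gauss_le_1: "0 \<le> e \<Longrightarrow> gauss e x \<le> 1"
  by (auto simp: gauss_def)

lemma gauss_minus: "gauss e (x - y) = gauss e (y - x)"
  by (simp add: gauss_def norm_minus_commute)

lemma gauss_hat_nonneg: "0 < e \<Longrightarrow> 0 \<le> gauss_hat e x"
  by (simp add: gauss_hat_def gauss_def)

lemma gauss_hat_minus: "gauss_hat e (x - y) = gauss_hat e (y - x)"
  by (simp add: gauss_hat_def gauss_minus[of _ x y])

lemma gauss_hat_le: "0 < e \<Longrightarrow> gauss_hat e (x :: real ^ 'n) \<le> sqrt (2 * pi / e) ^ CARD('n)"
  unfolding gauss_hat_def using gauss_le_1[of "1 / e" x] by (simp add: mult_left_le)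

lemma gauss_measurable [measurable]: "gauss e \<in> borel_measurable borel"
  unfolding gauss_def[abs_def] by measurable

lemma gauss_hat_measurable [measurable]: "gauss_hat e \<in> borel_measurable borel"
  unfolding gauss_hat_def[abs_def] by measurable

lemma norm_vec_power2: "(norm (x :: real ^ 'n))\<^sup>2 = (\<Sum>i\<in>UNIV. (x $ i)\<^sup>2)"
  unfolding power2_norm_eq_inner inner_vec_def by (simp add: power2_eq_square)

lemma gauss_prod: "gauss e x = (\<Prod>i\<in>UNIV. exp (- (e * (x $ i)\<^sup>2) / 2))"
  by (simp add: gauss_def norm_vec_power2 exp_sum[symmetric] sum_distrib_left sum_divide_distrib sum_negf)

text \<open>For e = 1 this is the characteristic function of the standard normal distribution;
  rescaling the variable by 1 / sqrt e gives general e.\<close>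

lemma gauss_fourier_real:
  fixes t :: real
  assumes e: "0 < e"
  shows "integrable lborel (\<lambda>x. exp (\<i> * of_real (t * x)) * complex_of_real (exp (- (e * x\<^sup>2) / 2)))" (is ?A)
    and "(\<integral>x. exp (\<i> * of_real (t * x)) * complex_of_real (exp (- (e * x\<^sup>2) / 2)) \<partial>lborel)
      = complex_of_real (sqrt (2 * pi / e) * exp (- (t\<^sup>2 / e) / 2))" (is ?B)
proof -
  let ?f = "\<lambda>e t x. exp (\<i> * of_real (t * x)) * complex_of_real (exp (- (e * x\<^sup>2) / 2))"
  have nd: "complex_of_real (exp (- x\<^sup>2 / 2)) = complex_of_real (sqrt (2 * pi)) * of_real (std_normal_density x)" for x
  proof -
    have "exp (- x\<^sup>2 / 2) = sqrt (2 * pi) * std_normal_density x" by (simp add: normal_density_def)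
    then show ?thesis by (simp only: of_real_mult[symmetric])
  qed
  have int1: "integrable lborel (?f 1 t)" for t
  proof (rule Bochner_Integration.integrable_bound)
    show "integrable lborel (\<lambda>x. sqrt (2 * pi) * std_normal_density x)"
      by (intro integrable_mult_right) (rule integrable_normal_density, simp)
    have "norm (?f 1 t x) = sqrt (2 * pi) * std_normal_density x" for x
      by (simp add: norm_mult normal_density_def)
    then show "AE x in lborel. norm (?f 1 t x) \<le> norm (sqrt (2 * pi) * std_normal_density x)" by simp
  qed measurable
  have val1: "(\<integral>x. ?f 1 t x \<partial>lborel) = complex_of_real (sqrt (2 * pi) * exp (- t\<^sup>2 / 2))" for t
  proof -
    have "complex_of_real (exp (- t\<^sup>2 / 2)) = char std_normal_distribution t"
      by (simp add: char_std_normal_distribution)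
    also have "\<dots> = (\<integral>x. std_normal_density x *\<^sub>R iexp (t * x) \<partial>lborel)"
      unfolding char_def by (subst integral_density) (auto simp: normal_density_nonneg)
    finally have 1: "complex_of_real (exp (- t\<^sup>2 / 2)) = (\<integral>x. std_normal_density x *\<^sub>R iexp (t * x) \<partial>lborel)" .
    have "(\<integral>x. ?f 1 t x \<partial>lborel) = (\<integral>x. of_real (sqrt (2 * pi)) * (std_normal_density x *\<^sub>R iexp (t * x)) \<partial>lborel)"
    proof (intro Bochner_Integration.integral_cong refl)
      fix x :: real
      show "?f 1 t x = of_real (sqrt (2 * pi)) * (std_normal_density x *\<^sub>R iexp (t * x))"
        using nd[of x] by (simp add: scaleR_conv_of_real mult_ac)
    qed
    also have "\<dots> = of_real (sqrt (2 * pi)) * complex_of_real (exp (- t\<^sup>2 / 2))"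
      unfolding integral_mult_right_zero 1 ..
    finally show ?thesis by simp
  qed
  define c where "c = 1 / sqrt e"
  have c: "c > 0" "e * c\<^sup>2 = 1" "c\<^sup>2 = 1 / e" using e by (auto simp: c_def power_divide)
  have sc: "?f e t (0 + c * x) = ?f 1 (t * c) x" for x
  proof -
    have "e * (c * x)\<^sup>2 = x\<^sup>2" using c(2) by (metis mult.assoc mult_1 power_mult_distrib)
    then show ?thesis by (simp add: mult.assoc)
  qed
  show ?A
    using lborel_integrable_real_affine_iff[of c "?f e t" 0] c(1) int1[of "t * c"] unfolding sc by simp
  have "(\<integral>x. ?f e t x \<partial>lborel) = \<bar>c\<bar> *\<^sub>R (\<integral>x. ?f e t (0 + c * x) \<partial>lborel)"
    by (rule lborel_integral_real_affine) (use c in auto)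
  also have "\<dots> = complex_of_real (c * (sqrt (2 * pi) * exp (- (t * c)\<^sup>2 / 2)))"
    unfolding sc val1 using c(1) by (simp add: scaleR_conv_of_real)
  also have "c * (sqrt (2 * pi) * exp (- (t * c)\<^sup>2 / 2)) = sqrt (2 * pi / e) * exp (- (t\<^sup>2 / e) / 2)"
    by (simp add: power_mult_distrib c(3)) (simp add: c_def real_sqrt_divide)
  finally show ?B .
qed

lemma gauss_fourier:
  fixes t :: "real ^ 'n"
  assumes e: "0 < e"
  shows "integrable lborel (\<lambda>x. exp (\<i> * of_real (x \<bullet> t)) * complex_of_real (gauss e x))"
    and "(\<integral>x. exp (\<i> * of_real (x \<bullet> t)) * complex_of_real (gauss e x) \<partial>lborel) = of_real (gauss_hat e t)"
proof -
  let ?f = "\<lambda>i x. exp (\<i> * of_real (t $ i * x)) * complex_of_real (exp (- (e * x\<^sup>2) / 2))"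
  have eq: "(\<lambda>x. exp (\<i> * of_real (x \<bullet> t)) * complex_of_real (gauss e x)) = (\<lambda>x. \<Prod>i\<in>UNIV. ?f i (x $ i))"
  proof
    fix x :: "real ^ 'n"
    have "exp (\<i> * complex_of_real (x \<bullet> t)) = (\<Prod>i\<in>UNIV. exp (\<i> * of_real (t $ i * x $ i)))"
      by (simp add: inner_vec_def sum_distrib_left exp_sum mult.commute)
    then show "exp (\<i> * of_real (x \<bullet> t)) * complex_of_real (gauss e x) = (\<Prod>i\<in>UNIV. ?f i (x $ i))"
      by (simp only: gauss_prod prod.distrib of_real_prod)
  qed
  show "integrable lborel (\<lambda>x. exp (\<i> * of_real (x \<bullet> t)) * complex_of_real (gauss e x))"
    unfolding eq by (intro integral_vec_prod gauss_fourier_real e)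
  have "(\<integral>x. exp (\<i> * of_real (x \<bullet> t)) * complex_of_real (gauss e x) \<partial>lborel)
    = (\<Prod>i\<in>UNIV. complex_of_real (sqrt (2 * pi / e) * exp (- ((t $ i)\<^sup>2 / e) / 2)))"
    unfolding eq by (subst integral_vec_prod(1)) (intro gauss_fourier_real e, simp only: gauss_fourier_real(2)[OF e])
  also have "\<dots> = of_real (gauss_hat e t)"
    unfolding of_real_prod[symmetric] prod.distrib gauss_hat_def gauss_prod by simp
  finally show "(\<integral>x. exp (\<i> * of_real (x \<bullet> t)) * complex_of_real (gauss e x) \<partial>lborel) = of_real (gauss_hat e t)" .
qed

lemma gauss_integrable:
  assumes e: "0 < e"
  shows "integrable lborel (\<lambda>x. complex_of_real (gauss e (x :: real ^ 'n)))"
  using gauss_fourier(1)[OF e, of 0] by simp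

lemma nn_integral_gauss:
  assumes e: "0 < e"
  shows "(\<integral>\<^sup>+x. gauss e (x :: real ^ 'n) \<partial>lborel) = ennreal (sqrt (2 * pi / e) ^ CARD('n))"
proof -
  have "integrable lborel (\<lambda>x :: real ^ 'n. gauss e x)"
    using gauss_integrable[OF e] by (simp add: complex_of_real_integrable_eq)
  then have "(\<integral>\<^sup>+x. gauss e (x :: real ^ 'n) \<partial>lborel) = ennreal (\<integral>x. gauss e (x :: real ^ 'n) \<partial>lborel)"
    by (intro nn_integral_eq_integral) (auto simp: less_imp_le[OF gauss_pos])
  also have "complex_of_real (\<integral>x. gauss e (x :: real ^ 'n) \<partial>lborel) = of_real (gauss_hat e (0 :: real ^ 'n))"
    using gauss_fourier(2)[OF e, of 0] by simp
  then have "(\<integral>x. gauss e (x :: real ^ 'n) \<partial>lborel) = gauss_hat e (0 :: real ^ 'n)"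
    by (simp only: of_real_eq_iff)
  finally show ?thesis by (simp add: gauss_hat_def gauss_def)
qed

lemma nn_integral_gauss_hat:
  assumes e: "0 < e"
  shows "(\<integral>\<^sup>+x. gauss_hat e (x :: real ^ 'n) \<partial>lborel) = ennreal ((2 * pi) ^ CARD('n))"
proof -
  have "sqrt (2 * pi / e) * sqrt (2 * pi * e) = 2 * pi"
  proof -
    have "2 * pi / e * (2 * pi * e) = (2 * pi)\<^sup>2" using e by (simp add: power2_eq_square)
    then show ?thesis unfolding real_sqrt_mult[symmetric] by (simp only: real_sqrt_abs) simp
  qed
  then have "sqrt (2 * pi / e) ^ CARD('n) * sqrt (2 * pi * e) ^ CARD('n) = (2 * pi) ^ CARD('n)"
    by (metis power_mult_distrib)
  moreover have "(\<integral>\<^sup>+x. gauss_hat e (x :: real ^ 'n) \<partial>lborel)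
      = ennreal (sqrt (2 * pi / e) ^ CARD('n)) * (\<integral>\<^sup>+x. gauss (1 / e) (x :: real ^ 'n) \<partial>lborel)"
    unfolding gauss_hat_def using e
    by (subst nn_integral_cmult[symmetric])
      (auto intro!: nn_integral_cong ennreal_mult simp: less_imp_le[OF gauss_pos])
  ultimately show ?thesis
    using e by (subst (asm) nn_integral_gauss) (auto simp: ennreal_mult[symmetric])
qed

text \<open>The Fourier transform, with positive sign in the exponent, of the image of the measure G
  dM under s. Three instances are used: s the sum of all frequencies (the operator itself), s =
  \<open>uminus\<close> (\<open>fourier\<close>), and s = \<open>lattice_pt\<close> on a finite
  counting measure (trigonometric sums).\<close>

definition fourier_ext :: "'a measure \<Rightarrow> ('a \<Rightarrow> real ^ 'n) \<Rightarrow> ('a \<Rightarrow> complex) \<Rightarrow> real ^ 'n \<Rightarrow> complex" where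
  "fourier_ext M s G x = (\<integral>\<xi>. exp (\<i> * of_real (x \<bullet> s \<xi>)) * G \<xi> \<partial>M)"

lemma norm_exp_i_times [simp]: "norm (exp (\<i> * complex_of_real t)) = 1"
  using norm_exp_i_times by blast

lemma fourier_ext_measurable:
  assumes "sigma_finite_measure M" and [measurable]: "s \<in> borel_measurable M" "G \<in> borel_measurable M"
  shows "fourier_ext M s G \<in> borel_measurable borel"
  unfolding fourier_ext_def[abs_def]
  by (rule sigma_finite_measure.borel_measurable_lebesgue_integral[OF assms(1)]) measurable

text \<open>The squared modulus is a double integral over M x M; integrating the Gaussian in x first
  leaves its transform at the difference of the two frequencies. Fubini applies because G is
  integrable and the Gaussian makes the x-integral finite. The identity serves upper bounds and, for
  nonnegative G, also lower bounds.\<close>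

lemma gauss_quadratic:
  fixes s :: "'a \<Rightarrow> real ^ 'n"
  assumes M: "sigma_finite_measure M" and G: "integrable M G" and s [measurable]: "s \<in> borel_measurable M"
    and e: "0 < e"
  defines "H \<equiv> \<lambda>z. G (fst z) * cnj (G (snd z)) * of_real (gauss_hat e (s (fst z) - s (snd z)))"
  shows "integrable (M \<Otimes>\<^sub>M M) H"
    and "(\<integral>\<^sup>+x. ennreal (gauss e x * (norm (fourier_ext M s G x))\<^sup>2) \<partial>lborel) = ennreal (Re (\<integral>z. H z \<partial>(M \<Otimes>\<^sub>M M)))"
proof -
  have [measurable]: "G \<in> borel_measurable M" using G by auto
  have [measurable]: "cnj \<in> borel_measurable borel"
    by (intro borel_measurable_continuous_onI continuous_intros)
  have cG: "integrable M (\<lambda>x. cnj (G x))" using G by (rule integrable_cnj)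
  interpret M: sigma_finite_measure M by fact
  interpret MM: pair_sigma_finite M M by (simp add: pair_sigma_finite_def M)
  have P: "sigma_finite_measure (M \<Otimes>\<^sub>M M)" by (rule MM.P.sigma_finite_measure_axioms)
  interpret L: pair_sigma_finite lborel "M \<Otimes>\<^sub>M M"
    by (simp add: pair_sigma_finite_def P sigma_finite_lborel)
  note [measurable] = fourier_ext_measurable[OF M s, of G]
  define F where "F = (\<lambda>p :: (real ^ 'n) \<times> ('a \<times> 'a). (exp (\<i> * of_real (fst p \<bullet> (s (fst (snd p)) - s (snd (snd p))))) *
     complex_of_real (gauss e (fst p))) * (G (fst (snd p)) * cnj (G (snd (snd p)))))"
  have [measurable]: "F \<in> borel_measurable (lborel \<Otimes>\<^sub>M (M \<Otimes>\<^sub>M M))" unfolding F_def by measurable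
  have int_GG: "integrable (M \<Otimes>\<^sub>M M) (\<lambda>z. G (fst z) * cnj (G (snd z)))"
    by (rule integral_pair_mult(1)[OF M M G cG])
  have int_F: "integrable (lborel \<Otimes>\<^sub>M (M \<Otimes>\<^sub>M M)) F"
  proof (rule Bochner_Integration.integrable_bound)
    show "integrable (lborel \<Otimes>\<^sub>M (M \<Otimes>\<^sub>M M)) (\<lambda>p :: (real ^ 'n) \<times> ('a \<times> 'a). complex_of_real (gauss e (fst p)) * (G (fst (snd p)) * cnj (G (snd (snd p)))))"
      by (rule integral_pair_mult(1)[OF _ P gauss_integrable[OF e] int_GG]) (rule sigma_finite_lborel)
    show "AE p in lborel \<Otimes>\<^sub>M (M \<Otimes>\<^sub>M M). norm (F p) \<le> norm (complex_of_real (gauss e (fst p)) * (G (fst (snd p)) * cnj (G (snd (snd p)))))"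
      by (simp add: F_def norm_mult)
  qed measurable
  then have int_F': "integrable (lborel \<Otimes>\<^sub>M (M \<Otimes>\<^sub>M M)) (case_prod (\<lambda>x z. F (x, z)))"
    by (simp add: case_prod_unfold)
  have x_int: "(\<integral>x. F (x, z) \<partial>lborel) = H z" for z
    unfolding F_def H_def fst_conv snd_conv
    by (simp only: integral_mult_left_zero gauss_fourier(2)[OF e]) (simp add: mult.commute)
  have z_int: "(\<integral>z. F (x, z) \<partial>(M \<Otimes>\<^sub>M M)) = complex_of_real (gauss e x * (norm (fourier_ext M s G x))\<^sup>2)" for x
  proof -
    define g where "g \<xi> = exp (\<i> * of_real (x \<bullet> s \<xi>)) * G \<xi>" for \<xi>
    have [measurable]: "g \<in> borel_measurable M" unfolding g_def by measurable
    have int_g: "integrable M g"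
      using G by (rule Bochner_Integration.integrable_bound) (auto simp: g_def norm_mult)
    have "F (x, z) = of_real (gauss e x) * (g (fst z) * cnj (g (snd z)))" for z
    proof -
      have "exp (\<i> * of_real (x \<bullet> (s (fst z) - s (snd z))))
          = exp (\<i> * of_real (x \<bullet> s (fst z))) * cnj (exp (\<i> * of_real (x \<bullet> s (snd z))))"
        by (simp add: exp_cnj inner_diff_right exp_add[symmetric] algebra_simps)
      then show ?thesis by (simp add: F_def g_def)
    qed
    then have "(\<integral>z. F (x, z) \<partial>(M \<Otimes>\<^sub>M M)) = of_real (gauss e x) * (\<integral>z. g (fst z) * cnj (g (snd z)) \<partial>(M \<Otimes>\<^sub>M M))"
      by simp
    also have "(\<integral>z. g (fst z) * cnj (g (snd z)) \<partial>(M \<Otimes>\<^sub>M M)) = (\<integral>z. g z \<partial>M) * (\<integral>z. cnj (g z) \<partial>M)"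
      by (rule integral_pair_mult(2)[OF M M int_g integrable_cnj[OF int_g]])
    also have "\<dots> = of_real ((norm (fourier_ext M s G x))\<^sup>2)"
    proof -
      have "fourier_ext M s G x = (\<integral>z. g z \<partial>M)" by (simp add: fourier_ext_def g_def)
      moreover have "(\<integral>z. cnj (g z) \<partial>M) = cnj (\<integral>z. g z \<partial>M)" by simp
      ultimately show ?thesis by (simp only: complex_norm_square)
    qed
    finally show ?thesis by simp
  qed
  show "integrable (M \<Otimes>\<^sub>M M) H"
    using L.integrable_snd[OF int_F'] by (simp add: x_int)
  have intU: "integrable lborel (\<lambda>x. complex_of_real (gauss e x * (norm (fourier_ext M s G x))\<^sup>2))"
    using L.integrable_fst'[OF int_F] unfolding z_int .
  have "(\<integral>x. complex_of_real (gauss e x * (norm (fourier_ext M s G x))\<^sup>2) \<partial>lborel) = (\<integral>z. H z \<partial>(M \<Otimes>\<^sub>M M))"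
    using L.integral_fst[OF int_F'] L.integral_snd[OF int_F'] by (simp only: x_int z_int)
  then have "(\<integral>z. H z \<partial>(M \<Otimes>\<^sub>M M)) = complex_of_real (\<integral>x. gauss e x * (norm (fourier_ext M s G x))\<^sup>2 \<partial>lborel)"
    by (simp only: integral_complex_of_real)
  then have "Re (\<integral>z. H z \<partial>(M \<Otimes>\<^sub>M M)) = (\<integral>x. gauss e x * (norm (fourier_ext M s G x))\<^sup>2 \<partial>lborel)" by simp
  moreover have "integrable lborel (\<lambda>x. gauss e x * (norm (fourier_ext M s G x))\<^sup>2)"
    using intU unfolding complex_of_real_integrable_eq .
  ultimately show "(\<integral>\<^sup>+x. ennreal (gauss e x * (norm (fourier_ext M s G x))\<^sup>2) \<partial>lborel) = ennreal (Re (\<integral>z. H z \<partial>(M \<Otimes>\<^sub>M M)))"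
    by (subst nn_integral_eq_integral) (auto simp: less_imp_le[OF gauss_pos])
qed

text \<open>If \<open>G\<close> acts boundedly on functions of \<open>s\<close> in \<open>L\<^sup>2\<close>, then its pushforward under \<open>s\<close> has an \<open>L\<^sup>2\<close>
  density, so this is Plancherel's inequality for that density. The Gaussian factor makes every
  integral finite before the bound is divided out.\<close>

lemma fourier_ext_L2:
  fixes s :: "'a \<Rightarrow> real ^ 'n"
  assumes M: "sigma_finite_measure M" and G: "integrable M G" and s [measurable]: "s \<in> borel_measurable M"
    and dual: "\<And>h :: real ^ 'n \<Rightarrow> ennreal. h \<in> borel_measurable borel \<Longrightarrow> (\<And>t. h t < top) \<Longrightarrow>
      (\<integral>\<^sup>+\<xi>. ennreal (norm (G \<xi>)) * h (s \<xi>) \<partial>M)\<^sup>2 \<le> B * (\<integral>\<^sup>+t. (h t)\<^sup>2 \<partial>lborel)"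
  shows "(\<integral>\<^sup>+x. ennreal ((norm (fourier_ext M s G x))\<^sup>2) \<partial>lborel) \<le> ennreal ((2 * pi) ^ CARD('n)) * B"
proof -
  have [measurable]: "G \<in> borel_measurable M" using G by auto
  interpret M: sigma_finite_measure M by fact
  interpret MM: pair_sigma_finite M M by (simp add: pair_sigma_finite_def M)
  interpret LM: pair_sigma_finite M "lborel :: (real ^ 'n) measure" by (simp add: pair_sigma_finite_def M sigma_finite_lborel)
  note [measurable] = fourier_ext_measurable[OF M s, of G]
  let ?c = "ennreal ((2 * pi) ^ CARD('n))"
  let ?U = "fourier_ext M s G"
  let ?g = "\<lambda>\<xi>. ennreal (norm (G \<xi>))"
  have Gfin: "(\<integral>\<^sup>+\<xi>. ?g \<xi> \<partial>M) < top" using G unfolding integrable_iff_bounded by simp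
  have main: "(\<integral>\<^sup>+x. ennreal (gauss e x * (norm (?U x))\<^sup>2) \<partial>lborel) \<le> ?c * B" if e: "0 < e" for e
  proof -
    let ?K = "\<lambda>t :: real ^ 'n. ennreal (gauss_hat e t)"
    let ?k = "ennreal (sqrt (2 * pi / e) ^ CARD('n))"
    have K_shift: "(\<integral>\<^sup>+t. ?K (t - u) \<partial>lborel) = ?c" for u
      using nn_integral_lborel_shift[of ?K "- u"] nn_integral_gauss_hat[OF e, where 'n='n] by simp
    have K_shift': "(\<integral>\<^sup>+t. ?K (u - t) \<partial>lborel) = ?c" for u
      using K_shift[of u] by (subst gauss_hat_minus)
    \<comment> \<open>\<open>h\<close> is the image of \<bar>G\<bar> dM under s smoothed by the
      Gaussian kernel, and \<open>h2\<close> below is \<open>h\<close> smoothed once more, so that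
      the square integral \<open>N\<close> of \<open>h\<close> is the pairing of \<bar>G\<bar> with
      \<open>h2\<close> composed with s. Testing \<open>dual\<close> with \<open>h2\<close> bounds
      N^2 by B times the square norm of \<open>h2\<close>, hence by a multiple of N itself.\<close>
    define h where "h t = (\<integral>\<^sup>+\<xi>. ?g \<xi> * ?K (t - s \<xi>) \<partial>M)" for t
    have [measurable]: "h \<in> borel_measurable borel" unfolding h_def by measurable
    have h_le: "h t \<le> (\<integral>\<^sup>+\<xi>. ?g \<xi> \<partial>M) * ?k" for t
      unfolding h_def
      by (subst nn_integral_multc[symmetric])
        (auto intro!: nn_integral_mono mult_left_mono ennreal_leI gauss_hat_le e)
    have h_fin: "h t < top" for t
      using h_le[of t] Gfin by (meson ennreal_less_top ennreal_mult_less_top le_less_trans)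
    have h_int: "(\<integral>\<^sup>+t. h t \<partial>lborel) = (\<integral>\<^sup>+\<xi>. ?g \<xi> \<partial>M) * ?c"
      unfolding h_def
      by (subst LM.Fubini') (simp_all add: nn_integral_cmult nn_integral_multc K_shift)
    define h2 where "h2 u = (\<integral>\<^sup>+t. h t * ?K (t - u) \<partial>lborel)" for u
    have [measurable]: "h2 \<in> borel_measurable borel" unfolding h2_def by measurable
    have h2_fin: "h2 u < top" for u
    proof -
      have "h2 u \<le> (\<integral>\<^sup>+t. h t \<partial>lborel) * ?k"
        unfolding h2_def
        by (subst nn_integral_multc[symmetric])
          (auto intro!: nn_integral_mono mult_left_mono ennreal_leI gauss_hat_le e)
      also have "\<dots> < top" using Gfin by (simp add: h_int ennreal_mult_less_top)
      finally show ?thesis .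
    qed
    define N where "N = (\<integral>\<^sup>+t. (h t)\<^sup>2 \<partial>lborel)"
    \<comment> \<open>One factor \<open>h\<close> is bounded and the other is integrable. This
      finiteness is what permits cancelling N.\<close>
    have N_fin: "N < top"
    proof -
      have "N \<le> (\<integral>\<^sup>+t. h t * ((\<integral>\<^sup>+\<xi>. ?g \<xi> \<partial>M) * ?k) \<partial>lborel)"
        unfolding N_def power2_eq_square by (intro nn_integral_mono mult_left_mono h_le) simp
      also have "\<dots> < top" using Gfin by (simp add: nn_integral_multc h_int ennreal_mult_less_top)
      finally show ?thesis .
    qed
    have "N = (\<integral>\<^sup>+t. (\<integral>\<^sup>+\<xi>. ?g \<xi> * (h t * ?K (t - s \<xi>)) \<partial>M) \<partial>lborel)"
      unfolding N_def power2_eq_square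
      by (subst (2) h_def) (auto intro!: nn_integral_cong simp: nn_integral_cmult[symmetric] mult_ac)
    also have "\<dots> = (\<integral>\<^sup>+\<xi>. ?g \<xi> * h2 (s \<xi>) \<partial>M)"
      unfolding h2_def by (subst LM.Fubini') (auto simp: nn_integral_cmult)
    finally have NB: "N\<^sup>2 \<le> B * (\<integral>\<^sup>+u. (h2 u)\<^sup>2 \<partial>lborel)"
      using dual[of h2] h2_fin by simp
    have "(\<integral>\<^sup>+u. (h2 u)\<^sup>2 \<partial>lborel) \<le> (\<integral>\<^sup>+u. (\<integral>\<^sup>+t. (h t)\<^sup>2 * ?K (t - u) \<partial>lborel) * ?c \<partial>lborel)"
    proof (intro nn_integral_mono)
      fix u :: "real ^ 'n"
      \<comment> \<open>Young's inequality by hand: the kernel is split into two square roots,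
        Cauchy-Schwarz is applied in t, and the mass of the kernel is used once in t here and once
        in u afterwards.\<close>
      define k where "k t = ennreal (sqrt (gauss_hat e (t - u)))" for t :: "real ^ 'n"
      have [measurable]: "k \<in> borel_measurable borel" unfolding k_def by measurable
      have sq: "k t * k t = ?K (t - u)" for t
        unfolding k_def by (subst ennreal_mult[symmetric]) (auto simp: gauss_hat_nonneg e)
      have "(h2 u)\<^sup>2 = (\<integral>\<^sup>+t. (h t * k t) * k t \<partial>lborel)\<^sup>2"
        unfolding h2_def by (simp add: mult.assoc sq)
      also have "\<dots> \<le> (\<integral>\<^sup>+t. (h t * k t)\<^sup>2 \<partial>lborel) * (\<integral>\<^sup>+t. (k t)\<^sup>2 \<partial>lborel)"
        by (rule Cauchy_Schwarz_nn_integral) measurable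
      also have "\<dots> = (\<integral>\<^sup>+t. (h t)\<^sup>2 * ?K (t - u) \<partial>lborel) * (\<integral>\<^sup>+t. ?K (t - u) \<partial>lborel)"
        by (simp only: power_mult_distrib power2_eq_square[of "k _"] sq)
      finally show "(h2 u)\<^sup>2 \<le> (\<integral>\<^sup>+t. (h t)\<^sup>2 * ?K (t - u) \<partial>lborel) * ?c" by (simp only: K_shift)
    qed
    also have "(\<integral>\<^sup>+u. (\<integral>\<^sup>+t. (h t)\<^sup>2 * ?K (t - u) \<partial>lborel) * ?c \<partial>lborel) = N * ?c * ?c"
      unfolding N_def
      by (subst nn_integral_multc, measurable, subst lborel_pair.Fubini')
        (auto simp: nn_integral_cmult nn_integral_multc K_shift')
    finally have "B * (\<integral>\<^sup>+u. (h2 u)\<^sup>2 \<partial>lborel) \<le> B * (N * ?c * ?c)" by (rule mult_left_mono) simp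
    from order.trans[OF NB this] have "N\<^sup>2 \<le> (B * ?c * ?c) * N" by (simp only: mult_ac)
    from ennreal_le_of_power2_le[OF this N_fin] have N: "N \<le> B * ?c * ?c" .
    \<comment> \<open>A second use of \<open>dual\<close>, now with \<open>h\<close>, controls the
      double integral of \<bar>G\<bar> against the Gaussian kernel. It dominates the quadratic form
      of \<open>gauss_quadratic\<close>, and the resulting bound does not depend on e.\<close>
    define Q where "Q = (\<integral>\<^sup>+\<xi>. ?g \<xi> * h (s \<xi>) \<partial>M)"
    have "Q\<^sup>2 \<le> B * N" unfolding Q_def N_def using h_fin by (intro dual) auto
    also have "\<dots> \<le> B * (B * ?c * ?c)" using N by (rule mult_left_mono) simp
    also have "\<dots> = (?c * B)\<^sup>2" by (simp add: power2_eq_square mult_ac)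
    finally have Q: "Q \<le> ?c * B" by (rule ennreal_power2_le_cancel)
    define H where "H = (\<lambda>z. G (fst z) * cnj (G (snd z)) * of_real (gauss_hat e (s (fst z) - s (snd z))))"
    have intH: "integrable (M \<Otimes>\<^sub>M M) H"
      unfolding H_def by (rule gauss_quadratic(1)[OF M G s e])
    have "(\<integral>\<^sup>+x. ennreal (gauss e x * (norm (?U x))\<^sup>2) \<partial>lborel) = ennreal (Re (\<integral>z. H z \<partial>(M \<Otimes>\<^sub>M M)))"
      unfolding H_def by (rule gauss_quadratic(2)[OF M G s e])
    also have "\<dots> \<le> ennreal (norm (\<integral>z. H z \<partial>(M \<Otimes>\<^sub>M M)))"
      by (intro ennreal_leI complex_Re_le_cmod)
    also have "\<dots> \<le> (\<integral>\<^sup>+z. ennreal (norm (H z)) \<partial>(M \<Otimes>\<^sub>M M))"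
      using integral_norm_bound_ennreal[OF intH] .
    also have "\<dots> = (\<integral>\<^sup>+z. ?g (fst z) * (?g (snd z) * ?K (s (fst z) - s (snd z))) \<partial>(M \<Otimes>\<^sub>M M))"
      by (intro nn_integral_cong) (simp add: H_def norm_mult ennreal_mult mult.assoc gauss_hat_nonneg[OF e])
    also have "\<dots> = Q"
      unfolding Q_def h_def
      by (subst M.nn_integral_fst[symmetric]) (auto simp: nn_integral_cmult)
    finally show ?thesis using Q by simp
  qed
  \<comment> \<open>The Gaussian factor is removed along e = 1/(k+1) by Fatou's lemma.\<close>
  have lim: "(\<lambda>k. ennreal (gauss (1 / real (Suc k)) x * (norm (?U x))\<^sup>2)) \<longlonglongrightarrow> ennreal ((norm (?U x))\<^sup>2)" for x
  proof (rule tendsto_ennrealI)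
    have "(\<lambda>k. exp (- (1 / real (Suc k) * (norm x)\<^sup>2) / 2)) \<longlonglongrightarrow> exp (- (0 * (norm x)\<^sup>2) / 2)"
      using LIMSEQ_inverse_real_of_nat by (intro tendsto_intros) (auto simp: inverse_eq_divide)
    then have "(\<lambda>k. gauss (1 / real (Suc k)) x) \<longlonglongrightarrow> 1" by (simp add: gauss_def)
    from tendsto_mult[OF this tendsto_const]
    show "(\<lambda>k. gauss (1 / real (Suc k)) x * (norm (?U x))\<^sup>2) \<longlonglongrightarrow> (norm (?U x))\<^sup>2" by simp
  qed
  have "(\<integral>\<^sup>+x. ennreal ((norm (?U x))\<^sup>2) \<partial>lborel)
      = (\<integral>\<^sup>+x. liminf (\<lambda>k. ennreal (gauss (1 / real (Suc k)) x * (norm (?U x))\<^sup>2)) \<partial>lborel)"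
    by (intro nn_integral_cong lim_imp_Liminf[symmetric] lim) simp
  also have "\<dots> \<le> liminf (\<lambda>k. \<integral>\<^sup>+x. ennreal (gauss (1 / real (Suc k)) x * (norm (?U x))\<^sup>2) \<partial>lborel)"
    by (rule nn_integral_liminf) measurable
  also have "\<dots> \<le> limsup (\<lambda>k::nat. ?c * B)"
    by (intro order.trans[OF Liminf_le_Limsup] Limsup_mono always_eventually allI main) auto
  also have "\<dots> = ?c * B" by (simp add: Limsup_const)
  finally show ?thesis .
qed

section \<open>The class \<open>\<B>\<^sub>N\<close> and multipliers\<close>

lemma epowr_two: "epowr a 2 = a\<^sup>2"
  by (cases a) (auto simp: epowr_def ennreal_power powr_numeral)

lemma epowr_half_power2: "(epowr a (1 / 2))\<^sup>2 = a"
  by (cases a) (auto simp: epowr_def ennreal_power powr_half_sqrt)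

lemma epowr_measurable [measurable]: "(\<lambda>a. epowr a r) \<in> borel_measurable borel"
  unfolding epowr_def[abs_def] by measurable

lemma Lp_norm_two: "Lp_norm M 2 f = epowr (\<integral>\<^sup>+x. (f x)\<^sup>2 \<partial>M) (1 / 2)"
  by (simp add: Lp_norm_def epowr_two)

lemma Lp_norm_two_power2: "(Lp_norm M 2 f)\<^sup>2 = (\<integral>\<^sup>+x. (f x)\<^sup>2 \<partial>M)"
  by (simp add: Lp_norm_two epowr_half_power2)

lemma nn_integral_count_space_measurable:
  fixes f :: "'k::countable \<Rightarrow> 'a \<Rightarrow> ennreal"
  assumes [measurable]: "\<And>k. f k \<in> borel_measurable M"
  shows "(\<lambda>x. \<integral>\<^sup>+k. f k x \<partial>count_space UNIV) \<in> borel_measurable M"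
proof -
  have "(\<lambda>z. f (snd z) (fst z)) \<in> borel_measurable (M \<Otimes>\<^sub>M count_space UNIV)"
    by (rule measurable_compose_countable[of "\<lambda>k z. f k (fst z)" _ _ snd]) measurable
  then show ?thesis
    by (intro sigma_finite_measure.borel_measurable_nn_integral[OF sigma_finite_measure_count_space_countable])
      (auto simp: case_prod_unfold)
qed

lemma nn_integral_periodization:
  fixes p :: "real ^ 'n \<Rightarrow> ennreal"
  assumes [measurable]: "p \<in> borel_measurable borel"
  shows "(\<integral>\<^sup>+x. indicator unit_cube x * (\<integral>\<^sup>+\<mu>. p (x + lattice_pt \<mu>) \<partial>count_space UNIV) \<partial>lborel)
    = (\<integral>\<^sup>+x. p x \<partial>lborel)"
proof -
  have "(\<integral>\<^sup>+x. p x \<partial>lborel) = (\<integral>\<^sup>+\<mu>. (\<integral>\<^sup>+x. indicator unit_cube x * p (x + lattice_pt \<mu>) \<partial>lborel) \<partial>count_space UNIV)"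
    by (rule nn_integral_tiling[where r=cell]) (auto simp: mem_unit_cube_iff)
  also have "\<dots> = (\<integral>\<^sup>+x. (\<integral>\<^sup>+\<mu>. indicator unit_cube x * p (x + lattice_pt \<mu>) \<partial>count_space UNIV) \<partial>lborel)"
    by (rule nn_integral_count_space_nn_integral[symmetric]) auto
  finally show ?thesis by (simp add: nn_integral_cmult)
qed

text \<open>With all slots but one fixed, the integral over the unit cube of the periodised p,
  translated by the sum of the fixed slots, is the integral of p; each fixed slot contributes a cube
  of volume one. Plain periodisation does not suffice, because a sum of points of the unit cube may
  leave the cube.\<close>

lemma nn_integral_block_cube_sum:
  fixes p :: "real ^ 'n \<Rightarrow> ennreal"
  assumes [measurable]: "p \<in> borel_measurable borel"
  shows "(\<integral>\<^sup>+\<theta>. indicator (block_cube :: ((real ^ 'n) ^ 'm) set) \<theta> *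
      (\<integral>\<^sup>+\<mu>. p ((\<Sum>j\<in>UNIV. \<theta> $ j) + lattice_pt \<mu>) \<partial>count_space UNIV) \<partial>lborel) = (\<integral>\<^sup>+x. p x \<partial>lborel)"
proof -
  interpret product_sigma_finite "\<lambda>_::'m. lborel :: (real ^ 'n) measure"
    by (rule product_sigma_finite_lborel)
  define P where "P x = (\<integral>\<^sup>+\<mu>. p (x + lattice_pt \<mu>) \<partial>count_space UNIV)" for x
  have [measurable]: "P \<in> borel_measurable borel"
    unfolding P_def by (rule nn_integral_count_space_measurable) measurable
  \<comment> \<open>An arbitrary slot, integrated first while the others are fixed.\<close>
  obtain j :: 'm where True by simp
  define I where "I = UNIV - {j}"
  have I: "finite I" "j \<notin> I" "insert j I = UNIV" by (auto simp: I_def)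
  have [measurable]: "(\<lambda>g. \<Sum>j\<in>UNIV. g j) \<in> PiM UNIV (\<lambda>_::'m. lborel :: (real ^ 'n) measure) \<rightarrow>\<^sub>M borel"
    by measurable
  have inner: "(\<integral>\<^sup>+y. indicator unit_cube y * P (y + c) \<partial>lborel) = (\<integral>\<^sup>+x. p x \<partial>lborel)" for c
  proof -
    have "(\<integral>\<^sup>+y. indicator unit_cube y * P (y + c) \<partial>lborel)
      = (\<integral>\<^sup>+x. indicator unit_cube x * (\<integral>\<^sup>+\<mu>. p ((x + lattice_pt \<mu>) + c) \<partial>count_space UNIV) \<partial>lborel)"
      by (simp add: P_def add_ac)
    also have "\<dots> = (\<integral>\<^sup>+x. p (x + c) \<partial>lborel)"
      by (rule nn_integral_periodization) measurable
    finally show ?thesis by (simp add: nn_integral_lborel_shift)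
  qed
  let ?F = "\<lambda>g :: 'm \<Rightarrow> real ^ 'n. (\<Prod>j\<in>UNIV. indicator unit_cube (g j)) * P (\<Sum>j\<in>UNIV. g j)"
  have "(\<integral>\<^sup>+\<theta>. indicator (block_cube :: ((real ^ 'n) ^ 'm) set) \<theta> * P (\<Sum>j\<in>UNIV. \<theta> $ j) \<partial>lborel)
      = (\<integral>\<^sup>+g. ?F g \<partial>PiM UNIV (\<lambda>_. lborel))"
    by (subst nn_integral_vec) (auto simp: indicator_block_cube)
  also have "\<dots> = (\<integral>\<^sup>+g. ?F g \<partial>PiM (insert j I) (\<lambda>_. lborel))" by (simp add: I)
  also have "\<dots> = (\<integral>\<^sup>+x. (\<integral>\<^sup>+y. ?F (x(j := y)) \<partial>lborel) \<partial>PiM I (\<lambda>_. lborel))"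
    by (rule product_nn_integral_insert) (use I in auto)
  also have "\<dots> = (\<integral>\<^sup>+x. (\<Prod>i\<in>I. indicator unit_cube (x i :: real ^ 'n)) * (\<integral>\<^sup>+x. p x \<partial>lborel) \<partial>PiM I (\<lambda>_. lborel))"
  proof (rule nn_integral_cong)
    fix x :: "'m \<Rightarrow> real ^ 'n"
    have "(\<Prod>i\<in>I. indicator unit_cube ((x(j := y)) i) :: ennreal) = (\<Prod>i\<in>I. indicator unit_cube (x i))" for y
      by (rule prod.cong) (use I in auto)
    then have pr: "(\<Prod>i\<in>UNIV. indicator unit_cube ((x(j := y)) i) :: ennreal)
        = indicator unit_cube y * (\<Prod>i\<in>I. indicator unit_cube (x i))" for y
      unfolding I(3)[symmetric] prod.insert[OF I(1,2)] by simp
    have "(\<Sum>i\<in>I. (x(j := y)) i) = (\<Sum>i\<in>I. x i)" for y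
      by (rule sum.cong) (use I in auto)
    then have su: "(\<Sum>i\<in>UNIV. (x(j := y)) i) = y + (\<Sum>i\<in>I. x i)" for y
      unfolding I(3)[symmetric] sum.insert[OF I(1,2)] by simp
    have "(\<integral>\<^sup>+y. ?F (x(j := y)) \<partial>lborel) = (\<integral>\<^sup>+y. (\<Prod>i\<in>I. indicator unit_cube (x i)) *
        (indicator unit_cube y * P (y + (\<Sum>i\<in>I. x i))) \<partial>lborel)"
      unfolding pr su by (simp add: mult_ac)
    also have "\<dots> = (\<Prod>i\<in>I. indicator unit_cube (x i)) * (\<integral>\<^sup>+x. p x \<partial>lborel)"
      by (subst nn_integral_cmult) (auto simp: inner)
    finally show "(\<integral>\<^sup>+y. ?F (x(j := y)) \<partial>lborel) = (\<Prod>i\<in>I. indicator unit_cube (x i)) * (\<integral>\<^sup>+x. p x \<partial>lborel)" .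
  qed
  also have "\<dots> = (\<integral>\<^sup>+x. p x \<partial>lborel)"
    using product_nn_integral_prod[OF I(1), of "\<lambda>_. indicator unit_cube"]
    by (subst nn_integral_multc) (auto simp: emeasure_unit_cube)
  finally show ?thesis by (simp add: P_def)
qed

lemma block_cell_add: "\<theta> \<in> block_cube \<Longrightarrow> block_cell (\<theta> + block_pt \<nu>) = \<nu>"
  using mem_block_cube_iff[of "\<theta> + block_pt \<nu>" \<nu>] by simp

lemma block_cell_measurable [measurable]:
  "(block_cell :: (real ^ 'n) ^ 'm \<Rightarrow> _) \<in> measurable borel (count_space UNIV)"
proof -
  have "block_cell -` {\<nu>} \<inter> space borel \<in> sets borel" for \<nu> :: "(int ^ 'n) ^ 'm"
  proof -
    have "block_cell -` {\<nu>} \<inter> space borel = (\<lambda>\<xi>. \<xi> - block_pt \<nu>) -` block_cube \<inter> space borel"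
      using mem_block_cube_iff by (auto simp: eq_commute)
    moreover have "(\<lambda>\<xi>. \<xi> - block_pt \<nu>) -` block_cube \<inter> space borel \<in> sets borel"
      by (rule measurable_sets[of _ borel borel]) measurable
    ultimately show ?thesis by simp
  qed
  then show ?thesis by (subst measurable_count_space_eq_countable) auto
qed

text \<open>For fixed \<theta> in the block cube the values of g_j and h at the lattice translates
  of \<theta>_j and of the sum of the \<theta>_j are sequences to which the inequality of
  \<open>B_class\<close> applies, since V of the cell of \<theta> + \<nu> is V \<nu>. On integrating
  in \<theta>, Cauchy-Schwarz separates h from the g_j, and periodisation restores all L2 norms. The
  squared form matches the hypothesis \<open>dual\<close> of \<open>fourier_ext_L2\<close>.\<close>

lemma B_class_dual:
  fixes V :: "(int ^ 'n) ^ 'm \<Rightarrow> real"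
  assumes "V \<in> B_class"
  obtains c :: real where "0 < c"
    "\<And>(g :: 'm \<Rightarrow> real ^ 'n \<Rightarrow> real) (h :: real ^ 'n \<Rightarrow> ennreal).
      (\<And>j. g j \<in> borel_measurable borel) \<Longrightarrow> (\<And>j x. 0 \<le> g j x) \<Longrightarrow>
      h \<in> borel_measurable borel \<Longrightarrow> (\<And>t. h t < top) \<Longrightarrow>
      (\<integral>\<^sup>+\<xi>. ennreal (V (block_cell \<xi>) * (\<Prod>j\<in>UNIV. g j (\<xi> $ j))) * h (\<Sum>j\<in>UNIV. \<xi> $ j) \<partial>lborel)\<^sup>2
      \<le> ennreal (c\<^sup>2) * (\<Prod>j\<in>UNIV. \<integral>\<^sup>+x. (ennreal (g j x))\<^sup>2 \<partial>lborel) * (\<integral>\<^sup>+t. (h t)\<^sup>2 \<partial>lborel)"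
proof -
  from assms obtain c :: real where c: "0 < c" and V: "\<And>\<nu>. 0 \<le> V \<nu>" and
    B: "\<And>(A0 :: int ^ 'n \<Rightarrow> real) (A :: 'm \<Rightarrow> int ^ 'n \<Rightarrow> real).
      (\<And>\<mu>. 0 \<le> A0 \<mu>) \<Longrightarrow> (\<And>j \<mu>. 0 \<le> A j \<mu>) \<Longrightarrow>
      (\<integral>\<^sup>+ \<nu>. ennreal (V \<nu> * A0 (\<Sum>j\<in>UNIV. \<nu> $ j) * (\<Prod>j\<in>UNIV. A j (\<nu> $ j))) \<partial>count_space UNIV)
          \<le> ennreal c * (Lp_norm (count_space UNIV) 2 (\<lambda>\<mu>. ennreal (A0 \<mu>)) *
              (\<Prod>j\<in>UNIV. Lp_norm (count_space UNIV) 2 (\<lambda>\<mu>. ennreal (A j \<mu>))))"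
    unfolding B_class_def by auto
  show thesis
  proof (rule that[OF c])
    fix g :: "'m \<Rightarrow> real ^ 'n \<Rightarrow> real" and h :: "real ^ 'n \<Rightarrow> ennreal"
    assume [measurable]: "\<And>j. g j \<in> borel_measurable borel" and g: "\<And>j x. 0 \<le> g j x"
      and [measurable]: "h \<in> borel_measurable borel" and h: "\<And>t. h t < top"
    define F where "F = (\<lambda>\<xi> :: (real ^ 'n) ^ 'm. ennreal (V (block_cell \<xi>) * (\<Prod>j\<in>UNIV. g j (\<xi> $ j))) * h (\<Sum>j\<in>UNIV. \<xi> $ j))"
    have [measurable]: "F \<in> borel_measurable borel" unfolding F_def by measurable
    define P where "P q x = (\<integral>\<^sup>+\<mu>. (q (x + lattice_pt \<mu>))\<^sup>2 \<partial>count_space UNIV)" for q :: "real ^ 'n \<Rightarrow> ennreal" and x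
    have P_meas: "P q \<in> borel_measurable borel" if [measurable]: "q \<in> borel_measurable borel" for q
      unfolding P_def by (rule nn_integral_count_space_measurable) measurable
    note [measurable] = P_meas[of h] P_meas[of "\<lambda>x. ennreal (g _ x)"]
    \<comment> \<open>\<open>L0\<close> is the l2 norm of the sampled h, and \<open>L1\<close> the
      product of the l2 norms of the sampled g_j.\<close>
    define L0 where "L0 \<theta> = epowr (P h (\<Sum>j\<in>UNIV. \<theta> $ j)) (1/2)" for \<theta> :: "(real ^ 'n) ^ 'm"
    define L1 where "L1 \<theta> = (\<Prod>j\<in>UNIV. epowr (P (\<lambda>x. ennreal (g j x)) (\<theta> $ j)) (1/2))" for \<theta> :: "(real ^ 'n) ^ 'm"
    have [measurable]: "L0 \<in> borel_measurable borel" "L1 \<in> borel_measurable borel"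
      unfolding L0_def[abs_def] L1_def[abs_def] by measurable
    have bound: "(\<integral>\<^sup>+\<nu>. F (\<theta> + block_pt \<nu>) \<partial>count_space UNIV) \<le> ennreal c * (L0 \<theta> * L1 \<theta>)"
      if \<theta>: "\<theta> \<in> block_cube" for \<theta>
    proof -
      have "F (\<theta> + block_pt \<nu>) = ennreal (V \<nu> * enn2real (h ((\<Sum>j\<in>UNIV. \<theta> $ j) + lattice_pt (\<Sum>j\<in>UNIV. \<nu> $ j)))
          * (\<Prod>j\<in>UNIV. g j (\<theta> $ j + lattice_pt (\<nu> $ j))))" for \<nu>
      proof -
        let ?x = "(\<Sum>j\<in>UNIV. \<theta> $ j) + lattice_pt (\<Sum>j\<in>UNIV. \<nu> $ j)"
        let ?p = "\<Prod>j\<in>UNIV. g j (\<theta> $ j + lattice_pt (\<nu> $ j))"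
        have "F (\<theta> + block_pt \<nu>) = ennreal (V \<nu> * ?p) * h ?x"
          unfolding F_def block_cell_add[OF \<theta>] by (simp add: block_pt_def sum.distrib lattice_pt_sum)
        also have "h ?x = ennreal (enn2real (h ?x))"
          using h[of ?x] by simp
        also have "ennreal (V \<nu> * ?p) * ennreal (enn2real (h ?x)) = ennreal ((V \<nu> * ?p) * enn2real (h ?x))"
          by (rule ennreal_mult[symmetric]) (auto simp: V g prod_nonneg)
        finally show ?thesis by (simp only: mult_ac)
      qed
      then have "(\<integral>\<^sup>+\<nu>. F (\<theta> + block_pt \<nu>) \<partial>count_space UNIV) \<le> ennreal c *
          (Lp_norm (count_space UNIV) 2 (\<lambda>\<mu>. ennreal (enn2real (h ((\<Sum>j\<in>UNIV. \<theta> $ j) + lattice_pt \<mu>)))) *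
          (\<Prod>j\<in>UNIV. Lp_norm (count_space UNIV) 2 (\<lambda>\<mu>. ennreal (g j (\<theta> $ j + lattice_pt \<mu>)))))"
        by (simp only:) (rule B; simp add: g)
      also have "\<dots> = ennreal c * (L0 \<theta> * L1 \<theta>)"
        unfolding L0_def L1_def P_def Lp_norm_two using h by (simp add: ennreal_enn2real_if less_top[symmetric])
      finally show ?thesis .
    qed
    have "(\<integral>\<^sup>+\<xi>. F \<xi> \<partial>lborel) = (\<integral>\<^sup>+\<nu>. (\<integral>\<^sup>+\<theta>. indicator block_cube \<theta> * F (\<theta> + block_pt \<nu>) \<partial>lborel) \<partial>count_space UNIV)"
      by (rule nn_integral_tiling[where r=block_cell]) (auto simp: mem_block_cube_iff)
    also have "\<dots> = (\<integral>\<^sup>+\<theta>. (\<integral>\<^sup>+\<nu>. indicator block_cube \<theta> * F (\<theta> + block_pt \<nu>) \<partial>count_space UNIV) \<partial>lborel)"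
      by (rule nn_integral_count_space_nn_integral[symmetric]) auto
    also have "\<dots> \<le> (\<integral>\<^sup>+\<theta>. ennreal c * ((indicator block_cube \<theta> * L0 \<theta>) * (indicator block_cube \<theta> * L1 \<theta>)) \<partial>lborel)"
    proof (intro nn_integral_mono)
      fix \<theta> :: "(real ^ 'n) ^ 'm"
      show "(\<integral>\<^sup>+\<nu>. indicator block_cube \<theta> * F (\<theta> + block_pt \<nu>) \<partial>count_space UNIV)
          \<le> ennreal c * ((indicator block_cube \<theta> * L0 \<theta>) * (indicator block_cube \<theta> * L1 \<theta>))"
        using bound[of \<theta>] by (cases "\<theta> \<in> block_cube") auto
    qed
    also have "\<dots> = ennreal c * (\<integral>\<^sup>+\<theta>. (indicator block_cube \<theta> * L0 \<theta>) * (indicator block_cube \<theta> * L1 \<theta>) \<partial>lborel)"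
      by (rule nn_integral_cmult) measurable
    finally have "(\<integral>\<^sup>+\<xi>. F \<xi> \<partial>lborel)\<^sup>2 \<le> (ennreal c * (\<integral>\<^sup>+\<theta>. (indicator block_cube \<theta> * L0 \<theta>) * (indicator block_cube \<theta> * L1 \<theta>) \<partial>lborel))\<^sup>2"
      by (rule power_mono) simp
    also have "\<dots> = ennreal (c\<^sup>2) * (\<integral>\<^sup>+\<theta>. (indicator block_cube \<theta> * L0 \<theta>) * (indicator block_cube \<theta> * L1 \<theta>) \<partial>lborel)\<^sup>2"
      using c by (simp add: power_mult_distrib ennreal_power)
    also have "\<dots> \<le> ennreal (c\<^sup>2) * ((\<integral>\<^sup>+\<theta>. (indicator block_cube \<theta> * L0 \<theta>)\<^sup>2 \<partial>lborel) * (\<integral>\<^sup>+\<theta>. (indicator block_cube \<theta> * L1 \<theta>)\<^sup>2 \<partial>lborel))"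
      by (intro mult_left_mono Cauchy_Schwarz_nn_integral) auto
    also have "(\<integral>\<^sup>+\<theta>. (indicator block_cube \<theta> * L0 \<theta>)\<^sup>2 \<partial>lborel) = (\<integral>\<^sup>+x. (h x)\<^sup>2 \<partial>lborel)"
    proof -
      have "(\<integral>\<^sup>+\<theta>. (indicator block_cube \<theta> * L0 \<theta>)\<^sup>2 \<partial>lborel)
          = (\<integral>\<^sup>+\<theta>. indicator (block_cube :: ((real ^ 'n) ^ 'm) set) \<theta> * P h (\<Sum>j\<in>UNIV. \<theta> $ j) \<partial>lborel)"
        unfolding L0_def by (intro nn_integral_cong) (auto simp: power_mult_distrib epowr_half_power2 indicator_def)
      also have "\<dots> = (\<integral>\<^sup>+x. (h x)\<^sup>2 \<partial>lborel)"
        unfolding P_def by (rule nn_integral_block_cube_sum) measurable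
      finally show ?thesis .
    qed
    also have "(\<integral>\<^sup>+\<theta>. (indicator block_cube \<theta> * L1 \<theta>)\<^sup>2 \<partial>lborel) = (\<Prod>j\<in>UNIV. \<integral>\<^sup>+x. (ennreal (g j x))\<^sup>2 \<partial>lborel)"
    proof -
      have "(\<integral>\<^sup>+\<theta>. (indicator block_cube \<theta> * L1 \<theta>)\<^sup>2 \<partial>lborel)
          = (\<integral>\<^sup>+\<theta>. (\<Prod>j\<in>UNIV. indicator unit_cube (\<theta> $ j) * P (\<lambda>x. ennreal (g j x)) (\<theta> $ j)) \<partial>(lborel :: ((real ^ 'n) ^ 'm) measure))"
      proof (intro nn_integral_cong)
        fix \<theta> :: "(real ^ 'n) ^ 'm"
        have "(indicator block_cube \<theta> * L1 \<theta>)\<^sup>2 = indicator block_cube \<theta> * (\<Prod>j\<in>UNIV. P (\<lambda>x. ennreal (g j x)) (\<theta> $ j))"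
          by (simp add: L1_def power_mult_distrib prod_power_distrib epowr_half_power2 indicator_def)
        then show "(indicator block_cube \<theta> * L1 \<theta>)\<^sup>2 = (\<Prod>j\<in>UNIV. indicator unit_cube (\<theta> $ j) * P (\<lambda>x. ennreal (g j x)) (\<theta> $ j))"
          by (simp only: indicator_block_cube prod.distrib)
      qed
      also have "\<dots> = (\<Prod>j\<in>UNIV. \<integral>\<^sup>+x. indicator unit_cube x * P (\<lambda>x. ennreal (g j x)) x \<partial>lborel)"
        by (rule nn_integral_vec_prod) measurable
      also have "\<dots> = (\<Prod>j\<in>UNIV. \<integral>\<^sup>+x. (ennreal (g j x))\<^sup>2 \<partial>lborel)"
        unfolding P_def by (intro prod.cong refl nn_integral_periodization) measurable
      finally show ?thesis .
    qed
    finally show "(\<integral>\<^sup>+\<xi>. F \<xi> \<partial>lborel)\<^sup>2 \<le> ennreal (c\<^sup>2) * (\<Prod>j\<in>UNIV. \<integral>\<^sup>+x. (ennreal (g j x))\<^sup>2 \<partial>lborel) * (\<integral>\<^sup>+t. (h t)\<^sup>2 \<partial>lborel)"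
      by (simp add: mult_ac)
  qed
qed

text \<open>\<open>B_class_dual\<close> with g_j = \<bar>u_j\<bar> verifies the duality hypothesis
  of \<open>fourier_ext_L2\<close>. C is chosen before u, m and D, which makes the estimate uniform
  over all frozen symbols.\<close>

lemma multiplier_bound:
  fixes V :: "(int ^ 'n) ^ 'm \<Rightarrow> real"
  assumes "V \<in> B_class"
  obtains C :: real where "0 < C"
    "\<And>(u :: 'm \<Rightarrow> real ^ 'n \<Rightarrow> complex) m D.
      (\<And>j. u j \<in> borel_measurable borel) \<Longrightarrow> 0 \<le> D \<Longrightarrow> (\<And>\<xi>. norm (m \<xi>) \<le> D * V (block_cell \<xi>)) \<Longrightarrow>
      integrable lborel (\<lambda>\<xi>. m \<xi> * (\<Prod>j\<in>UNIV. u j (\<xi> $ j))) \<Longrightarrow>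
      (\<integral>\<^sup>+x. ennreal ((norm (fourier_ext lborel (\<lambda>\<xi>. \<Sum>j\<in>UNIV. \<xi> $ j) (\<lambda>\<xi>. m \<xi> * (\<Prod>j\<in>UNIV. u j (\<xi> $ j))) x))\<^sup>2) \<partial>lborel)
      \<le> ennreal (C * D\<^sup>2) * (\<Prod>j\<in>UNIV. \<integral>\<^sup>+x. ennreal ((norm (u j x))\<^sup>2) \<partial>lborel)"
proof -
  have V: "\<And>\<nu>. 0 \<le> V \<nu>" using assms by (auto simp: B_class_def)
  obtain c :: real where c: "0 < c" and B: 
    "\<And>(g :: 'm \<Rightarrow> real ^ 'n \<Rightarrow> real) (h :: real ^ 'n \<Rightarrow> ennreal).
      (\<And>j. g j \<in> borel_measurable borel) \<Longrightarrow> (\<And>j x. 0 \<le> g j x) \<Longrightarrow>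
      h \<in> borel_measurable borel \<Longrightarrow> (\<And>t. h t < top) \<Longrightarrow>
      (\<integral>\<^sup>+\<xi>. ennreal (V (block_cell \<xi>) * (\<Prod>j\<in>UNIV. g j (\<xi> $ j))) * h (\<Sum>j\<in>UNIV. \<xi> $ j) \<partial>lborel)\<^sup>2
      \<le> ennreal (c\<^sup>2) * (\<Prod>j\<in>UNIV. \<integral>\<^sup>+x. (ennreal (g j x))\<^sup>2 \<partial>lborel) * (\<integral>\<^sup>+t. (h t)\<^sup>2 \<partial>lborel)"
    using B_class_dual[OF assms] by blast
  show thesis
  proof (rule that[of "(2 * pi) ^ CARD('n) * c\<^sup>2"])
    show "0 < (2 * pi) ^ CARD('n) * c\<^sup>2" using c by simp
    fix u :: "'m \<Rightarrow> real ^ 'n \<Rightarrow> complex" and m D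
    assume [measurable]: "\<And>j. u j \<in> borel_measurable borel" and D: "0 \<le> D"
      and m: "\<And>\<xi>. norm (m \<xi>) \<le> D * V (block_cell \<xi>)"
      and int: "integrable lborel (\<lambda>\<xi>. m \<xi> * (\<Prod>j\<in>UNIV. u j (\<xi> $ j)))"
    let ?P = "\<Prod>j\<in>UNIV. \<integral>\<^sup>+x. ennreal ((norm (u j x))\<^sup>2) \<partial>lborel"
    let ?G = "\<lambda>\<xi>. m \<xi> * (\<Prod>j\<in>UNIV. u j (\<xi> $ j))"
    have "(\<integral>\<^sup>+x. ennreal ((norm (fourier_ext lborel (\<lambda>\<xi>. \<Sum>j\<in>UNIV. \<xi> $ j) ?G x))\<^sup>2) \<partial>lborel)
      \<le> ennreal ((2 * pi) ^ CARD('n)) * (ennreal (D\<^sup>2 * c\<^sup>2) * ?P)"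
    proof (rule fourier_ext_L2[OF sigma_finite_lborel int])
      fix h :: "real ^ 'n \<Rightarrow> ennreal"
      assume [measurable]: "h \<in> borel_measurable borel" and h: "\<And>t. h t < top"
      have "(\<integral>\<^sup>+\<xi>. ennreal (norm (?G \<xi>)) * h (\<Sum>j\<in>UNIV. \<xi> $ j) \<partial>lborel)
        \<le> (\<integral>\<^sup>+\<xi>. ennreal D * (ennreal (V (block_cell \<xi>) * (\<Prod>j\<in>UNIV. norm (u j (\<xi> $ j)))) * h (\<Sum>j\<in>UNIV. \<xi> $ j)) \<partial>lborel)"
      proof (intro nn_integral_mono)
        fix \<xi> :: "(real ^ 'n) ^ 'm"
        have "norm (?G \<xi>) \<le> D * (V (block_cell \<xi>) * (\<Prod>j\<in>UNIV. norm (u j (\<xi> $ j))))"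
          using mult_right_mono[OF m[of \<xi>], of "\<Prod>j\<in>UNIV. norm (u j (\<xi> $ j))"]
          by (simp add: norm_mult prod_norm prod_nonneg mult.assoc)
        then have "ennreal (norm (?G \<xi>)) \<le> ennreal D * ennreal (V (block_cell \<xi>) * (\<Prod>j\<in>UNIV. norm (u j (\<xi> $ j))))"
          using D V by (subst ennreal_mult[symmetric]) (auto intro!: ennreal_leI mult_nonneg_nonneg prod_nonneg)
        then show "ennreal (norm (?G \<xi>)) * h (\<Sum>j\<in>UNIV. \<xi> $ j)
          \<le> ennreal D * (ennreal (V (block_cell \<xi>) * (\<Prod>j\<in>UNIV. norm (u j (\<xi> $ j)))) * h (\<Sum>j\<in>UNIV. \<xi> $ j))"
          unfolding mult.assoc[symmetric] by (rule mult_right_mono) simp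
      qed
      also have "\<dots> = ennreal D * (\<integral>\<^sup>+\<xi>. ennreal (V (block_cell \<xi>) * (\<Prod>j\<in>UNIV. norm (u j (\<xi> $ j)))) * h (\<Sum>j\<in>UNIV. \<xi> $ j) \<partial>lborel)"
        by (rule nn_integral_cmult) measurable
      finally have "(\<integral>\<^sup>+\<xi>. ennreal (norm (?G \<xi>)) * h (\<Sum>j\<in>UNIV. \<xi> $ j) \<partial>lborel)\<^sup>2
        \<le> (ennreal D * (\<integral>\<^sup>+\<xi>. ennreal (V (block_cell \<xi>) * (\<Prod>j\<in>UNIV. norm (u j (\<xi> $ j)))) * h (\<Sum>j\<in>UNIV. \<xi> $ j) \<partial>lborel))\<^sup>2"
        by (rule power_mono) simp
      also have "\<dots> = ennreal (D\<^sup>2) * (\<integral>\<^sup>+\<xi>. ennreal (V (block_cell \<xi>) * (\<Prod>j\<in>UNIV. norm (u j (\<xi> $ j)))) * h (\<Sum>j\<in>UNIV. \<xi> $ j) \<partial>lborel)\<^sup>2"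
        using D by (simp add: power_mult_distrib ennreal_power)
      also have "\<dots> \<le> ennreal (D\<^sup>2) * (ennreal (c\<^sup>2) * (\<Prod>j\<in>UNIV. \<integral>\<^sup>+x. (ennreal (norm (u j x)))\<^sup>2 \<partial>lborel) * (\<integral>\<^sup>+t. (h t)\<^sup>2 \<partial>lborel))"
        by (intro mult_left_mono B) (auto simp: h)
      also have "\<dots> = ennreal (D\<^sup>2 * c\<^sup>2) * ?P * (\<integral>\<^sup>+t. (h t)\<^sup>2 \<partial>lborel)"
        by (simp add: ennreal_mult ennreal_power mult.assoc)
      finally show "(\<integral>\<^sup>+\<xi>. ennreal (norm (?G \<xi>)) * h (\<Sum>j\<in>UNIV. \<xi> $ j) \<partial>lborel)\<^sup>2
        \<le> ennreal (D\<^sup>2 * c\<^sup>2) * ?P * (\<integral>\<^sup>+t. (h t)\<^sup>2 \<partial>lborel)" .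
    qed measurable
    also have "\<dots> = ennreal ((2 * pi) ^ CARD('n) * c\<^sup>2 * D\<^sup>2) * ?P"
    proof -
      have "ennreal ((2 * pi) ^ CARD('n) * (D\<^sup>2 * c\<^sup>2)) = ennreal ((2 * pi) ^ CARD('n)) * ennreal (D\<^sup>2 * c\<^sup>2)"
        by (rule ennreal_mult) auto
      then show ?thesis by (simp only: mult_ac)
    qed
    finally show "(\<integral>\<^sup>+x. ennreal ((norm (fourier_ext lborel (\<lambda>\<xi>. \<Sum>j\<in>UNIV. \<xi> $ j) ?G x))\<^sup>2) \<partial>lborel)
      \<le> ennreal ((2 * pi) ^ CARD('n) * c\<^sup>2 * D\<^sup>2) * ?P" .
  qed
qed

lemma fourier_eq_ext: "fourier f = fourier_ext lborel uminus f"
  by (auto simp: fourier_def fourier_ext_def inner_commute fun_eq_iff)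

text \<open>Plancherel's inequality: for s = \<open>uminus\<close> the duality hypothesis of
  \<open>fourier_ext_L2\<close> is Cauchy-Schwarz together with reflection invariance.\<close>

lemma fourier_L2:
  fixes f :: "real ^ 'n \<Rightarrow> complex"
  assumes "integrable lborel f"
  shows "(\<integral>\<^sup>+x. ennreal ((norm (fourier f x))\<^sup>2) \<partial>lborel)
    \<le> ennreal ((2 * pi) ^ CARD('n)) * (\<integral>\<^sup>+x. ennreal ((norm (f x))\<^sup>2) \<partial>lborel)"
  unfolding fourier_eq_ext
proof (rule fourier_ext_L2[OF sigma_finite_lborel assms])
  fix h :: "real ^ 'n \<Rightarrow> ennreal"
  assume [measurable]: "h \<in> borel_measurable borel"
  have [measurable]: "f \<in> borel_measurable borel" using assms by auto
  have "(\<integral>\<^sup>+\<xi>. ennreal (norm (f \<xi>)) * h (- \<xi>) \<partial>lborel)\<^sup>2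
    \<le> (\<integral>\<^sup>+\<xi>. (ennreal (norm (f \<xi>)))\<^sup>2 \<partial>lborel) * (\<integral>\<^sup>+\<xi>. (h (- \<xi>))\<^sup>2 \<partial>lborel)"
    by (rule Cauchy_Schwarz_nn_integral) measurable
  also have "(\<integral>\<^sup>+\<xi>. (h (- \<xi>))\<^sup>2 \<partial>lborel) = (\<integral>\<^sup>+\<xi>. (h \<xi>)\<^sup>2 \<partial>lborel)"
    using nn_integral_lborel_reflect[of "\<lambda>x. (h x)\<^sup>2" 0] by simp
  finally show "(\<integral>\<^sup>+\<xi>. ennreal (norm (f \<xi>)) * h (- \<xi>) \<partial>lborel)\<^sup>2
    \<le> (\<integral>\<^sup>+x. ennreal ((norm (f x))\<^sup>2) \<partial>lborel) * (\<integral>\<^sup>+t. (h t)\<^sup>2 \<partial>lborel)"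
    by (simp add: ennreal_power)
qed measurable

section \<open>Schwartz functions and their Fourier transforms\<close>

definition rapid :: "('a::euclidean_space \<Rightarrow> complex) set" where
  "rapid = {f. \<forall>k. \<exists>C. \<forall>x. (1 + norm x) ^ k * norm (f x) \<le> C}"

definition slow :: "('a::euclidean_space \<Rightarrow> complex) set" where
  "slow = {f. \<exists>k C. \<forall>x. norm (f x) \<le> C * (1 + norm x) ^ k}"

lemma rapid_add: "f \<in> rapid \<Longrightarrow> g \<in> rapid \<Longrightarrow> (\<lambda>x. f x + g x) \<in> rapid"
  unfolding rapid_def
proof (intro CollectI allI)
  fix k assume "f \<in> {f. \<forall>k. \<exists>C. \<forall>x. (1 + norm x) ^ k * norm (f x) \<le> C}"
    "g \<in> {f. \<forall>k. \<exists>C. \<forall>x. (1 + norm x) ^ k * norm (f x) \<le> C}"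
  then obtain C D where *: "\<And>x. (1 + norm x) ^ k * norm (f x) \<le> C" "\<And>x. (1 + norm x) ^ k * norm (g x) \<le> D"
    by blast
  have "(1 + norm x) ^ k * norm (f x + g x) \<le> C + D" for x
  proof -
    have "(1 + norm x) ^ k * norm (f x + g x) \<le> (1 + norm x) ^ k * (norm (f x) + norm (g x))"
      by (intro mult_left_mono norm_triangle_ineq) auto
    also have "\<dots> \<le> C + D" using *[of x] by (simp add: distrib_left)
    finally show ?thesis .
  qed
  then show "\<exists>C. \<forall>x. (1 + norm x) ^ k * norm (f x + g x) \<le> C" by blast
qed

lemma slow_mult_rapid:
  assumes "f \<in> slow" "g \<in> rapid"
  shows "(\<lambda>x. f x * g x) \<in> rapid"
  unfolding rapid_def
proof (intro CollectI allI)
  fix k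
  obtain l C where C: "\<And>x. norm (f x) \<le> C * (1 + norm x) ^ l" using assms(1) by (auto simp: slow_def)
  obtain D where D: "\<And>x. (1 + norm x) ^ (k + l) * norm (g x) \<le> D" using assms(2) unfolding rapid_def by blast
  have "(1 + norm x) ^ k * norm (f x * g x) \<le> \<bar>C\<bar> * \<bar>D\<bar>" for x
  proof -
    have "norm (f x) \<le> \<bar>C\<bar> * (1 + norm x) ^ l"
      using C[of x] by (rule order.trans) (intro mult_right_mono, auto)
    then have "(1 + norm x) ^ k * norm (f x * g x) \<le> (1 + norm x) ^ k * ((\<bar>C\<bar> * (1 + norm x) ^ l) * norm (g x))"
      unfolding norm_mult by (intro mult_left_mono mult_right_mono) auto
    also have "\<dots> = \<bar>C\<bar> * ((1 + norm x) ^ (k + l) * norm (g x))" by (simp add: power_add)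
    also have "\<dots> \<le> \<bar>C\<bar> * \<bar>D\<bar>" using D[of x] by (intro mult_left_mono) auto
    finally show ?thesis .
  qed
  then show "\<exists>C. \<forall>x. (1 + norm x) ^ k * norm (f x * g x) \<le> C" by blast
qed

text \<open>From monomials to powers of 1 + norm x, pure powers of one coordinate are enough: 1 +
  norm x is at most 1 + d times the larger of 1 and the largest coordinate in modulus. Conversely
  every coordinate is at most 1 + norm x in modulus.\<close>

lemma schwartz_eq: "schwartz f \<longleftrightarrow> f \<in> derivs_in rapid"
proof
  assume S: "schwartz (f :: 'a \<Rightarrow> complex)"
  then have sm: "smooth f" by (simp add: schwartz_def)
  have "foldr partial bs f \<in> rapid" if bs: "set bs \<subseteq> Basis" for bs
    unfolding rapid_def
  proof (intro CollectI allI)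
    fix k
    define d where "d = real DIM('a)"
    let ?g = "mderiv (count (mset bs)) f"
    have "\<forall>b\<in>Basis. \<exists>C. \<forall>x. \<bar>x \<bullet> b\<bar> ^ k * norm (?g x) \<le> C"
    proof
      fix b :: 'a assume b: "b \<in> Basis"
      have "(\<Prod>c\<in>Basis. (x \<bullet> c) ^ (if c = b then k else 0)) = (x \<bullet> b) ^ k" for x
        using b by (subst prod.remove[of _ b]) (auto intro!: prod.neutral)
      moreover obtain C where "\<And>x. norm ((\<Prod>c\<in>Basis. (x \<bullet> c) ^ (if c = b then k else 0)) *\<^sub>R ?g x) \<le> C"
        using S unfolding schwartz_def by meson
      ultimately show "\<exists>C. \<forall>x. \<bar>x \<bullet> b\<bar> ^ k * norm (?g x) \<le> C"
        by (auto simp: power_abs)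
    qed
    then obtain C where C: "\<And>b x. b \<in> Basis \<Longrightarrow> \<bar>x \<bullet> b\<bar> ^ k * norm (?g x) \<le> C b" by metis
    obtain C0 where C0: "\<And>x. norm ((\<Prod>c\<in>Basis. (x \<bullet> c) ^ (\<lambda>_. 0) c) *\<^sub>R ?g x) \<le> C0"
      using S unfolding schwartz_def by meson
    have "(1 + norm x) ^ k * norm (?g x) \<le> (1 + d) ^ k * (C0 + (\<Sum>b\<in>Basis. C b))" for x
    proof -
      have nn: "0 \<le> C b" if "b \<in> Basis" for b
        using order.trans[OF _ C[OF that, of x]] by simp
      obtain M where M: "1 + norm x \<le> (1 + d) * M" "M ^ k * norm (?g x) \<le> C0 + (\<Sum>b\<in>Basis. C b)" "0 \<le> M"
      proof (cases "\<exists>b\<in>Basis. 1 \<le> \<bar>x \<bullet> b\<bar>")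
        case False
        show ?thesis
        proof (rule that[of 1])
          have "norm x \<le> (\<Sum>b\<in>Basis. \<bar>x \<bullet> b\<bar>)" by (rule norm_le_l1)
          also have "\<dots> \<le> (\<Sum>b\<in>(Basis::'a set). 1)" using False by (intro sum_mono) force
          finally show "1 + norm x \<le> (1 + d) * 1" by (simp add: d_def)
          show "1 ^ k * norm (?g x) \<le> C0 + (\<Sum>b\<in>Basis. C b)"
            using C0[of x] sum_nonneg[of Basis C] nn by simp
        qed simp
      next
        case True
        define M where "M = Max ((\<lambda>b. \<bar>x \<bullet> b\<bar>) ` Basis)"
        have fin: "finite ((\<lambda>b. \<bar>x \<bullet> b\<bar>) ` Basis)" by simp
        have Mge: "\<bar>x \<bullet> b\<bar> \<le> M" if "b \<in> Basis" for b
          unfolding M_def using that by (intro Max_ge) auto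
        have "M \<in> (\<lambda>b. \<bar>x \<bullet> b\<bar>) ` Basis" unfolding M_def by (intro Max_in) auto
        then obtain b where b: "b \<in> Basis" "M = \<bar>x \<bullet> b\<bar>" by auto
        have M1: "1 \<le> M" using True Mge by force
        show ?thesis
        proof (rule that[of M])
          have "norm x \<le> (\<Sum>b\<in>Basis. \<bar>x \<bullet> b\<bar>)" by (rule norm_le_l1)
          also have "\<dots> \<le> (\<Sum>b\<in>(Basis::'a set). M)" using Mge by (intro sum_mono)
          finally show "1 + norm x \<le> (1 + d) * M" using M1 by (simp add: d_def distrib_right)
          have "M ^ k * norm (?g x) \<le> C b" using C[OF b(1)] b(2) by simp
          also have "\<dots> \<le> (\<Sum>b\<in>Basis. C b)" using b nn by (intro member_le_sum) auto
          also have "\<dots> \<le> C0 + (\<Sum>b\<in>Basis. C b)" using order.trans[OF norm_ge_zero C0[of x]] by simp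
          finally show "M ^ k * norm (?g x) \<le> C0 + (\<Sum>b\<in>Basis. C b)" .
        qed (use M1 in simp)
      qed
      have "(1 + norm x) ^ k * norm (?g x) \<le> ((1 + d) * M) ^ k * norm (?g x)"
        using M(1) by (intro mult_right_mono power_mono) auto
      also have "\<dots> = (1 + d) ^ k * (M ^ k * norm (?g x))" by (simp add: power_mult_distrib)
      also have "\<dots> \<le> (1 + d) ^ k * (C0 + (\<Sum>b\<in>Basis. C b))"
        using M(2) by (intro mult_left_mono) (auto simp: d_def)
      finally show ?thesis .
    qed
    then show "\<exists>C. \<forall>x. (1 + norm x) ^ k * norm (foldr partial bs f x) \<le> C"
      unfolding foldr_partial_eq_mderiv[OF sm bs] by blast
  qed
  then show "f \<in> derivs_in rapid" using sm by (auto simp: derivs_in_def)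
next
  assume f: "f \<in> derivs_in rapid"
  have "\<exists>C. \<forall>x. norm ((\<Prod>b\<in>Basis. (x \<bullet> b) ^ \<alpha> b) *\<^sub>R mderiv \<beta> f x) \<le> C" for \<alpha> \<beta>
  proof -
    have "set (concat (map (\<lambda>b. replicate (\<beta> b) b) basis_list)) \<subseteq> Basis"
      by (auto simp: basis_list)
    from derivs_inD(3)[OF f this] have "mderiv \<beta> f \<in> rapid" by (simp add: mderiv_eq_foldr)
    then obtain C where C: "\<And>x. (1 + norm x) ^ (\<Sum>b\<in>Basis. \<alpha> b) * norm (mderiv \<beta> f x) \<le> C"
      unfolding rapid_def by blast
    have "norm ((\<Prod>b\<in>Basis. (x \<bullet> b) ^ \<alpha> b) *\<^sub>R mderiv \<beta> f x) \<le> C" for x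
    proof -
      have "norm (\<Prod>b\<in>Basis. (x \<bullet> b) ^ \<alpha> b) \<le> (\<Prod>b\<in>Basis. (1 + norm x) ^ \<alpha> b)"
        unfolding prod_norm[symmetric] norm_power
        using Basis_le_norm[of _ x] by (intro prod_mono conjI power_mono) (auto simp: add_increasing)
      then show ?thesis
        using C[of x] by (simp add: power_sum[symmetric] mult_right_mono order.trans[OF mult_right_mono])
    qed
    then show ?thesis by blast
  qed
  then show "schwartz f" using f by (auto simp: schwartz_def dest: derivs_inD)
qed

lemma schwartz_slow_mult: "f \<in> derivs_in slow \<Longrightarrow> g \<in> derivs_in rapid \<Longrightarrow> (\<lambda>x. f x * g x) \<in> derivs_in rapid"
  by (erule derivs_in_mult) (auto intro: rapid_add slow_mult_rapid)

text \<open>A product of one-dimensional profiles instead of a power of 1 + norm x: it is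
  integrable, its integrals split over the coordinates, and its factors are exactly the squared
  moduli of 1 / (1 - \<i> s), the smooth weights used for localisation.\<close>

definition cauchy_weight :: "real ^ 'n \<Rightarrow> real" where
  "cauchy_weight x = (\<Prod>i\<in>UNIV. inverse (1 + (x $ i)\<^sup>2))"

lemma cauchy_weight_pos: "0 < cauchy_weight x"
  unfolding cauchy_weight_def by (intro prod_pos) (auto simp: add_pos_nonneg)

lemma cauchy_weight_integrable: "integrable lborel (\<lambda>x. complex_of_real (cauchy_weight x))"
proof -
  have "integrable lborel (\<lambda>x::real. inverse (1 + x\<^sup>2))"
    using integrable_inverse_1_plus_square by (simp add: set_integrable_def)
  then show ?thesis unfolding cauchy_weight_def of_real_prod
    by (intro integral_vec_prod(2)) (simp add: complex_of_real_integrable_eq del: of_real_inverse)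
qed

lemma integrable_cauchy_dominated:
  fixes f :: "real ^ 'n \<Rightarrow> complex"
  assumes [measurable]: "f \<in> borel_measurable borel" and "\<And>x. norm (f x) \<le> C * cauchy_weight x"
  shows "integrable lborel f"
proof (rule Bochner_Integration.integrable_bound)
  show "integrable lborel (\<lambda>x :: real ^ 'n. of_real C * complex_of_real (cauchy_weight x))"
    by (intro integrable_mult_right cauchy_weight_integrable)
  have "norm (f x) \<le> norm (of_real C * complex_of_real (cauchy_weight x))" for x
    using order.trans[OF assms(2) abs_ge_self] by (simp add: norm_mult abs_mult)
  then show "AE x in lborel. norm (f x) \<le> norm (of_real C * complex_of_real (cauchy_weight x))" by simp
qed measurable

lemma rapid_integrable:
  fixes f :: "real ^ 'n \<Rightarrow> complex"
  assumes m: "f \<in> borel_measurable borel" and f: "f \<in> rapid"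
  shows "integrable lborel f"
proof -
  \<comment> \<open>The exponent is 2n because the product of the n factors 1 + x_i^2 is at most 1 +
    norm x to the power 2n.\<close>
  obtain C where C: "\<And>x. (1 + norm x) ^ (2 * CARD('n)) * norm (f x) \<le> C" using f unfolding rapid_def by blast
  show ?thesis
  proof (rule integrable_cauchy_dominated[OF m])
    fix x :: "real ^ 'n"
    have "(\<Prod>i\<in>UNIV. 1 + (x $ i)\<^sup>2) \<le> (\<Prod>i::'n\<in>UNIV. (1 + norm x)\<^sup>2)"
    proof (intro prod_mono conjI)
      fix i
      have "(x $ i)\<^sup>2 \<le> (norm x)\<^sup>2" using component_le_norm_cart[of x i] by (simp add: abs_le_square_iff[symmetric])
      then show "1 + (x $ i)\<^sup>2 \<le> (1 + norm x)\<^sup>2" using norm_ge_zero[of x] by (simp add: power2_sum del: norm_ge_zero)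
    qed auto
    also have "\<dots> = (1 + norm x) ^ (2 * CARD('n))" by (simp add: power_mult)
    finally have "(\<Prod>i\<in>UNIV. 1 + (x $ i)\<^sup>2) * norm (f x) \<le> C"
      by (intro order.trans[OF mult_right_mono C[of x]]) auto
    moreover have "cauchy_weight x * (\<Prod>i\<in>UNIV. 1 + (x $ i)\<^sup>2) = 1"
      unfolding cauchy_weight_def prod.distrib[symmetric]
      by (intro prod.neutral ballI left_inverse) (simp add: add_nonneg_eq_0_iff)
    ultimately have "norm (f x) \<le> cauchy_weight x * C"
      using mult_left_mono[of "(\<Prod>i\<in>UNIV. 1 + (x $ i)\<^sup>2) * norm (f x)" C "cauchy_weight x"] cauchy_weight_pos[of x]
      by (simp add: mult.assoc[symmetric])
    then show "norm (f x) \<le> C * cauchy_weight x" by (simp add: mult.commute)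
  qed
qed

lemma schwartz_integrable: "f \<in> derivs_in rapid \<Longrightarrow> integrable lborel (f :: real ^ 'n \<Rightarrow> complex)"
  by (intro rapid_integrable smooth_measurable) (auto dest: derivs_inD)

section \<open>Integration by parts and derivatives of Fourier transforms\<close>

lemma lborel_integral_shift:
  fixes f :: "'a::euclidean_space \<Rightarrow> complex"
  assumes "integrable lborel f"
  shows "integrable lborel (\<lambda>x. f (x + c))" "(\<integral>x. f (x + c) \<partial>lborel) = (\<integral>x. f x \<partial>lborel)"
proof -
  have [measurable]: "f \<in> borel_measurable borel" using assms by auto
  have "integrable (distr lborel borel ((+) c)) f" using assms by (simp add: lborel_distr_plus)
  then show "integrable lborel (\<lambda>x. f (x + c))" by (simp add: integrable_distr_eq add.commute)
  have "(\<integral>x. f x \<partial>lborel) = (\<integral>x. f x \<partial>distr lborel borel ((+) c))" by (simp add: lborel_distr_plus)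
  then show "(\<integral>x. f (x + c) \<partial>lborel) = (\<integral>x. f x \<partial>lborel)" by (simp add: integral_distr add.commute)
qed

text \<open>By translation invariance \<open>F (x + b) - F x\<close> integrates to zero, and it is the average of the
  directional derivative over a unit segment.\<close>

lemma integral_derivative_zero:
  fixes F :: "'a::euclidean_space \<Rightarrow> complex"
  assumes d: "\<And>x t. ((\<lambda>t. F (x + t *\<^sub>R b)) has_vector_derivative F' (x + t *\<^sub>R b)) (at t)"
    and F: "integrable lborel F" and F': "integrable lborel F'" and c: "continuous_on UNIV F'"
  shows "(\<integral>x. F' x \<partial>lborel) = 0"
proof -
  have [measurable]: "F' \<in> borel_measurable borel" using F' by auto
  define H where "H = (\<lambda>(x, s::real). indicator {0..1} s *\<^sub>R F' (x + s *\<^sub>R b))"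
  have [measurable]: "H \<in> borel_measurable (lborel \<Otimes>\<^sub>M lborel)"
    unfolding H_def by measurable
  have inner: "(\<integral>s. H (x, s) \<partial>lborel) = F (x + b) - F x" for x
  proof -
    have "(\<integral>s. indicator {0..1} s *\<^sub>R F' (x + s *\<^sub>R b) \<partial>lborel) = F (x + 1 *\<^sub>R b) - F (x + 0 *\<^sub>R b)"
    proof (rule integral_FTC_Icc)
      show "continuous_on {0..1} (\<lambda>s. F' (x + s *\<^sub>R b))"
        by (intro continuous_on_compose2[OF c] continuous_intros) auto
    qed (auto intro: has_vector_derivative_at_within d)
    then show ?thesis by (simp add: H_def)
  qed
  have "(\<integral>\<^sup>+z. ennreal (norm (H z)) \<partial>(lborel \<Otimes>\<^sub>M lborel)) = (\<integral>\<^sup>+s. (\<integral>\<^sup>+x. ennreal (norm (H (x, s))) \<partial>lborel) \<partial>lborel)"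
    by (rule lborel_pair.nn_integral_snd[symmetric]) measurable
  also have "\<dots> = (\<integral>\<^sup>+s. indicator {0..1} s * (\<integral>\<^sup>+x. ennreal (norm (F' x)) \<partial>lborel) \<partial>(lborel :: real measure))"
  proof (rule nn_integral_cong)
    fix s :: real
    show "(\<integral>\<^sup>+x. ennreal (norm (H (x, s))) \<partial>lborel) = indicator {0..1} s * (\<integral>\<^sup>+x. ennreal (norm (F' x)) \<partial>lborel)"
      using nn_integral_lborel_shift[of "\<lambda>x. ennreal (norm (F' x))" "s *\<^sub>R b"]
      by (auto simp: H_def indicator_def)
  qed
  also have "\<dots> < \<infinity>"
    using F' by (subst nn_integral_multc) (auto simp: integrable_iff_bounded)
  finally have int: "integrable (lborel \<Otimes>\<^sub>M lborel) H" by (intro integrableI_bounded) auto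
  have eq: "case_prod (\<lambda>x s. H (x, s)) = H" by auto
  have "(\<integral>s. (\<integral>x. H (x, s) \<partial>lborel) \<partial>lborel) = (\<integral>x. (\<integral>s. H (x, s) \<partial>lborel) \<partial>lborel)"
    by (rule lborel_pair.Fubini_integral) (simp add: eq int)
  also have "\<dots> = 0"
    unfolding inner using lborel_integral_shift[OF F, of b] F by simp
  also have "(\<lambda>s. \<integral>x. H (x, s) \<partial>lborel) = (\<lambda>s. indicator {0..1} s *\<^sub>R (\<integral>x. F' x \<partial>lborel))"
    using lborel_integral_shift[OF F'] by (auto simp: H_def fun_eq_iff)
  finally show ?thesis by simp
qed

lemma norm_iexp_diff_le: "norm (exp (\<i> * of_real a) - exp (\<i> * of_real b)) \<le> \<bar>a - b\<bar>"
proof -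
  have "exp (\<i> * of_real a) - exp (\<i> * of_real b) = exp (\<i> * of_real b) * (iexp (a - b) - 1)"
    by (simp add: algebra_simps exp_add[symmetric] flip: of_real_mult)
  then show ?thesis using iexp_approx1[of "a - b" 0] by (simp add: norm_mult)
qed

lemma fourier_alt: "fourier f \<xi> = (\<integral>x. exp (\<i> * of_real (- (x \<bullet> \<xi>))) * f x \<partial>lborel)"
  by (simp add: fourier_def)

lemma fourier_integrable:
  assumes "integrable lborel f"
  shows "integrable lborel (\<lambda>x. exp (\<i> * of_real (- (x \<bullet> \<xi>))) * f x)"
proof -
  have [measurable]: "f \<in> borel_measurable borel" using assms by auto
  show ?thesis using assms by (rule Bochner_Integration.integrable_bound) (auto simp: norm_mult)
qed

lemma norm_fourier_le:
  assumes "integrable lborel f"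
  shows "norm (fourier f \<xi>) \<le> (\<integral>x. norm (f x) \<partial>lborel)"
  using integral_norm_bound[of lborel "\<lambda>x. exp (\<i> * of_real (- (x \<bullet> \<xi>))) * f x"]
  by (simp add: fourier_def norm_mult del: integral_norm_bound)

lemma fourier_continuous:
  fixes f :: "'a::euclidean_space \<Rightarrow> complex"
  assumes f: "integrable lborel f"
  shows "continuous_on UNIV (fourier f)"
proof (rule continuous_at_imp_continuous_on, rule ballI)
  fix \<xi> :: 'a
  have [measurable]: "f \<in> borel_measurable borel" using f by auto
  show "isCont (fourier f) \<xi>"
    unfolding continuous_at_sequentially comp_def fourier_alt
  proof (intro allI impI integral_dominated_convergence[where w="\<lambda>x. norm (f x)"])
    fix X assume X: "X \<longlonglongrightarrow> \<xi>"
    show "AE x in lborel. (\<lambda>k. exp (\<i> * of_real (- (x \<bullet> X k))) * f x) \<longlonglongrightarrow> exp (\<i> * of_real (- (x \<bullet> \<xi>))) * f x"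
      by (intro AE_I2 tendsto_intros X)
  qed (use f in \<open>auto simp: norm_mult\<close>)
qed

lemma has_vector_derivative_iff_slope:
  fixes f :: "real \<Rightarrow> complex"
  shows "(f has_vector_derivative D) (at t) \<longleftrightarrow> ((\<lambda>h. (f (t + h) - f t) / of_real h) \<longlongrightarrow> D) (at 0)"
proof -
  have ev: "\<forall>\<^sub>F h in at 0. norm (f (t + h) - f t - h *\<^sub>R D) / norm h = norm ((f (t + h) - f t) / of_real h - D)"
    unfolding eventually_at_filter
  proof (intro always_eventually allI impI)
    fix h :: real assume "h \<noteq> 0"
    then have "(f (t + h) - f t) / of_real h - D = (f (t + h) - f t - h *\<^sub>R D) / of_real h"
      by (simp add: diff_divide_distrib scaleR_conv_of_real)
    then show "norm (f (t + h) - f t - h *\<^sub>R D) / norm h = norm ((f (t + h) - f t) / of_real h - D)"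
      by (simp only: norm_divide norm_of_real real_norm_def)
  qed
  have "(f has_vector_derivative D) (at t) \<longleftrightarrow> ((\<lambda>h. norm (f (t + h) - f t - h *\<^sub>R D) / norm h) \<longlongrightarrow> 0) (at 0)"
    by (simp add: has_vector_derivative_def has_derivative_at bounded_linear_scaleR_left)
  also have "\<dots> \<longleftrightarrow> ((\<lambda>h. norm ((f (t + h) - f t) / of_real h - D)) \<longlongrightarrow> 0) (at 0)"
    by (rule filterlim_cong[OF refl refl ev])
  also have "\<dots> \<longleftrightarrow> ((\<lambda>h. (f (t + h) - f t) / of_real h) \<longlongrightarrow> D) (at 0)"
    by (simp only: tendsto_norm_zero_iff LIM_zero_iff)
  finally show ?thesis .
qed

text \<open>Dominated convergence for difference quotients, with the bound \<bar>y . b\<bar> \<bar>f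
  y\<bar> supplied by \<open>norm_iexp_diff_le\<close>. The derivative is taken along a line, the
  form that \<open>integral_derivative_zero\<close> consumes.\<close>

lemma fourier_has_derivative:
  fixes f :: "'a::euclidean_space \<Rightarrow> complex"
  assumes f: "integrable lborel f" and g: "integrable lborel (\<lambda>y. - \<i> * of_real (y \<bullet> b) * f y)"
  shows "((\<lambda>t. fourier f (\<xi> + t *\<^sub>R b)) has_vector_derivative
      fourier (\<lambda>y. - \<i> * of_real (y \<bullet> b) * f y) (\<xi> + t *\<^sub>R b)) (at t)"
proof -
  have [measurable]: "f \<in> borel_measurable borel" using f by auto
  define E where "E y s = exp (\<i> * of_real (- (y \<bullet> (\<xi> + s *\<^sub>R b)))) * f y" for y s
  have dE: "((\<lambda>s. E y s) has_vector_derivative (- \<i> * of_real (y \<bullet> b) * E y t)) (at t)" for y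
  proof -
    have "((\<lambda>s. - (y \<bullet> (\<xi> + s *\<^sub>R b))) has_real_derivative - (y \<bullet> b)) (at t)"
      unfolding inner_add_right inner_scaleR_right by (auto intro!: derivative_eq_intros)
    then have "((\<lambda>s. \<i> * complex_of_real (- (y \<bullet> (\<xi> + s *\<^sub>R b)))) has_vector_derivative \<i> * of_real (- (y \<bullet> b))) (at t)"
      by (intro has_vector_derivative_mult_right has_vector_derivative_of_real)
    from field_vector_diff_chain_at[OF this DERIV_exp]
    have "((\<lambda>s. exp (\<i> * of_real (- (y \<bullet> (\<xi> + s *\<^sub>R b))))) has_vector_derivative
        \<i> * of_real (- (y \<bullet> b)) * exp (\<i> * of_real (- (y \<bullet> (\<xi> + t *\<^sub>R b))))) (at t)"
      by (simp add: o_def)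
    from has_vector_derivative_mult_left[OF this, of "f y"] show ?thesis by (simp add: E_def mult_ac)
  qed
  have iE: "integrable lborel (\<lambda>y. E y s)" for s
    unfolding E_def by (rule fourier_integrable[OF f])
  let ?g = "fourier (\<lambda>y. - \<i> * of_real (y \<bullet> b) * f y) (\<xi> + t *\<^sub>R b)"
  show ?thesis
    unfolding has_vector_derivative_iff_slope tendsto_at_iff_sequentially comp_def
  proof (intro allI impI)
    fix X :: "nat \<Rightarrow> real" assume X: "\<forall>i. X i \<in> UNIV - {0}" "X \<longlonglongrightarrow> 0"
    have "(\<lambda>k. \<integral>y. (E y (t + X k) - E y t) / of_real (X k) \<partial>lborel) \<longlonglongrightarrow> (\<integral>y. - \<i> * of_real (y \<bullet> b) * E y t \<partial>lborel)"
    proof (rule integral_dominated_convergence[where w="\<lambda>y. norm (- \<i> * of_real (y \<bullet> b) * f y)"])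
      show "AE y in lborel. (\<lambda>k. (E y (t + X k) - E y t) / of_real (X k)) \<longlonglongrightarrow> - \<i> * of_real (y \<bullet> b) * E y t"
        using dE[unfolded has_vector_derivative_iff_slope tendsto_at_iff_sequentially comp_def, rule_format,
            OF X(1)[rule_format] X(2)] by (intro AE_I2)
      show "AE y in lborel. norm ((E y (t + X k) - E y t) / of_real (X k)) \<le> norm (- \<i> * of_real (y \<bullet> b) * f y)" for k
      proof (rule AE_I2)
        fix y
        have "norm (E y (t + X k) - E y t) = norm (exp (\<i> * of_real (- (y \<bullet> (\<xi> + (t + X k) *\<^sub>R b)))) - exp (\<i> * of_real (- (y \<bullet> (\<xi> + t *\<^sub>R b))))) * norm (f y)"
          unfolding E_def left_diff_distrib[symmetric] norm_mult ..
        also have "\<dots> \<le> \<bar>- (y \<bullet> (\<xi> + (t + X k) *\<^sub>R b)) - (- (y \<bullet> (\<xi> + t *\<^sub>R b)))\<bar> * norm (f y)"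
          by (intro mult_right_mono norm_iexp_diff_le) simp
        also have "- (y \<bullet> (\<xi> + (t + X k) *\<^sub>R b)) - (- (y \<bullet> (\<xi> + t *\<^sub>R b))) = - (X k * (y \<bullet> b))"
          by (simp add: inner_add_right algebra_simps)
        finally show "norm ((E y (t + X k) - E y t) / of_real (X k)) \<le> norm (- \<i> * of_real (y \<bullet> b) * f y)"
          using X(1)[rule_format, of k] by (simp add: norm_divide norm_mult abs_mult field_simps)
      qed
    qed (use g iE in \<open>auto simp: E_def intro!: integrable_norm\<close>)
    moreover have "(\<integral>y. (E y (t + X k) - E y t) / of_real (X k) \<partial>lborel)
        = (fourier f (\<xi> + (t + X k) *\<^sub>R b) - fourier f (\<xi> + t *\<^sub>R b)) / of_real (X k)" for k
      using iE by (simp add: Bochner_Integration.integral_diff fourier_alt E_def)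
    moreover have "(\<integral>y. - \<i> * of_real (y \<bullet> b) * E y t \<partial>lborel) = ?g"
      unfolding fourier_alt E_def by (intro Bochner_Integration.integral_cong refl) simp
    ultimately show "(\<lambda>k. (fourier f (\<xi> + (t + X k) *\<^sub>R b) - fourier f (\<xi> + t *\<^sub>R b)) / of_real (X k)) \<longlonglongrightarrow> ?g"
      by (simp only:)
  qed
qed

text \<open>The directional derivative of exp(-\<i> x . \<xi>) f(x) integrates to zero by
  \<open>integral_derivative_zero\<close>; the product rule splits it into the two sides of the
  identity.\<close>

lemma fourier_partial:
  fixes f :: "'a::euclidean_space \<Rightarrow> complex"
  assumes f: "\<And>x. f differentiable (at x)" and c: "continuous_on UNIV (partial b f)"
    and i: "integrable lborel f" "integrable lborel (partial b f)"
  shows "fourier (partial b f) \<xi> = \<i> * of_real (\<xi> \<bullet> b) * fourier f \<xi>"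
proof -
  let ?E = "\<lambda>x. exp (\<i> * of_real (- (x \<bullet> \<xi>)))"
  let ?F' = "\<lambda>x. ?E x * partial b f x + - \<i> * of_real (\<xi> \<bullet> b) * (?E x * f x)"
  have iF: "integrable lborel (\<lambda>x. ?E x * f x)" "integrable lborel (\<lambda>x. ?E x * partial b f x)"
    by (intro fourier_integrable i)+
  have cf: "continuous_on UNIV f"
    using f by (simp add: continuous_at_imp_continuous_on differentiable_imp_continuous_within)
  have "(\<integral>x. ?F' x \<partial>lborel) = 0"
  proof (rule integral_derivative_zero[where F="\<lambda>x. ?E x * f x" and b=b])
    fix x t
    have "((\<lambda>s. - ((x + s *\<^sub>R b) \<bullet> \<xi>)) has_real_derivative - (\<xi> \<bullet> b)) (at t)"
      unfolding inner_add_left inner_scaleR_left by (auto intro!: derivative_eq_intros simp: inner_commute)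
    then have "((\<lambda>s. \<i> * complex_of_real (- ((x + s *\<^sub>R b) \<bullet> \<xi>))) has_vector_derivative \<i> * of_real (- (\<xi> \<bullet> b))) (at t)"
      by (intro has_vector_derivative_mult_right has_vector_derivative_of_real)
    from field_vector_diff_chain_at[OF this DERIV_exp]
    have "((\<lambda>s. ?E (x + s *\<^sub>R b)) has_vector_derivative - \<i> * of_real (\<xi> \<bullet> b) * ?E (x + t *\<^sub>R b)) (at t)"
      by (simp add: o_def)
    from has_vector_derivative_mult[OF this has_vector_derivative_along_line[OF f]]
    show "((\<lambda>s. ?E (x + s *\<^sub>R b) * f (x + s *\<^sub>R b)) has_vector_derivative ?F' (x + t *\<^sub>R b)) (at t)"
      by (simp add: mult_ac)
  next
    show "integrable lborel ?F'" using iF by (intro Bochner_Integration.integrable_add integrable_mult_right)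
    show "continuous_on UNIV ?F'" by (intro continuous_intros c cf)
  qed (rule iF)
  moreover have "(\<integral>x. ?F' x \<partial>lborel) = fourier (partial b f) \<xi> + - \<i> * of_real (\<xi> \<bullet> b) * fourier f \<xi>"
    unfolding fourier_alt
    using Bochner_Integration.integral_add[OF iF(2) integrable_mult_right[OF iF(1)]]
    by (simp only: integral_mult_right_zero)
  ultimately show ?thesis by simp
qed

lemma schwartz_fourier_partial:
  fixes f :: "real ^ 'n \<Rightarrow> complex"
  assumes "f \<in> derivs_in rapid" "b \<in> Basis"
  shows "fourier (partial b f) \<xi> = \<i> * of_real (\<xi> \<bullet> b) * fourier f \<xi>"
proof -
  note d = derivs_inD[OF assms(1)] and d' = derivs_inD[OF derivs_inD(4)[OF assms]]
  show ?thesis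
    by (intro fourier_partial d(5) smooth_continuous d' schwartz_integrable assms derivs_inD(4))
qed

lemma const_slow: "(\<lambda>_ :: 'a::euclidean_space. c) \<in> derivs_in slow"
proof (rule derivs_in_coinduct[of _ "range (\<lambda>c _. c)"])
  fix f :: "'a \<Rightarrow> complex" and b assume "f \<in> range (\<lambda>c _. c)"
  then obtain c where f: "f = (\<lambda>_. c)" by auto
  have "partial b f = (\<lambda>_. 0)" by (simp add: partial_def f fun_eq_iff)
  then show "partial b f \<in> range (\<lambda>c _. c)" by auto
next
  have "(\<lambda>_. c) \<in> slow" for c :: complex
    unfolding slow_def by (intro CollectI exI[of _ 0] exI[of _ "norm c"]) simp
  then show "range (\<lambda>c _. c) \<subseteq> (slow :: ('a \<Rightarrow> complex) set)" by auto
qed auto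

lemma derivs_in_cmult_slow: "f \<in> derivs_in rapid \<Longrightarrow> (\<lambda>x. c * f x) \<in> derivs_in rapid"
  by (rule schwartz_slow_mult[OF const_slow])

lemma schwartz_add: "f \<in> derivs_in rapid \<Longrightarrow> g \<in> derivs_in rapid \<Longrightarrow> (\<lambda>x. f x + g x) \<in> derivs_in rapid"
  by (rule derivs_in_add) (auto intro: rapid_add)

lemma fourier_add:
  "integrable lborel f \<Longrightarrow> integrable lborel g \<Longrightarrow> fourier (\<lambda>x. f x + g x) \<xi> = fourier f \<xi> + fourier g \<xi>"
  unfolding fourier_alt distrib_left by (intro Bochner_Integration.integral_add fourier_integrable)

lemma fourier_cmult: "fourier (\<lambda>x. c * f x) \<xi> = c * fourier f \<xi>"
  unfolding fourier_alt mult.left_commute[of _ c] by simp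

text \<open>Applying 1 - d_i^2 for each coordinate i keeps the function Schwartz and multiplies its
  transform by the product of the 1 + \<xi>_i^2; the transform of the result is bounded by an L1
  norm. The decay makes the integrand of the operator integrable.\<close>

lemma schwartz_fourier_decay:
  fixes f :: "real ^ 'n \<Rightarrow> complex"
  assumes "f \<in> derivs_in rapid"
  obtains C where "0 \<le> C" "\<And>\<xi>. norm (fourier f \<xi>) \<le> C * cauchy_weight \<xi>"
proof -
  have "\<forall>f \<in> derivs_in rapid. \<exists>h \<in> derivs_in rapid. \<forall>\<xi> :: real ^ 'n.
      fourier h \<xi> = (\<Prod>i\<in>S. 1 + (of_real (\<xi> $ i))\<^sup>2) * fourier f \<xi>" if "finite S" for S
    using that
  proof induction
    case empty
    then show ?case by auto
  next
    case (insert i S)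
    show ?case
    proof
      fix f :: "real ^ 'n \<Rightarrow> complex" assume "f \<in> derivs_in rapid"
      then obtain h where h: "h \<in> derivs_in rapid" and
        eq: "\<And>\<xi>. fourier h \<xi> = (\<Prod>i\<in>S. 1 + (of_real (\<xi> $ i))\<^sup>2) * fourier f \<xi>"
        using insert.IH by blast
      let ?b = "axis i 1 :: real ^ 'n"
      have b: "?b \<in> Basis" by (auto simp: Basis_vec_def)
      have hb: "partial ?b h \<in> derivs_in rapid" "partial ?b (partial ?b h) \<in> derivs_in rapid"
        by (intro derivs_inD(4) h b)+
      let ?h = "\<lambda>x. h x + (-1) * partial ?b (partial ?b h) x"
      have "?h \<in> derivs_in rapid" by (intro schwartz_add derivs_in_cmult_slow hb h)
      moreover have "fourier ?h \<xi> = (\<Prod>i\<in>insert i S. 1 + (of_real (\<xi> $ i))\<^sup>2) * fourier f \<xi>" for \<xi>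
      proof -
        have "fourier ?h \<xi> = fourier h \<xi> + (-1) * fourier (partial ?b (partial ?b h)) \<xi>"
          by (subst fourier_add) (auto intro!: schwartz_integrable h hb derivs_in_cmult_slow[of _ "-1", simplified] simp: fourier_cmult[of "-1", simplified])
        also have "\<dots> = (1 + (of_real (\<xi> $ i))\<^sup>2) * fourier h \<xi>"
          by (simp add: schwartz_fourier_partial[OF _ b] h hb inner_axis algebra_simps power2_eq_square)
        finally show ?thesis using insert.hyps by (simp add: eq mult.assoc)
      qed
      ultimately show "\<exists>h \<in> derivs_in rapid. \<forall>\<xi>. fourier h \<xi> = (\<Prod>i\<in>insert i S. 1 + (of_real (\<xi> $ i))\<^sup>2) * fourier f \<xi>"
        by blast
    qed
  qed
  from this[OF finite_class.finite_UNIV] assms obtain h where h: "h \<in> derivs_in rapid" and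
    eq: "\<And>\<xi> :: real ^ 'n. fourier h \<xi> = (\<Prod>i\<in>UNIV. 1 + (of_real (\<xi> $ i))\<^sup>2) * fourier f \<xi>" by blast
  show thesis
  proof (rule that)
    fix \<xi> :: "real ^ 'n"
    have "(\<Prod>i\<in>UNIV. 1 + (of_real (\<xi> $ i))\<^sup>2) = complex_of_real (\<Prod>i\<in>UNIV. 1 + (\<xi> $ i)\<^sup>2)" by simp
    then have "norm (fourier h \<xi>) = (\<Prod>i\<in>UNIV. 1 + (\<xi> $ i)\<^sup>2) * norm (fourier f \<xi>)"
      unfolding eq norm_mult by (simp only: norm_of_real) (simp add: prod_nonneg)
    also have "\<dots> = norm (fourier f \<xi>) / cauchy_weight \<xi>"
      by (simp add: cauchy_weight_def prod_inversef[symmetric] divide_inverse mult.commute)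
    finally have "norm (fourier f \<xi>) = norm (fourier h \<xi>) * cauchy_weight \<xi>"
      using cauchy_weight_pos[of \<xi>] by (simp add: field_simps)
    also have "\<dots> \<le> (\<integral>x. norm (h x) \<partial>lborel) * cauchy_weight \<xi>"
      using cauchy_weight_pos[of \<xi>] by (intro mult_right_mono norm_fourier_le schwartz_integrable h) auto
    finally show "norm (fourier f \<xi>) \<le> (\<integral>x. norm (h x) \<partial>lborel) * cauchy_weight \<xi>" .
  qed simp
qed

section \<open>Frozen symbols and localisation\<close>

text \<open>The operator without its constant, with the symbol already evaluated in its space
  variable. Keeping x in the exponential apart from the space variable of the symbol is what permits
  freezing the latter at another point.\<close>

definition osc :: "real ^ 'n \<Rightarrow> ((real ^ 'n) ^ 'm \<Rightarrow> complex) \<Rightarrow> ('m \<Rightarrow> real ^ 'n \<Rightarrow> complex) \<Rightarrow> complex" where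
  "osc x s f = fourier_ext lborel (\<lambda>\<xi>. \<Sum>j\<in>UNIV. \<xi> $ j) (\<lambda>\<xi>. s \<xi> * (\<Prod>j\<in>UNIV. fourier (f j) (\<xi> $ j))) x"

lemma pseudo_op_eq_osc:
  "pseudo_op \<sigma> (f :: 'm::finite \<Rightarrow> real ^ 'n \<Rightarrow> complex) x = 1 / (2 * of_real pi) ^ (CARD('m) * CARD('n)) * osc x (\<lambda>\<xi>. \<sigma> (x, \<xi>)) f"
  by (simp add: pseudo_op_def osc_def fourier_ext_def mult.assoc)

lemma fourier_measurable: "integrable lborel f \<Longrightarrow> fourier f \<in> borel_measurable borel"
  by (intro borel_measurable_continuous_onI fourier_continuous)

lemma prod_fourier_integrable:
  fixes f :: "'m::finite \<Rightarrow> real ^ 'n \<Rightarrow> complex"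
  assumes f: "\<And>j. f j \<in> derivs_in rapid"
  shows "integrable lborel (\<lambda>\<xi>. \<Prod>j\<in>UNIV. fourier (f j) (\<xi> $ j))"
proof (rule integral_vec_prod(2))
  fix j
  obtain C where "\<And>\<xi>. norm (fourier (f j) \<xi>) \<le> C * cauchy_weight \<xi>"
    using schwartz_fourier_decay[OF f] by blast
  then show "integrable lborel (fourier (f j))"
    by (intro integrable_cauchy_dominated fourier_measurable schwartz_integrable f)
qed

lemma osc_integrable:
  fixes f :: "'m::finite \<Rightarrow> real ^ 'n \<Rightarrow> complex"
  assumes f: "\<And>j. f j \<in> derivs_in rapid" and [measurable]: "s \<in> borel_measurable borel"
    and s: "\<And>\<xi>. norm (s \<xi>) \<le> C"
  shows "integrable lborel (\<lambda>\<xi>. s \<xi> * (\<Prod>j\<in>UNIV. fourier (f j) (\<xi> $ j)))"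
    and "integrable lborel (\<lambda>\<xi>. exp (\<i> * of_real (x \<bullet> (\<Sum>j\<in>UNIV. \<xi> $ j))) * (s \<xi> * (\<Prod>j\<in>UNIV. fourier (f j) (\<xi> $ j))))"
proof -
  note [measurable] = fourier_measurable[OF schwartz_integrable[OF f]]
  have C: "0 \<le> C" using order.trans[OF norm_ge_zero s] .
  have int: "integrable lborel (\<lambda>\<xi>. of_real C * (\<Prod>j\<in>UNIV. fourier (f j) (\<xi> $ j)))"
    by (intro integrable_mult_right prod_fourier_integrable f)
  show "integrable lborel (\<lambda>\<xi>. s \<xi> * (\<Prod>j\<in>UNIV. fourier (f j) (\<xi> $ j)))"
    by (rule Bochner_Integration.integrable_bound[OF int])
      (use s C in \<open>auto simp: norm_mult intro!: mult_right_mono\<close>)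
  show "integrable lborel (\<lambda>\<xi>. exp (\<i> * of_real (x \<bullet> (\<Sum>j\<in>UNIV. \<xi> $ j))) * (s \<xi> * (\<Prod>j\<in>UNIV. fourier (f j) (\<xi> $ j))))"
    by (rule Bochner_Integration.integrable_bound[OF int])
      (use s C in \<open>auto simp: norm_mult intro!: mult_right_mono\<close>)
qed

lemma coordinate_slow: "(\<lambda>y :: real ^ 'n. c * complex_of_real (y $ i)) \<in> derivs_in slow"
proof (rule derivs_in_coinduct[of _ "{f. \<exists>a c. f = (\<lambda>y. a + c * complex_of_real (y $ i))}"])
  show "(\<lambda>y. c * complex_of_real (y $ i)) \<in> {f. \<exists>a c. f = (\<lambda>y. a + c * complex_of_real (y $ i))}"
    by (intro CollectI exI[of _ 0] exI[of _ c]) simp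
  have d: "((\<lambda>y :: real ^ 'n. a + c * complex_of_real (y $ i)) has_derivative (\<lambda>y. c * complex_of_real (y $ i))) (at x)" for a c x
    by (auto intro!: derivative_eq_intros bounded_linear.has_derivative[OF bounded_linear_vec_nth])
  fix f :: "real ^ 'n \<Rightarrow> complex" and x b
  assume "f \<in> {f. \<exists>a c. f = (\<lambda>y. a + c * complex_of_real (y $ i))}"
  then obtain a c where f: "f = (\<lambda>y. a + c * complex_of_real (y $ i))" by auto
  show "f differentiable (at x)" unfolding f using d by (auto simp: differentiable_def)
  show "partial b f \<in> {f. \<exists>a c. f = (\<lambda>y. a + c * complex_of_real (y $ i))}"
    unfolding f partial_eq_derivative[OF d, abs_def]
    by (intro CollectI exI[of _ "c * of_real (b $ i)"] exI[of _ 0]) (auto simp: partial_eq_derivative[OF d])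
next
  show "{f. \<exists>a c. f = (\<lambda>y. a + c * complex_of_real (y $ i))} \<subseteq> slow"
  proof clarify
    fix a c
    have "norm (a + c * complex_of_real (y $ i)) \<le> (norm a + norm c) * (1 + norm y) ^ 1" for y :: "real ^ 'n"
    proof -
      have "norm (a + c * complex_of_real (y $ i)) \<le> norm a + norm c * norm y"
        using component_le_norm_cart[of y i]
        by (intro order.trans[OF norm_triangle_ineq] add_left_mono) (simp add: norm_mult mult_left_mono)
      also have "\<dots> \<le> (norm a + norm c) * (1 + norm y)"
        by (simp add: algebra_simps)
      finally show ?thesis by simp
    qed
    then show "(\<lambda>y. a + c * complex_of_real (y $ i)) \<in> slow" unfolding slow_def by blast
  qed
qed

text \<open>The denominator has real part 1, so the inverse is smooth and bounded by 1, and
  differentiating a power of the inverse gives a multiple of the next power. The complex factor is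
  preferred to 1 + \<bar>t - y_i\<bar>, which is not smooth.\<close>

lemma inverse_weight_slow:
  "(\<lambda>y :: real ^ 'n. inverse (1 - \<i> * complex_of_real (t - y $ i))) \<in> derivs_in slow"
proof -
  define w where "w y = 1 - \<i> * complex_of_real (t - y $ i)" for y :: "real ^ 'n"
  have w0: "w y \<noteq> 0" for y using arg_cong[of "w y" 0 Re] by (auto simp: w_def)
  have w1: "norm (inverse (w y)) \<le> 1" for y
  proof -
    have "1 \<le> norm (w y)" using abs_Re_le_cmod[of "w y"] by (simp add: w_def)
    then show ?thesis by (simp add: norm_inverse inverse_le_1_iff)
  qed
  have dw: "(w has_derivative (\<lambda>h. \<i> * complex_of_real (h $ i))) (at y)" for y
    unfolding w_def[abs_def]
    by (auto intro!: derivative_eq_intros bounded_linear.has_derivative[OF bounded_linear_vec_nth])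
  have dz: "DERIV (\<lambda>z. c * inverse z ^ k) (w y) :> (- c * of_nat k) * inverse (w y) ^ Suc k" for c k y
  proof -
    have "c * (of_nat k * (- (inverse (w y) ^ Suc (Suc 0)) * inverse (w y) ^ (k - Suc 0))) = (- c * of_nat k) * inverse (w y) ^ Suc k"
      by (cases k) (auto simp: mult_ac)
    then show ?thesis using DERIV_cmult[OF DERIV_power[OF DERIV_inverse[OF w0[of y]], of k], of c] by (simp only:)
  qed
  have d: "((\<lambda>y. c * inverse (w y) ^ k) has_derivative
      (\<lambda>h. (- c * of_nat k) * inverse (w y) ^ Suc k * (\<i> * complex_of_real (h $ i)))) (at y)" for c k y
    using has_derivative_compose[OF dw dz[unfolded has_field_derivative_def]] .
  let ?C = "{f. \<exists>c k. f = (\<lambda>y. c * inverse (w y) ^ k)}"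
  have "(\<lambda>y. inverse (w y)) \<in> derivs_in slow"
  proof (rule derivs_in_coinduct[of _ ?C])
    show "(\<lambda>y. inverse (w y)) \<in> ?C" by (intro CollectI exI[of _ 1]) auto
    show "?C \<subseteq> slow"
    proof clarify
      fix c k
      have "norm (c * inverse (w y) ^ k) \<le> norm c * (1 + norm y) ^ 0" for y
        unfolding norm_mult norm_power using w1[of y] by (simp add: mult_left_le power_le_one)
      then show "(\<lambda>y. c * inverse (w y) ^ k) \<in> slow" unfolding slow_def by blast
    qed
    fix f :: "real ^ 'n \<Rightarrow> complex" and x b assume "f \<in> ?C"
    then obtain c k where f: "f = (\<lambda>y. c * inverse (w y) ^ k)" by auto
    show "f differentiable (at x)" unfolding f using d by (auto simp: differentiable_def)
    have "partial b f = (\<lambda>y. (\<i> * complex_of_real (b $ i) * (- c * of_nat k)) * inverse (w y) ^ Suc k)"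
      unfolding f fun_eq_iff partial_eq_derivative[OF d] by (simp only: mult_ac) simp
    then show "partial b f \<in> ?C" by blast
  qed
  then show ?thesis by (simp add: w_def)
qed

text \<open>Differentiate the integrand in coordinate i of slot j: the exponential, the symbol and
  the j-th transform give one term each, and the total integrates to zero.\<close>

lemma osc_shift:
  fixes f :: "'m::finite \<Rightarrow> real ^ 'n \<Rightarrow> complex"
  assumes f: "\<And>j. f j \<in> derivs_in rapid"
    and d: "\<And>\<xi> t. ((\<lambda>t. s (\<xi> + t *\<^sub>R axis j (axis i 1))) has_vector_derivative s' (\<xi> + t *\<^sub>R axis j (axis i 1))) (at t)"
    and c: "continuous_on UNIV s" "continuous_on UNIV s'"
    and C: "\<And>\<xi>. norm (s \<xi>) \<le> C" "\<And>\<xi>. norm (s' \<xi>) \<le> C"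
  shows "\<i> * of_real (x $ i) * osc x s f + osc x s' f
    + osc x s (f(j := \<lambda>y. - \<i> * of_real (y \<bullet> axis i 1) * f j y)) = 0"
proof -
  let ?e = "axis i 1 :: real ^ 'n"
  define g where "g = f(j := \<lambda>y. - \<i> * of_real (y \<bullet> ?e) * f j y)"
  have gj: "(\<lambda>y. - \<i> * of_real (y \<bullet> ?e) * f j y) \<in> derivs_in rapid"
    unfolding inner_axis using schwartz_slow_mult[OF coordinate_slow[of "- \<i>" i] f] by simp
  then have g: "g l \<in> derivs_in rapid" for l by (simp add: g_def f)
  have [measurable]: "s \<in> borel_measurable borel" "s' \<in> borel_measurable borel"
    using c by (auto intro: borel_measurable_continuous_onI)
  let ?E = "\<lambda>\<xi> :: (real ^ 'n) ^ 'm. exp (\<i> * of_real (x \<bullet> (\<Sum>j\<in>UNIV. \<xi> $ j)))"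
  let ?P = "\<lambda>f. \<lambda>\<xi>. \<Prod>j\<in>UNIV. fourier (f j) (\<xi> $ j)"
  let ?F' = "\<lambda>\<xi>. \<i> * of_real (x $ i) * (?E \<xi> * (s \<xi> * ?P f \<xi>)) + ?E \<xi> * (s' \<xi> * ?P f \<xi>) + ?E \<xi> * (s \<xi> * ?P g \<xi>)"
  have cP: "continuous_on UNIV (?P f)" if "\<And>j. f j \<in> derivs_in rapid" for f :: "'m \<Rightarrow> real ^ 'n \<Rightarrow> complex"
    by (intro continuous_on_prod continuous_on_compose2[OF fourier_continuous] schwartz_integrable that continuous_intros) auto
  note ints = osc_integrable(2)[OF f _ C(1), where x=x] osc_integrable(2)[OF f _ C(2), where x=x] osc_integrable(2)[OF g _ C(1), where x=x]
  have "(\<integral>\<xi>. ?F' \<xi> \<partial>lborel) = 0"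
  proof (rule integral_derivative_zero[where b="axis j ?e" and F="\<lambda>\<xi>. ?E \<xi> * (s \<xi> * ?P f \<xi>)"])
    show "integrable lborel (\<lambda>\<xi>. ?E \<xi> * (s \<xi> * ?P f \<xi>))" by (rule ints) simp
    show "integrable lborel ?F'"
      by (intro Bochner_Integration.integrable_add integrable_mult_right ints) auto
    show "continuous_on UNIV ?F'"
      by (intro continuous_intros c cP f g)
  next
    fix \<xi> :: "(real ^ 'n) ^ 'm" and t :: real
    let ?\<xi> = "\<lambda>t. \<xi> + t *\<^sub>R axis j ?e"
    define R where "R = (\<Prod>l\<in>UNIV - {j}. fourier (f l) (\<xi> $ l))"
    have comp: "?\<xi> t $ l = (if l = j then \<xi> $ j + t *\<^sub>R ?e else \<xi> $ l)" for t l
      by (simp add: axis_def)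
    have Pf: "?P f (?\<xi> t) = fourier (f j) (\<xi> $ j + t *\<^sub>R ?e) * R" for t
      unfolding R_def comp by (subst prod.remove[of _ j]) (auto intro!: prod.cong)
    have Pg: "?P g (?\<xi> t) = fourier (\<lambda>y. - \<i> * of_real (y \<bullet> ?e) * f j y) (\<xi> $ j + t *\<^sub>R ?e) * R" for t
      unfolding R_def comp by (subst prod.remove[of _ j]) (auto intro!: prod.cong simp: g_def)
    have lin: "x \<bullet> (\<Sum>j\<in>UNIV. ?\<xi> t $ j) = x \<bullet> (\<Sum>j\<in>UNIV. \<xi> $ j) + t * (x $ i)" for t
    proof -
      have "(\<Sum>l\<in>UNIV. (t *\<^sub>R axis j ?e) $ l) = t *\<^sub>R ?e"
        by (subst sum.remove[of _ j]) (auto simp: axis_def intro!: sum.neutral)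
      then show ?thesis by (simp add: sum.distrib inner_add_right inner_axis)
    qed
    have "((\<lambda>t. x \<bullet> (\<Sum>j\<in>UNIV. ?\<xi> t $ j)) has_real_derivative (x $ i)) (at t)"
      unfolding lin by (auto intro!: derivative_eq_intros)
    then have "((\<lambda>t. \<i> * complex_of_real (x \<bullet> (\<Sum>j\<in>UNIV. ?\<xi> t $ j))) has_vector_derivative \<i> * of_real (x $ i)) (at t)"
      by (intro has_vector_derivative_mult_right has_vector_derivative_of_real)
    from field_vector_diff_chain_at[OF this DERIV_exp]
    have dE: "((\<lambda>t. ?E (?\<xi> t)) has_vector_derivative \<i> * of_real (x $ i) * ?E (?\<xi> t)) (at t)"
      by (simp add: o_def)
    have dP: "((\<lambda>t. ?P f (?\<xi> t)) has_vector_derivative ?P g (?\<xi> t)) (at t)"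
      unfolding Pf Pg
      by (intro has_vector_derivative_mult_left fourier_has_derivative schwartz_integrable f gj)
    from has_vector_derivative_mult[OF dE has_vector_derivative_mult[OF d dP]]
    show "((\<lambda>t. ?E (?\<xi> t) * (s (?\<xi> t) * ?P f (?\<xi> t))) has_vector_derivative ?F' (?\<xi> t)) (at t)"
      by (simp add: algebra_simps)
  qed
  moreover have "(\<integral>\<xi>. ?F' \<xi> \<partial>lborel) = \<i> * of_real (x $ i) * osc x s f + osc x s' f + osc x s g"
    unfolding osc_def fourier_ext_def
    by (subst Bochner_Integration.integral_add, intro Bochner_Integration.integrable_add integrable_mult_right ints; (rule ints)?; measurable?)
      (subst Bochner_Integration.integral_add, intro integrable_mult_right ints; (rule ints)?; simp)
  ultimately show ?thesis by (simp add: g_def)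
qed

lemma osc_linear:
  fixes f :: "'m::finite \<Rightarrow> real ^ 'n \<Rightarrow> complex"
  assumes f: "\<And>j. f j \<in> derivs_in rapid" and u: "u \<in> derivs_in rapid" "v \<in> derivs_in rapid"
    and s: "s \<in> borel_measurable borel" "\<And>\<xi>. norm (s \<xi>) \<le> C"
  shows "osc x s (f(j := \<lambda>y. a * u y + b * v y)) = a * osc x s (f(j := u)) + b * osc x s (f(j := v))"
proof -
  let ?E = "\<lambda>\<xi> :: (real ^ 'n) ^ 'm. exp (\<i> * of_real (x \<bullet> (\<Sum>j\<in>UNIV. \<xi> $ j)))"
  let ?P = "\<lambda>f. \<lambda>\<xi>. \<Prod>j\<in>UNIV. fourier (f j) (\<xi> $ j)"
  have *: "?P (f(j := w)) \<xi> = fourier w (\<xi> $ j) * (\<Prod>l\<in>UNIV - {j}. fourier (f l) (\<xi> $ l))" for w \<xi>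
    by (subst prod.remove[of _ j]) (auto intro!: prod.cong)
  have fo: "fourier (\<lambda>y. a * u y + b * v y) \<eta> = a * fourier u \<eta> + b * fourier v \<eta>" for \<eta>
    by (subst fourier_add) (auto intro!: schwartz_integrable u integrable_mult_right simp: fourier_cmult)
  have "?P (f(j := \<lambda>y. a * u y + b * v y)) \<xi> = a * ?P (f(j := u)) \<xi> + b * ?P (f(j := v)) \<xi>" for \<xi>
    unfolding * fo by (simp add: algebra_simps)
  then have eq: "(\<lambda>\<xi>. ?E \<xi> * (s \<xi> * ?P (f(j := \<lambda>y. a * u y + b * v y)) \<xi>))
    = (\<lambda>\<xi>. a * (?E \<xi> * (s \<xi> * ?P (f(j := u)) \<xi>)) + b * (?E \<xi> * (s \<xi> * ?P (f(j := v)) \<xi>)))"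
    by (simp add: algebra_simps)
  have f': "(f(j := w)) l \<in> derivs_in rapid" if "w \<in> derivs_in rapid" for w l using f that by simp
  show ?thesis
    unfolding osc_def fourier_ext_def eq
    using osc_integrable(2)[OF f'[OF u(1)] s, where x=x] osc_integrable(2)[OF f'[OF u(2)] s, where x=x]
    by (subst Bochner_Integration.integral_add) (auto intro!: integrable_mult_right)
qed

text \<open>The factor 1 - \<i> (\<tau> - y_i) is chosen so that after \<open>osc_shift\<close> the
  variable x enters only through x_i - \<tau>, which is bounded for x in a cube around a point with
  i-th coordinate \<tau>. Read from right to left of the argument, a decaying factor in slot j is
  bought with one derivative of the symbol.\<close>

lemma osc_weight:
  fixes g :: "'m::finite \<Rightarrow> real ^ 'n \<Rightarrow> complex"
  assumes g: "\<And>j. g j \<in> derivs_in rapid"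
    and d: "\<And>\<xi> t. ((\<lambda>t. s (\<xi> + t *\<^sub>R axis j (axis i 1))) has_vector_derivative s' (\<xi> + t *\<^sub>R axis j (axis i 1))) (at t)"
    and c: "continuous_on UNIV s" "continuous_on UNIV s'"
    and C: "\<And>\<xi>. norm (s \<xi>) \<le> C" "\<And>\<xi>. norm (s' \<xi>) \<le> C"
  shows "osc x s (g(j := \<lambda>y. (1 - \<i> * of_real (\<tau> - y $ i)) * g j y))
    = (1 + \<i> * of_real (x $ i - \<tau>)) * osc x s g + osc x s' g"
proof -
  let ?v = "\<lambda>y :: real ^ 'n. - \<i> * of_real (y $ i) * g j y"
  have v: "?v \<in> derivs_in rapid"
    using schwartz_slow_mult[OF coordinate_slow[of "- \<i>"] g] by simp
  have s: "s \<in> borel_measurable borel" using c by (auto intro: borel_measurable_continuous_onI)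
  have "(\<lambda>y. (1 - \<i> * of_real (\<tau> - y $ i)) * g j y) = (\<lambda>y. (1 - \<i> * of_real \<tau>) * g j y + (-1) * ?v y)"
    by (auto simp: algebra_simps)
  then have 1: "osc x s (g(j := \<lambda>y. (1 - \<i> * of_real (\<tau> - y $ i)) * g j y))
      = (1 - \<i> * of_real \<tau>) * osc x s (g(j := g j)) + (-1) * osc x s (g(j := ?v))"
    using osc_linear[OF g g v s C(1), where a="1 - \<i> * of_real \<tau>" and b="-1" and x=x and j=j] by simp
  have "\<i> * of_real (x $ i) * osc x s g + osc x s' g + osc x s (g(j := ?v)) = 0"
    using osc_shift[OF g d c C] by (simp add: inner_axis)
  then have 2: "osc x s (g(j := ?v)) = - (\<i> * of_real (x $ i) * osc x s g + osc x s' g)"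
    by (simp only: eq_neg_iff_add_eq_0 add_ac)
  show ?thesis unfolding 1 2 by (simp add: algebra_simps)
qed

section \<open>Removing the dependence on the space variable\<close>

text \<open>The fundamental solution of 1 + d/ds, and at the same time a probability density: a
  bounded function is an average of itself plus its first derivative.\<close>

definition exp_kernel :: "real \<Rightarrow> real" where
  "exp_kernel s = indicator {0<..} s * exp (- s)"

lemma exp_kernel_nonneg: "0 \<le> exp_kernel s"
  by (simp add: exp_kernel_def)

lemma exp_kernel_measurable [measurable]: "exp_kernel \<in> borel_measurable borel"
  unfolding exp_kernel_def[abs_def] by measurable

lemma nn_integral_exp_kernel: "(\<integral>\<^sup>+s. exp_kernel s \<partial>lborel) \<le> 1"
proof -
  have "(\<integral>\<^sup>+s. exp_kernel s \<partial>lborel) \<le> (\<integral>\<^sup>+s. ennreal (exponential_density 1 s) \<partial>lborel)"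
    by (intro nn_integral_mono ennreal_leI) (auto simp: exp_kernel_def exponential_density_def indicator_def)
  also have "\<dots> = emeasure (density lborel (exponential_density 1)) UNIV"
    by (simp add: emeasure_density)
  also have "\<dots> = 1"
    using prob_space.emeasure_space_1[OF prob_space_exponential_density[of 1]] by simp
  finally show ?thesis .
qed

lemma exp_kernel_integrable: "integrable lborel (\<lambda>s. complex_of_real (exp_kernel s))"
proof (rule integrableI_bounded)
  have "(\<integral>\<^sup>+s. ennreal (norm (complex_of_real (exp_kernel s))) \<partial>lborel) \<le> 1"
    using nn_integral_exp_kernel by (simp add: exp_kernel_nonneg)
  also have "\<dots> < \<infinity>" by simp
  finally show "(\<integral>\<^sup>+s. ennreal (norm (complex_of_real (exp_kernel s))) \<partial>lborel) < \<infinity>" .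
qed measurable

text \<open>The fundamental theorem of calculus on the half line for -exp(-s) F(x - s b), whose
  derivative in s is the integrand; boundedness of F makes the value at infinity vanish.\<close>

lemma exp_kernel_representation:
  fixes F :: "'a::euclidean_space \<Rightarrow> complex"
  assumes F: "smooth F" and b: "b \<in> Basis"
    and C: "\<And>x. norm (F x) \<le> C" "\<And>x. norm (partial b F x) \<le> C"
  shows "F x = (\<integral>s. of_real (exp_kernel s) * (F (x - s *\<^sub>R b) + partial b F (x - s *\<^sub>R b)) \<partial>lborel)"
proof -
  have cF: "continuous_on UNIV F" "continuous_on UNIV (partial b F)"
    by (intro smooth_continuous smooth_partial F b)+
  have d: "((\<lambda>s. F (x - s *\<^sub>R b)) has_vector_derivative - partial b F (x - s *\<^sub>R b)) (at s)" for s
  proof -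
    have "((\<lambda>t. F (x + t *\<^sub>R b)) \<circ> uminus has_vector_derivative (-1) *\<^sub>R partial b F (x + (- s) *\<^sub>R b)) (at s)"
      by (intro vector_diff_chain_at has_vector_derivative_along_line smooth_differentiable F)
        (auto intro!: derivative_eq_intros)
    then show ?thesis by (simp add: o_def)
  qed
  let ?f = "\<lambda>s. complex_of_real (exp (- s)) * (F (x - s *\<^sub>R b) + partial b F (x - s *\<^sub>R b))"
  let ?G = "\<lambda>s. - complex_of_real (exp (- s)) * F (x - s *\<^sub>R b)"
  have C0: "0 \<le> C" using order.trans[OF norm_ge_zero C(1)] .
  have [measurable]: "F \<in> borel_measurable borel" "partial b F \<in> borel_measurable borel"
    using cF by (auto intro: borel_measurable_continuous_onI)
  have int: "set_integrable lborel (einterval 0 \<infinity>) ?f"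
    unfolding set_integrable_def
  proof (rule Bochner_Integration.integrable_bound)
    show "integrable lborel (\<lambda>s. complex_of_real (2 * C) * complex_of_real (exp_kernel s))"
      by (intro integrable_mult_right exp_kernel_integrable)
    have "norm (indicator (einterval 0 \<infinity>) s *\<^sub>R ?f s) \<le> norm (complex_of_real (2 * C) * complex_of_real (exp_kernel s))" for s
    proof -
      have "norm (F (x - s *\<^sub>R b) + partial b F (x - s *\<^sub>R b)) \<le> 2 * C"
        using C[of "x - s *\<^sub>R b"] by (intro order.trans[OF norm_triangle_ineq]) simp
      then have "exp (- s) * norm (F (x - s *\<^sub>R b) + partial b F (x - s *\<^sub>R b)) \<le> exp (- s) * (2 * C)"
        by (intro mult_left_mono) auto
      then show ?thesis
        using C0 by (auto simp: norm_mult exp_kernel_def indicator_def einterval_def mult_ac zero_ereal_def)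
    qed
    then show "AE s in lborel. norm (indicator (einterval 0 \<infinity>) s *\<^sub>R ?f s) \<le> norm (complex_of_real (2 * C) * complex_of_real (exp_kernel s))"
      by simp
  qed measurable
  have dG: "(?G has_vector_derivative ?f s) (at s)" for s
  proof -
    have "((\<lambda>s. - exp (- s)) has_real_derivative exp (- s)) (at s)"
      by (auto intro!: derivative_eq_intros)
    from has_vector_derivative_mult[OF has_vector_derivative_of_real[OF this] d]
    show ?thesis by (simp add: algebra_simps)
  qed
  have "(LBINT s=0..\<infinity>. ?f s) = 0 - (- F x)"
  proof (rule interval_integral_FTC_integrable[where F="?G"])
    fix s :: real
    show "(?G has_vector_derivative ?f s) (at s)" by (rule dG)
    show "isCont ?f s"
    proof -
      have "continuous_on UNIV ?f"
        by (intro continuous_intros continuous_on_compose2[OF cF(1)] continuous_on_compose2[OF cF(2)]) auto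
      then show ?thesis by (simp add: continuous_on_eq_continuous_at)
    qed
    have "(?G \<longlongrightarrow> ?G 0) (at 0)"
      using has_vector_derivative_continuous[OF dG[of 0]] by (rule isContD)
    then have "(?G \<longlongrightarrow> ?G 0) (at_right 0)"
      by (rule tendsto_within_subset) auto
    then show "((?G \<circ> real_of_ereal) \<longlongrightarrow> - F x) (at_right 0)"
      unfolding zero_ereal_def ereal_tendsto_simps by simp
    have "((\<lambda>s. exp (- s) * C) \<longlongrightarrow> 0 * C) at_top"
      by (intro tendsto_intros filterlim_compose[OF exp_at_bot] filterlim_uminus_at_bot_at_top)
    then have "(?G \<longlongrightarrow> 0) at_top"
      by (intro Lim_null_comparison[of ?G "\<lambda>s. exp (- s) * C"] always_eventually)
        (auto simp: norm_mult C mult_left_mono)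
    then show "((?G \<circ> real_of_ereal) \<longlongrightarrow> 0) (at_left \<infinity>)"
      unfolding ereal_tendsto_simps .
  qed (use int in auto)
  moreover have "(LBINT s=0..\<infinity>. ?f s) = (\<integral>s. of_real (exp_kernel s) * (F (x - s *\<^sub>R b) + partial b F (x - s *\<^sub>R b)) \<partial>lborel)"
    unfolding interval_lebesgue_integral_def set_lebesgue_integral_def
    by (auto intro!: Bochner_Integration.integral_cong simp: exp_kernel_def einterval_def indicator_def scaleR_conv_of_real zero_ereal_def)
  ultimately show ?thesis by simp
qed

abbreviation bounded_symbols :: "('a \<Rightarrow> real) \<Rightarrow> ((real ^ 'n) \<times> 'a::euclidean_space \<Rightarrow> complex) set" where
  "bounded_symbols W \<equiv> derivs_in (dominated (\<lambda>(x, \<xi>). W \<xi>))"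

lemma bounded_symbolsE:
  assumes "\<sigma> \<in> bounded_symbols W" "\<And>\<xi>. 0 \<le> W \<xi>"
  obtains C where "0 \<le> C" "\<And>x \<xi>. norm (\<sigma> (x, \<xi>)) \<le> C * W \<xi>"
  using dominatedE[OF derivs_inD(2)[OF assms(1)]] assms(2) by (auto split: prod.splits)

lemma bounded_symbols_bounded:
  assumes "\<sigma> \<in> bounded_symbols W" "\<And>\<xi>. 0 \<le> W \<xi>" "\<And>\<xi>. W \<xi> \<le> B"
  obtains C where "0 \<le> C" "\<And>z. norm (\<sigma> z) \<le> C"
proof -
  obtain C where C: "0 \<le> C" "\<And>x \<xi>. norm (\<sigma> (x, \<xi>)) \<le> C * W \<xi>" using bounded_symbolsE[OF assms(1,2)] by blast
  have "norm (\<sigma> z) \<le> C * B" for z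
    using C(2)[of "fst z" "snd z"] mult_left_mono[OF assms(3) C(1), of "snd z"] by simp
  moreover from this have "0 \<le> C * B" using order.trans[OF norm_ge_zero] by blast
  ultimately show thesis using that by blast
qed

text \<open>One application of \<open>exp_kernel_representation\<close> for each coordinate of x, so
  \<sigma>' is the product of the operators 1 + d/dx_i applied to \<sigma>. It stays in the class
  for the same W because derivatives of symbols obey the same bounds.\<close>

lemma symbol_representation:
  fixes \<sigma> :: "(real ^ 'n) \<times> 'a::euclidean_space \<Rightarrow> complex"
  assumes \<sigma>: "\<sigma> \<in> bounded_symbols W" and W: "\<And>\<xi>. 0 \<le> W \<xi>" "\<And>\<xi>. W \<xi> \<le> B"
  obtains \<sigma>' where "\<sigma>' \<in> bounded_symbols W"
    "\<And>x \<xi>. \<sigma> (x, \<xi>) = (\<integral>y. of_real (\<Prod>i\<in>UNIV. exp_kernel (y $ i)) * \<sigma>' (x - y, \<xi>) \<partial>lborel)"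
proof -
  interpret product_sigma_finite "\<lambda>_::'n. lborel :: real measure" by (rule product_sigma_finite_lborel)
  let ?v = "\<lambda>S y. \<Sum>i\<in>S. y i *\<^sub>R axis i (1::real) :: real ^ 'n"
  have "\<exists>\<sigma>'\<in>bounded_symbols W. \<forall>x \<xi>. \<sigma> (x, \<xi>) =
      (\<integral>y. (\<Prod>i\<in>S. complex_of_real (exp_kernel (y i))) * \<sigma>' (x - ?v S y, \<xi>) \<partial>PiM S (\<lambda>_. lborel))" if "finite S" for S
    using that
  proof induction
    case empty
    then show ?case using \<sigma> by (intro bexI[of _ \<sigma>]) (simp_all add: PiM_empty lebesgue_integral_count_space_finite)
  next
    case (insert i S)
    then obtain \<sigma>' where \<sigma>': "\<sigma>' \<in> bounded_symbols W" and
      eq: "\<And>x \<xi>. \<sigma> (x, \<xi>) = (\<integral>y. (\<Prod>i\<in>S. complex_of_real (exp_kernel (y i))) * \<sigma>' (x - ?v S y, \<xi>) \<partial>PiM S (\<lambda>_. lborel))"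
      by blast
    let ?b = "(axis i 1, 0) :: (real ^ 'n) \<times> 'a"
    have b: "?b \<in> Basis" by (auto simp: Basis_prod_def Basis_vec_def)
    define \<sigma>2 where "\<sigma>2 z = \<sigma>' z + partial ?b \<sigma>' z" for z
    have \<sigma>2: "\<sigma>2 \<in> bounded_symbols W"
      unfolding \<sigma>2_def by (intro derivs_in_add derivs_inD(4) \<sigma>' b dominated_add)
    have [measurable]: "\<sigma>2 \<in> borel_measurable (borel \<Otimes>\<^sub>M borel)"
      using smooth_measurable[OF derivs_inD(1)[OF \<sigma>2]] by (simp add: borel_prod)
    obtain C1 where C1: "\<And>z. norm (\<sigma>' z) \<le> C1" using bounded_symbols_bounded[OF \<sigma>' W] by blast
    obtain C2 where C2: "\<And>z. norm (partial ?b \<sigma>' z) \<le> C2"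
      using bounded_symbols_bounded[OF derivs_inD(4)[OF \<sigma>' b] W] by blast
    obtain C3 where C3: "0 \<le> C3" "\<And>z. norm (\<sigma>2 z) \<le> C3" using bounded_symbols_bounded[OF \<sigma>2 W] by blast
    have rep: "\<sigma>' (x, \<xi>) = (\<integral>s. of_real (exp_kernel s) * \<sigma>2 (x - s *\<^sub>R axis i 1, \<xi>) \<partial>lborel)" for x \<xi>
      using exp_kernel_representation[OF derivs_inD(1)[OF \<sigma>'] b, of "max C1 C2" "(x, \<xi>)"] C1 C2
      by (simp add: \<sigma>2_def max.coboundedI1 max.coboundedI2)
    show ?case
    proof (intro bexI[OF _ \<sigma>2] allI)
      fix x \<xi>
      let ?H = "\<lambda>y. (\<Prod>i\<in>insert i S. complex_of_real (exp_kernel (y i))) * \<sigma>2 (x - ?v (insert i S) y, \<xi>)"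
      have "integrable (PiM (insert i S) (\<lambda>_. lborel)) ?H"
      proof (rule Bochner_Integration.integrable_bound)
        show "integrable (PiM (insert i S) (\<lambda>_. lborel)) (\<lambda>y. complex_of_real C3 * (\<Prod>i\<in>insert i S. complex_of_real (exp_kernel (y i))))"
          using insert.hyps by (intro integrable_mult_right product_integrable_prod exp_kernel_integrable) auto
        show "AE y in PiM (insert i S) (\<lambda>_. lborel). norm (?H y) \<le> norm (complex_of_real C3 * (\<Prod>i\<in>insert i S. complex_of_real (exp_kernel (y i))))"
          unfolding norm_mult norm_of_real abs_of_nonneg[OF C3(1)]
          by (rule AE_I2, subst mult.commute) (rule mult_right_mono[OF C3(2) norm_ge_zero])
      qed measurable
      then have "(\<integral>y. ?H y \<partial>PiM (insert i S) (\<lambda>_. lborel)) = (\<integral>y. (\<integral>s. ?H (y(i := s)) \<partial>lborel) \<partial>PiM S (\<lambda>_. lborel))"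
        using insert.hyps by (intro product_integral_insert) auto
      also have "\<dots> = (\<integral>y. (\<Prod>i\<in>S. complex_of_real (exp_kernel (y i))) * \<sigma>' (x - ?v S y, \<xi>) \<partial>PiM S (\<lambda>_. lborel))"
      proof (intro Bochner_Integration.integral_cong refl)
        fix y :: "'n \<Rightarrow> real"
        have 1: "(\<Prod>l\<in>insert i S. complex_of_real (exp_kernel ((y(i := s)) l))) = of_real (exp_kernel s) * (\<Prod>i\<in>S. complex_of_real (exp_kernel (y i)))" for s
        proof -
          have "(\<Prod>l\<in>S. complex_of_real (exp_kernel ((y(i := s)) l))) = (\<Prod>i\<in>S. complex_of_real (exp_kernel (y i)))"
            by (rule prod.cong) (use insert.hyps in auto)
          then show ?thesis using insert.hyps by simp
        qed
        have 2: "x - ?v (insert i S) (y(i := s)) = (x - ?v S y) - s *\<^sub>R axis i 1" for s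
        proof -
          have "?v S (y(i := s)) = ?v S y" by (rule sum.cong) (use insert.hyps in auto)
          then show ?thesis using insert.hyps by simp
        qed
        have "(\<integral>s. ?H (y(i := s)) \<partial>lborel) = (\<integral>s. (\<Prod>i\<in>S. complex_of_real (exp_kernel (y i))) *
            (of_real (exp_kernel s) * \<sigma>2 ((x - ?v S y) - s *\<^sub>R axis i 1, \<xi>)) \<partial>lborel)"
          unfolding 1 2 by (simp add: mult_ac)
        also have "\<dots> = (\<Prod>i\<in>S. complex_of_real (exp_kernel (y i))) * \<sigma>' (x - ?v S y, \<xi>)"
          unfolding integral_mult_right_zero rep ..
        finally show "(\<integral>s. ?H (y(i := s)) \<partial>lborel) = (\<Prod>i\<in>S. complex_of_real (exp_kernel (y i))) * \<sigma>' (x - ?v S y, \<xi>)" .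
      qed
      finally show "\<sigma> (x, \<xi>) = (\<integral>y. ?H y \<partial>PiM (insert i S) (\<lambda>_. lborel))" unfolding eq by (rule sym)
    qed
  qed
  from this[OF finite_class.finite_UNIV] obtain \<sigma>' where \<sigma>': "\<sigma>' \<in> bounded_symbols W" and
    eq: "\<And>x \<xi>. \<sigma> (x, \<xi>) = (\<integral>y. (\<Prod>i\<in>UNIV. complex_of_real (exp_kernel (y i))) * \<sigma>' (x - ?v UNIV y, \<xi>) \<partial>PiM UNIV (\<lambda>_. lborel))"
    by blast
  have [measurable]: "\<sigma>' \<in> borel_measurable (borel \<Otimes>\<^sub>M borel)"
    using smooth_measurable[OF derivs_inD(1)[OF \<sigma>']] by (simp add: borel_prod)
  have v: "?v UNIV y = (\<chi> i. y i)" for y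
    by (simp add: vec_eq_iff axis_def if_distrib[of "\<lambda>x. _ * x"] cong: if_cong)
  show thesis
  proof (rule that[OF \<sigma>'])
    fix x \<xi>
    show "\<sigma> (x, \<xi>) = (\<integral>y. of_real (\<Prod>i\<in>UNIV. exp_kernel (y $ i)) * \<sigma>' (x - y, \<xi>) \<partial>lborel)"
      unfolding eq v by (subst lborel_vec, subst integral_distr) auto
  qed
qed

text \<open>Cauchy-Schwarz for a kernel of mass at most one, split into its square roots. In the
  non-integrable case the Bochner integral has the value 0 and the bound is trivial.\<close>

lemma kernel_average_bound:
  fixes U :: "'a \<Rightarrow> complex"
  assumes [measurable]: "k \<in> borel_measurable M" "U \<in> borel_measurable M"
    and k: "\<And>y. 0 \<le> k y" "(\<integral>\<^sup>+y. ennreal (k y) \<partial>M) \<le> 1"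
  shows "ennreal ((norm (\<integral>y. of_real (k y) * U y \<partial>M))\<^sup>2) \<le> (\<integral>\<^sup>+y. ennreal (k y * (norm (U y))\<^sup>2) \<partial>M)"
proof (cases "integrable M (\<lambda>y. of_real (k y) * U y)")
  case True
  have "ennreal (norm (\<integral>y. of_real (k y) * U y \<partial>M)) \<le> (\<integral>\<^sup>+y. ennreal (norm (of_real (k y) * U y)) \<partial>M)"
    by (rule integral_norm_bound_ennreal[OF True])
  also have "\<dots> = (\<integral>\<^sup>+y. ennreal (sqrt (k y) * norm (U y)) * ennreal (sqrt (k y)) \<partial>M)"
    by (intro nn_integral_cong) (simp add: norm_mult ennreal_mult[symmetric] k mult_ac flip: mult.assoc)
  finally have "(ennreal (norm (\<integral>y. of_real (k y) * U y \<partial>M)))\<^sup>2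
    \<le> (\<integral>\<^sup>+y. ennreal (sqrt (k y) * norm (U y)) * ennreal (sqrt (k y)) \<partial>M)\<^sup>2"
    by (rule power_mono) simp
  also have "\<dots> \<le> (\<integral>\<^sup>+y. (ennreal (sqrt (k y) * norm (U y)))\<^sup>2 \<partial>M) * (\<integral>\<^sup>+y. (ennreal (sqrt (k y)))\<^sup>2 \<partial>M)"
    by (rule Cauchy_Schwarz_nn_integral) measurable
  also have "\<dots> = (\<integral>\<^sup>+y. ennreal (k y * (norm (U y))\<^sup>2) \<partial>M) * (\<integral>\<^sup>+y. ennreal (k y) \<partial>M)"
    by (simp add: ennreal_power k power_mult_distrib)
  also have "\<dots> \<le> (\<integral>\<^sup>+y. ennreal (k y * (norm (U y))\<^sup>2) \<partial>M) * 1"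
    by (intro mult_left_mono k) simp
  finally show ?thesis by (simp add: ennreal_power)
qed (simp add: not_integrable_integral_eq)

lemma ennreal_prod_mono:
  fixes f g :: "'i \<Rightarrow> ennreal"
  assumes "\<And>i. i \<in> A \<Longrightarrow> f i \<le> g i"
  shows "prod f A \<le> prod g A"
  using assms by (induction A rule: infinite_finite_induct) (auto intro: mult_mono)

text \<open>For x in a unit cube around t this replaces the kernel at x - z by a multiple of
  \<open>cauchy_weight (t - z)\<close>, which no longer contains x. The constant comes from 1 + s'^2
  \<le> 4 (1 + s + s^2/2) \<le> 4 exp s for s > 0.\<close>

lemma exp_kernel_le:
  assumes "\<bar>s - s'\<bar> \<le> 1 / 2"
  shows "exp_kernel s \<le> 4 * inverse (1 + s'\<^sup>2)"
proof (cases "0 < s")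
  case True
  have "\<bar>s'\<bar> \<le> s + 1/2" using assms True by linarith
  then have "s'\<^sup>2 \<le> (s + 1/2)\<^sup>2" by (metis abs_ge_zero power2_abs power_mono)
  also have "(s + 1/2)\<^sup>2 = s\<^sup>2 + s + 1/4" by (simp add: power2_sum power_divide)
  finally have "s'\<^sup>2 \<le> s\<^sup>2 + s + 1/4" .
  moreover have "4 * (1 + s + s\<^sup>2 / 2) = 4 + 4 * s + 2 * s\<^sup>2" by simp
  ultimately have "1 + s'\<^sup>2 \<le> 4 * (1 + s + s\<^sup>2 / 2)" using True zero_le_power2[of s] by linarith
  also have "\<dots> \<le> 4 * exp s" using exp_lower_Taylor_quadratic[of s] True by simp
  finally have "1 + s'\<^sup>2 \<le> 4 * exp s" .
  moreover have "0 < 1 + s'\<^sup>2" by (simp add: add_pos_nonneg)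
  ultimately show ?thesis using True by (simp add: exp_kernel_def exp_minus field_simps)
qed (auto simp: exp_kernel_def)

lemma unit_cube_component: "x \<in> unit_cube \<Longrightarrow> \<bar>x $ i\<bar> \<le> 1 / 2"
  unfolding unit_cube_def mem_Collect_eq by (drule spec[of _ i]) linarith

lemma nn_integral_cauchy_weight:
  "(\<integral>\<^sup>+x. ennreal (cauchy_weight (x :: real ^ 'n)) \<partial>lborel) = ennreal (\<integral>x. cauchy_weight (x :: real ^ 'n) \<partial>lborel)"
proof (rule nn_integral_eq_integral)
  show "integrable lborel (cauchy_weight :: real ^ 'n \<Rightarrow> real)"
    using cauchy_weight_integrable unfolding complex_of_real_integrable_eq .
qed (simp add: cauchy_weight_pos less_imp_le)

lemma cauchy_weight_measurable [measurable]: "cauchy_weight \<in> borel_measurable borel"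
  unfolding cauchy_weight_def[abs_def] by measurable

lemma osc_local_bound:
  fixes V :: "(int ^ 'n) ^ 'm \<Rightarrow> real"
  assumes V: "V \<in> B_class" and B: "\<And>\<nu>. V \<nu> \<le> B"
    and \<sigma>: "\<sigma> \<in> bounded_symbols (\<lambda>\<xi>. V (block_cell \<xi>))"
  obtains C :: real where "0 \<le> C" "\<And>t f. (\<And>j. f j \<in> derivs_in rapid) \<Longrightarrow>
    (\<integral>\<^sup>+x. indicator unit_cube (x - t) * ennreal ((norm (osc x (\<lambda>\<xi>. \<sigma> (x, \<xi>)) f))\<^sup>2) \<partial>lborel)
      \<le> ennreal C * (\<Prod>j\<in>UNIV. \<integral>\<^sup>+x. ennreal ((norm (f j x))\<^sup>2) \<partial>lborel)"
proof -
  have V0: "0 \<le> V \<nu>" for \<nu> using V by (auto simp: B_class_def)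
  obtain \<sigma>' where \<sigma>': "\<sigma>' \<in> bounded_symbols (\<lambda>\<xi>. V (block_cell \<xi>))" and
    rep: "\<And>x \<xi>. \<sigma> (x, \<xi>) = (\<integral>y. of_real (\<Prod>i\<in>UNIV. exp_kernel (y $ i)) * \<sigma>' (x - y, \<xi>) \<partial>lborel)"
    using symbol_representation[OF \<sigma> V0 B] by blast
  obtain D where D: "0 \<le> D" "\<And>x \<xi>. norm (\<sigma>' (x, \<xi>)) \<le> D * V (block_cell \<xi>)"
    using bounded_symbolsE[OF \<sigma>' V0] by blast
  obtain D1 where D1: "0 \<le> D1" "\<And>z. norm (\<sigma>' z) \<le> D1"
    using bounded_symbols_bounded[OF \<sigma>' V0 B] by blast
  obtain C0 :: real where C0: "0 < C0" and mult: 
    "\<And>(u :: 'm \<Rightarrow> real ^ 'n \<Rightarrow> complex) m D.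
      (\<And>j. u j \<in> borel_measurable borel) \<Longrightarrow> 0 \<le> D \<Longrightarrow> (\<And>\<xi>. norm (m \<xi>) \<le> D * V (block_cell \<xi>)) \<Longrightarrow>
      integrable lborel (\<lambda>\<xi>. m \<xi> * (\<Prod>j\<in>UNIV. u j (\<xi> $ j))) \<Longrightarrow>
      (\<integral>\<^sup>+x. ennreal ((norm (fourier_ext lborel (\<lambda>\<xi>. \<Sum>j\<in>UNIV. \<xi> $ j) (\<lambda>\<xi>. m \<xi> * (\<Prod>j\<in>UNIV. u j (\<xi> $ j))) x))\<^sup>2) \<partial>lborel)
      \<le> ennreal (C0 * D\<^sup>2) * (\<Prod>j\<in>UNIV. \<integral>\<^sup>+x. ennreal ((norm (u j x))\<^sup>2) \<partial>lborel)"
    using multiplier_bound[OF V] by blast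
  have [measurable]: "\<sigma>' \<in> borel_measurable (borel \<Otimes>\<^sub>M borel)"
    using smooth_measurable[OF derivs_inD(1)[OF \<sigma>']] by (simp add: borel_prod)
  define \<kappa> where "\<kappa> y = (\<Prod>i\<in>UNIV. exp_kernel (y $ i))" for y :: "real ^ 'n"
  have \<kappa>0: "0 \<le> \<kappa> y" for y unfolding \<kappa>_def by (intro prod_nonneg) (simp add: exp_kernel_nonneg)
  have [measurable]: "\<kappa> \<in> borel_measurable borel" unfolding \<kappa>_def by measurable
  have \<kappa>1: "(\<integral>\<^sup>+y. ennreal (\<kappa> y) \<partial>lborel) \<le> 1"
  proof -
    have "(\<integral>\<^sup>+y. ennreal (\<kappa> y) \<partial>lborel) = (\<integral>\<^sup>+y. (\<Prod>i\<in>UNIV. ennreal (exp_kernel ((y :: real ^ 'n) $ i))) \<partial>lborel)"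
      by (simp add: \<kappa>_def prod_ennreal exp_kernel_nonneg)
    also have "\<dots> = (\<Prod>i::'n\<in>UNIV. \<integral>\<^sup>+y. ennreal (exp_kernel y) \<partial>lborel)"
      by (rule nn_integral_vec_prod) measurable
    also have "\<dots> \<le> (\<Prod>i::'n\<in>UNIV. 1)" by (intro ennreal_prod_mono nn_integral_exp_kernel)
    finally show ?thesis by simp
  qed
  have \<kappa>int: "integrable lborel (\<lambda>y. complex_of_real (\<kappa> y))"
    unfolding \<kappa>_def of_real_prod by (intro integral_vec_prod(2) exp_kernel_integrable)
  define cw where "cw = (\<integral>x. cauchy_weight (x :: real ^ 'n) \<partial>lborel)"
  have cw0: "0 \<le> cw" unfolding cw_def by (intro Bochner_Integration.integral_nonneg) (simp add: cauchy_weight_pos less_imp_le)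
  \<comment> \<open>4^n \<open>cw\<close> is the mass of the dominating kernel, \<open>C0\<close>
    D^2 comes from the multiplier estimate, and (2 pi)^n is Plancherel's constant for each of the N
    arguments.\<close>
  define C where "C = 4 ^ CARD('n) * cw * (C0 * D\<^sup>2 * ((2 * pi) ^ CARD('n)) ^ CARD('m))"
  show thesis
  proof (rule that[of C])
    show "0 \<le> C" unfolding C_def using cw0 C0 by simp
    fix t :: "real ^ 'n" and f :: "'m \<Rightarrow> real ^ 'n \<Rightarrow> complex"
    assume f: "\<And>j. f j \<in> derivs_in rapid"
    note [measurable] = fourier_measurable[OF schwartz_integrable[OF f]]
    let ?P = "\<lambda>\<xi> :: (real ^ 'n) ^ 'm. \<Prod>j\<in>UNIV. fourier (f j) (\<xi> $ j)"
    let ?E = "\<lambda>x. \<lambda>\<xi> :: (real ^ 'n) ^ 'm. exp (\<i> * of_real (x \<bullet> (\<Sum>j\<in>UNIV. \<xi> $ j)))"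
    let ?N = "\<Prod>j\<in>UNIV. \<integral>\<^sup>+x. ennreal ((norm (f j x))\<^sup>2) \<partial>lborel"
    define U where "U x z = osc x (\<lambda>\<xi>. \<sigma>' (z, \<xi>)) f" for x z
    have [measurable]: "(\<lambda>p. U (fst p) (snd p)) \<in> borel_measurable (borel \<Otimes>\<^sub>M borel)"
      unfolding U_def osc_def fourier_ext_def
      by (rule sigma_finite_measure.borel_measurable_lebesgue_integral[OF sigma_finite_lborel]) measurable
    have U_meas [measurable (raw)]: "(\<lambda>y. U (a y) (b y)) \<in> borel_measurable M"
      if [measurable]: "a \<in> borel_measurable M" "b \<in> borel_measurable M" for a b and M :: "'c measure"
      using measurable_compose[of "\<lambda>y. (a y, b y)" M "borel \<Otimes>\<^sub>M borel" "\<lambda>p. U (fst p) (snd p)" borel] by simp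
    have int_U: "integrable lborel (\<lambda>\<xi>. \<sigma>' (z, \<xi>) * ?P \<xi>)" for z
      by (rule osc_integrable(1)[OF f _ D1(2)]) measurable
    have U_L2: "(\<integral>\<^sup>+x. ennreal ((norm (U x z))\<^sup>2) \<partial>lborel) \<le> ennreal (C0 * D\<^sup>2 * ((2 * pi) ^ CARD('n)) ^ CARD('m)) * ?N" for z
    proof -
      have "(\<integral>\<^sup>+x. ennreal ((norm (U x z))\<^sup>2) \<partial>lborel) \<le> ennreal (C0 * D\<^sup>2) * (\<Prod>j\<in>UNIV. \<integral>\<^sup>+x. ennreal ((norm (fourier (f j) x))\<^sup>2) \<partial>lborel)"
        unfolding U_def osc_def by (rule mult[OF _ D int_U]) measurable
      also have "\<dots> \<le> ennreal (C0 * D\<^sup>2) * (\<Prod>j\<in>UNIV. ennreal ((2 * pi) ^ CARD('n)) * (\<integral>\<^sup>+x. ennreal ((norm (f j x))\<^sup>2) \<partial>lborel))"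
        by (intro mult_left_mono ennreal_prod_mono fourier_L2 schwartz_integrable f) auto
      also have "\<dots> = ennreal (C0 * D\<^sup>2) * (ennreal (((2 * pi) ^ CARD('n)) ^ CARD('m)) * ?N)"
        by (simp add: prod.distrib ennreal_power del: power_mult_distrib)
      also have "\<dots> = ennreal (C0 * D\<^sup>2 * ((2 * pi) ^ CARD('n)) ^ CARD('m)) * ?N"
        using C0 by (subst ennreal_mult) (auto simp: mult.assoc)
      finally show ?thesis .
    qed
    \<comment> \<open>The average over y leaves the \<xi>-integral by Fubini; boundedness of
      \<sigma>' and integrability of the product of transforms justify it.\<close>
    have avg: "osc x (\<lambda>\<xi>. \<sigma> (x, \<xi>)) f = (\<integral>y. of_real (\<kappa> y) * U x (x - y) \<partial>lborel)" for x
    proof -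
      let ?H = "\<lambda>\<xi> y. of_real (\<kappa> y) * (?E x \<xi> * (\<sigma>' (x - y, \<xi>) * ?P \<xi>))"
      have int: "integrable (lborel \<Otimes>\<^sub>M lborel) (case_prod ?H)"
      proof (rule Bochner_Integration.integrable_bound)
        show "integrable (lborel \<Otimes>\<^sub>M lborel) (\<lambda>z. of_real D1 * (?P (fst z) * complex_of_real (\<kappa> (snd z))))"
          by (intro integrable_mult_right integral_pair_mult(1) prod_fourier_integrable f \<kappa>int sigma_finite_lborel)
        show "AE z in lborel \<Otimes>\<^sub>M lborel. norm (case_prod ?H z) \<le> norm (of_real D1 * (?P (fst z) * complex_of_real (\<kappa> (snd z))))"
        proof (rule AE_I2)
          fix z :: "((real ^ 'n) ^ 'm) \<times> (real ^ 'n)"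
          have "norm (case_prod ?H z) = norm (\<sigma>' (x - snd z, fst z)) * (norm (?P (fst z)) * \<kappa> (snd z))"
            using \<kappa>0 by (simp add: case_prod_unfold norm_mult mult_ac)
          also have "\<dots> \<le> D1 * (norm (?P (fst z)) * \<kappa> (snd z))"
            using \<kappa>0 by (intro mult_right_mono D1) auto
          also have "\<dots> = norm (of_real D1 * (?P (fst z) * complex_of_real (\<kappa> (snd z))))"
            using \<kappa>0 D1(1) by (simp add: norm_mult)
          finally show "norm (case_prod ?H z) \<le> norm (of_real D1 * (?P (fst z) * complex_of_real (\<kappa> (snd z))))" .
        qed
      qed measurable
      have "osc x (\<lambda>\<xi>. \<sigma> (x, \<xi>)) f = (\<integral>\<xi>. ?E x \<xi> * ((\<integral>y. of_real (\<kappa> y) * \<sigma>' (x - y, \<xi>) \<partial>lborel) * ?P \<xi>) \<partial>lborel)"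
        unfolding osc_def fourier_ext_def rep \<kappa>_def ..
      also have "\<dots> = (\<integral>\<xi>. (\<integral>y. ?H \<xi> y \<partial>lborel) \<partial>lborel)"
      proof (intro Bochner_Integration.integral_cong refl)
        fix \<xi>
        have "(\<integral>y. ?H \<xi> y \<partial>lborel) = (\<integral>y. (?E x \<xi> * ?P \<xi>) * (of_real (\<kappa> y) * \<sigma>' (x - y, \<xi>)) \<partial>lborel)"
          by (simp add: mult_ac)
        also have "\<dots> = (?E x \<xi> * ?P \<xi>) * (\<integral>y. of_real (\<kappa> y) * \<sigma>' (x - y, \<xi>) \<partial>lborel)"
          by (rule integral_mult_right_zero)
        finally show "?E x \<xi> * ((\<integral>y. of_real (\<kappa> y) * \<sigma>' (x - y, \<xi>) \<partial>lborel) * ?P \<xi>) = (\<integral>y. ?H \<xi> y \<partial>lborel)"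
          by (simp only: mult_ac)
      qed
      also have "\<dots> = (\<integral>y. (\<integral>\<xi>. ?H \<xi> y \<partial>lborel) \<partial>lborel)"
        by (rule lborel_pair.Fubini_integral[symmetric, OF int])
      also have "\<dots> = (\<integral>y. of_real (\<kappa> y) * U x (x - y) \<partial>lborel)"
        unfolding integral_mult_right_zero U_def osc_def fourier_ext_def ..
      finally show ?thesis .
    qed
    have ker: "indicator unit_cube (x - t) * ennreal (\<kappa> (x - z) * u) \<le> ennreal (4 ^ CARD('n) * cauchy_weight (t - z)) * ennreal u"
      if u: "0 \<le> u" for x z u
    proof (cases "x - t \<in> unit_cube")
      case True
      have "\<kappa> (x - z) \<le> (\<Prod>i\<in>UNIV. 4 * inverse (1 + ((t - z) $ i)\<^sup>2))"
        unfolding \<kappa>_def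
      proof (intro prod_mono conjI exp_kernel_le exp_kernel_nonneg)
        fix i show "\<bar>(x - z) $ i - (t - z) $ i\<bar> \<le> 1 / 2"
          using unit_cube_component[OF True, of i] by simp
      qed
      also have "\<dots> = 4 ^ CARD('n) * cauchy_weight (t - z)"
        by (simp add: prod.distrib cauchy_weight_def)
      finally have "\<kappa> (x - z) * u \<le> (4 ^ CARD('n) * cauchy_weight (t - z)) * u" using u by (rule mult_right_mono)
      then show ?thesis using True u cauchy_weight_pos[of "t - z"]
        by (simp add: ennreal_mult[symmetric] ennreal_leI)
    qed simp
    have "(\<integral>\<^sup>+x. indicator unit_cube (x - t) * ennreal ((norm (osc x (\<lambda>\<xi>. \<sigma> (x, \<xi>)) f))\<^sup>2) \<partial>lborel)
      \<le> (\<integral>\<^sup>+x. indicator unit_cube (x - t) * (\<integral>\<^sup>+y. ennreal (\<kappa> y * (norm (U x (x - y)))\<^sup>2) \<partial>lborel) \<partial>lborel)"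
      unfolding avg by (intro nn_integral_mono mult_left_mono kernel_average_bound \<kappa>0 \<kappa>1) auto
    also have "\<dots> = (\<integral>\<^sup>+x. (\<integral>\<^sup>+z. indicator unit_cube (x - t) * ennreal (\<kappa> (x - z) * (norm (U x z))\<^sup>2) \<partial>lborel) \<partial>lborel)"
    proof (intro nn_integral_cong)
      fix x
      have "(\<integral>\<^sup>+y. ennreal (\<kappa> y * (norm (U x (x - y)))\<^sup>2) \<partial>lborel) = (\<integral>\<^sup>+z. ennreal (\<kappa> (x - z) * (norm (U x z))\<^sup>2) \<partial>lborel)"
        using nn_integral_lborel_reflect[of "\<lambda>z. ennreal (\<kappa> (x - z) * (norm (U x z))\<^sup>2)" x] by simp
      then show "indicator unit_cube (x - t) * (\<integral>\<^sup>+y. ennreal (\<kappa> y * (norm (U x (x - y)))\<^sup>2) \<partial>lborel)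
        = (\<integral>\<^sup>+z. indicator unit_cube (x - t) * ennreal (\<kappa> (x - z) * (norm (U x z))\<^sup>2) \<partial>lborel)"
        by (simp add: nn_integral_cmult)
    qed
    also have "\<dots> \<le> (\<integral>\<^sup>+x. (\<integral>\<^sup>+z. ennreal (4 ^ CARD('n) * cauchy_weight (t - z)) * ennreal ((norm (U x z))\<^sup>2) \<partial>lborel) \<partial>lborel)"
      by (intro nn_integral_mono ker) simp
    also have "\<dots> = (\<integral>\<^sup>+z. (\<integral>\<^sup>+x. ennreal (4 ^ CARD('n) * cauchy_weight (t - z)) * ennreal ((norm (U x z))\<^sup>2) \<partial>lborel) \<partial>lborel)"
      by (rule lborel_pair.Fubini') measurable
    also have "\<dots> = (\<integral>\<^sup>+z. ennreal (4 ^ CARD('n) * cauchy_weight (t - z)) * (\<integral>\<^sup>+x. ennreal ((norm (U x z))\<^sup>2) \<partial>lborel) \<partial>lborel)"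
      by (intro nn_integral_cong nn_integral_cmult) measurable
    also have "\<dots> \<le> (\<integral>\<^sup>+z. ennreal (4 ^ CARD('n) * cauchy_weight (t - z)) * (ennreal (C0 * D\<^sup>2 * ((2 * pi) ^ CARD('n)) ^ CARD('m)) * ?N) \<partial>lborel)"
      by (intro nn_integral_mono mult_left_mono U_L2) simp
    also have "\<dots> = (\<integral>\<^sup>+z. ennreal (4 ^ CARD('n) * cauchy_weight (t - z)) \<partial>lborel) * (ennreal (C0 * D\<^sup>2 * ((2 * pi) ^ CARD('n)) ^ CARD('m)) * ?N)"
      by (rule nn_integral_multc) measurable
    also have "(\<integral>\<^sup>+z. ennreal (4 ^ CARD('n) * cauchy_weight (t - z)) \<partial>lborel) = ennreal (4 ^ CARD('n) * cw)"
    proof -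
      have "(\<integral>\<^sup>+z. ennreal (4 ^ CARD('n) * cauchy_weight (t - z)) \<partial>lborel) = (\<integral>\<^sup>+z. ennreal (4 ^ CARD('n)) * ennreal (cauchy_weight (z :: real ^ 'n)) \<partial>lborel)"
        using nn_integral_lborel_reflect[of "\<lambda>z. ennreal (4 ^ CARD('n) * cauchy_weight z)" t]
        by (simp add: ennreal_mult cauchy_weight_pos less_imp_le)
      also have "\<dots> = ennreal (4 ^ CARD('n)) * ennreal cw"
        by (subst nn_integral_cmult) (auto simp: nn_integral_cauchy_weight cw_def)
      finally show ?thesis using cw0 by (subst ennreal_mult) auto
    qed
    also have "ennreal (4 ^ CARD('n) * cw) * (ennreal (C0 * D\<^sup>2 * ((2 * pi) ^ CARD('n)) ^ CARD('m)) * ?N) = ennreal C * ?N"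
      unfolding C_def mult.assoc[symmetric]
      using cw0 C0 by (subst ennreal_mult[symmetric]) (auto simp: mult.assoc)
    finally show "(\<integral>\<^sup>+x. indicator unit_cube (x - t) * ennreal ((norm (osc x (\<lambda>\<xi>. \<sigma> (x, \<xi>)) f))\<^sup>2) \<partial>lborel) \<le> ennreal C * ?N" .
  qed
qed

section \<open>Decay weights on the individual arguments\<close>

text \<open>Each pair (l, i) of the list contributes one inverse factor in coordinate i to the
  argument in slot l, and repetitions produce powers. The list form lets the weights be acquired one
  factor at a time.\<close>

fun slot_weight :: "('m \<times> 'n) list \<Rightarrow> real ^ 'n \<Rightarrow> 'm \<Rightarrow> real ^ 'n \<Rightarrow> complex" where
  "slot_weight [] t j y = 1"
| "slot_weight ((l, i) # ps) t j y =
    slot_weight ps t j y * (if j = l then inverse (1 - \<i> * of_real (t $ i - y $ i)) else 1)"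

text \<open>The induction statement quantifies over all symbols of the class, because the step
  applies the hypothesis both to \<sigma> and to a \<xi>-derivative of \<sigma>. The constant
  depends on the list and the symbol, but not on t or f.\<close>

lemma osc_weighted_bound:
  fixes V :: "(int ^ 'n) ^ 'm \<Rightarrow> real"
  assumes V: "V \<in> B_class" and B: "\<And>\<nu>. V \<nu> \<le> B"
  shows "\<forall>\<sigma> \<in> bounded_symbols (\<lambda>\<xi>. V (block_cell \<xi>)). \<exists>C\<ge>0. \<forall>t f. (\<forall>j. f j \<in> derivs_in rapid) \<longrightarrow>
    (\<integral>\<^sup>+x. indicator unit_cube (x - t) * ennreal ((norm (osc x (\<lambda>\<xi>. \<sigma> (x, \<xi>)) f))\<^sup>2) \<partial>lborel)
      \<le> ennreal C * (\<Prod>j\<in>UNIV. \<integral>\<^sup>+x. ennreal ((norm (slot_weight ps t j x * f j x))\<^sup>2) \<partial>lborel)"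
proof (induction ps)
  case Nil
  show ?case
  proof
    fix \<sigma> :: "((real ^ 'n) \<times> ((real ^ 'n) ^ 'm)) \<Rightarrow> complex"
    assume "\<sigma> \<in> bounded_symbols (\<lambda>\<xi>. V (block_cell \<xi>))"
    from osc_local_bound[OF V B this] obtain C :: real where "0 \<le> C" and
      C: "\<And>t f. (\<And>j. f j \<in> derivs_in rapid) \<Longrightarrow>
      (\<integral>\<^sup>+x. indicator unit_cube (x - t) * ennreal ((norm (osc x (\<lambda>\<xi>. \<sigma> (x, \<xi>)) f))\<^sup>2) \<partial>lborel)
      \<le> ennreal C * (\<Prod>j\<in>UNIV. \<integral>\<^sup>+x. ennreal ((norm (f j x))\<^sup>2) \<partial>lborel)" by blast
    then show "\<exists>C\<ge>0. \<forall>t f. (\<forall>j. f j \<in> derivs_in rapid) \<longrightarrow>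
      (\<integral>\<^sup>+x. indicator unit_cube (x - t) * ennreal ((norm (osc x (\<lambda>\<xi>. \<sigma> (x, \<xi>)) f))\<^sup>2) \<partial>lborel)
      \<le> ennreal C * (\<Prod>j\<in>UNIV. \<integral>\<^sup>+x. ennreal ((norm (slot_weight [] t j x * f j x))\<^sup>2) \<partial>lborel)"
      unfolding slot_weight.simps mult_1 by blast
  qed
next
  case (Cons p ps)
  obtain l i where p: "p = (l, i)" by force
  have V0: "0 \<le> V \<nu>" for \<nu> using V by (auto simp: B_class_def)
  show ?case
  proof
    fix \<sigma> :: "((real ^ 'n) \<times> ((real ^ 'n) ^ 'm)) \<Rightarrow> complex"
    assume \<sigma>: "\<sigma> \<in> bounded_symbols (\<lambda>\<xi>. V (block_cell \<xi>))"
    let ?a = "axis l (axis i 1) :: (real ^ 'n) ^ 'm"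
    let ?b = "(0, ?a) :: (real ^ 'n) \<times> ((real ^ 'n) ^ 'm)"
    have "?a \<in> Basis" by (auto simp: Basis_vec_def)
    then have b: "?b \<in> Basis" by (simp add: Basis_prod_def)
    define \<sigma>2 where "\<sigma>2 = partial ?b \<sigma>"
    have \<sigma>2: "\<sigma>2 \<in> bounded_symbols (\<lambda>\<xi>. V (block_cell \<xi>))"
      unfolding \<sigma>2_def by (rule derivs_inD(4)[OF \<sigma> b])
    let ?N = "\<lambda>\<sigma> t f. \<integral>\<^sup>+x. indicator unit_cube (x - t) * ennreal ((norm (osc x (\<lambda>\<xi>. \<sigma> (x, \<xi>)) f))\<^sup>2) \<partial>lborel"
    let ?R = "\<lambda>ps t f. \<Prod>j\<in>UNIV. \<integral>\<^sup>+x. ennreal ((norm (slot_weight ps t j x * f j x))\<^sup>2) \<partial>lborel"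
    obtain C1 where C1: "C1 \<ge> 0" "\<And>t f. (\<And>j. f j \<in> derivs_in rapid) \<Longrightarrow> ?N \<sigma> t f \<le> ennreal C1 * ?R ps t f"
      using bspec[OF Cons.IH \<sigma>] by blast
    obtain C2 where C2: "C2 \<ge> 0" "\<And>t f. (\<And>j. f j \<in> derivs_in rapid) \<Longrightarrow> ?N \<sigma>2 t f \<le> ennreal C2 * ?R ps t f"
      using bspec[OF Cons.IH \<sigma>2] by blast
    obtain B1 where "0 \<le> B1" and B1: "\<And>z. norm (\<sigma> z) \<le> B1" using bounded_symbols_bounded[OF \<sigma> V0 B] by blast
    obtain B2 where "0 \<le> B2" and B2: "\<And>z. norm (\<sigma>2 z) \<le> B2" using bounded_symbols_bounded[OF \<sigma>2 V0 B] by blast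
    have c: "continuous_on UNIV (\<lambda>\<xi>. s (x, \<xi>))" if "s \<in> bounded_symbols (\<lambda>\<xi>. V (block_cell \<xi>))" for x and s :: "((real ^ 'n) \<times> ((real ^ 'n) ^ 'm)) \<Rightarrow> complex"
      by (intro continuous_on_compose2[OF smooth_continuous[OF derivs_inD(1)[OF that], of UNIV]] continuous_intros) auto
    have [measurable]: "s \<in> borel_measurable (borel \<Otimes>\<^sub>M borel)" if "s \<in> bounded_symbols (\<lambda>\<xi>. V (block_cell \<xi>))" for s :: "((real ^ 'n) \<times> ((real ^ 'n) ^ 'm)) \<Rightarrow> complex"
      using smooth_measurable[OF derivs_inD(1)[OF that]] by (simp add: borel_prod)
    note [measurable] = this[OF \<sigma>] this[OF \<sigma>2]
    show "\<exists>C\<ge>0. \<forall>t f. (\<forall>j. f j \<in> derivs_in rapid) \<longrightarrow> ?N \<sigma> t f \<le> ennreal C * ?R (p # ps) t f"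
    \<comment> \<open>On the cube around t the factor 1 + \<i> (x_i - t_i) has modulus at most 2,
      and (2a + b)^2 \<le> 8 a^2 + 2 b^2.\<close>
    proof (intro exI[of _ "8 * C1 + 2 * C2"] conjI allI impI)
      show "0 \<le> 8 * C1 + 2 * C2" using C1 C2 by simp
      fix t and f :: "'m \<Rightarrow> real ^ 'n \<Rightarrow> complex" assume f: "\<forall>j. f j \<in> derivs_in rapid"
      let ?w = "\<lambda>y :: real ^ 'n. 1 - \<i> * complex_of_real (t $ i - y $ i)"
      \<comment> \<open>The weight is absorbed into g, and \<open>osc_weight\<close> is applied to
        g: multiplying its slot l by ?w gives back f.\<close>
      define g where "g = f(l := \<lambda>y. inverse (?w y) * f l y)"
      have w0: "?w y \<noteq> 0" for y using arg_cong[of "?w y" 0 Re] by auto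
      have g: "g j \<in> derivs_in rapid" for j
        using f schwartz_slow_mult[OF inverse_weight_slow, of "f l" "t $ i" i] by (simp add: g_def)
      have fg: "f = g(l := \<lambda>y. ?w y * g l y)"
        using w0 by (auto simp: g_def fun_eq_iff)
      note [measurable] = fourier_measurable[OF schwartz_integrable[OF g]]
      have [measurable]: "(\<lambda>x. osc x (\<lambda>\<xi>. s (x, \<xi>)) g) \<in> borel_measurable borel"
        if [measurable]: "s \<in> borel_measurable (borel \<Otimes>\<^sub>M borel)" for s
        unfolding osc_def fourier_ext_def
        by (rule sigma_finite_measure.borel_measurable_lebesgue_integral[OF sigma_finite_lborel]) measurable
      have id: "osc x (\<lambda>\<xi>. \<sigma> (x, \<xi>)) f = (1 + \<i> * of_real (x $ i - t $ i)) * osc x (\<lambda>\<xi>. \<sigma> (x, \<xi>)) g + osc x (\<lambda>\<xi>. \<sigma>2 (x, \<xi>)) g" for x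
      proof (subst fg, rule osc_weight[OF g _ c[OF \<sigma>] c[OF \<sigma>2], where C="max B1 B2"])
        fix \<xi> and s :: real
        show "((\<lambda>t. \<sigma> (x, \<xi> + t *\<^sub>R ?a)) has_vector_derivative \<sigma>2 (x, \<xi> + s *\<^sub>R ?a)) (at s)"
          using has_vector_derivative_along_line[of \<sigma> "(x, \<xi>)" ?b s UNIV] derivs_inD(5)[OF \<sigma>] by (simp add: \<sigma>2_def)
      qed (use B1 B2 in \<open>auto simp: max.coboundedI1 max.coboundedI2\<close>)
      have pw: "indicator unit_cube (x - t) * ennreal ((norm (osc x (\<lambda>\<xi>. \<sigma> (x, \<xi>)) f))\<^sup>2)
        \<le> ennreal 8 * (indicator unit_cube (x - t) * ennreal ((norm (osc x (\<lambda>\<xi>. \<sigma> (x, \<xi>)) g))\<^sup>2))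
          + ennreal 2 * (indicator unit_cube (x - t) * ennreal ((norm (osc x (\<lambda>\<xi>. \<sigma>2 (x, \<xi>)) g))\<^sup>2))" for x
      proof (cases "x - t \<in> unit_cube")
        case True
        let ?A = "norm (osc x (\<lambda>\<xi>. \<sigma> (x, \<xi>)) g)" and ?B = "norm (osc x (\<lambda>\<xi>. \<sigma>2 (x, \<xi>)) g)"
        have "norm (1 + \<i> * complex_of_real (x $ i - t $ i)) \<le> 2"
          using unit_cube_component[OF True, of i]
          by (intro order.trans[OF norm_triangle_ineq]) (simp add: norm_mult del: of_real_diff)
        then have "norm (osc x (\<lambda>\<xi>. \<sigma> (x, \<xi>)) f) \<le> 2 * ?A + ?B"
          unfolding id by (intro order.trans[OF norm_triangle_ineq] add_right_mono) (simp add: norm_mult mult_right_mono del: of_real_diff)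
        then have "(norm (osc x (\<lambda>\<xi>. \<sigma> (x, \<xi>)) f))\<^sup>2 \<le> (2 * ?A + ?B)\<^sup>2" by (rule power_mono) simp
        also have "\<dots> \<le> 8 * ?A\<^sup>2 + 2 * ?B\<^sup>2"
          using zero_le_power2[of "2 * ?A - ?B"] by (simp add: power2_sum power2_diff power_mult_distrib)
        finally have "ennreal ((norm (osc x (\<lambda>\<xi>. \<sigma> (x, \<xi>)) f))\<^sup>2) \<le> ennreal (8 * ?A\<^sup>2 + 2 * ?B\<^sup>2)"
          by (rule ennreal_leI)
        also have "\<dots> = ennreal 8 * ennreal (?A\<^sup>2) + ennreal 2 * ennreal (?B\<^sup>2)"
          by (subst ennreal_plus) (auto simp: ennreal_mult)
        finally show ?thesis using True by simp
      qed simp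
      have "?N \<sigma> t f \<le> (\<integral>\<^sup>+x. ennreal 8 * (indicator unit_cube (x - t) * ennreal ((norm (osc x (\<lambda>\<xi>. \<sigma> (x, \<xi>)) g))\<^sup>2))
          + ennreal 2 * (indicator unit_cube (x - t) * ennreal ((norm (osc x (\<lambda>\<xi>. \<sigma>2 (x, \<xi>)) g))\<^sup>2)) \<partial>lborel)"
        by (rule nn_integral_mono) (rule pw)
      also have "\<dots> = ennreal 8 * ?N \<sigma> t g + ennreal 2 * ?N \<sigma>2 t g"
        by (subst nn_integral_add) (auto simp: nn_integral_cmult)
      also have "\<dots> \<le> ennreal 8 * (ennreal C1 * ?R ps t g) + ennreal 2 * (ennreal C2 * ?R ps t g)"
        by (intro add_mono mult_left_mono C1 C2 g) auto
      also have "\<dots> = ennreal (8 * C1 + 2 * C2) * ?R ps t g"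
        using C1 C2 by (simp add: ennreal_mult distrib_right mult.assoc)
      also have "?R ps t g = ?R (p # ps) t f"
        by (intro prod.cong refl nn_integral_cong) (auto simp: p g_def mult.assoc)
      finally show "?N \<sigma> t f \<le> ennreal (8 * C1 + 2 * C2) * ?R (p # ps) t f" .
    qed
  qed
qed

section \<open>Sequence spaces\<close>

lemma epowr_mono: "a \<le> b \<Longrightarrow> 0 \<le> r \<Longrightarrow> epowr a r \<le> epowr b r"
  unfolding epowr_def by (auto simp: top_unique intro!: ennreal_leI powr_mono2 enn2real_mono simp: less_top[symmetric])

lemma epowr_ennreal: "0 \<le> x \<Longrightarrow> epowr (ennreal x) r = ennreal (x powr r)"
  by (simp add: epowr_def)

lemma le_Lp_norm_count_space:
  fixes f :: "'t \<Rightarrow> ennreal"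
  assumes q: "0 < q"
  shows "f t \<le> Lp_norm (count_space UNIV) q f"
proof (cases "q = top")
  case True
  have "AE t in count_space UNIV. f t \<le> esssup (count_space UNIV) f" by (rule esssup_AE)
  then show ?thesis using True by (simp add: Lp_norm_def AE_count_space)
next
  case False
  define p where "p = enn2real q"
  have p: "p > 0" using q False by (simp add: p_def enn2real_positive_iff less_top)
  have "epowr (f t) p = (\<integral>\<^sup>+s. epowr (f s) p * indicator {t} s \<partial>count_space UNIV)"
    by (simp add: nn_integral_indicator_singleton')
  also have "\<dots> \<le> (\<integral>\<^sup>+s. epowr (f s) p \<partial>count_space UNIV)"
    by (intro nn_integral_mono) (auto simp: indicator_def)
  finally have "epowr (epowr (f t) p) (1 / p) \<le> epowr (\<integral>\<^sup>+s. epowr (f s) p \<partial>count_space UNIV) (1 / p)"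
    using p by (intro epowr_mono) auto
  moreover have "epowr (epowr (f t) p) (1 / p) = f t"
    using p by (cases "f t") (auto simp: epowr_def powr_powr)
  ultimately show ?thesis using False by (simp add: Lp_norm_def p_def)
qed

lemma Lp_norm_count_space_powr:
  assumes q: "0 < q" "q < top" and fin: "Lp_norm M q f = ennreal A" "0 \<le> A"
  shows "(\<integral>\<^sup>+t. epowr (f t) (enn2real q) \<partial>M) = ennreal (A powr enn2real q)"
proof -
  define p where "p = enn2real q"
  have p: "p > 0" using q by (simp add: p_def enn2real_positive_iff)
  define X where "X = (\<integral>\<^sup>+t. epowr (f t) p \<partial>M)"
  have "q \<noteq> top" using q by auto
  then have "epowr X (1 / p) = ennreal A" using fin by (simp add: Lp_norm_def X_def p_def)
  then show ?thesis
    unfolding p_def[symmetric] X_def[symmetric]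
    using p fin(2) by (cases X) (auto simp: epowr_def powr_powr)
qed

text \<open>The product of the normalised sequences is dominated pointwise by the sum of their powers, because
  each of them is at most one and the exponents add up to at least one.\<close>

lemma prod_powr_le_sum:
  fixes u t :: "'i \<Rightarrow> real"
  assumes F: "finite F" and u: "\<And>j. j \<in> F \<Longrightarrow> 0 \<le> u j \<and> u j \<le> 1"
    and t: "\<And>j. j \<in> F \<Longrightarrow> 0 < t j" "1 \<le> (\<Sum>j\<in>F. t j)"
  shows "(\<Prod>j\<in>F. u j powr t j) \<le> (\<Sum>j\<in>F. u j)"
proof -
  define U where "U = (\<Sum>j\<in>F. u j)"
  have uU: "u j \<le> U" if "j \<in> F" for j
    unfolding U_def using that u F by (intro member_le_sum) auto
  have U0: "0 \<le> U" unfolding U_def using u by (intro sum_nonneg) auto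
  show ?thesis
  proof (cases "1 \<le> U \<or> U = 0")
    case True
    then show ?thesis
    proof
      assume "1 \<le> U"
      have "(\<Prod>j\<in>F. u j powr t j) \<le> 1"
      proof (rule prod_le_1)
        fix j assume j: "j \<in> F"
        show "0 \<le> u j powr t j \<and> u j powr t j \<le> 1"
          using u[OF j] t(1)[OF j] powr_mono2[of "t j" "u j" 1] by simp
      qed
      then show ?thesis using \<open>1 \<le> U\<close> by (simp add: U_def)
    next
      assume U: "U = 0"
      obtain j where j: "j \<in> F" using t(2) by fastforce
      have "u j = 0" using uU[OF j] u[OF j] U by simp
      then have "(\<Prod>j\<in>F. u j powr t j) = 0" using F j by (intro prod_zero) auto
      then show ?thesis using U by (simp add: U_def)
    qed
  next
    case False
    have "(\<Prod>j\<in>F. u j powr t j) \<le> (\<Prod>j\<in>F. U powr t j)"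
      using u uU t by (intro prod_mono conjI powr_mono2) (auto intro: less_imp_le)
    also have "\<dots> = U powr (\<Sum>j\<in>F. t j)" using False F by (simp add: powr_sum)
    also have "\<dots> \<le> U powr 1" using False U0 t(2) by (intro powr_mono') auto
    finally show ?thesis using U0 by (simp add: U_def)
  qed
qed

lemma Lp_norm_product_bound:
  fixes \<beta> :: "'m::finite \<Rightarrow> 't \<Rightarrow> real" and q :: "'m \<Rightarrow> ennreal" and r :: ennreal
  assumes q: "\<And>j. 0 < q j" and r: "0 < r" and qr: "(\<Sum>j\<in>UNIV. 1 / q j) \<ge> 1 / r"
    and A: "\<And>j. 0 < A j" and \<beta>: "\<And>j t. 0 \<le> \<beta> j t" and C: "0 \<le> C"
    and top: "\<And>j t. q j = top \<Longrightarrow> \<beta> j t \<le> A j"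
    and fin: "\<And>j. q j < top \<Longrightarrow> (\<integral>\<^sup>+t. ennreal (\<beta> j t powr enn2real (q j)) \<partial>count_space UNIV) \<le> ennreal (A j powr enn2real (q j))"
    and b: "\<And>t. b t \<le> ennreal (C * (\<Prod>j\<in>UNIV. \<beta> j t))"
  shows "Lp_norm (count_space UNIV) r b
    \<le> ennreal (C * (if r = top then 1 else real CARD('m) powr (1 / enn2real r)) * (\<Prod>j\<in>UNIV. A j))"
proof -
  define g where "g j t = \<beta> j t / A j" for j t
  have g0: "0 \<le> g j t" for j t using \<beta> A less_imp_le[OF A] by (simp add: g_def)
  have gfin: "(\<integral>\<^sup>+t. ennreal (g j t powr enn2real (q j)) \<partial>count_space UNIV) \<le> 1" if "q j < top" for j
  proof -
    have "(\<integral>\<^sup>+t. ennreal (g j t powr enn2real (q j)) \<partial>count_space UNIV)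
      = (\<integral>\<^sup>+t. ennreal (\<beta> j t powr enn2real (q j)) * ennreal (1 / A j powr enn2real (q j)) \<partial>count_space UNIV)"
      using \<beta> A less_imp_le[OF A] by (intro nn_integral_cong) (simp add: g_def powr_divide ennreal_mult[symmetric])
    also have "\<dots> \<le> ennreal (A j powr enn2real (q j)) * ennreal (1 / A j powr enn2real (q j))"
      using fin[OF that] by (subst nn_integral_multc) (auto intro!: mult_right_mono)
    also have "\<dots> = 1" using A[of j] by (simp add: ennreal_mult[symmetric])
    finally show ?thesis .
  qed
  have g1: "g j t \<le> 1" for j t
  proof (cases "q j = top")
    case True
    then show ?thesis using top[OF True, of t] A[of j] by (simp add: g_def)
  next
    case False
    define p where "p = enn2real (q j)"
    have p: "p > 0" using q[of j] False by (simp add: p_def enn2real_positive_iff less_top)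
    have "ennreal (g j t powr p) \<le> (\<integral>\<^sup>+t. ennreal (g j t powr p) \<partial>count_space UNIV)"
      by (rule nn_integral_ge_point) simp
    also have "\<dots> \<le> 1" using gfin[of j] False by (simp add: p_def less_top)
    finally have "g j t powr p \<le> 1" by simp
    then show ?thesis using gr_one_powr[of "g j t" p] p by linarith
  qed
  define D where "D = C * (\<Prod>j\<in>UNIV. A j)"
  have D: "0 \<le> D" unfolding D_def using C less_imp_le[OF A] by (intro mult_nonneg_nonneg prod_nonneg) auto
  have bD: "b t \<le> ennreal (D * (\<Prod>j\<in>UNIV. g j t))" for t
  proof -
    have "(\<Prod>j\<in>UNIV. \<beta> j t) = (\<Prod>j\<in>UNIV. A j) * (\<Prod>j\<in>UNIV. g j t)"
      unfolding prod.distrib[symmetric] using less_imp_neq[OF A] by (simp add: g_def)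
    then show ?thesis using b[of t] by (simp add: D_def mult.assoc)
  qed
  show ?thesis
  proof (cases "r = top")
    case True
    have "b t \<le> ennreal D" for t
    proof -
      have "(\<Prod>j\<in>UNIV. g j t) \<le> 1" using g0 g1 by (intro prod_le_1) auto
      then have "D * (\<Prod>j\<in>UNIV. g j t) \<le> D" using D by (simp add: mult_left_le)
      then show ?thesis using bD[of t] by (meson ennreal_leI order.trans)
    qed
    then have "esssup (count_space UNIV) b \<le> ennreal D"
      by (intro esssup_I) (auto simp: AE_count_space)
    then show ?thesis using True by (simp add: Lp_norm_def D_def)
  next
    case False
    define \<rho> where "\<rho> = enn2real r"
    have \<rho>: "\<rho> > 0" using r False by (simp add: \<rho>_def enn2real_positive_iff less_top)
    have r_eq: "r = ennreal \<rho>" using False by (simp add: \<rho>_def less_top)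
    \<comment> \<open>The slots with finite exponent. The others have 1 / q_j = 0, so F carries the
      whole condition on the exponents.\<close>
    define F where "F = {j. q j < top}"
    define p where "p j = enn2real (q j)" for j
    have p: "p j > 0" "q j = ennreal (p j)" if "j \<in> F" for j
      using that q[of j] by (auto simp: F_def p_def enn2real_positive_iff)
    have "(\<Sum>j\<in>UNIV. 1 / q j) = (\<Sum>j\<in>F. 1 / q j)"
      by (rule sum.mono_neutral_right) (auto simp: F_def less_top[symmetric])
    also have "\<dots> = (\<Sum>j\<in>F. ennreal (1 / p j))"
      using p by (intro sum.cong refl) (simp add: divide_ennreal[of 1, simplified])
    also have "\<dots> = ennreal (\<Sum>j\<in>F. 1 / p j)"
      using p by (intro sum_ennreal) (auto intro: less_imp_le)
    finally have "ennreal (1 / \<rho>) \<le> ennreal (\<Sum>j\<in>F. 1 / p j)"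
      using qr \<rho> by (simp add: r_eq divide_ennreal[of 1, simplified])
    then have "1 / \<rho> \<le> (\<Sum>j\<in>F. 1 / p j)"
      by (subst (asm) ennreal_le_iff) (auto intro!: sum_nonneg less_imp_le[OF p(1)])
    then have sum1: "1 \<le> (\<Sum>j\<in>F. \<rho> / p j)"
      using \<rho> by (simp add: field_simps sum_divide_distrib sum_distrib_left)
    have pw: "epowr (b t) \<rho> \<le> ennreal (D powr \<rho>) * (\<Sum>j\<in>F. ennreal (g j t powr p j))" for t
    proof -
      have "(\<Prod>j\<in>UNIV. g j t) powr \<rho> = (\<Prod>j\<in>UNIV. g j t powr \<rho>)"
        using g0 by (simp add: prod_powr_distrib)
      also have "\<dots> \<le> (\<Prod>j\<in>F. g j t powr \<rho>)"
      proof -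
        have "(\<Prod>j\<in>UNIV. g j t powr \<rho>) = (\<Prod>j\<in>F. g j t powr \<rho>) * (\<Prod>j\<in>UNIV - F. g j t powr \<rho>)"
          by (subst mult.commute, rule prod.subset_diff) auto
        also have "\<dots> \<le> (\<Prod>j\<in>F. g j t powr \<rho>)"
          using g0 g1 \<rho> by (intro mult_left_le prod_nonneg prod_le_1) (auto intro!: powr_le1)
        finally show ?thesis .
      qed
      also have "\<dots> = (\<Prod>j\<in>F. (g j t powr p j) powr (\<rho> / p j))"
        using less_imp_neq[OF p(1)] by (intro prod.cong refl) (fastforce simp: powr_powr)
      also have "\<dots> \<le> (\<Sum>j\<in>F. g j t powr p j)"
        using g0 g1 p(1) \<rho> sum1 by (intro prod_powr_le_sum) (auto intro!: powr_le1 simp: less_imp_le)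
      finally have *: "(\<Prod>j\<in>UNIV. g j t) powr \<rho> \<le> (\<Sum>j\<in>F. g j t powr p j)" .
      have "epowr (b t) \<rho> \<le> epowr (ennreal (D * (\<Prod>j\<in>UNIV. g j t))) \<rho>"
        using bD \<rho> by (intro epowr_mono) auto
      also have "\<dots> = ennreal (D powr \<rho> * (\<Prod>j\<in>UNIV. g j t) powr \<rho>)"
        using D g0 by (simp add: epowr_ennreal prod_nonneg powr_mult)
      also have "\<dots> \<le> ennreal (D powr \<rho> * (\<Sum>j\<in>F. g j t powr p j))"
        using * by (intro ennreal_leI mult_left_mono) auto
      also have "\<dots> = ennreal (D powr \<rho>) * (\<Sum>j\<in>F. ennreal (g j t powr p j))"
        by (simp add: ennreal_mult sum_nonneg)
      finally show ?thesis .
    qed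
    have "(\<integral>\<^sup>+t. epowr (b t) \<rho> \<partial>count_space UNIV) \<le> (\<integral>\<^sup>+t. ennreal (D powr \<rho>) * (\<Sum>j\<in>F. ennreal (g j t powr p j)) \<partial>count_space UNIV)"
      by (intro nn_integral_mono pw)
    also have "\<dots> = ennreal (D powr \<rho>) * (\<Sum>j\<in>F. \<integral>\<^sup>+t. ennreal (g j t powr p j) \<partial>count_space UNIV)"
      by (subst nn_integral_cmult, simp, subst nn_integral_sum) auto
    also have "\<dots> \<le> ennreal (D powr \<rho>) * (\<Sum>j\<in>F. 1)"
      using gfin by (intro mult_left_mono sum_mono) (auto simp: F_def p_def)
    also have "\<dots> \<le> ennreal (D powr \<rho>) * ennreal (real CARD('m))"
      by (intro mult_left_mono) (auto simp: ennreal_of_nat_eq_real_of_nat[symmetric] intro!: card_mono)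
    also have "\<dots> = ennreal (D powr \<rho> * real CARD('m))" by (simp add: ennreal_mult)
    finally have "epowr (\<integral>\<^sup>+t. epowr (b t) \<rho> \<partial>count_space UNIV) (1 / \<rho>) \<le> epowr (ennreal (D powr \<rho> * real CARD('m))) (1 / \<rho>)"
      using \<rho> by (intro epowr_mono) auto
    also have "\<dots> = ennreal (D * real CARD('m) powr (1 / \<rho>))"
      using \<rho> D by (subst epowr_ennreal) (auto simp: powr_mult powr_powr)
    finally show ?thesis using False by (simp add: Lp_norm_def \<rho>_def D_def mult_ac)
  qed
qed

lemma Lp_norm_zero: "0 < r \<Longrightarrow> Lp_norm (count_space (UNIV :: 't set)) r (\<lambda>_. 0) = 0"
  using esssup_I[of "\<lambda>_. 0 :: ennreal" "count_space (UNIV :: 't set)" 0] by (simp add: Lp_norm_def epowr_def)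

text \<open>If some A_j is 0, then \<beta>_j vanishes identically and b with it; this case escapes
  the normalisation by A_j.\<close>

corollary Lp_norm_product_bound':
  fixes \<beta> :: "'m::finite \<Rightarrow> 't \<Rightarrow> real" and q :: "'m \<Rightarrow> ennreal" and r :: ennreal
  assumes q: "\<And>j. 0 < q j" and r: "0 < r" and qr: "(\<Sum>j\<in>UNIV. 1 / q j) \<ge> 1 / r"
    and A: "\<And>j. 0 \<le> A j" and \<beta>: "\<And>j t. 0 \<le> \<beta> j t" and C: "0 \<le> C"
    and top: "\<And>j t. q j = top \<Longrightarrow> \<beta> j t \<le> A j"
    and fin: "\<And>j. q j < top \<Longrightarrow> (\<integral>\<^sup>+t. ennreal (\<beta> j t powr enn2real (q j)) \<partial>count_space UNIV) \<le> ennreal (A j powr enn2real (q j))"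
    and b: "\<And>t. b t \<le> ennreal (C * (\<Prod>j\<in>UNIV. \<beta> j t))"
  shows "Lp_norm (count_space UNIV) r b
    \<le> ennreal (C * (if r = top then 1 else real CARD('m) powr (1 / enn2real r)) * (\<Prod>j\<in>UNIV. A j))"
proof (cases "\<forall>j. 0 < A j")
  case True
  then show ?thesis using Lp_norm_product_bound[OF q r qr _ \<beta> C top fin b] by blast
next
  case False
  then obtain j where j: "A j = 0" using A by (metis antisym_conv2)
  have "\<beta> j t = 0" for t
  proof (cases "q j = top")
    case True
    then show ?thesis using top[OF True, of t] \<beta>[of j t] j by simp
  next
    case False
    then have "q j < top" by (simp add: less_top)
    have "ennreal (\<beta> j t powr enn2real (q j)) \<le> (\<integral>\<^sup>+t. ennreal (\<beta> j t powr enn2real (q j)) \<partial>count_space UNIV)"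
      by (rule nn_integral_ge_point) simp
    also have "\<dots> \<le> 0" using fin[OF \<open>q j < top\<close>] j by simp
    finally show ?thesis using powr_ge_zero[of "\<beta> j t" "enn2real (q j)"] by simp
  qed
  then have pz: "(\<Prod>j\<in>UNIV. \<beta> j t) = 0" for t by (intro prod_zero) auto
  have "b t = 0" for t using b[of t] unfolding pz by simp
  then have "b = (\<lambda>_. 0)" by (simp add: fun_eq_iff)
  then show ?thesis using r by (simp add: Lp_norm_zero)
qed

section \<open>Sums over the lattice\<close>

text \<open>From \<bar>y_i\<bar> \<le> \<bar>x_i\<bar> + 1/2 one gets 1 + y_i^2 \<le> 4 (1 + x_i^2).
  The weight is thus constant on unit cells up to a factor, and its lattice sums compare with
  integrals.\<close>

lemma cauchy_weight_le:
  assumes "\<And>i. \<bar>x $ i - y $ i\<bar> \<le> 1 / 2"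
  shows "cauchy_weight (x :: real ^ 'n) \<le> 4 ^ CARD('n) * cauchy_weight y"
proof -
  have "cauchy_weight x \<le> (\<Prod>i\<in>UNIV. 4 * inverse (1 + (y $ i)\<^sup>2))"
    unfolding cauchy_weight_def
  proof (intro prod_mono conjI)
    fix i :: 'n
    have "\<bar>y $ i\<bar> \<le> \<bar>x $ i\<bar> + 1/2" using assms[of i] by linarith
    then have "(y $ i)\<^sup>2 \<le> (\<bar>x $ i\<bar> + 1/2)\<^sup>2" by (metis abs_ge_zero power2_abs power_mono)
    also have "\<dots> \<le> 3 + 4 * (x $ i)\<^sup>2"
      using zero_le_power2[of "\<bar>x $ i\<bar> - 1/2"] by (simp add: power2_sum power2_diff power_divide)
    finally have "1 + (y $ i)\<^sup>2 \<le> 4 * (1 + (x $ i)\<^sup>2)" by simp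
    moreover have "0 < 1 + (x $ i)\<^sup>2" "0 < 1 + (y $ i)\<^sup>2" by (auto simp: add_pos_nonneg)
    ultimately show "inverse (1 + (x $ i)\<^sup>2) \<le> 4 * inverse (1 + (y $ i)\<^sup>2)"
      by (simp add: field_simps)
  qed auto
  then show ?thesis by (simp add: prod.distrib cauchy_weight_def)
qed

lemma cauchy_weight_le_1: "cauchy_weight x \<le> 1"
  unfolding cauchy_weight_def by (intro prod_le_1) (auto simp: inverse_le_1_iff)

text \<open>Each term is compared with an integral over the cell of its lattice point, at the cost
  of 4^n. Row and column sums are both recorded, since the weight in t - \<mu> acts as a matrix in
  Schur type arguments.\<close>

lemma cauchy_weight_lattice_sum:
  obtains S :: real where "1 \<le> S"
    "\<And>t :: int ^ 'n. (\<integral>\<^sup>+\<mu>. ennreal (cauchy_weight (lattice_pt (t - \<mu>))) \<partial>count_space UNIV) \<le> ennreal S"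
    "\<And>\<mu> :: int ^ 'n. (\<integral>\<^sup>+t. ennreal (cauchy_weight (lattice_pt (t - \<mu>))) \<partial>count_space UNIV) \<le> ennreal S"
proof -
  define S where "S = max 1 (4 ^ CARD('n) * (\<integral>x. cauchy_weight (x :: real ^ 'n) \<partial>lborel))"
  let ?w = "\<lambda>\<kappa> :: int ^ 'n. ennreal (cauchy_weight (lattice_pt \<kappa>))"
  have "(\<integral>\<^sup>+\<kappa>. ?w \<kappa> \<partial>count_space UNIV) \<le>
      (\<integral>\<^sup>+\<kappa>. (\<integral>\<^sup>+x. indicator unit_cube x * ennreal (4 ^ CARD('n) * cauchy_weight (x + lattice_pt (\<kappa> :: int ^ 'n))) \<partial>lborel) \<partial>count_space UNIV)"
  proof (intro nn_integral_mono)
    fix \<kappa> :: "int ^ 'n"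
    have "?w \<kappa> = (\<integral>\<^sup>+x. indicator (unit_cube :: (real ^ 'n) set) x * ?w \<kappa> \<partial>lborel)"
      by (simp add: nn_integral_multc emeasure_unit_cube)
    also have "\<dots> \<le> (\<integral>\<^sup>+x. indicator unit_cube x * ennreal (4 ^ CARD('n) * cauchy_weight (x + lattice_pt \<kappa>)) \<partial>lborel)"
    proof (intro nn_integral_mono)
      fix x :: "real ^ 'n"
      show "indicator unit_cube x * ?w \<kappa> \<le> indicator unit_cube x * ennreal (4 ^ CARD('n) * cauchy_weight (x + lattice_pt \<kappa>))"
        using unit_cube_component[of x] by (cases "x \<in> unit_cube") (auto intro!: ennreal_leI cauchy_weight_le)
    qed
    finally show "?w \<kappa> \<le> (\<integral>\<^sup>+x. indicator unit_cube x * ennreal (4 ^ CARD('n) * cauchy_weight (x + lattice_pt \<kappa>)) \<partial>lborel)" .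
  qed
  also have "\<dots> = (\<integral>\<^sup>+x. ennreal (4 ^ CARD('n) * cauchy_weight (x :: real ^ 'n)) \<partial>lborel)"
    by (rule nn_integral_tiling[where r=cell, symmetric]) (auto simp: mem_unit_cube_iff)
  also have "\<dots> = ennreal (4 ^ CARD('n) * (\<integral>x. cauchy_weight (x :: real ^ 'n) \<partial>lborel))"
    by (simp add: ennreal_mult cauchy_weight_pos less_imp_le nn_integral_cmult nn_integral_cauchy_weight
      Bochner_Integration.integral_nonneg)
  also have "\<dots> \<le> ennreal S" unfolding S_def by (intro ennreal_leI) simp
  finally have S: "(\<integral>\<^sup>+\<kappa>. ?w \<kappa> \<partial>count_space UNIV) \<le> ennreal S" .
  have 1: "(\<integral>\<^sup>+\<mu>. ?w (t - \<mu>) \<partial>count_space UNIV) = (\<integral>\<^sup>+\<kappa>. ?w \<kappa> \<partial>count_space UNIV)" for t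
    by (rule nn_integral_bij_count_space) (rule bij_betwI[of _ _ _ "\<lambda>k. t - k"], auto)
  have 2: "(\<integral>\<^sup>+t. ?w (t - \<mu>) \<partial>count_space UNIV) = (\<integral>\<^sup>+\<kappa>. ?w \<kappa> \<partial>count_space UNIV)" for \<mu>
    by (rule nn_integral_bij_count_space) (rule bij_betwI[of _ _ _ "\<lambda>k. k + \<mu>"], auto)
  show thesis
    by (rule that[of S]) (use S 1 2 in \<open>auto simp: S_def\<close>)
qed

section \<open>Boundedness for weights in \<open>\<B>\<^sub>N\<close>\<close>

text \<open>Reconciles the definition, a Lebesgue integral of a translate over the fixed cube, with
  a Borel integral over the translated cube, the form that the local estimates produce.\<close>

lemma local_norm_power2:
  fixes f :: "real ^ 'n \<Rightarrow> complex"
  assumes [measurable]: "f \<in> borel_measurable borel"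
  shows "(Lp_norm (restrict_space lebesgue unit_cube) 2 (\<lambda>x. ennreal (norm (f (x + lattice_pt \<nu>)))))\<^sup>2
    = (\<integral>\<^sup>+x. indicator unit_cube (x - lattice_pt \<nu>) * ennreal ((norm (f x))\<^sup>2) \<partial>lborel)"
proof -
  have "(unit_cube :: (real ^ 'n) set) \<in> sets lebesgue" by (intro sets_completionI_sets) simp
  then have "(Lp_norm (restrict_space lebesgue unit_cube) 2 (\<lambda>x. ennreal (norm (f (x + lattice_pt \<nu>)))))\<^sup>2
    = (\<integral>\<^sup>+x. (ennreal (norm (f (x + lattice_pt \<nu>))))\<^sup>2 * indicator unit_cube x \<partial>lborel)"
    unfolding Lp_norm_two_power2 by (subst nn_integral_restrict_space) (auto simp: nn_integral_completion)
  also have "\<dots> = (\<integral>\<^sup>+x. indicator unit_cube ((x + lattice_pt \<nu>) - lattice_pt \<nu>) * ennreal ((norm (f (x + lattice_pt \<nu>)))\<^sup>2) \<partial>lborel)"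
    by (simp add: ennreal_power mult.commute)
  also have "\<dots> = (\<integral>\<^sup>+x. indicator unit_cube (x - lattice_pt \<nu>) * ennreal ((norm (f x))\<^sup>2) \<partial>lborel)"
    by (rule nn_integral_lborel_shift) measurable
  finally show ?thesis .
qed

lemma osc_measurable:
  fixes f :: "'m::finite \<Rightarrow> real ^ 'n \<Rightarrow> complex"
  assumes \<sigma>: "smooth \<sigma>" and f: "\<And>j. f j \<in> derivs_in rapid"
  shows "(\<lambda>x. osc x (\<lambda>\<xi>. \<sigma> (x, \<xi>)) f) \<in> borel_measurable borel"
proof -
  note [measurable] = fourier_measurable[OF schwartz_integrable[OF f]]
  have [measurable]: "\<sigma> \<in> borel_measurable (borel \<Otimes>\<^sub>M borel)"
    using smooth_measurable[OF \<sigma>] by (simp add: borel_prod)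
  show ?thesis
    unfolding osc_def fourier_ext_def
    by (rule sigma_finite_measure.borel_measurable_lebesgue_integral[OF sigma_finite_lborel]) measurable
qed

lemma slot_weight_append: "slot_weight (ps @ qs) t j y = slot_weight ps t j y * slot_weight qs t j y"
  by (induction ps) auto

text \<open>L lists every pair of slot and coordinate once, so each argument receives all n
  one-dimensional factors, and \<bar>1 - \<i> s\<bar>^2 = 1 + s^2 turns them into
  \<open>cauchy_weight\<close>. Repeating L gives the power M.\<close>

lemma slot_weight_norm:
  fixes L :: "('m::finite \<times> 'n::finite) list"
  assumes "set L = UNIV" "distinct L"
  shows "(norm (slot_weight (concat (replicate M L)) t j y))\<^sup>2 = cauchy_weight (t - y) ^ M"
proof -
  have n: "(norm (inverse (1 - \<i> * complex_of_real s)))\<^sup>2 = inverse (1 + s\<^sup>2)" for s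
    by (simp add: norm_inverse power_inverse cmod_power2)
  have "(norm (slot_weight ps t j y))\<^sup>2 = (\<Prod>p\<in>set ps. if fst p = j then inverse (1 + (t $ snd p - y $ snd p)\<^sup>2) else 1)"
    if "distinct ps" for ps :: "('m \<times> 'n) list"
    using that
  proof (induction ps)
    case (Cons p ps)
    obtain l i where p: "p = (l, i)" by force
    show ?case using Cons n[of "t $ i - y $ i"] by (simp add: p norm_mult power_mult_distrib mult.commute)
  qed simp
  then have "(norm (slot_weight L t j y))\<^sup>2 = (\<Prod>p\<in>UNIV. if fst p = j then inverse (1 + (t $ snd p - y $ snd p)\<^sup>2) else 1)"
    using assms by simp
  also have "\<dots> = (\<Prod>l\<in>UNIV. \<Prod>i\<in>UNIV. if l = j then inverse (1 + (t $ i - y $ i)\<^sup>2) else 1)"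
    by (simp add: prod.cartesian_product case_prod_unfold)
  also have "\<dots> = (\<Prod>l\<in>UNIV. if l = j then cauchy_weight (t - y) else 1)"
    by (intro prod.cong refl) (simp add: cauchy_weight_def)
  also have "\<dots> = cauchy_weight (t - y)" by simp
  finally have L: "(norm (slot_weight L t j y))\<^sup>2 = cauchy_weight (t - y)" .
  show ?thesis
    by (induction M) (simp_all add: slot_weight_append norm_mult power_mult_distrib L)
qed

text \<open>Raising the last hypothesis to the power 2/p gives w^(2/p) a^2 \<le> b^2. Since w \<le>
  1 and M - 2/p \<ge> 1, one factor w remains, and it is this factor that makes the later lattice
  sum converge.\<close>

lemma weighted_power_bound:
  fixes w a b p :: real
  assumes w: "0 < w" "w \<le> 1" and a: "0 \<le> a" and b: "0 \<le> b" and p: "0 < p"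
    and M: "1 + 2 / p \<le> real M" and le: "w * a powr p \<le> b powr p"
  shows "w ^ M * a\<^sup>2 \<le> w * b\<^sup>2"
proof -
  have "(w * a powr p) powr (2 / p) \<le> (b powr p) powr (2 / p)"
    using w p le by (intro powr_mono2) auto
  then have *: "w powr (2 / p) * a\<^sup>2 \<le> b\<^sup>2"
    using w a b p by (simp add: powr_mult powr_powr powr_numeral)
  have "w ^ M = w powr (real M - 2 / p) * w powr (2 / p)"
    using w by (simp add: powr_add[symmetric] powr_realpow)
  then have "w ^ M * a\<^sup>2 = w powr (real M - 2 / p) * (w powr (2 / p) * a\<^sup>2)" by simp
  also have "\<dots> \<le> w powr 1 * b\<^sup>2"
    using w M * by (intro mult_mono powr_mono') auto
  finally show ?thesis using w by simp
qed

text \<open>With a_j(\<mu>) the local norm of f_j on the cell of \<mu>,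
  \<open>\<beta> j \<tau>\<close> is, for finite q_j, the l^(q_j) norm of a_j with weight w(\<tau> -
  \<mu>). The output on the cell of \<tau> is bounded by the product of the
  \<open>\<beta> j \<tau>\<close>, each \<open>\<beta> j\<close> is controlled in l^(q_j) by the
  amalgam norm of f_j, and \<open>Lp_norm_product_bound'\<close> concludes.\<close>

theorem B_class_sufficient:
  fixes V :: "(int ^ 'n) ^ 'm \<Rightarrow> real" and q :: "'m \<Rightarrow> ennreal"
  assumes V: "V \<in> B_class" and B: "\<And>\<nu>. V \<nu> \<le> B"
    and \<sigma>: "\<sigma> \<in> symbol_class (extend_weight V)"
    and q: "\<And>j. 0 < q j" and r: "0 < r" and qr: "(\<Sum>j\<in>UNIV. 1 / q j) \<ge> 1 / r"
  shows "amalgam_bounded (pseudo_op \<sigma>) (\<lambda>_. 2) q 2 r"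
proof -
  have \<sigma>: "\<sigma> \<in> bounded_symbols (\<lambda>\<xi>. V (block_cell \<xi>))"
    using \<sigma> by (simp add: symbol_class_eq extend_weight_eq)
  define p where "p j = enn2real (q j)" for j
  have p: "0 < p j" if "q j < top" for j using q[of j] that by (simp add: p_def enn2real_positive_iff)
  \<comment> \<open>Large enough for \<open>weighted_power_bound\<close> in every slot at once. For
    q_j = \<infinity> the conversion gives p_j = 0, hence 2 / p_j = 0, and the requirement reduces
    to 1 \<le> M.\<close>
  define M where "M = nat \<lceil>1 + (\<Sum>j\<in>UNIV. 2 / p j)\<rceil>"
  have p0: "0 \<le> 2 / p j" for j by (simp add: p_def)
  have M: "1 + 2 / p j \<le> real M" for j
  proof -
    have "2 / p j \<le> (\<Sum>j\<in>UNIV. 2 / p j)" using p0 by (intro member_le_sum) auto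
    then show ?thesis unfolding M_def using real_nat_ceiling_ge[of "1 + (\<Sum>j\<in>UNIV. 2 / p j)"] by linarith
  qed
  then have M1: "1 \<le> M" using p0[of undefined] by (metis M_def nat_ceiling_le_eq add_increasing2 dual_order.trans le_add_same_cancel1 of_nat_1 of_nat_le_iff)
  obtain L :: "('m \<times> 'n) list" where L: "set L = UNIV" "distinct L"
    using finite_distinct_list[OF finite_class.finite_UNIV] by blast
  define ps where "ps = concat (replicate M L)"
  have ps: "(norm (slot_weight ps t j y))\<^sup>2 = cauchy_weight (t - y) ^ M" for t j y
    unfolding ps_def by (rule slot_weight_norm[OF L])
  obtain C where C: "0 \<le> C" and osc: "\<And>t f. (\<And>j. f j \<in> derivs_in rapid) \<Longrightarrow>
      (\<integral>\<^sup>+x. indicator unit_cube (x - t) * ennreal ((norm (osc x (\<lambda>\<xi>. \<sigma> (x, \<xi>)) f))\<^sup>2) \<partial>lborel)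
      \<le> ennreal C * (\<Prod>j\<in>UNIV. \<integral>\<^sup>+x. ennreal ((norm (slot_weight ps t j x * f j x))\<^sup>2) \<partial>lborel)"
    using bspec[OF osc_weighted_bound[OF V B, of ps] \<sigma>] by blast
  obtain S :: real where S: "1 \<le> S"
    "\<And>t :: int ^ 'n. (\<integral>\<^sup>+\<mu>. ennreal (cauchy_weight (lattice_pt (t - \<mu>))) \<partial>count_space UNIV) \<le> ennreal S"
    "\<And>\<mu> :: int ^ 'n. (\<integral>\<^sup>+t. ennreal (cauchy_weight (lattice_pt (t - \<mu>))) \<partial>count_space UNIV) \<le> ennreal S"
    using cauchy_weight_lattice_sum by blast
  define w where "w \<kappa> = cauchy_weight (lattice_pt \<kappa>)" for \<kappa> :: "int ^ 'n"
  have w: "0 < w \<kappa>" "w \<kappa> \<le> 1" for \<kappa> by (auto simp: w_def cauchy_weight_pos cauchy_weight_le_1)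
  \<comment> \<open>The cost of replacing the M-th power of \<open>cauchy_weight\<close> at a point
    of a cell by its value at the lattice point.\<close>
  define K where "K = (4 ^ CARD('n) :: real) ^ M"
  have K: "0 \<le> K" by (simp add: K_def)
  define c0 where "c0 = norm (1 / (2 * complex_of_real pi) ^ (CARD('m) * CARD('n)))"
  \<comment> \<open>A square root because the local estimate is for squares; K S enters once for
    each argument.\<close>
  define C3 where "C3 = sqrt (c0\<^sup>2 * (C * (K * S) ^ CARD('m)))"
  have C3: "0 \<le> C3" "C3\<^sup>2 = c0\<^sup>2 * (C * (K * S) ^ CARD('m))"
    unfolding C3_def using C K S by auto
  \<comment> \<open>The norm on l^(q_j) of the passage from a_j to \<open>\<beta> j\<close>: for
    each \<mu> the weights w(\<tau> - \<mu>) sum to at most S.\<close>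
  define \<Omega> where "\<Omega> j = (if q j = top then 1 else S powr (1 / p j))" for j
  have \<Omega>: "0 \<le> \<Omega> j" for j by (simp add: \<Omega>_def)
  define A where "A = C3 * (if r = top then 1 else real CARD('m) powr (1 / enn2real r)) * (\<Prod>j\<in>UNIV. \<Omega> j)"
  have A: "0 \<le> A" unfolding A_def using C3 \<Omega> by (intro mult_nonneg_nonneg prod_nonneg) auto
  show ?thesis
    unfolding amalgam_bounded_def
  proof (intro exI[of _ A] allI impI)
    fix f :: "'m \<Rightarrow> real ^ 'n \<Rightarrow> complex"
    assume asm: "\<forall>j. schwartz (f j) \<and> f j \<in> amalgam_space 2 (q j)"
    then have f: "f j \<in> derivs_in rapid" for j by (simp add: schwartz_eq)
    have fm [measurable]: "f j \<in> borel_measurable borel" for j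
      by (intro smooth_measurable derivs_inD(1)[OF f])
    define N where "N j = enn2real (amalgam_norm 2 (q j) (f j))" for j
    have N: "amalgam_norm 2 (q j) (f j) = ennreal (N j)" for j
      using asm by (simp add: N_def amalgam_space_def)
    have N0: "0 \<le> N j" for j by (simp add: N_def)
    define l where "l g \<nu> = Lp_norm (restrict_space lebesgue unit_cube) 2 (\<lambda>x. ennreal (norm (g (x + lattice_pt \<nu>))))" for g :: "real ^ 'n \<Rightarrow> complex" and \<nu>
    have am: "amalgam_norm 2 s g = Lp_norm (count_space UNIV) s (l g)" for s g
      unfolding amalgam_norm_def l_def[abs_def] ..
    define a where "a j \<mu> = enn2real (l (f j) \<mu>)" for j \<mu>
    have l_le: "l (f j) \<mu> \<le> ennreal (N j)" for j \<mu>
      using le_Lp_norm_count_space[OF q, of "l (f j)" \<mu> j] by (simp add: am[symmetric] N)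
    have a: "l (f j) \<mu> = ennreal (a j \<mu>)" for j \<mu>
    proof -
      have "l (f j) \<mu> < top" by (rule le_less_trans[OF l_le]) simp
      then show ?thesis by (simp add: a_def)
    qed
    have a0: "0 \<le> a j \<mu>" for j \<mu> by (simp add: a_def)
    have aN: "a j \<mu> \<le> N j" for j \<mu> using l_le[of j \<mu>] N0 by (simp add: a)
    define I where "I j \<tau> = (\<integral>\<^sup>+\<mu>. ennreal (w (\<tau> - \<mu>) * a j \<mu> powr p j) \<partial>count_space UNIV)" for j \<tau>
    have sumN: "(\<integral>\<^sup>+\<mu>. ennreal (a j \<mu> powr p j) \<partial>count_space UNIV) = ennreal (N j powr p j)" if "q j < top" for j
      using Lp_norm_count_space_powr[OF q that, of "count_space UNIV" "l (f j)" "N j"] N0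
      by (simp add: am[symmetric] N a epowr_ennreal a0 p_def)
    have I_fin: "I j \<tau> < top" if "q j < top" for j \<tau>
    proof -
      have "I j \<tau> \<le> (\<integral>\<^sup>+\<mu>. ennreal (a j \<mu> powr p j) \<partial>count_space UNIV)"
        unfolding I_def using w by (intro nn_integral_mono ennreal_leI) (simp add: mult_left_le_one_le less_imp_le)
      then show ?thesis using sumN[OF that] by (simp add: order.strict_trans1)
    qed
    \<comment> \<open>For q_j = \<infinity> the constant sequence equal to the amalgam norm takes
      the place of a weighted mean.\<close>
    define \<beta> where "\<beta> j \<tau> = (if q j = top then N j else enn2real (I j \<tau>) powr (1 / p j))" for j \<tau>
    have \<beta>0: "0 \<le> \<beta> j \<tau>" for j \<tau> using N0 by (simp add: \<beta>_def)
    have \<beta>p: "ennreal (\<beta> j \<tau> powr p j) = I j \<tau>" if "q j < top" for j \<tau>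
      using less_imp_neq[OF that] p[OF that] I_fin[OF that, of \<tau>] by (simp add: \<beta>_def powr_powr)
    have fin: "(\<integral>\<^sup>+\<tau>. ennreal (\<beta> j \<tau> powr p j) \<partial>count_space UNIV) \<le> ennreal ((\<Omega> j * N j) powr p j)" if j: "q j < top" for j
    proof -
      have "(\<integral>\<^sup>+\<tau>. ennreal (\<beta> j \<tau> powr p j) \<partial>count_space UNIV)
        = (\<integral>\<^sup>+\<tau>. (\<integral>\<^sup>+\<mu>. ennreal (w (\<tau> - \<mu>)) * ennreal (a j \<mu> powr p j) \<partial>count_space UNIV) \<partial>count_space UNIV)"
        unfolding \<beta>p[OF j] I_def using w by (simp add: ennreal_mult less_imp_le)
      also have "\<dots> = (\<integral>\<^sup>+\<mu>. (\<integral>\<^sup>+\<tau>. ennreal (w (\<tau> - \<mu>)) * ennreal (a j \<mu> powr p j) \<partial>count_space UNIV) \<partial>count_space UNIV)"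
        by (rule nn_integral_count_space_nn_integral) auto
      also have "\<dots> \<le> (\<integral>\<^sup>+\<mu>. ennreal S * ennreal (a j \<mu> powr p j) \<partial>count_space UNIV)"
      proof (intro nn_integral_mono)
        fix \<mu>
        have "(\<integral>\<^sup>+\<tau>. ennreal (w (\<tau> - \<mu>)) * ennreal (a j \<mu> powr p j) \<partial>count_space UNIV)
          = (\<integral>\<^sup>+\<tau>. ennreal (w (\<tau> - \<mu>)) \<partial>count_space UNIV) * ennreal (a j \<mu> powr p j)"
          by (rule nn_integral_multc) simp
        also have "\<dots> \<le> ennreal S * ennreal (a j \<mu> powr p j)"
          unfolding w_def by (intro mult_right_mono S) simp
        finally show "(\<integral>\<^sup>+\<tau>. ennreal (w (\<tau> - \<mu>)) * ennreal (a j \<mu> powr p j) \<partial>count_space UNIV) \<le> ennreal S * ennreal (a j \<mu> powr p j)" .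
      qed
      also have "\<dots> = ennreal (S * N j powr p j)"
        using S(1) by (simp add: nn_integral_cmult sumN[OF j] ennreal_mult)
      also have "S * N j powr p j = (\<Omega> j * N j) powr p j"
        using less_imp_neq[OF j] p[OF j] S(1) N0 by (simp add: \<Omega>_def powr_mult powr_powr)
      finally show ?thesis .
    qed
    \<comment> \<open>A single term of \<open>I j \<tau>\<close> is at most the whole sum. This
      controls a_j(\<mu>) by \<open>\<beta> j \<tau>\<close> up to a negative power of the weight,
      which the M factors absorb.\<close>
    have point: "w (\<tau> - \<mu>) ^ M * (a j \<mu>)\<^sup>2 \<le> w (\<tau> - \<mu>) * (\<beta> j \<tau>)\<^sup>2" for j \<tau> \<mu>
    proof (cases "q j = top")
      case True
      have "w (\<tau> - \<mu>) ^ M \<le> w (\<tau> - \<mu>) ^ 1" using w[of "\<tau> - \<mu>"] M1 by (intro power_decreasing) auto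
      moreover have "(a j \<mu>)\<^sup>2 \<le> (\<beta> j \<tau>)\<^sup>2" using aN a0 True by (simp add: \<beta>_def power_mono)
      ultimately show ?thesis using w[of "\<tau> - \<mu>"] by (intro mult_mono) auto
    next
      case False
      then have j: "q j < top" by (simp add: less_top)
      have "ennreal (w (\<tau> - \<mu>) * a j \<mu> powr p j) \<le> I j \<tau>"
        unfolding I_def by (rule nn_integral_ge_point) simp
      then have "w (\<tau> - \<mu>) * a j \<mu> powr p j \<le> \<beta> j \<tau> powr p j"
        unfolding \<beta>p[OF j, symmetric] by simp
      then show ?thesis by (intro weighted_power_bound[OF w a0 \<beta>0 p[OF j] M])
    qed
    \<comment> \<open>The integral is cut into cells, the weight is replaced by its lattice value,
      and \<open>point\<close> leaves one factor w(\<tau> - \<mu>) to be summed over \<mu>.\<close>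
    have slot: "(\<integral>\<^sup>+x. ennreal ((norm (slot_weight ps (lattice_pt \<tau>) j x * f j x))\<^sup>2) \<partial>lborel) \<le> ennreal (K * S * (\<beta> j \<tau>)\<^sup>2)" for j \<tau>
    proof -
      let ?g = "\<lambda>x. ennreal (cauchy_weight (lattice_pt \<tau> - x) ^ M) * ennreal ((norm (f j x))\<^sup>2)"
      have "(\<integral>\<^sup>+x. ennreal ((norm (slot_weight ps (lattice_pt \<tau>) j x * f j x))\<^sup>2) \<partial>lborel) = (\<integral>\<^sup>+x. ?g x \<partial>lborel)"
        by (simp add: norm_mult power_mult_distrib ps ennreal_mult cauchy_weight_pos less_imp_le)
      also have "\<dots> = (\<integral>\<^sup>+\<mu>. (\<integral>\<^sup>+x. indicator unit_cube x * ?g (x + lattice_pt \<mu>) \<partial>lborel) \<partial>count_space UNIV)"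
        by (rule nn_integral_tiling[where r=cell]) (auto simp: mem_unit_cube_iff)
      also have "\<dots> \<le> (\<integral>\<^sup>+\<mu>. ennreal (K * w (\<tau> - \<mu>) ^ M) * ennreal ((a j \<mu>)\<^sup>2) \<partial>count_space UNIV)"
      proof (intro nn_integral_mono)
        fix \<mu> :: "int ^ 'n"
        have "(\<integral>\<^sup>+x. indicator unit_cube x * ?g (x + lattice_pt \<mu>) \<partial>lborel)
          \<le> (\<integral>\<^sup>+x. ennreal (K * w (\<tau> - \<mu>) ^ M) * (indicator unit_cube ((x + lattice_pt \<mu>) - lattice_pt \<mu>) * ennreal ((norm (f j (x + lattice_pt \<mu>)))\<^sup>2)) \<partial>lborel)"
        proof (intro nn_integral_mono)
          fix x :: "real ^ 'n"
          show "indicator unit_cube x * ?g (x + lattice_pt \<mu>) \<le> ennreal (K * w (\<tau> - \<mu>) ^ M) * (indicator unit_cube ((x + lattice_pt \<mu>) - lattice_pt \<mu>) * ennreal ((norm (f j (x + lattice_pt \<mu>)))\<^sup>2))"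
          proof (cases "x \<in> unit_cube")
            case True
            have "cauchy_weight (lattice_pt \<tau> - (x + lattice_pt \<mu>)) \<le> 4 ^ CARD('n) * w (\<tau> - \<mu>)"
              unfolding w_def
            proof (rule cauchy_weight_le)
              fix i
              show "\<bar>(lattice_pt \<tau> - (x + lattice_pt \<mu>)) $ i - lattice_pt (\<tau> - \<mu>) $ i\<bar> \<le> 1 / 2"
                using unit_cube_component[OF True, of i] by (simp add: lattice_pt_diff)
            qed
            then have "cauchy_weight (lattice_pt \<tau> - (x + lattice_pt \<mu>)) ^ M \<le> (4 ^ CARD('n) * w (\<tau> - \<mu>)) ^ M"
              by (intro power_mono) (auto simp: cauchy_weight_pos less_imp_le)
            also have "\<dots> = K * w (\<tau> - \<mu>) ^ M" by (simp add: K_def power_mult_distrib)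
            finally show ?thesis using True by (auto intro!: mult_right_mono ennreal_leI)
          qed simp
        qed
        also have "\<dots> = ennreal (K * w (\<tau> - \<mu>) ^ M) * (\<integral>\<^sup>+x. indicator unit_cube (x - lattice_pt \<mu>) * ennreal ((norm (f j x))\<^sup>2) \<partial>lborel)"
          using nn_integral_lborel_shift[of "\<lambda>x. indicator unit_cube (x - lattice_pt \<mu>) * ennreal ((norm (f j x))\<^sup>2)" "lattice_pt \<mu>"]
          by (subst nn_integral_cmult) auto
        also have "\<dots> = ennreal (K * w (\<tau> - \<mu>) ^ M) * ennreal ((a j \<mu>)\<^sup>2)"
          using local_norm_power2[OF fm, of j \<mu>] by (simp add: l_def[symmetric] a ennreal_power a0)
        finally show "(\<integral>\<^sup>+x. indicator unit_cube x * ?g (x + lattice_pt \<mu>) \<partial>lborel) \<le> ennreal (K * w (\<tau> - \<mu>) ^ M) * ennreal ((a j \<mu>)\<^sup>2)" .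
      qed
      also have "\<dots> \<le> (\<integral>\<^sup>+\<mu>. ennreal (w (\<tau> - \<mu>)) * ennreal (K * (\<beta> j \<tau>)\<^sup>2) \<partial>count_space UNIV)"
      proof (intro nn_integral_mono)
        fix \<mu>
        have "(K * w (\<tau> - \<mu>) ^ M) * (a j \<mu>)\<^sup>2 \<le> w (\<tau> - \<mu>) * (K * (\<beta> j \<tau>)\<^sup>2)"
          using mult_left_mono[OF point K, of \<tau> \<mu> j] by (simp add: mult_ac)
        then show "ennreal (K * w (\<tau> - \<mu>) ^ M) * ennreal ((a j \<mu>)\<^sup>2) \<le> ennreal (w (\<tau> - \<mu>)) * ennreal (K * (\<beta> j \<tau>)\<^sup>2)"
          using K w[of "\<tau> - \<mu>"] by (simp add: ennreal_mult[symmetric] ennreal_leI)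
      qed
      also have "\<dots> = (\<integral>\<^sup>+\<mu>. ennreal (w (\<tau> - \<mu>)) \<partial>count_space UNIV) * ennreal (K * (\<beta> j \<tau>)\<^sup>2)"
        by (rule nn_integral_multc) simp
      also have "\<dots> \<le> ennreal S * ennreal (K * (\<beta> j \<tau>)\<^sup>2)"
        unfolding w_def by (intro mult_right_mono S) simp
      also have "\<dots> = ennreal (K * S * (\<beta> j \<tau>)\<^sup>2)" using S K by (simp add: ennreal_mult[symmetric] mult_ac)
      finally show ?thesis .
    qed
    have Tm: "pseudo_op \<sigma> f \<in> borel_measurable borel"
      unfolding pseudo_op_eq_osc[abs_def] using osc_measurable[OF derivs_inD(1)[OF \<sigma>] f] by measurable
    have b: "l (pseudo_op \<sigma> f) \<tau> \<le> ennreal (C3 * (\<Prod>j\<in>UNIV. \<beta> j \<tau>))" for \<tau>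
    proof (rule ennreal_power2_le_cancel)
      have [measurable]: "(\<lambda>x. osc x (\<lambda>\<xi>. \<sigma> (x, \<xi>)) f) \<in> borel_measurable borel"
        by (rule osc_measurable[OF derivs_inD(1)[OF \<sigma>] f])
      have "(l (pseudo_op \<sigma> f) \<tau>)\<^sup>2 = (\<integral>\<^sup>+x. indicator unit_cube (x - lattice_pt \<tau>) * ennreal ((norm (pseudo_op \<sigma> f x))\<^sup>2) \<partial>lborel)"
        unfolding l_def by (rule local_norm_power2[OF Tm])
      also have "\<dots> = (\<integral>\<^sup>+x. ennreal (c0\<^sup>2) * (indicator unit_cube (x - lattice_pt \<tau>) * ennreal ((norm (osc x (\<lambda>\<xi>. \<sigma> (x, \<xi>)) f))\<^sup>2)) \<partial>lborel)"
      proof (intro nn_integral_cong)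
        fix x
        have "norm (pseudo_op \<sigma> f x) = c0 * norm (osc x (\<lambda>\<xi>. \<sigma> (x, \<xi>)) f)"
          unfolding pseudo_op_eq_osc norm_mult c0_def ..
        then show "indicator unit_cube (x - lattice_pt \<tau>) * ennreal ((norm (pseudo_op \<sigma> f x))\<^sup>2)
          = ennreal (c0\<^sup>2) * (indicator unit_cube (x - lattice_pt \<tau>) * ennreal ((norm (osc x (\<lambda>\<xi>. \<sigma> (x, \<xi>)) f))\<^sup>2))"
          by (simp add: power_mult_distrib ennreal_mult mult_ac)
      qed
      also have "\<dots> = ennreal (c0\<^sup>2) * (\<integral>\<^sup>+x. indicator unit_cube (x - lattice_pt \<tau>) * ennreal ((norm (osc x (\<lambda>\<xi>. \<sigma> (x, \<xi>)) f))\<^sup>2) \<partial>lborel)"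
        by (rule nn_integral_cmult) measurable
      also have "\<dots> \<le> ennreal (c0\<^sup>2) * (ennreal C * (\<Prod>j\<in>UNIV. ennreal (K * S * (\<beta> j \<tau>)\<^sup>2)))"
        by (intro mult_left_mono order.trans[OF osc[OF f]] ennreal_prod_mono slot) auto
      also have "(\<Prod>j\<in>UNIV. ennreal (K * S * (\<beta> j \<tau>)\<^sup>2)) = ennreal (\<Prod>j\<in>UNIV. K * S * (\<beta> j \<tau>)\<^sup>2)"
        using K S by (intro prod_ennreal) auto
      also have "ennreal (c0\<^sup>2) * (ennreal C * ennreal (\<Prod>j\<in>UNIV. K * S * (\<beta> j \<tau>)\<^sup>2)) = ennreal (c0\<^sup>2 * (C * (\<Prod>j\<in>UNIV. K * S * (\<beta> j \<tau>)\<^sup>2)))"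
        using C K S by (simp add: ennreal_mult prod_nonneg)
      also have "c0\<^sup>2 * (C * (\<Prod>j\<in>UNIV. K * S * (\<beta> j \<tau>)\<^sup>2)) = (C3 * (\<Prod>j\<in>UNIV. \<beta> j \<tau>))\<^sup>2"
        by (simp add: power_mult_distrib C3(2) prod.distrib prod_power_distrib mult.assoc)
      also have "ennreal ((C3 * (\<Prod>j\<in>UNIV. \<beta> j \<tau>))\<^sup>2) = (ennreal (C3 * (\<Prod>j\<in>UNIV. \<beta> j \<tau>)))\<^sup>2"
        using C3(1) \<beta>0 by (simp add: ennreal_power prod_nonneg)
      finally show "(l (pseudo_op \<sigma> f) \<tau>)\<^sup>2 \<le> (ennreal (C3 * (\<Prod>j\<in>UNIV. \<beta> j \<tau>)))\<^sup>2" .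
    qed
    have "Lp_norm (count_space UNIV) r (l (pseudo_op \<sigma> f))
      \<le> ennreal (C3 * (if r = top then 1 else real CARD('m) powr (1 / enn2real r)) * (\<Prod>j\<in>UNIV. \<Omega> j * N j))"
    proof (rule Lp_norm_product_bound'[OF q r qr _ \<beta>0 C3(1) _ _ b])
      show "0 \<le> \<Omega> j * N j" for j using \<Omega> N0 by simp
      show "\<beta> j t \<le> \<Omega> j * N j" if "q j = top" for j t using that by (simp add: \<beta>_def \<Omega>_def)
      show "(\<integral>\<^sup>+t. ennreal (\<beta> j t powr enn2real (q j)) \<partial>count_space UNIV) \<le> ennreal ((\<Omega> j * N j) powr enn2real (q j))" if "q j < top" for j
        using fin[OF that] by (simp add: p_def)
    qed
    also have "\<dots> = ennreal A * ennreal (\<Prod>j\<in>UNIV. N j)"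
      using A N0 by (subst ennreal_mult[symmetric]) (auto simp: A_def prod.distrib prod_nonneg mult_ac)
    also have "ennreal (\<Prod>j\<in>UNIV. N j) = (\<Prod>j\<in>UNIV. amalgam_norm 2 (q j) (f j))"
      using N0 by (simp add: N prod_ennreal)
    finally show "amalgam_norm 2 r (pseudo_op \<sigma> f) \<le> ennreal A * (\<Prod>j\<in>UNIV. amalgam_norm 2 (q j) (f j))"
      by (simp only: am)
  qed
qed

section \<open>A test symbol\<close>

text \<open>The classical function exp(-1/s), flat at 0, times powers of 1/s: the index k makes the
  derivative a combination of members of the same family.\<close>

definition flat :: "nat \<Rightarrow> real \<Rightarrow> real" where
  "flat k s = (if 0 < s then inverse s ^ k * exp (- inverse s) else 0)"

lemma power_le_fact_exp: "0 \<le> x \<Longrightarrow> x ^ k \<le> fact k * exp (x :: real)"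
proof -
  assume x: "0 \<le> x"
  have "(\<Sum>n\<in>{k}. x ^ n /\<^sub>R fact n) \<le> (\<Sum>n. x ^ n /\<^sub>R fact n)"
    using x by (intro sum_le_suminf summable_exp_generic) auto
  then have "x ^ k / fact k \<le> exp x" by (simp add: exp_def divide_inverse mult.commute)
  then show ?thesis by (simp add: field_simps)
qed

lemma flat_bound: "0 \<le> flat k s" "flat k s \<le> fact k"
proof -
  show "0 \<le> flat k s" by (simp add: flat_def)
  have "inverse s ^ k * exp (- inverse s) \<le> fact k" if "0 < s"
    using power_le_fact_exp[of "inverse s" k] that by (simp add: exp_minus field_simps)
  then show "flat k s \<le> fact k" by (auto simp: flat_def)
qed

text \<open>The difference quotient at 0 becomes s times the bounded function
  \<open>flat (k + 2)\<close>, which gives the derivative 0 there.\<close>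

lemma flat_shift: "flat k s = s\<^sup>2 * flat (k + 2) s"
proof (cases "0 < s")
  case True
  then have "s\<^sup>2 * inverse s ^ (k + 2) = inverse s ^ k" by (simp add: power2_eq_square field_simps)
  then show ?thesis using True by (simp add: flat_def mult.assoc[symmetric])
qed (simp add: flat_def)

lemma flat_has_derivative: "(flat k has_real_derivative flat (k + 2) s - real k * flat (k + 1) s) (at s)"
proof -
  consider "0 < s" | "s < 0" | "s = 0" by linarith
  then show ?thesis
  proof cases
    case 1
    have "((\<lambda>s. inverse s ^ k * exp (- inverse s)) has_real_derivative
        inverse s ^ (k + 2) * exp (- inverse s) - real k * (inverse s ^ (k + 1) * exp (- inverse s))) (at s)"
    proof -
      have *: "((\<lambda>s. inverse s ^ k) has_real_derivative - (real k * inverse s ^ (k + 1))) (at s)"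
      proof -
        have "real k * (- (inverse s ^ Suc (Suc 0)) * inverse s ^ (k - Suc 0)) = - (real k * inverse s ^ (k + 1))"
          by (cases k) auto
        moreover have "s \<noteq> 0" using 1 by simp
        ultimately show ?thesis using DERIV_power[OF DERIV_inverse, where n=k and x=s] by (simp only:) simp
      qed
      have "((\<lambda>s. exp (- inverse s)) has_real_derivative exp (- inverse s) * inverse s ^ 2) (at s)"
        using 1 by (auto intro!: derivative_eq_intros simp: power2_eq_square)
      from DERIV_mult[OF * this] show ?thesis by (rule DERIV_cong) (simp add: algebra_simps power_add power2_eq_square)
    qed
    then have "(flat k has_real_derivative
        inverse s ^ (k + 2) * exp (- inverse s) - real k * (inverse s ^ (k + 1) * exp (- inverse s))) (at s)"
      by (rule has_field_derivative_transform_within_open[of _ _ _ "{0<..}"]) (use 1 in \<open>auto simp: flat_def\<close>)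
    then show ?thesis using 1 by (simp add: flat_def)
  next
    case 2
    have "((\<lambda>s. 0) has_real_derivative 0) (at s)" by simp
    then have "(flat k has_real_derivative 0) (at s)"
      by (rule has_field_derivative_transform_within_open[of _ _ _ "{..<0}"]) (use 2 in \<open>auto simp: flat_def\<close>)
    then show ?thesis using 2 by (simp add: flat_def)
  next
    case 3
    have "((\<lambda>y. (flat k y - flat k 0) / (y - 0)) \<longlongrightarrow> 0) (at 0)"
    proof (rule Lim_null_comparison)
      have "norm ((flat k y - flat k 0) / (y - 0)) \<le> \<bar>y\<bar> * fact (k + 2)" for y
      proof -
        have "norm ((flat k y - flat k 0) / (y - 0)) = \<bar>y\<bar> * flat (k + 2) y"
          using flat_bound(1)[of "k + 2" y] unfolding flat_shift[of k]
          by (simp add: power2_eq_square abs_mult)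
        then show ?thesis using flat_bound(2)[of "k + 2" y] by (simp add: mult_left_mono)
      qed
      then show "\<forall>\<^sub>F y in at 0. norm ((flat k y - flat k 0) / (y - 0)) \<le> \<bar>y\<bar> * fact (k + 2)" by simp
      have "((\<lambda>y::real. \<bar>y\<bar> * fact (k + 2)) \<longlongrightarrow> \<bar>0\<bar> * fact (k + 2)) (at 0)" by (intro tendsto_intros)
      then show "((\<lambda>y::real. \<bar>y\<bar> * fact (k + 2)) \<longlongrightarrow> 0) (at 0)" by simp
    qed
    then show ?thesis unfolding 3 has_field_derivative_iff by (simp add: flat_def)
  qed
qed

section \<open>Periodic bumps and the symbols built from them\<close>

text \<open>A linear family of functions of period 1, stable under differentiation, that vanish
  where cos(2 pi t) \<le> 0, that is at distance at least 1/4 from the integers. Periodicity lets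
  one formula serve all cells, with no sum over lattice points.\<close>

inductive_set bumps :: "(real \<Rightarrow> real) set" where
  flat: "(\<lambda>t. flat k (cos (2 * pi * t))) \<in> bumps"
| sin: "f \<in> bumps \<Longrightarrow> (\<lambda>t. sin (2 * pi * t) * f t) \<in> bumps"
| cos: "f \<in> bumps \<Longrightarrow> (\<lambda>t. cos (2 * pi * t) * f t) \<in> bumps"
| scale: "f \<in> bumps \<Longrightarrow> (\<lambda>t. c * f t) \<in> bumps"
| add: "f \<in> bumps \<Longrightarrow> g \<in> bumps \<Longrightarrow> (\<lambda>t. f t + g t) \<in> bumps"

lemma bumps_derivative: "f \<in> bumps \<Longrightarrow> \<exists>g\<in>bumps. \<forall>t. (f has_real_derivative g t) (at t)"
proof (induction rule: bumps.induct)
  case (flat k)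
  let ?g = "\<lambda>t. (- 2 * pi) * (sin (2 * pi * t) * (flat (k + 2) (cos (2 * pi * t)) + (- real k) * flat (k + 1) (cos (2 * pi * t))))"
  show ?case
  proof (intro bexI[of _ ?g] allI)
    show "?g \<in> bumps" by (intro bumps.intros)
    fix t
    have "((\<lambda>t. cos (2 * pi * t)) has_real_derivative - sin (2 * pi * t) * (2 * pi)) (at t)"
      by (auto intro!: derivative_eq_intros)
    from DERIV_chain2[OF flat_has_derivative this]
    show "((\<lambda>t. flat k (cos (2 * pi * t))) has_real_derivative ?g t) (at t)"
      by (rule DERIV_cong) (simp add: algebra_simps)
  qed
next
  case (sin f)
  then obtain g where g: "g \<in> bumps" "\<And>t. (f has_real_derivative g t) (at t)" by blast
  let ?g = "\<lambda>t. (2 * pi) * (cos (2 * pi * t) * f t) + sin (2 * pi * t) * g t"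
  show ?case
  proof (intro bexI[of _ ?g] allI)
    show "?g \<in> bumps" by (intro bumps.intros sin g)
    show "((\<lambda>t. sin (2 * pi * t) * f t) has_real_derivative ?g t) (at t)" for t
      by (auto intro!: derivative_eq_intros g)
  qed
next
  case (cos f)
  then obtain g where g: "g \<in> bumps" "\<And>t. (f has_real_derivative g t) (at t)" by blast
  let ?g = "\<lambda>t. (- 2 * pi) * (sin (2 * pi * t) * f t) + cos (2 * pi * t) * g t"
  show ?case
  proof (intro bexI[of _ ?g] allI)
    show "?g \<in> bumps" by (intro bumps.intros cos g)
    show "((\<lambda>t. cos (2 * pi * t) * f t) has_real_derivative ?g t) (at t)" for t
      by (auto intro!: derivative_eq_intros g)
  qed
next
  case (scale f c)
  then obtain g where g: "g \<in> bumps" "\<And>t. (f has_real_derivative g t) (at t)" by blast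
  then show ?case by (intro bexI[of _ "\<lambda>t. c * g t"] allI bumps.intros DERIV_cmult)
next
  case (add f1 f2)
  then obtain g1 g2 where g: "g1 \<in> bumps" "\<And>t. (f1 has_real_derivative g1 t) (at t)"
    "g2 \<in> bumps" "\<And>t. (f2 has_real_derivative g2 t) (at t)" by blast
  then show ?case by (intro bexI[of _ "\<lambda>t. g1 t + g2 t"] allI bumps.intros DERIV_add)
qed

lemma bumps_bounded: "f \<in> bumps \<Longrightarrow> \<exists>C. \<forall>t. \<bar>f t\<bar> \<le> C"
proof (induction rule: bumps.induct)
  case (flat k)
  then show ?case using flat_bound[of k] by (intro exI[of _ "fact k"]) auto
next
  case (sin f)
  then obtain C where C: "\<And>t. \<bar>f t\<bar> \<le> C" by blast
  have "\<bar>sin (2 * pi * t) * f t\<bar> \<le> 1 * C" for t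
    unfolding abs_mult by (intro mult_mono C) auto
  then show ?case by blast
next
  case (cos f)
  then obtain C where C: "\<And>t. \<bar>f t\<bar> \<le> C" by blast
  have "\<bar>cos (2 * pi * t) * f t\<bar> \<le> 1 * C" for t
    unfolding abs_mult by (intro mult_mono C) auto
  then show ?case by blast
next
  case (scale f c)
  then obtain C where C: "\<And>t. \<bar>f t\<bar> \<le> C" by blast
  have "\<bar>c * f t\<bar> \<le> \<bar>c\<bar> * C" for t
    unfolding abs_mult by (intro mult_left_mono C) auto
  then show ?case by blast
next
  case (add f g)
  then obtain C D where C: "\<And>t. \<bar>f t\<bar> \<le> C" "\<And>t. \<bar>g t\<bar> \<le> D" by blast
  have "\<bar>f t + g t\<bar> \<le> C + D" for t
    using C[of t] by linarith
  then show ?case by blast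
qed

lemma bumps_eq_zero: "f \<in> bumps \<Longrightarrow> cos (2 * pi * t) \<le> 0 \<Longrightarrow> f t = 0"
  by (induction rule: bumps.induct) (auto simp: flat_def)

lemma bumps_zero: "(\<lambda>t. 0) \<in> bumps"
  using bumps.scale[OF bumps.flat, of 0] by simp

text \<open>An arbitrary bump is allowed for each coordinate of each slot, since the family must
  contain the derivatives of the test symbol.\<close>

definition bump_symbol ::
  "((int ^ 'n) ^ 'm \<Rightarrow> real) \<Rightarrow> ('m \<times> 'n \<Rightarrow> real \<Rightarrow> real) \<Rightarrow> (real ^ 'n) \<times> ((real ^ 'n) ^ 'm) \<Rightarrow> complex" where
  "bump_symbol V f z = complex_of_real (V (block_cell (snd z)) * (\<Prod>p\<in>UNIV. f p (snd z $ fst p $ snd p)))"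

lemma block_cell_eqI:
  assumes "\<And>j i. \<bar>\<xi> $ j $ i - of_int (\<nu> $ j $ i)\<bar> < 1 / 2"
  shows "block_cell \<xi> = \<nu>"
proof -
  have "\<lfloor>\<xi> $ j $ i + 1 / 2\<rfloor> = \<nu> $ j $ i" for j i
    using assms[of j i] by linarith
  then show ?thesis by (simp add: block_cell_def cell_def vec_eq_iff)
qed

text \<open>The jumps of \<open>V (block_cell \<xi>)\<close> lie on the hyperplanes where a coordinate is a half-integer, and
  there some factor vanishes in a neighbourhood.\<close>

lemma bump_symbol_locally:
  fixes f :: "'m::finite \<times> 'n::finite \<Rightarrow> real \<Rightarrow> real" and \<xi>0 :: "(real ^ 'n) ^ 'm"
  assumes f: "\<And>p. f p \<in> bumps"
  obtains S where "open S" "\<xi>0 \<in> S"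
    "\<forall>\<xi>\<in>S. V (block_cell \<xi>) * (\<Prod>p\<in>UNIV. f p (\<xi> $ fst p $ snd p))
      = V (block_cell \<xi>0) * (\<Prod>p\<in>UNIV. f p (\<xi> $ fst p $ snd p))"
proof (cases "\<forall>p. cos (2 * pi * (\<xi>0 $ fst p $ snd p)) \<ge> 0")
  case False
  then obtain p where p: "cos (2 * pi * (\<xi>0 $ fst p $ snd p)) < 0" by (auto simp: not_le)
  show thesis
  proof (rule that)
    show "open {\<xi> :: (real ^ 'n) ^ 'm. cos (2 * pi * (\<xi> $ fst p $ snd p)) < 0}"
      by (intro open_Collect_less continuous_intros)
    show "\<xi>0 \<in> {\<xi>. cos (2 * pi * (\<xi> $ fst p $ snd p)) < 0}" using p by simp
    show "\<forall>\<xi>\<in>{\<xi>. cos (2 * pi * (\<xi> $ fst p $ snd p)) < 0}. V (block_cell \<xi>) * (\<Prod>p\<in>UNIV. f p (\<xi> $ fst p $ snd p))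
      = V (block_cell \<xi>0) * (\<Prod>p\<in>UNIV. f p (\<xi> $ fst p $ snd p))"
    proof
    fix \<xi> :: "(real ^ 'n) ^ 'm" assume "\<xi> \<in> {\<xi>. cos (2 * pi * (\<xi> $ fst p $ snd p)) < 0}"
    then have "f p (\<xi> $ fst p $ snd p) = 0" using bumps_eq_zero[OF f] by simp
    then have "(\<Prod>p\<in>UNIV. f p (\<xi> $ fst p $ snd p)) = 0"
      by (intro prod_zero bexI[of _ p]) auto
    then show "V (block_cell \<xi>) * (\<Prod>p\<in>UNIV. f p (\<xi> $ fst p $ snd p))
      = V (block_cell \<xi>0) * (\<Prod>p\<in>UNIV. f p (\<xi> $ fst p $ snd p))" by (simp only: mult_zero_right)
    qed
  qed
next
  case True
  define \<nu> where "\<nu> = block_cell \<xi>0"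
  have near: "\<bar>\<xi>0 $ j $ i - of_int (\<nu> $ j $ i)\<bar> < 1 / 2" for j i
  proof -
    define d where "d = \<xi>0 $ j $ i - of_int (\<nu> $ j $ i)"
    have d: "- 1/2 \<le> d" "d < 1/2"
      unfolding d_def \<nu>_def block_cell_def cell_def by (simp, linarith)+
    have "cos (2 * pi * (\<xi>0 $ j $ i)) = cos (2 * pi * d)"
    proof -
      have "2 * pi * (\<xi>0 $ j $ i) = 2 * pi * d + 2 * pi * of_int (\<nu> $ j $ i)"
        by (simp add: d_def algebra_simps)
      then show ?thesis by (simp only: cos_add cos_int_2pin sin_int_2pin mult_1_right mult_zero_right diff_zero)
    qed
    \<comment> \<open>The only boundary value in the half-open cell is d = -1/2, and there the
      cosine would be -1.\<close>
    then have "d \<noteq> - 1/2" using True[rule_format, of "(j, i)"] by auto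
    then show ?thesis using d unfolding d_def[symmetric] by linarith
  qed
  define S where "S = (\<Inter>p\<in>UNIV. {\<xi> :: (real ^ 'n) ^ 'm. \<bar>\<xi> $ fst p $ snd p - of_int (\<nu> $ fst p $ snd p)\<bar> < 1 / 2})"
  show thesis
  proof (rule that)
    show "open S" unfolding S_def
      by (intro open_INT ballI open_Collect_less continuous_intros) auto
    show "\<xi>0 \<in> S" using near by (auto simp: S_def)
    show "\<forall>\<xi>\<in>S. V (block_cell \<xi>) * (\<Prod>p\<in>UNIV. f p (\<xi> $ fst p $ snd p))
      = V (block_cell \<xi>0) * (\<Prod>p\<in>UNIV. f p (\<xi> $ fst p $ snd p))"
    proof
    fix \<xi> assume "\<xi> \<in> S"
    then have "block_cell \<xi> = \<nu>" by (intro block_cell_eqI) (auto simp: S_def)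
    then show "V (block_cell \<xi>) * (\<Prod>p\<in>UNIV. f p (\<xi> $ fst p $ snd p))
      = V (block_cell \<xi>0) * (\<Prod>p\<in>UNIV. f p (\<xi> $ fst p $ snd p))" by (simp add: \<nu>_def)
    qed
  qed
qed

text \<open>\<open>bump_symbol_locally\<close> freezes the step function V at its value at the base
  point, so only the product of bumps is differentiated.\<close>

lemma bump_symbol_has_derivative:
  fixes f g :: "'m::finite \<times> 'n::finite \<Rightarrow> real \<Rightarrow> real"
  assumes f: "\<And>p. f p \<in> bumps" and g: "\<And>p t. (f p has_real_derivative g p t) (at t)"
  shows "(bump_symbol V f has_derivative (\<lambda>h. complex_of_real (V (block_cell (snd z)) *
      (\<Sum>p\<in>UNIV. (snd h $ fst p $ snd p * g p (snd z $ fst p $ snd p)) *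
        (\<Prod>q\<in>UNIV - {p}. f q (snd z $ fst q $ snd q)))))) (at z)"
proof -
  obtain S where S: "open S" "snd z \<in> S" and eq:
    "\<forall>\<xi>\<in>S. V (block_cell \<xi>) * (\<Prod>p\<in>UNIV. f p (\<xi> $ fst p $ snd p))
      = V (block_cell (snd z)) * (\<Prod>p\<in>UNIV. f p (\<xi> $ fst p $ snd p))"
    by (rule bump_symbol_locally[OF f, of "snd z" V], rule that)
  have lin: "((\<lambda>z :: (real ^ 'n) \<times> ((real ^ 'n) ^ 'm). snd z $ fst p $ snd p) has_derivative (\<lambda>h. snd h $ fst p $ snd p)) (at z)" for p
    by (intro bounded_linear.has_derivative[OF bounded_linear_vec_nth] has_derivative_snd has_derivative_ident)
  have "((\<lambda>z. \<Prod>p\<in>UNIV. f p (snd z $ fst p $ snd p)) has_derivative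
      (\<lambda>h. \<Sum>p\<in>UNIV. (snd h $ fst p $ snd p * g p (snd z $ fst p $ snd p)) * (\<Prod>q\<in>UNIV - {p}. f q (snd z $ fst q $ snd q)))) (at z)"
    by (rule has_derivative_prod) (rule DERIV_compose_FDERIV[OF g lin])
  then have "((\<lambda>w. complex_of_real (V (block_cell (snd z)) * (\<Prod>p\<in>UNIV. f p (snd w $ fst p $ snd p)))) has_derivative
      (\<lambda>h. complex_of_real (V (block_cell (snd z)) * (\<Sum>p\<in>UNIV. (snd h $ fst p $ snd p * g p (snd z $ fst p $ snd p)) *
        (\<Prod>q\<in>UNIV - {p}. f q (snd z $ fst q $ snd q)))))) (at z)"
    by (intro bounded_linear.has_derivative[OF bounded_linear_of_real] bounded_linear.has_derivative[OF bounded_linear_mult_right])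
  then show ?thesis
  proof (rule has_derivative_transform_within_open)
    show "open (snd -` S :: ((real ^ 'n) \<times> ((real ^ 'n) ^ 'm)) set)" using S(1) by (rule open_vimage_snd)
    show "z \<in> snd -` S" using S(2) by simp
    show "complex_of_real (V (block_cell (snd z)) * (\<Prod>p\<in>UNIV. f p (snd w $ fst p $ snd p))) = bump_symbol V f w"
      if "w \<in> snd -` S" for w
    proof -
      have "snd w \<in> S" using that by simp
      from bspec[OF eq this] show ?thesis unfolding bump_symbol_def by (simp only:)
    qed
  qed
qed

text \<open>A \<xi>-derivative replaces one bump by its derivative, and an x-derivative is the bump
  symbol with all bumps zero, so the family is stable under \<open>partial\<close>. Each member is
  bounded by V times the product of bounds for its bumps.\<close>

lemma bump_symbol_in_class:
  fixes V :: "(int ^ 'n) ^ 'm \<Rightarrow> real"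
  assumes V: "\<And>\<nu>. 0 \<le> V \<nu>" and f: "\<And>p. f p \<in> bumps"
  shows "bump_symbol V f \<in> symbol_class (extend_weight V)"
proof -
  let ?C = "{bump_symbol V f |f. \<forall>p. f p \<in> bumps}"
  have "bump_symbol V f \<in> bounded_symbols (\<lambda>\<xi>. V (block_cell \<xi>))"
  proof (rule derivs_in_coinduct)
    show "bump_symbol V f \<in> ?C" using f by auto
    show "?C \<subseteq> dominated (\<lambda>(x, \<xi>). V (block_cell \<xi>))"
    proof clarify
      fix f :: "'m \<times> 'n \<Rightarrow> real \<Rightarrow> real" assume f: "\<forall>p. f p \<in> bumps"
      have "\<forall>p. \<exists>C. \<forall>t. \<bar>f p t\<bar> \<le> C" using f bumps_bounded by blast
      then obtain C where C: "\<And>p t. \<bar>f p t\<bar> \<le> C p" by metis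
      have "norm (bump_symbol V f z) \<le> (\<Prod>p\<in>UNIV. C p) * V (block_cell (snd z))" for z
      proof -
        have "\<bar>\<Prod>p\<in>UNIV. f p (snd z $ fst p $ snd p)\<bar> \<le> (\<Prod>p\<in>UNIV. C p)"
          unfolding abs_prod by (intro prod_mono conjI C) auto
        then show ?thesis
          unfolding bump_symbol_def norm_of_real abs_mult abs_of_nonneg[OF V]
          by (subst mult.commute) (rule mult_right_mono[OF _ V])
      qed
      then show "bump_symbol V f \<in> dominated (\<lambda>(x, \<xi>). V (block_cell \<xi>))"
        unfolding dominated_def by (intro CollectI exI[of _ "\<Prod>p\<in>UNIV. C p"]) (simp add: case_prod_unfold)
    qed
    fix F :: "(real ^ 'n) \<times> ((real ^ 'n) ^ 'm) \<Rightarrow> complex" and z b :: "(real ^ 'n) \<times> ((real ^ 'n) ^ 'm)"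
    assume "F \<in> ?C"
    then obtain f where F: "F = bump_symbol V f" and f: "\<And>p. f p \<in> bumps" by auto
    have "\<forall>p. \<exists>g\<in>bumps. \<forall>t. (f p has_real_derivative g t) (at t)" using f bumps_derivative by blast
    then obtain g where g: "\<And>p. g p \<in> bumps" "\<And>p t. (f p has_real_derivative g p t) (at t)" by metis
    note d = bump_symbol_has_derivative[where f=f and g=g and V=V, OF f g(2)]
    show "F differentiable (at z)" unfolding F differentiable_def by (intro exI) (rule d)
    assume "b \<in> Basis"
    then consider i where "b = (axis i 1, 0)" | j i where "b = (0, axis j (axis i 1))"
      by (auto simp: Basis_prod_def Basis_vec_def)
    then show "partial b F \<in> ?C"
    proof cases
      case 1
      have "partial b F = bump_symbol V (\<lambda>p t. 0)"
        unfolding F fun_eq_iff partial_eq_derivative[OF d] by (simp add: 1 bump_symbol_def)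
      then show ?thesis using bumps_zero by auto
    next
      case 2
      let ?f = "f((j, i) := g (j, i))"
      have "partial b F z = bump_symbol V ?f z" for z
      proof -
        have "(\<Sum>p\<in>UNIV. (snd b $ fst p $ snd p * g p (snd z $ fst p $ snd p)) * (\<Prod>q\<in>UNIV - {p}. f q (snd z $ fst q $ snd q)))
          = (\<Sum>p\<in>UNIV. if p = (j, i) then g p (snd z $ fst p $ snd p) * (\<Prod>q\<in>UNIV - {p}. f q (snd z $ fst q $ snd q)) else 0)"
          by (intro sum.cong refl) (auto simp: 2 axis_def)
        also have "\<dots> = g (j, i) (snd z $ j $ i) * (\<Prod>q\<in>UNIV - {(j, i)}. f q (snd z $ fst q $ snd q))"
          by simp
        also have "\<dots> = (\<Prod>p\<in>UNIV. ?f p (snd z $ fst p $ snd p))"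
          by (subst prod.remove[of UNIV "(j, i)"]) (auto intro!: prod.cong)
        finally show ?thesis unfolding F partial_eq_derivative[OF d] bump_symbol_def by (simp only:)
      qed
      then have "partial b F = bump_symbol V ?f" by blast
      moreover have "\<forall>p. ?f p \<in> bumps" using f g by simp
      ultimately show ?thesis by blast
    qed
  qed
  then show ?thesis by (simp add: symbol_class_eq extend_weight_eq)
qed

section \<open>Wave packets\<close>

lemma slow_add:
  assumes "f \<in> slow" "g \<in> slow"
  shows "(\<lambda>x. f x + g x) \<in> slow"
proof -
  obtain k C where C: "\<And>x. norm (f x) \<le> C * (1 + norm x) ^ k" using assms(1) by (auto simp: slow_def)
  obtain l D where D: "\<And>x. norm (g x) \<le> D * (1 + norm x) ^ l" using assms(2) by (auto simp: slow_def)
  have "norm (f x + g x) \<le> (\<bar>C\<bar> + \<bar>D\<bar>) * (1 + norm x) ^ (k + l)" for x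
  proof -
    have "norm (f x) \<le> \<bar>C\<bar> * (1 + norm x) ^ (k + l)"
      by (rule order.trans[OF C mult_mono]) (auto intro: power_increasing)
    moreover have "norm (g x) \<le> \<bar>D\<bar> * (1 + norm x) ^ (k + l)"
      by (rule order.trans[OF D mult_mono]) (auto intro: power_increasing)
    ultimately show ?thesis
      by (intro order.trans[OF norm_triangle_ineq]) (simp add: distrib_right)
  qed
  then show ?thesis unfolding slow_def by blast
qed

lemma slow_mult:
  assumes "f \<in> slow" "g \<in> slow"
  shows "(\<lambda>x. f x * g x) \<in> slow"
proof -
  obtain k C where C: "\<And>x. norm (f x) \<le> C * (1 + norm x) ^ k" using assms(1) by (auto simp: slow_def)
  obtain l D where D: "\<And>x. norm (g x) \<le> D * (1 + norm x) ^ l" using assms(2) by (auto simp: slow_def)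
  have "norm (f x * g x) \<le> (C * D) * (1 + norm x) ^ (k + l)" for x
    unfolding norm_mult
    by (rule order.trans[OF mult_mono[OF C D order.trans[OF norm_ge_zero C]]]) (auto simp: power_add)
  then show ?thesis unfolding slow_def by blast
qed

definition wave_packet :: "real ^ 'n \<Rightarrow> real ^ 'n \<Rightarrow> complex" where
  "wave_packet k y = exp (\<i> * of_real (y \<bullet> k)) * of_real (gauss 1 y)"

lemma norm_wave_packet: "norm (wave_packet k y) = gauss 1 y"
  by (simp add: wave_packet_def norm_mult gauss_pos less_imp_le)

lemma gauss_rapid_bound: "(1 + norm y) ^ k * gauss 1 y \<le> fact k * exp (3 / 2)"
proof -
  have "(1 + norm y) ^ k * gauss 1 y \<le> (fact k * exp (1 + norm y)) * gauss 1 y"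
    by (intro mult_right_mono power_le_fact_exp) (auto simp: gauss_pos less_imp_le)
  also have "\<dots> = fact k * exp (1 + norm y - (norm y)\<^sup>2 / 2)"
    by (simp add: gauss_def exp_add[symmetric])
  also have "1 + norm y - (norm y)\<^sup>2 / 2 \<le> 3 / 2"
    using zero_le_power2[of "norm y - 1"] by (simp add: power2_diff)
  finally show ?thesis by simp
qed

text \<open>A derivative of the packet is the packet times an affine function, so its products with
  members of \<open>derivs_in slow\<close> form a stable family.\<close>

lemma wave_packet_schwartz: "wave_packet (k :: real ^ 'n) \<in> derivs_in rapid"
proof -
  let ?C = "{\<lambda>y. P y * wave_packet k y |P. P \<in> derivs_in slow}"
  have E: "wave_packet k y = exp (\<i> * of_real (y \<bullet> k) - of_real (y \<bullet> y) / 2)" for y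
    unfolding wave_packet_def gauss_def exp_of_real[symmetric] exp_add[symmetric]
    by (simp add: power2_norm_eq_inner)
  have dE: "(wave_packet k has_derivative (\<lambda>h. (\<i> * of_real (h \<bullet> k) - of_real (y \<bullet> h)) * wave_packet k y)) (at y)" for y
  proof -
    have "((\<lambda>y. \<i> * complex_of_real (y \<bullet> k) - of_real (y \<bullet> y) / 2) has_derivative (\<lambda>h. \<i> * of_real (h \<bullet> k) - of_real (y \<bullet> h))) (at y)"
      by (auto intro!: derivative_eq_intros simp: inner_commute)
    from has_derivative_compose[OF this DERIV_exp[unfolded has_field_derivative_def]]
    show ?thesis unfolding E[abs_def] by (simp add: mult.commute)
  qed
  have rap: "wave_packet k \<in> rapid"
    unfolding rapid_def
  proof (intro CollectI allI)
    fix l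
    show "\<exists>C. \<forall>x. (1 + norm x) ^ l * norm (wave_packet k x) \<le> C"
      unfolding norm_wave_packet by (intro exI[of _ "fact l * exp (3 / 2)"] allI gauss_rapid_bound)
  qed
  have "wave_packet k \<in> ?C" using const_slow[of 1] by (intro CollectI exI[of _ "\<lambda>_. 1"]) auto
  then show ?thesis
  proof (rule derivs_in_coinduct)
    show "?C \<subseteq> rapid" using slow_mult_rapid[OF derivs_inD(2) rap] by blast
    fix F :: "real ^ 'n \<Rightarrow> complex" and y b :: "real ^ 'n" assume "F \<in> ?C"
    then obtain P where P: "P \<in> derivs_in slow" and F: "F = (\<lambda>y. P y * wave_packet k y)" by blast
    have dif: "wave_packet k differentiable (at y)" for y using dE by (auto simp: differentiable_def)
    show "F differentiable (at y)" unfolding F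
      by (intro differentiable_mult derivs_inD(5)[OF P] dif)
    assume b: "b \<in> Basis"
    then obtain i where i: "b = axis i 1" by (auto simp: Basis_vec_def)
    let ?Q = "\<lambda>y. partial b P y + P y * (\<i> * of_real (b \<bullet> k) + (-1) * complex_of_real (y $ i))"
    have lin: "(\<lambda>y. \<i> * of_real (b \<bullet> k) + (-1) * complex_of_real (y $ i)) \<in> derivs_in slow"
      by (rule derivs_in_add[OF const_slow coordinate_slow slow_add])
    have "?Q \<in> derivs_in slow"
      by (rule derivs_in_add[OF derivs_inD(4)[OF P b] derivs_in_mult[OF P lin slow_add slow_mult] slow_add])
    moreover have "partial b F = (\<lambda>y. ?Q y * wave_packet k y)"
      unfolding F fun_eq_iff
    proof
      fix y
      show "partial b (\<lambda>y. P y * wave_packet k y) y = ?Q y * wave_packet k y"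
        unfolding partial_mult[OF derivs_inD(5)[OF P] dif] partial_eq_derivative[OF dE]
        by (simp add: i inner_axis algebra_simps)
    qed
    ultimately show "partial b F \<in> ?C" by (intro CollectI exI[of _ ?Q] conjI)
  qed
qed

lemma fourier_wave_packet: "fourier (wave_packet k) \<xi> = of_real (gauss_hat 1 (k - \<xi>))"
proof -
  have "fourier (wave_packet k) \<xi> = (\<integral>x. exp (\<i> * of_real (x \<bullet> (k - \<xi>))) * complex_of_real (gauss 1 x) \<partial>lborel)"
    unfolding fourier_def wave_packet_def mult.assoc[symmetric] exp_add[symmetric]
    by (intro Bochner_Integration.integral_cong refl) (simp add: inner_diff_right algebra_simps)
  then show ?thesis by (simp only: gauss_fourier(2)[OF zero_less_one])
qed

lemma gauss_ge:
  assumes "\<And>i. \<bar>x $ i\<bar> \<le> a"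
  shows "exp (- (a\<^sup>2 / 2)) ^ CARD('n) \<le> gauss 1 (x :: real ^ 'n)"
proof -
  have "(\<Prod>i::'n\<in>UNIV. exp (- (a\<^sup>2 / 2))) \<le> gauss 1 x"
    unfolding gauss_prod
  proof (intro prod_mono conjI)
    fix i
    have "(x $ i)\<^sup>2 \<le> a\<^sup>2" using assms[of i] by (metis abs_ge_zero power2_abs power_mono)
    then show "exp (- (a\<^sup>2 / 2)) \<le> exp (- (1 * (x $ i)\<^sup>2) / 2)" by simp
  qed simp
  then show ?thesis by simp
qed

text \<open>In each coordinate, v = (1 + x_i^2) / 2 satisfies v^k \<le> k! exp v, where exp v is
  exp(1/2) exp(x_i^2 / 2) and exp(1/2) \<le> 2.\<close>

lemma gauss_le_cauchy_weight:
  "gauss 1 (x :: real ^ 'n) \<le> (2 ^ (k + 1) * fact k) ^ CARD('n) * cauchy_weight x ^ k"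
proof -
  have "gauss 1 x \<le> (\<Prod>i\<in>UNIV. (2 ^ (k + 1) * fact k) * inverse (1 + (x $ i)\<^sup>2) ^ k)"
    unfolding gauss_prod
  proof (intro prod_mono conjI)
    fix i
    define v where "v = (1 + (x $ i)\<^sup>2) / 2"
    have v: "0 < v" by (simp add: v_def add_pos_nonneg)
    have e: "exp (1/2 :: real) \<le> 2" using exp_bound_half[of "1/2 :: real"] by simp
    have "v ^ k \<le> fact k * exp v" using v by (intro power_le_fact_exp) simp
    also have "exp v = exp (1/2) * exp ((x $ i)\<^sup>2 / 2)" by (simp add: v_def exp_add[symmetric] add_divide_distrib)
    also have "fact k * (exp (1/2) * exp ((x $ i)\<^sup>2 / 2)) \<le> fact k * (2 * exp ((x $ i)\<^sup>2 / 2))"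
      using e by (intro mult_left_mono mult_right_mono) auto
    finally have v1: "2 ^ k * v ^ k \<le> 2 ^ k * (fact k * (2 * exp ((x $ i)\<^sup>2 / 2)))" by (rule mult_left_mono) simp
    have "2 * v = 1 + (x $ i)\<^sup>2" by (simp add: v_def)
    then have v2: "2 ^ k * v ^ k = (1 + (x $ i)\<^sup>2) ^ k" by (metis power_mult_distrib)
    have "(1 + (x $ i)\<^sup>2) ^ k \<le> (2 ^ (k + 1) * fact k) * exp ((x $ i)\<^sup>2 / 2)"
      using v1 unfolding v2 by (simp add: mult_ac)
    moreover have "0 < (1 + (x $ i)\<^sup>2) ^ k" by (simp add: add_pos_nonneg)
    ultimately show "exp (- (1 * (x $ i)\<^sup>2) / 2) \<le> (2 ^ (k + 1) * fact k) * inverse (1 + (x $ i)\<^sup>2) ^ k"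
      by (simp add: exp_minus power_inverse field_simps)
  qed simp
  also have "\<dots> = (2 ^ (k + 1) * fact k) ^ CARD('n) * cauchy_weight x ^ k"
    by (simp add: prod.distrib cauchy_weight_def prod_power_distrib)
  finally show ?thesis .
qed

section \<open>Finite sums of wave packets\<close>

text \<open>In space this is concentrated at the origin, in frequency it is a sum of Gaussians
  centred at the points of S. For nonnegative A the transform is nonnegative, on which the lower
  bound for the operator relies.\<close>

definition packet_sum :: "(int ^ 'n) set \<Rightarrow> (int ^ 'n \<Rightarrow> real) \<Rightarrow> real ^ 'n \<Rightarrow> complex" where
  "packet_sum S A y = (\<Sum>\<kappa>\<in>S. of_real (A \<kappa>) * wave_packet (lattice_pt \<kappa>) y)"

lemma packet_sum_schwartz:
  assumes "finite S"
  shows "packet_sum S A \<in> derivs_in rapid"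
    and "fourier (packet_sum S A) \<xi> = of_real (\<Sum>\<kappa>\<in>S. A \<kappa> * gauss_hat 1 (lattice_pt \<kappa> - \<xi>))"
proof -
  have "packet_sum S A \<in> derivs_in rapid \<and>
    fourier (packet_sum S A) \<xi> = of_real (\<Sum>\<kappa>\<in>S. A \<kappa> * gauss_hat 1 (lattice_pt \<kappa> - \<xi>))"
    using assms
  proof induction
    case empty
    have "packet_sum {} A = (\<lambda>y. 0 * wave_packet 0 y)" by (simp add: packet_sum_def[abs_def])
    then show ?case using derivs_in_cmult_slow[OF wave_packet_schwartz, of 0 0] by (simp add: fourier_def)
  next
    case (insert \<kappa> S)
    have eq: "packet_sum (insert \<kappa> S) A = (\<lambda>y. of_real (A \<kappa>) * wave_packet (lattice_pt \<kappa>) y + packet_sum S A y)"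
      using insert.hyps by (simp add: packet_sum_def[abs_def])
    have w: "(\<lambda>y. of_real (A \<kappa>) * wave_packet (lattice_pt \<kappa>) y) \<in> derivs_in rapid"
      by (intro derivs_in_cmult_slow wave_packet_schwartz)
    show ?case
      unfolding eq
    proof
      show "(\<lambda>y. of_real (A \<kappa>) * wave_packet (lattice_pt \<kappa>) y + packet_sum S A y) \<in> derivs_in rapid"
        using w insert.IH by (intro schwartz_add) auto
      show "fourier (\<lambda>y. of_real (A \<kappa>) * wave_packet (lattice_pt \<kappa>) y + packet_sum S A y) \<xi>
        = of_real (\<Sum>\<kappa>\<in>insert \<kappa> S. A \<kappa> * gauss_hat 1 (lattice_pt \<kappa> - \<xi>))"
        using insert by (subst fourier_add) (auto intro!: schwartz_integrable w simp: fourier_cmult fourier_wave_packet)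
    qed
  qed
  then show "packet_sum S A \<in> derivs_in rapid"
    and "fourier (packet_sum S A) \<xi> = of_real (\<Sum>\<kappa>\<in>S. A \<kappa> * gauss_hat 1 (lattice_pt \<kappa> - \<xi>))" by auto
qed

text \<open>Almost orthogonality: \<open>gauss_quadratic\<close> on the counting measure of S gives
  a quadratic form whose matrix is \<open>gauss_hat 1\<close> at \<kappa> - \<kappa>', and \<bar>A
  \<kappa>\<bar> \<bar>A \<kappa>'\<bar> \<le> (A \<kappa>)^2 + (A \<kappa>')^2 bounds it by row and
  column sums. The centre t only multiplies the coefficients by phases.\<close>

lemma lattice_exponential_L2:
  obtains C :: real where "0 \<le> C"
    "\<And>(S :: (int ^ 'n) set) A t. finite S \<Longrightarrow>
      (\<integral>\<^sup>+y. ennreal (gauss 1 (y - t) * (norm (\<Sum>\<kappa>\<in>S. of_real (A \<kappa>) * exp (\<i> * of_real (y \<bullet> lattice_pt \<kappa>))))\<^sup>2) \<partial>lborel)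
        \<le> ennreal (C * (\<Sum>\<kappa>\<in>S. (A \<kappa>)\<^sup>2))"
proof -
  obtain s :: real where s: "1 \<le> s"
    "\<And>t :: int ^ 'n. (\<integral>\<^sup>+\<mu>. ennreal (cauchy_weight (lattice_pt (t - \<mu>))) \<partial>count_space UNIV) \<le> ennreal s"
    "\<And>\<mu> :: int ^ 'n. (\<integral>\<^sup>+t. ennreal (cauchy_weight (lattice_pt (t - \<mu>))) \<partial>count_space UNIV) \<le> ennreal s"
    using cauchy_weight_lattice_sum by blast
  define c where "c = sqrt (2 * pi) ^ CARD('n) * 4 ^ CARD('n)"
  have c: "0 \<le> c" by (simp add: c_def)
  have K: "gauss_hat 1 x \<le> c * cauchy_weight x" for x :: "real ^ 'n"
    using mult_left_mono[OF gauss_le_cauchy_weight[of x 1], of "sqrt (2 * pi) ^ CARD('n)"]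
    by (simp add: gauss_hat_def c_def mult.assoc)
  show thesis
  proof (rule that[of "2 * (c * s)"])
    show "0 \<le> 2 * (c * s)" using c s by simp
    fix S :: "(int ^ 'n) set" and A :: "int ^ 'n \<Rightarrow> real" and t :: "real ^ 'n"
    assume S: "finite S"
    let ?M = "count_space S"
    let ?P = "\<lambda>y. \<Sum>\<kappa>\<in>S. of_real (A \<kappa>) * exp (\<i> * of_real (y \<bullet> lattice_pt \<kappa>))"
    define G where "G \<kappa> = of_real (A \<kappa>) * exp (\<i> * of_real (t \<bullet> lattice_pt \<kappa>))" for \<kappa>
    have M: "sigma_finite_measure ?M" using S by (intro sigma_finite_measure_count_space_countable countable_finite)
    interpret M: sigma_finite_measure ?M by fact
    have G: "integrable ?M G" using S by (simp add: integrable_count_space)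
    have sm: "lattice_pt \<in> borel_measurable ?M" by simp
    define H where "H = (\<lambda>z. G (fst z) * cnj (G (snd z)) * of_real (gauss_hat 1 (lattice_pt (fst z) - lattice_pt (snd z) :: real ^ 'n)))"
    have intH: "integrable (?M \<Otimes>\<^sub>M ?M) H"
      unfolding H_def by (rule gauss_quadratic(1)[OF M G sm]) simp
    have [measurable]: "H \<in> borel_measurable (?M \<Otimes>\<^sub>M ?M)" using intH by auto
    have "fourier_ext ?M lattice_pt G y = ?P (y + t)" for y
      unfolding fourier_ext_def lebesgue_integral_count_space_finite[OF S] G_def
      by (intro sum.cong refl) (simp add: inner_add_left exp_add algebra_simps)
    then have "(\<integral>\<^sup>+y. ennreal (gauss 1 (y - t) * (norm (?P y))\<^sup>2) \<partial>lborel)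
      = (\<integral>\<^sup>+y. ennreal (gauss 1 y * (norm (fourier_ext ?M lattice_pt G y))\<^sup>2) \<partial>lborel)"
      by (subst nn_integral_lborel_shift[symmetric, of _ t]) auto
    also have "\<dots> = ennreal (Re (\<integral>z. H z \<partial>(?M \<Otimes>\<^sub>M ?M)))"
      unfolding H_def by (rule gauss_quadratic(2)[OF M G sm]) simp
    also have "\<dots> \<le> ennreal (norm (\<integral>z. H z \<partial>(?M \<Otimes>\<^sub>M ?M)))"
      by (intro ennreal_leI complex_Re_le_cmod)
    also have "\<dots> \<le> (\<integral>\<^sup>+z. ennreal (norm (H z)) \<partial>(?M \<Otimes>\<^sub>M ?M))"
      by (rule integral_norm_bound_ennreal[OF intH])
    also have "\<dots> = (\<integral>\<^sup>+\<kappa>. (\<integral>\<^sup>+\<kappa>'. ennreal (norm (H (\<kappa>, \<kappa>'))) \<partial>?M) \<partial>?M)"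
      by (rule M.nn_integral_fst[symmetric]) measurable
    also have "\<dots> = (\<Sum>\<kappa>\<in>S. \<Sum>\<kappa>'\<in>S. ennreal (norm (H (\<kappa>, \<kappa>'))))"
      using S by (simp add: nn_integral_count_space_finite)
    also have "\<dots> \<le> (\<Sum>\<kappa>\<in>S. \<Sum>\<kappa>'\<in>S. ennreal (c * (A \<kappa>)\<^sup>2) * ennreal (cauchy_weight (lattice_pt (\<kappa> - \<kappa>')))
        + ennreal (c * (A \<kappa>')\<^sup>2) * ennreal (cauchy_weight (lattice_pt (\<kappa> - \<kappa>'))))"
    proof (intro sum_mono)
      fix \<kappa> \<kappa>' :: "int ^ 'n"
      let ?w = "cauchy_weight (lattice_pt (\<kappa> - \<kappa>'))"
      have "norm (H (\<kappa>, \<kappa>')) = \<bar>A \<kappa>\<bar> * \<bar>A \<kappa>'\<bar> * gauss_hat 1 (lattice_pt (\<kappa> - \<kappa>'))"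
        using gauss_hat_nonneg[of 1 "lattice_pt (\<kappa> - \<kappa>')"]
        by (simp add: H_def G_def norm_mult lattice_pt_diff)
      also have "\<dots> \<le> ((A \<kappa>)\<^sup>2 + (A \<kappa>')\<^sup>2) * (c * ?w)"
      proof (intro mult_mono K gauss_hat_nonneg)
        have "2 * (\<bar>A \<kappa>\<bar> * \<bar>A \<kappa>'\<bar>) \<le> (A \<kappa>)\<^sup>2 + (A \<kappa>')\<^sup>2"
          using zero_le_power2[of "\<bar>A \<kappa>\<bar> - \<bar>A \<kappa>'\<bar>"] by (simp add: power2_diff)
        moreover have "0 \<le> \<bar>A \<kappa>\<bar> * \<bar>A \<kappa>'\<bar>" by simp
        ultimately show "\<bar>A \<kappa>\<bar> * \<bar>A \<kappa>'\<bar> \<le> (A \<kappa>)\<^sup>2 + (A \<kappa>')\<^sup>2" by linarith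
      qed auto
      also have "\<dots> = c * (A \<kappa>)\<^sup>2 * ?w + c * (A \<kappa>')\<^sup>2 * ?w" by (simp add: algebra_simps)
      finally have "ennreal (norm (H (\<kappa>, \<kappa>'))) \<le> ennreal (c * (A \<kappa>)\<^sup>2 * ?w + c * (A \<kappa>')\<^sup>2 * ?w)" by (rule ennreal_leI)
      also have "\<dots> = ennreal (c * (A \<kappa>)\<^sup>2) * ennreal ?w + ennreal (c * (A \<kappa>')\<^sup>2) * ennreal ?w"
        using c cauchy_weight_pos[of "lattice_pt (\<kappa> - \<kappa>')"] by (subst ennreal_plus) (auto simp: ennreal_mult less_imp_le)
      finally show "ennreal (norm (H (\<kappa>, \<kappa>'))) \<le> ennreal (c * (A \<kappa>)\<^sup>2) * ennreal ?w + ennreal (c * (A \<kappa>')\<^sup>2) * ennreal ?w" .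
    qed
    also have "\<dots> = (\<Sum>\<kappa>\<in>S. ennreal (c * (A \<kappa>)\<^sup>2) * (\<Sum>\<kappa>'\<in>S. ennreal (cauchy_weight (lattice_pt (\<kappa> - \<kappa>')))))
      + (\<Sum>\<kappa>'\<in>S. ennreal (c * (A \<kappa>')\<^sup>2) * (\<Sum>\<kappa>\<in>S. ennreal (cauchy_weight (lattice_pt (\<kappa> - \<kappa>')))))"
      unfolding sum.distrib sum_distrib_left
      by (subst (2) sum.swap) simp
    also have "\<dots> \<le> (\<Sum>\<kappa>\<in>S. ennreal (c * (A \<kappa>)\<^sup>2) * ennreal s) + (\<Sum>\<kappa>'\<in>S. ennreal (c * (A \<kappa>')\<^sup>2) * ennreal s)"
    proof (intro add_mono sum_mono mult_left_mono)
      have le: "(\<Sum>\<kappa>\<in>S. g \<kappa>) \<le> (\<integral>\<^sup>+\<kappa>. g \<kappa> \<partial>count_space UNIV)" for g :: "int ^ 'n \<Rightarrow> ennreal"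
      proof -
        have "(\<Sum>\<kappa>\<in>S. g \<kappa>) = (\<integral>\<^sup>+\<kappa>. g \<kappa> * indicator S \<kappa> \<partial>count_space UNIV)"
          using S by (subst nn_integral_count_space_indicator[symmetric]) (auto simp: nn_integral_count_space_finite)
        also have "\<dots> \<le> (\<integral>\<^sup>+\<kappa>. g \<kappa> \<partial>count_space UNIV)"
          by (intro nn_integral_mono) (auto simp: indicator_def)
        finally show ?thesis .
      qed
      show "(\<Sum>\<kappa>'\<in>S. ennreal (cauchy_weight (lattice_pt (\<kappa> - \<kappa>')))) \<le> ennreal s" for \<kappa>
        by (rule order.trans[OF le s(2)])
      show "(\<Sum>\<kappa>\<in>S. ennreal (cauchy_weight (lattice_pt (\<kappa> - \<kappa>')))) \<le> ennreal s" for \<kappa>'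
        by (rule order.trans[OF le s(3)])
    qed auto
    also have "(\<Sum>\<kappa>\<in>S. ennreal (c * (A \<kappa>)\<^sup>2) * ennreal s) = ennreal (c * s * (\<Sum>\<kappa>\<in>S. (A \<kappa>)\<^sup>2))"
    proof -
      have "(\<Sum>\<kappa>\<in>S. ennreal (c * (A \<kappa>)\<^sup>2) * ennreal s) = (\<Sum>\<kappa>\<in>S. ennreal (c * s * (A \<kappa>)\<^sup>2))"
        using c s by (intro sum.cong refl) (simp add: ennreal_mult[symmetric] mult_ac)
      then show ?thesis using c s by (simp add: sum_ennreal sum_distrib_left)
    qed
    also have "ennreal (c * s * (\<Sum>\<kappa>\<in>S. (A \<kappa>)\<^sup>2)) + ennreal (c * s * (\<Sum>\<kappa>\<in>S. (A \<kappa>)\<^sup>2)) = ennreal (2 * (c * s) * (\<Sum>\<kappa>\<in>S. (A \<kappa>)\<^sup>2))"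
      using c s by (subst ennreal_plus[symmetric]) (auto simp: sum_nonneg)
    finally show "(\<integral>\<^sup>+y. ennreal (gauss 1 (y - t) * (norm (?P y))\<^sup>2) \<partial>lborel) \<le> ennreal (2 * (c * s) * (\<Sum>\<kappa>\<in>S. (A \<kappa>)\<^sup>2))" .
  qed
qed

text \<open>On the cell of \<tau> the sum is a trigonometric sum times a Gaussian dominated by the
  k-th power of the weight at \<tau>, while a Gaussian centred at \<tau> is bounded below there.
  Inserting the latter reduces the estimate to \<open>lattice_exponential_L2\<close>.\<close>

lemma packet_sum_local_norm:
  fixes k :: nat
  obtains D :: real where "0 \<le> D"
    "\<And>(S :: (int ^ 'n) set) A \<tau>. finite S \<Longrightarrow>
      Lp_norm (restrict_space lebesgue unit_cube) 2 (\<lambda>x. ennreal (norm (packet_sum S A (x + lattice_pt \<tau>))))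
        \<le> ennreal (D * sqrt (\<Sum>\<kappa>\<in>S. (A \<kappa>)\<^sup>2) * cauchy_weight (lattice_pt \<tau>) ^ k)"
proof -
  obtain C :: real where C: "0 \<le> C" and ex:
    "\<And>(S :: (int ^ 'n) set) A t. finite S \<Longrightarrow>
      (\<integral>\<^sup>+y. ennreal (gauss 1 (y - t) * (norm (\<Sum>\<kappa>\<in>S. of_real (A \<kappa>) * exp (\<i> * of_real (y \<bullet> lattice_pt \<kappa>))))\<^sup>2) \<partial>lborel)
        \<le> ennreal (C * (\<Sum>\<kappa>\<in>S. (A \<kappa>)\<^sup>2))"
    using lattice_exponential_L2[where 'n='n] by blast
  define g where "g = (2 ^ (k + 1) * fact k :: real) ^ CARD('n) * (4 ^ CARD('n)) ^ k"
  have g: "0 \<le> g" by (simp add: g_def)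
  \<comment> \<open>A lower bound of \<open>gauss 1\<close> on the unit cube, where all coordinates
    are at most 1/2 in modulus.\<close>
  define e where "e = exp (- ((1 / 2)\<^sup>2 / 2) :: real) ^ CARD('n)"
  have e: "0 < e" by (simp add: e_def)
  define D where "D = sqrt (g\<^sup>2 / e * C)"
  have D: "0 \<le> D" "D\<^sup>2 = g\<^sup>2 / e * C" using C e by (auto simp: D_def)
  show thesis
  proof (rule that[OF D(1)])
    fix S :: "(int ^ 'n) set" and A \<tau> assume S: "finite S"
    let ?P = "\<lambda>y. \<Sum>\<kappa>\<in>S. of_real (A \<kappa>) * exp (\<i> * of_real (y \<bullet> lattice_pt \<kappa>))"
    let ?w = "cauchy_weight (lattice_pt \<tau> :: real ^ 'n)"
    let ?a = "\<Sum>\<kappa>\<in>S. (A \<kappa>)\<^sup>2"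
    have w: "0 \<le> ?w" by (simp add: cauchy_weight_pos less_imp_le)
    have a: "0 \<le> ?a" by (intro sum_nonneg) simp
    have [measurable]: "packet_sum S A \<in> borel_measurable borel"
      by (intro smooth_measurable derivs_inD(1)[OF packet_sum_schwartz(1)[OF S]])
    have f: "packet_sum S A y = ?P y * of_real (gauss 1 y)" for y
      by (simp add: packet_sum_def wave_packet_def sum_distrib_right mult.assoc)
    have "(Lp_norm (restrict_space lebesgue unit_cube) 2 (\<lambda>x. ennreal (norm (packet_sum S A (x + lattice_pt \<tau>)))))\<^sup>2
      = (\<integral>\<^sup>+x. indicator unit_cube (x - lattice_pt \<tau>) * ennreal ((norm (packet_sum S A x))\<^sup>2) \<partial>lborel)"
      by (rule local_norm_power2) measurable
    also have "\<dots> \<le> (\<integral>\<^sup>+x. ennreal ((g * ?w ^ k)\<^sup>2 / e) * ennreal (gauss 1 (x - lattice_pt \<tau>) * (norm (?P x))\<^sup>2) \<partial>lborel)"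
    proof (intro nn_integral_mono)
      fix x :: "real ^ 'n"
      show "indicator unit_cube (x - lattice_pt \<tau>) * ennreal ((norm (packet_sum S A x))\<^sup>2)
        \<le> ennreal ((g * ?w ^ k)\<^sup>2 / e) * ennreal (gauss 1 (x - lattice_pt \<tau>) * (norm (?P x))\<^sup>2)"
      proof (cases "x - lattice_pt \<tau> \<in> unit_cube")
        case True
        have comp: "\<bar>(x - lattice_pt \<tau>) $ i\<bar> \<le> 1 / 2" for i using unit_cube_component[OF True] .
        have "cauchy_weight x \<le> 4 ^ CARD('n) * ?w" using comp by (intro cauchy_weight_le) simp
        then have "cauchy_weight x ^ k \<le> (4 ^ CARD('n)) ^ k * ?w ^ k"
          unfolding power_mult_distrib[symmetric] by (intro power_mono) (auto simp: cauchy_weight_pos less_imp_le)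
        then have "(2 ^ (k + 1) * fact k) ^ CARD('n) * cauchy_weight x ^ k \<le> (2 ^ (k + 1) * fact k) ^ CARD('n) * ((4 ^ CARD('n)) ^ k * ?w ^ k)"
          by (intro mult_left_mono) auto
        from order.trans[OF gauss_le_cauchy_weight this] have gx: "gauss 1 x \<le> g * ?w ^ k"
          by (simp only: g_def mult.assoc)
        have e1: "1 \<le> gauss 1 (x - lattice_pt \<tau>) / e"
          using gauss_ge[OF comp] e by (simp add: e_def)
        have "(norm (packet_sum S A x))\<^sup>2 = (gauss 1 x)\<^sup>2 * (norm (?P x))\<^sup>2"
          unfolding f by (simp add: norm_mult power_mult_distrib)
        also have "\<dots> \<le> (g * ?w ^ k)\<^sup>2 * (norm (?P x))\<^sup>2"
          using gx by (intro mult_right_mono power_mono) (auto simp: gauss_pos less_imp_le)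
        also have "\<dots> \<le> ((g * ?w ^ k)\<^sup>2 * (norm (?P x))\<^sup>2) * (gauss 1 (x - lattice_pt \<tau>) / e)"
          using mult_left_mono[OF e1, of "(g * ?w ^ k)\<^sup>2 * (norm (?P x))\<^sup>2"] by simp
        also have "\<dots> = (g * ?w ^ k)\<^sup>2 / e * (gauss 1 (x - lattice_pt \<tau>) * (norm (?P x))\<^sup>2)" by simp
        finally show ?thesis using True e
          by (simp add: ennreal_mult[symmetric] gauss_pos less_imp_le ennreal_leI)
      qed simp
    qed
    also have "\<dots> = ennreal ((g * ?w ^ k)\<^sup>2 / e) * (\<integral>\<^sup>+x. ennreal (gauss 1 (x - lattice_pt \<tau>) * (norm (?P x))\<^sup>2) \<partial>lborel)"
      by (rule nn_integral_cmult) measurable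
    also have "\<dots> \<le> ennreal ((g * ?w ^ k)\<^sup>2 / e) * ennreal (C * ?a)"
      by (intro mult_left_mono ex S) simp
    also have "\<dots> = ennreal ((D * sqrt ?a * ?w ^ k)\<^sup>2)"
      using e C a by (subst ennreal_mult[symmetric]) (auto simp: power_mult_distrib D(2) mult_ac)
    also have "\<dots> = (ennreal (D * sqrt ?a * ?w ^ k))\<^sup>2"
      using D(1) a w by (simp add: ennreal_power)
    finally show "Lp_norm (restrict_space lebesgue unit_cube) 2 (\<lambda>x. ennreal (norm (packet_sum S A (x + lattice_pt \<tau>))))
        \<le> ennreal (D * sqrt ?a * ?w ^ k)" by (rule ennreal_power2_le_cancel)
  qed
qed

text \<open>The local norms decay like any prescribed power k of \<open>cauchy_weight\<close>, so
  for finite q with k q \<ge> 1 their q-th powers are summable; small q needs large k, and D depends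
  on q.\<close>

lemma packet_sum_amalgam_norm:
  assumes q: "0 < q"
  obtains D :: real where "0 \<le> D"
    "\<And>(S :: (int ^ 'n) set) A. finite S \<Longrightarrow> amalgam_norm 2 q (packet_sum S A) \<le> ennreal (D * sqrt (\<Sum>\<kappa>\<in>S. (A \<kappa>)\<^sup>2))"
proof -
  define p where "p = enn2real q"
  obtain k :: nat where k: "1 \<le> real k * p \<or> q = top"
  proof (cases "q = top")
    case False
    then have "0 < p" using q by (simp add: p_def enn2real_positive_iff less_top)
    then obtain k where "1 \<le> real k * p" using reals_Archimedean3[of p] less_imp_le by blast
    then show thesis using that by blast
  qed (use that in blast)
  obtain D :: real where D: "0 \<le> D" and loc:
    "\<And>(S :: (int ^ 'n) set) A \<tau>. finite S \<Longrightarrow>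
      Lp_norm (restrict_space lebesgue unit_cube) 2 (\<lambda>x. ennreal (norm (packet_sum S A (x + lattice_pt \<tau>))))
        \<le> ennreal (D * sqrt (\<Sum>\<kappa>\<in>S. (A \<kappa>)\<^sup>2) * cauchy_weight (lattice_pt \<tau>) ^ k)"
    using packet_sum_local_norm[where 'n='n and k=k] by blast
  obtain s :: real where s: "1 \<le> s"
    "\<And>t :: int ^ 'n. (\<integral>\<^sup>+\<mu>. ennreal (cauchy_weight (lattice_pt (t - \<mu>))) \<partial>count_space UNIV) \<le> ennreal s"
    "\<And>\<mu> :: int ^ 'n. (\<integral>\<^sup>+t. ennreal (cauchy_weight (lattice_pt (t - \<mu>))) \<partial>count_space UNIV) \<le> ennreal s"
    using cauchy_weight_lattice_sum by blast
  show thesis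
  proof (rule that[of "D * (if q = top then 1 else s powr (1 / p))"])
    show "0 \<le> D * (if q = top then 1 else s powr (1 / p))" using D by simp
    fix S :: "(int ^ 'n) set" and A assume S: "finite S"
    let ?a = "sqrt (\<Sum>\<kappa>\<in>S. (A \<kappa>)\<^sup>2)"
    have a: "0 \<le> ?a" by (simp add: sum_nonneg)
    let ?l = "\<lambda>\<tau>. Lp_norm (restrict_space lebesgue unit_cube) 2 (\<lambda>x. ennreal (norm (packet_sum S A (x + lattice_pt \<tau>))))"
    let ?w = "\<lambda>\<tau>. cauchy_weight (lattice_pt \<tau> :: real ^ 'n)"
    have w: "0 < ?w \<tau>" "?w \<tau> \<le> 1" for \<tau> by (auto simp: cauchy_weight_pos cauchy_weight_le_1)
    have am: "amalgam_norm 2 q (packet_sum S A) = Lp_norm (count_space UNIV) q ?l" by (simp add: amalgam_norm_def)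
    show "amalgam_norm 2 q (packet_sum S A) \<le> ennreal (D * (if q = top then 1 else s powr (1 / p)) * ?a)"
    proof (cases "q = top")
      case True
      have "?l \<tau> \<le> ennreal (D * ?a)" for \<tau>
      proof -
        have "D * ?a * ?w \<tau> ^ k \<le> D * ?a"
          using w[of \<tau>] D a by (intro mult_left_le power_le_one) auto
        then show ?thesis using loc[OF S, of A \<tau>] by (meson ennreal_leI order.trans)
      qed
      then have "esssup (count_space UNIV) ?l \<le> ennreal (D * ?a)"
        by (intro esssup_I) (auto simp: AE_count_space)
      then show ?thesis using True unfolding am Lp_norm_def[of "count_space UNIV" q] by simp
    next
      case False
      have p: "0 < p" using q False by (simp add: p_def enn2real_positive_iff less_top)
      have pw: "epowr (?l \<tau>) p \<le> ennreal ((D * ?a) powr p) * ennreal (?w (\<tau> - 0))" for \<tau>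
      proof -
        have "epowr (?l \<tau>) p \<le> epowr (ennreal (D * ?a * ?w \<tau> ^ k)) p"
          using p by (intro epowr_mono loc S) simp
        also have "\<dots> = ennreal ((D * ?a) powr p * ?w \<tau> powr (real k * p))"
          using D a w[of \<tau>] by (simp add: epowr_ennreal powr_mult powr_powr flip: powr_realpow)
        also have "\<dots> \<le> ennreal ((D * ?a) powr p * ?w \<tau> powr 1)"
          using k False w[of \<tau>] by (intro ennreal_leI mult_left_mono powr_mono') auto
        finally show ?thesis using w[of \<tau>] by (simp add: ennreal_mult)
      qed
      have "(\<integral>\<^sup>+\<tau>. epowr (?l \<tau>) p \<partial>count_space UNIV) \<le> (\<integral>\<^sup>+\<tau>. ennreal ((D * ?a) powr p) * ennreal (?w (\<tau> - 0)) \<partial>count_space UNIV)"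
        by (intro nn_integral_mono pw)
      also have "\<dots> = ennreal ((D * ?a) powr p) * (\<integral>\<^sup>+\<tau>. ennreal (?w (\<tau> - 0)) \<partial>count_space UNIV)"
        by (rule nn_integral_cmult) simp
      also have "\<dots> \<le> ennreal ((D * ?a) powr p) * ennreal s" by (intro mult_left_mono s(3)) simp
      also have "\<dots> = ennreal ((D * ?a) powr p * s)" using s(1) by (simp add: ennreal_mult)
      finally have "epowr (\<integral>\<^sup>+\<tau>. epowr (?l \<tau>) p \<partial>count_space UNIV) (1 / p) \<le> epowr (ennreal ((D * ?a) powr p * s)) (1 / p)"
        using p by (intro epowr_mono) auto
      also have "\<dots> = ennreal (D * ?a * s powr (1 / p))"
        using p D a s(1) by (simp add: epowr_ennreal powr_mult powr_powr)
      finally show ?thesis using False unfolding am Lp_norm_def[of "count_space UNIV" q] p_def by (simp add: mult_ac)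
    qed
  qed
qed

section \<open>Necessity of the condition\<close>

text \<open>Packet sums are finite, so only finite parts of the sum in \<open>B_class\<close> can be
  tested; monotone convergence along an enumeration recovers the whole sum.\<close>

lemma nn_integral_count_space_le_finite:
  fixes f :: "'t::countable \<Rightarrow> ennreal"
  assumes "\<And>N. finite N \<Longrightarrow> (\<Sum>t\<in>N. f t) \<le> X"
  shows "(\<integral>\<^sup>+t. f t \<partial>count_space UNIV) \<le> X"
proof -
  define N where "N k = {t :: 't. to_nat t < k}" for k :: nat
  have fin: "finite (N k)" for k
    unfolding N_def using finite_vimageI[of "{..<k}" "to_nat :: 't \<Rightarrow> nat"] by (simp add: vimage_def)
  have sup: "f t = (SUP k. f t * indicator (N k) t)" for t
  proof (rule antisym)
    have "f t = f t * indicator (N (Suc (to_nat t))) t" by (simp add: N_def)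
    also have "\<dots> \<le> (SUP k. f t * indicator (N k) t)" by (rule SUP_upper) simp
    finally show "f t \<le> (SUP k. f t * indicator (N k) t)" .
    show "(SUP k. f t * indicator (N k) t) \<le> f t" by (intro SUP_least) (auto simp: indicator_def)
  qed
  have "(\<integral>\<^sup>+t. f t \<partial>count_space UNIV) = (\<integral>\<^sup>+t. (SUP k. f t * indicator (N k) t) \<partial>count_space UNIV)"
    using sup by simp
  also have "\<dots> = (SUP k. \<integral>\<^sup>+t. f t * indicator (N k) t \<partial>count_space UNIV)"
    by (intro nn_integral_monotone_convergence_SUP) (auto simp: incseq_def le_fun_def N_def indicator_def)
  also have "\<dots> \<le> X"
  proof (rule SUP_least)
    fix k
    have "(\<integral>\<^sup>+t. f t * indicator (N k) t \<partial>count_space UNIV) = (\<Sum>t\<in>N k. f t)"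
      using fin by (subst nn_integral_count_space_indicator[symmetric]) (auto simp: nn_integral_count_space_finite)
    then show "(\<integral>\<^sup>+t. f t * indicator (N k) t \<partial>count_space UNIV) \<le> X" using assms[OF fin] by simp
  qed
  finally show ?thesis .
qed

lemma sum_fibre_squares:
  fixes h :: "'a \<Rightarrow> real" and s :: "'a \<Rightarrow> 'b"
  assumes "finite N"
  shows "(\<Sum>\<nu>\<in>N. \<Sum>\<nu>'\<in>N. if s \<nu> = s \<nu>' then h \<nu> * h \<nu>' else 0) = (\<Sum>\<mu>\<in>s ` N. (\<Sum>\<nu>\<in>{\<nu>\<in>N. s \<nu> = \<mu>}. h \<nu>)\<^sup>2)"
proof -
  have "(\<Sum>\<nu>\<in>N. \<Sum>\<nu>'\<in>N. if s \<nu> = s \<nu>' then h \<nu> * h \<nu>' else 0) = (\<Sum>\<nu>\<in>N. h \<nu> * (\<Sum>\<nu>'\<in>{\<nu>'\<in>N. s \<nu>' = s \<nu>}. h \<nu>'))"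
    using assms by (intro sum.cong refl) (auto simp: sum_distrib_left sum.inter_filter intro!: sum.cong)
  also have "\<dots> = (\<Sum>\<mu>\<in>s ` N. \<Sum>\<nu>\<in>{\<nu>\<in>N. s \<nu> = \<mu>}. h \<nu> * (\<Sum>\<nu>'\<in>{\<nu>'\<in>N. s \<nu>' = s \<nu>}. h \<nu>'))"
    by (rule sum.image_gen[OF assms])
  also have "\<dots> = (\<Sum>\<mu>\<in>s ` N. (\<Sum>\<nu>\<in>{\<nu>\<in>N. s \<nu> = \<mu>}. h \<nu>)\<^sup>2)"
    by (intro sum.cong refl) (auto simp: power2_eq_square sum_distrib_right)
  finally show ?thesis .
qed

text \<open>Grouping by the value of s and Cauchy-Schwarz remove the sequence a. What remains is the
  double sum over pairs with equal s, the part of the Gaussian quadratic form kept in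
  \<open>test_symbol_lower_bound\<close>.\<close>

lemma sum_duality:
  fixes h :: "'a \<Rightarrow> real" and s :: "'a \<Rightarrow> 'b" and a :: "'b \<Rightarrow> real"
  assumes "finite N"
  shows "(\<Sum>\<nu>\<in>N. h \<nu> * a (s \<nu>))\<^sup>2
    \<le> (\<Sum>\<mu>\<in>s ` N. (a \<mu>)\<^sup>2) * (\<Sum>\<nu>\<in>N. \<Sum>\<nu>'\<in>N. if s \<nu> = s \<nu>' then h \<nu> * h \<nu>' else 0)"
proof -
  have "(\<Sum>\<nu>\<in>N. h \<nu> * a (s \<nu>)) = (\<Sum>\<mu>\<in>s ` N. \<Sum>\<nu>\<in>{\<nu>\<in>N. s \<nu> = \<mu>}. h \<nu> * a (s \<nu>))"
    by (rule sum.image_gen[OF assms])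
  also have "\<dots> = (\<Sum>\<mu>\<in>s ` N. a \<mu> * (\<Sum>\<nu>\<in>{\<nu>\<in>N. s \<nu> = \<mu>}. h \<nu>))"
    by (intro sum.cong refl) (auto simp: sum_distrib_left mult.commute)
  finally show ?thesis
    unfolding sum_fibre_squares[OF assms] by (simp only: Cauchy_Schwarz_ineq_sum)
qed

text \<open>Side 1/4 keeps the translate by a lattice point inside its cell, and there the angles
  differ from multiples of 2 pi by at most pi/4 < pi/3, so the cosines in the test symbol are at
  least 1/2.\<close>

definition small_cube :: "((real ^ 'n) ^ 'm) set" where
  "small_cube = cbox (\<chi> j i. - 1 / 8) (\<chi> j i. 1 / 8)"

lemma small_cube_component: "\<theta> \<in> small_cube \<Longrightarrow> \<bar>\<theta> $ j $ i\<bar> \<le> 1 / 8"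
  unfolding small_cube_def mem_box
  by (drule bspec[of _ _ "axis j (axis i 1)"]) (auto simp: Basis_vec_def inner_axis)

lemma small_cube_measure:
  obtains v where "0 < v" "emeasure lborel (small_cube :: ((real ^ 'n) ^ 'm) set) = ennreal v"
proof
  have b: "b \<in> (Basis :: ((real ^ 'n) ^ 'm) set) \<Longrightarrow> ((\<chi> j i. 1 / 8) - (\<chi> j i. - 1 / 8) :: (real ^ 'n) ^ 'm) \<bullet> b = 1 / 4" for b
    by (auto simp: Basis_vec_def inner_axis)
  then have b': "b \<in> (Basis :: ((real ^ 'n) ^ 'm) set) \<Longrightarrow> ((\<chi> j i. - 1 / 8) :: (real ^ 'n) ^ 'm) \<bullet> b \<le> (\<chi> j i. 1 / 8) \<bullet> b" for b
    by (auto simp: Basis_vec_def inner_axis)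
  show "emeasure lborel (small_cube :: ((real ^ 'n) ^ 'm) set) = ennreal (\<Prod>b\<in>(Basis :: ((real ^ 'n) ^ 'm) set). 1 / 4)"
    unfolding small_cube_def by (simp only: emeasure_lborel_cbox[OF b'] prod.cong[OF refl b])
qed (auto intro: prod_pos)

abbreviation test_symbol :: "((int ^ 'n) ^ 'm \<Rightarrow> real) \<Rightarrow> (real ^ 'n) \<times> ((real ^ 'n) ^ 'm) \<Rightarrow> complex" where
  "test_symbol V \<equiv> bump_symbol V (\<lambda>p t. flat 0 (cos (2 * pi * t)))"

text \<open>Since all Fourier transforms involved are nonnegative, discarding the off-diagonal interactions
  only decreases the Gaussian quadratic form.\<close>

lemma test_symbol_lower_bound:
  fixes V :: "(int ^ 'n) ^ 'm \<Rightarrow> real"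
  assumes V: "\<And>\<nu>. 0 \<le> V \<nu>" and Vb: "\<And>\<nu>. V \<nu> \<le> B"
  obtains c :: real where "0 < c"
    "\<And>(S :: (int ^ 'n) set) (A :: 'm \<Rightarrow> int ^ 'n \<Rightarrow> real) N. finite S \<Longrightarrow> finite N \<Longrightarrow> (\<And>j \<mu>. 0 \<le> A j \<mu>) \<Longrightarrow>
      (\<And>\<nu> j. \<nu> \<in> N \<Longrightarrow> \<nu> $ j \<in> S) \<Longrightarrow>
      ennreal (c * (\<Sum>\<nu>\<in>N. \<Sum>\<nu>'\<in>N. if (\<Sum>j\<in>UNIV. \<nu> $ j) = (\<Sum>j\<in>UNIV. \<nu>' $ j)
          then (V \<nu> * (\<Prod>j\<in>UNIV. A j (\<nu> $ j))) * (V \<nu>' * (\<Prod>j\<in>UNIV. A j (\<nu>' $ j))) else 0))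
      \<le> (\<integral>\<^sup>+x. ennreal (gauss 1 x * (norm (osc x (\<lambda>\<xi>. test_symbol V (x, \<xi>)) (\<lambda>j. packet_sum S (A j))))\<^sup>2) \<partial>lborel)"
proof -
  obtain v where v: "0 < v" "emeasure lborel (small_cube :: ((real ^ 'n) ^ 'm) set) = ennreal v"
    using small_cube_measure by blast
  \<comment> \<open>Three lower bounds near lattice points: \<open>b1\<close> for the product of
    bumps, each at least exp(-2) since its cosine is at least 1/2; \<open>b2\<close> for the
    Gaussians in the transforms, each at its own lattice point; \<open>b3\<close> for the kernel
    between two cells with equal frequency sum.\<close>
  define b1 where "b1 = exp (- 2 :: real) ^ CARD('m \<times> 'n)"
  define b2 where "b2 = (exp (- ((1 / 8)\<^sup>2 / 2) :: real) ^ CARD('n)) ^ CARD('m)"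
  define b3 where "b3 = exp (- ((real CARD('m))\<^sup>2 / 2) :: real) ^ CARD('n)"
  have b: "0 < b1" "0 < b2" "0 < b3" by (auto simp: b1_def b2_def b3_def)
  have ghat: "gauss 1 x \<le> gauss_hat 1 x" for x :: "real ^ 'n"
  proof -
    have "1 \<le> sqrt (2 * pi)" using pi_ge_two by simp
    then have "1 \<le> sqrt (2 * pi) ^ CARD('n)" by (rule one_le_power)
    then show ?thesis using mult_right_mono[of 1 "sqrt (2 * pi) ^ CARD('n)" "gauss 1 x"] gauss_pos[of 1 x]
      by (simp add: gauss_hat_def)
  qed
  show thesis
  proof (rule that[of "(b1 * b2)\<^sup>2 * b3 * v\<^sup>2"])
    show "0 < (b1 * b2)\<^sup>2 * b3 * v\<^sup>2" using b v by simp
    fix S :: "(int ^ 'n) set" and A :: "'m \<Rightarrow> int ^ 'n \<Rightarrow> real" and N :: "((int ^ 'n) ^ 'm) set"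
    assume S: "finite S" and N: "finite N" and A: "\<And>j \<mu>. 0 \<le> A j \<mu>" and NS: "\<And>\<nu> j. \<nu> \<in> N \<Longrightarrow> \<nu> $ j \<in> S"
    let ?s = "\<lambda>\<xi> :: (real ^ 'n) ^ 'm. \<Sum>j\<in>UNIV. \<xi> $ j"
    let ?h = "\<lambda>\<nu> :: (int ^ 'n) ^ 'm. V \<nu> * (\<Prod>j\<in>UNIV. A j (\<nu> $ j))"
    have h0: "0 \<le> ?h \<nu>" for \<nu> using V A by (intro mult_nonneg_nonneg prod_nonneg) auto
    define \<psi> where "\<psi> \<xi> = (\<Prod>p\<in>UNIV. flat 0 (cos (2 * pi * (\<xi> $ fst p $ snd p))))" for \<xi> :: "(real ^ 'n) ^ 'm"
    define F where "F j \<eta> = (\<Sum>\<kappa>\<in>S. A j \<kappa> * gauss_hat 1 (lattice_pt \<kappa> - \<eta>))" for j \<eta>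
    define R where "R \<xi> = (V (block_cell \<xi>) * \<psi> \<xi>) * (\<Prod>j\<in>UNIV. F j (\<xi> $ j))" for \<xi>
    have \<psi>0: "0 \<le> \<psi> \<xi>" for \<xi> unfolding \<psi>_def by (intro prod_nonneg) (simp add: flat_bound)
    have F0: "0 \<le> F j \<eta>" for j \<eta> unfolding F_def using A by (intro sum_nonneg mult_nonneg_nonneg gauss_hat_nonneg) auto
    have R0: "0 \<le> R \<xi>" for \<xi> unfolding R_def using V \<psi>0 F0 by (intro mult_nonneg_nonneg prod_nonneg) auto
    let ?G = "\<lambda>\<xi>. complex_of_real (R \<xi>)"
    have ts: "test_symbol V (x, \<xi>) = of_real (V (block_cell \<xi>) * \<psi> \<xi>)" for x \<xi>
      by (simp add: bump_symbol_def \<psi>_def)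
    have G: "test_symbol V (x, \<xi>) * (\<Prod>j\<in>UNIV. fourier (packet_sum S (A j)) (\<xi> $ j)) = ?G \<xi>" for x \<xi>
      unfolding ts packet_sum_schwartz(2)[OF S] F_def[symmetric] by (simp add: R_def)
    have ext: "osc x (\<lambda>\<xi>. test_symbol V (x, \<xi>)) (\<lambda>j. packet_sum S (A j)) = fourier_ext lborel ?s ?G x" for x
      unfolding osc_def G ..
    have sym: "test_symbol V \<in> bounded_symbols (\<lambda>\<xi>. V (block_cell \<xi>))"
      using bump_symbol_in_class[OF V, of "\<lambda>p t. flat 0 (cos (2 * pi * t))"] bumps.flat
      by (simp add: symbol_class_eq extend_weight_eq)
    obtain D where D: "\<And>z. norm (test_symbol V z) \<le> D"
      using bounded_symbols_bounded[OF sym V Vb] by blast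
    have "test_symbol V \<in> borel_measurable (borel \<Otimes>\<^sub>M borel)"
      using smooth_measurable[OF derivs_inD(1)[OF sym]] by (simp add: borel_prod)
    then have tm: "(\<lambda>\<xi>. test_symbol V (0, \<xi>)) \<in> borel_measurable borel" by measurable
    have intG: "integrable lborel ?G"
      using osc_integrable(1)[OF packet_sum_schwartz(1)[OF S] tm D, of A] unfolding G .
    have sm: "?s \<in> borel_measurable lborel" by measurable
    have Rm [measurable]: "R \<in> borel_measurable borel"
      using intG unfolding complex_of_real_integrable_eq by auto
    let ?K = "\<lambda>\<xi> \<xi>'. gauss_hat 1 (?s \<xi> - ?s \<xi>')"
    let ?H = "\<lambda>z. R (fst z) * R (snd z) * ?K (fst z) (snd z)"
    have H: "?G (fst z) * cnj (?G (snd z)) * of_real (?K (fst z) (snd z)) = complex_of_real (?H z)" for z by simp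
    have intH: "integrable (lborel \<Otimes>\<^sub>M lborel) ?H"
      using gauss_quadratic(1)[OF sigma_finite_lborel intG sm zero_less_one] unfolding H complex_of_real_integrable_eq .
    have H0: "0 \<le> ?H z" for z using R0 by (intro mult_nonneg_nonneg gauss_hat_nonneg) auto
    have "(\<integral>\<^sup>+x. ennreal (gauss 1 x * (norm (fourier_ext lborel ?s ?G x))\<^sup>2) \<partial>lborel) = ennreal (Re (\<integral>z. complex_of_real (?H z) \<partial>(lborel \<Otimes>\<^sub>M lborel)))"
      using gauss_quadratic(2)[OF sigma_finite_lborel intG sm zero_less_one] unfolding H .
    also have "\<dots> = ennreal (\<integral>z. ?H z \<partial>(lborel \<Otimes>\<^sub>M lborel))" by (simp only: integral_complex_of_real Re_complex_of_real)
    also have "\<dots> = (\<integral>\<^sup>+z. ennreal (?H z) \<partial>(lborel \<Otimes>\<^sub>M lborel))"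
      using intH H0 by (intro nn_integral_eq_integral[symmetric]) auto
    also have "\<dots> = (\<integral>\<^sup>+\<xi>. (\<integral>\<^sup>+\<xi>'. ennreal (?H (\<xi>, \<xi>')) \<partial>lborel) \<partial>lborel)"
      by (rule lborel.nn_integral_fst[symmetric]) measurable
    finally have eq: "(\<integral>\<^sup>+x. ennreal (gauss 1 x * (norm (fourier_ext lborel ?s ?G x))\<^sup>2) \<partial>lborel)
      = (\<integral>\<^sup>+\<xi>. (\<integral>\<^sup>+\<xi>'. ennreal (R \<xi> * R \<xi>' * ?K \<xi> \<xi>') \<partial>lborel) \<partial>lborel)" by simp
    let ?I = "\<lambda>(\<nu> :: (int ^ 'n) ^ 'm) (\<xi> :: (real ^ 'n) ^ 'm). indicator small_cube (\<xi> - block_pt \<nu>) :: real"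
    have cell: "block_cell \<xi> = \<nu>" if "\<xi> - block_pt \<nu> \<in> small_cube" for \<xi> :: "(real ^ 'n) ^ 'm" and \<nu> :: "(int ^ 'n) ^ 'm"
    proof (rule block_cell_eqI)
      fix j i
      show "\<bar>\<xi> $ j $ i - of_int (\<nu> $ j $ i)\<bar> < 1 / 2"
        using small_cube_component[OF that, of j i] by (simp add: block_pt_def lattice_pt_def)
    qed
    \<comment> \<open>All terms are nonnegative, so in each sum \<open>F\<close> only the Gaussian
      centred at the component of \<nu> is retained.\<close>
    have R_ge: "b1 * b2 * ?h \<nu> \<le> R \<xi>" if \<nu>: "\<nu> \<in> N" and sc: "\<xi> - block_pt \<nu> \<in> small_cube" for \<nu> :: "(int ^ 'n) ^ 'm" and \<xi> :: "(real ^ 'n) ^ 'm"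
    proof -
      have comp: "\<bar>\<xi> $ j $ i - of_int (\<nu> $ j $ i)\<bar> \<le> 1 / 8" for j i
        using small_cube_component[OF sc, of j i] by (simp add: block_pt_def lattice_pt_def)
      have "(\<Prod>p::'m \<times> 'n\<in>UNIV. exp (- 2 :: real)) \<le> \<psi> \<xi>"
        unfolding \<psi>_def
      proof (intro prod_mono conjI)
        fix p :: "'m \<times> 'n"
        define d where "d = \<xi> $ fst p $ snd p - of_int (\<nu> $ fst p $ snd p)"
        have d: "\<bar>d\<bar> \<le> 1 / 8" unfolding d_def by (rule comp)
        have "2 * pi * (\<xi> $ fst p $ snd p) = 2 * pi * d + 2 * pi * of_int (\<nu> $ fst p $ snd p)"
          by (simp add: d_def algebra_simps)
        then have "cos (2 * pi * (\<xi> $ fst p $ snd p)) = cos (2 * pi * d)"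
          by (simp only: cos_add cos_int_2pin sin_int_2pin mult_1_right mult_zero_right diff_zero)
        also have "\<dots> = cos \<bar>2 * pi * d\<bar>" by simp
        also have "\<dots> \<ge> cos (pi / 3)"
        proof (rule cos_monotone_0_pi_le)
          have "\<bar>2 * pi * d\<bar> = 2 * pi * \<bar>d\<bar>" by (simp add: abs_mult)
          also have "\<dots> \<le> 2 * pi * (1 / 8)" using d by (intro mult_left_mono) auto
          also have "\<dots> \<le> pi / 3" by simp
          finally show "\<bar>2 * pi * d\<bar> \<le> pi / 3" .
        qed auto
        finally have c: "1 / 2 \<le> cos (2 * pi * (\<xi> $ fst p $ snd p))" by (simp add: cos_60)
        then have "inverse (cos (2 * pi * (\<xi> $ fst p $ snd p))) \<le> inverse (1 / 2)"
          by (intro le_imp_inverse_le) auto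
        then show "exp (- 2) \<le> flat 0 (cos (2 * pi * (\<xi> $ fst p $ snd p)))"
          using c by (simp add: flat_def)
      qed simp
      then have p1: "b1 \<le> \<psi> \<xi>" by (simp add: b1_def)
      have "b2 * (\<Prod>j\<in>UNIV. A j (\<nu> $ j)) = (\<Prod>j\<in>UNIV. exp (- ((1 / 8)\<^sup>2 / 2)) ^ CARD('n) * A j (\<nu> $ j))"
        by (simp add: prod.distrib b2_def)
      also have "\<dots> \<le> (\<Prod>j\<in>UNIV. F j (\<xi> $ j))"
      proof (intro prod_mono conjI)
        fix j
        have "exp (- ((1 / 8)\<^sup>2 / 2)) ^ CARD('n) \<le> gauss 1 (lattice_pt (\<nu> $ j) - \<xi> $ j)"
          using comp[of j] by (intro gauss_ge) (simp add: lattice_pt_def abs_minus_commute)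
        also have "\<dots> \<le> gauss_hat 1 (lattice_pt (\<nu> $ j) - \<xi> $ j)" by (rule ghat)
        finally have "exp (- ((1 / 8)\<^sup>2 / 2)) ^ CARD('n) * A j (\<nu> $ j) \<le> A j (\<nu> $ j) * gauss_hat 1 (lattice_pt (\<nu> $ j) - \<xi> $ j)"
          using A by (subst mult.commute) (rule mult_left_mono)
        also have "\<dots> \<le> F j (\<xi> $ j)"
          unfolding F_def using S NS[OF \<nu>] A
          by (intro member_le_sum mult_nonneg_nonneg gauss_hat_nonneg) auto
        finally show "exp (- ((1 / 8)\<^sup>2 / 2)) ^ CARD('n) * A j (\<nu> $ j) \<le> F j (\<xi> $ j)" .
        show "0 \<le> exp (- ((1 / 8)\<^sup>2 / 2)) ^ CARD('n) * A j (\<nu> $ j)" using A by simp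
      qed
      finally have p2: "b2 * (\<Prod>j\<in>UNIV. A j (\<nu> $ j)) \<le> (\<Prod>j\<in>UNIV. F j (\<xi> $ j))" .
      have "b1 * b2 * ?h \<nu> = (V \<nu> * b1) * (b2 * (\<Prod>j\<in>UNIV. A j (\<nu> $ j)))" by simp
      also have "\<dots> \<le> (V \<nu> * \<psi> \<xi>) * (\<Prod>j\<in>UNIV. F j (\<xi> $ j))"
        using V b A \<psi>0 by (intro mult_mono p1 p2 mult_left_mono mult_nonneg_nonneg prod_nonneg) (auto intro: less_imp_le)
      also have "\<dots> = R \<xi>" by (simp add: R_def cell[OF sc])
      finally show ?thesis .
    qed
    \<comment> \<open>The translated small cubes lie in distinct cells, so at most one term of the
      sum is nonzero.\<close>
    have single: "(\<Sum>\<nu>\<in>N. b1 * b2 * ?h \<nu> * ?I \<nu> \<xi>) \<le> R \<xi>" for \<xi>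
    proof (cases "block_cell \<xi> \<in> N \<and> \<xi> - block_pt (block_cell \<xi>) \<in> small_cube")
      case True
      have "(\<Sum>\<nu>\<in>N. b1 * b2 * ?h \<nu> * ?I \<nu> \<xi>) = (\<Sum>\<nu>\<in>N. if \<nu> = block_cell \<xi> then b1 * b2 * ?h \<nu> * ?I \<nu> \<xi> else 0)"
        using cell by (intro sum.cong refl) (auto simp: indicator_def)
      also have "\<dots> = b1 * b2 * ?h (block_cell \<xi>)" using N True by simp
      also have "\<dots> \<le> R \<xi>" using R_ge True by blast
      finally show ?thesis .
    next
      case False
      have "(\<Sum>\<nu>\<in>N. b1 * b2 * ?h \<nu> * ?I \<nu> \<xi>) = 0"
        using cell False by (intro sum.neutral) (auto simp: indicator_def)
      then show ?thesis using R0 by simp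
    qed
    \<comment> \<open>Equal lattice sums cancel, and every coordinate of the difference of the
      frequency sums is then bounded by the number of slots.\<close>
    have K_ge: "b3 \<le> ?K \<xi> \<xi>'" if "\<xi> - block_pt \<nu> \<in> small_cube" "\<xi>' - block_pt \<nu>' \<in> small_cube"
      "(\<Sum>j\<in>UNIV. \<nu> $ j) = (\<Sum>j\<in>UNIV. \<nu>' $ j)" for \<xi> \<xi>' :: "(real ^ 'n) ^ 'm" and \<nu> \<nu>' :: "(int ^ 'n) ^ 'm"
    proof -
      have "(\<Sum>j\<in>UNIV. block_pt \<nu> $ j) = (\<Sum>j\<in>UNIV. block_pt \<nu>' $ j)"
        using that(3) by (simp add: block_pt_def lattice_pt_sum[symmetric])
      then have diff: "?s \<xi> - ?s \<xi>' = (\<Sum>j\<in>UNIV. (\<xi> - block_pt \<nu>) $ j - (\<xi>' - block_pt \<nu>') $ j)"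
        by (simp add: sum_subtractf)
      have "b3 \<le> gauss 1 (?s \<xi> - ?s \<xi>')"
        unfolding b3_def
      proof (rule gauss_ge)
        fix i
        have "\<bar>(?s \<xi> - ?s \<xi>') $ i\<bar> \<le> (\<Sum>j\<in>UNIV. \<bar>(\<xi> - block_pt \<nu>) $ j $ i - (\<xi>' - block_pt \<nu>') $ j $ i\<bar>)"
          unfolding diff by (simp only: sum_component vector_minus_component sum_abs)
        also have "\<dots> \<le> (\<Sum>j::'m\<in>UNIV. 1)"
        proof (intro sum_mono)
          fix j
          show "\<bar>(\<xi> - block_pt \<nu>) $ j $ i - (\<xi>' - block_pt \<nu>') $ j $ i\<bar> \<le> 1"
            using small_cube_component[OF that(1), of j i] small_cube_component[OF that(2), of j i] by linarith
        qed
        finally show "\<bar>(?s \<xi> - ?s \<xi>') $ i\<bar> \<le> real CARD('m)" by simp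
      qed
      then show ?thesis using ghat order.trans by blast
    qed
    let ?k = "\<lambda>\<nu>. b1 * b2 * ?h \<nu>"
    have k0: "0 \<le> ?k \<nu>" for \<nu> using b h0[of \<nu>] by (intro mult_nonneg_nonneg[OF _ h0]) auto
    let ?J = "\<lambda>(\<nu> :: (int ^ 'n) ^ 'm) (\<nu>' :: (int ^ 'n) ^ 'm). if (\<Sum>j\<in>UNIV. \<nu> $ j) = (\<Sum>j\<in>UNIV. \<nu>' $ j) then ?k \<nu> * ?k \<nu>' * b3 else 0"
    have J0: "0 \<le> ?J \<nu> \<nu>'" for \<nu> \<nu>' using k0 b by (auto intro!: mult_nonneg_nonneg less_imp_le)
    have pw: "(\<Sum>\<nu>\<in>N. \<Sum>\<nu>'\<in>N. ?J \<nu> \<nu>' * (?I \<nu> \<xi> * ?I \<nu>' \<xi>')) \<le> R \<xi> * R \<xi>' * ?K \<xi> \<xi>'" for \<xi> \<xi>'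
    proof -
      have "(\<Sum>\<nu>\<in>N. \<Sum>\<nu>'\<in>N. ?J \<nu> \<nu>' * (?I \<nu> \<xi> * ?I \<nu>' \<xi>')) \<le> (\<Sum>\<nu>\<in>N. \<Sum>\<nu>'\<in>N. (?k \<nu> * ?I \<nu> \<xi>) * (?k \<nu>' * ?I \<nu>' \<xi>') * ?K \<xi> \<xi>')"
      proof (intro sum_mono)
        fix \<nu> \<nu>'
        show "?J \<nu> \<nu>' * (?I \<nu> \<xi> * ?I \<nu>' \<xi>') \<le> (?k \<nu> * ?I \<nu> \<xi>) * (?k \<nu>' * ?I \<nu>' \<xi>') * ?K \<xi> \<xi>'"
        proof (cases "\<xi> - block_pt \<nu> \<in> small_cube \<and> \<xi>' - block_pt \<nu>' \<in> small_cube")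
          case True
          have "?J \<nu> \<nu>' \<le> ?k \<nu> * ?k \<nu>' * ?K \<xi> \<xi>'"
          proof (cases "(\<Sum>j\<in>UNIV. \<nu> $ j) = (\<Sum>j\<in>UNIV. \<nu>' $ j)")
            case eq: True
            show ?thesis
              using mult_left_mono[OF K_ge[OF conjunct1[OF True] conjunct2[OF True] eq] mult_nonneg_nonneg[OF k0 k0]] eq
              by (simp only: if_True simp_thms)
          next
            case False
            then show ?thesis
              by (simp only: if_False) (intro mult_nonneg_nonneg[OF mult_nonneg_nonneg[OF k0 k0]] gauss_hat_nonneg zero_less_one)
          qed
          then show ?thesis using True by simp
        next
          case False
          then show ?thesis by (auto simp: indicator_def)
        qed
      qed
      also have "\<dots> = (\<Sum>\<nu>\<in>N. ?k \<nu> * ?I \<nu> \<xi>) * (\<Sum>\<nu>'\<in>N. ?k \<nu>' * ?I \<nu>' \<xi>') * ?K \<xi> \<xi>'"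
        unfolding sum_product by (simp only: sum_distrib_right)
      also have "\<dots> \<le> R \<xi> * R \<xi>' * ?K \<xi> \<xi>'"
        by (intro mult_right_mono mult_mono single gauss_hat_nonneg R0 zero_less_one sum_nonneg mult_nonneg_nonneg[OF k0])
          (auto simp: indicator_def)
      finally show ?thesis .
    qed
    have vol: "(\<integral>\<^sup>+\<xi>. ennreal (?I \<nu> \<xi>) \<partial>lborel) = ennreal v" for \<nu>
    proof -
      have m: "(small_cube :: ((real ^ 'n) ^ 'm) set) \<in> sets borel" by (simp add: small_cube_def)
      have "(\<integral>\<^sup>+\<xi>. ennreal (?I \<nu> \<xi>) \<partial>lborel) = (\<integral>\<^sup>+\<xi>. indicator small_cube (\<xi> + (- block_pt \<nu>)) \<partial>lborel)"
        by (intro nn_integral_cong) (simp add: indicator_def)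
      also have "\<dots> = (\<integral>\<^sup>+\<xi>. indicator (small_cube :: ((real ^ 'n) ^ 'm) set) \<xi> \<partial>lborel)"
        using m by (intro nn_integral_lborel_shift) simp
      finally show ?thesis using m v by simp
    qed
    have [measurable]: "?I \<nu> \<in> borel_measurable borel" for \<nu>
    proof -
      have [measurable]: "(small_cube :: ((real ^ 'n) ^ 'm) set) \<in> sets borel" by (simp add: small_cube_def)
      show ?thesis by measurable
    qed
    have ennreal_double_sum: "(\<Sum>\<nu>\<in>N. \<Sum>\<nu>'\<in>N. ennreal (g \<nu> \<nu>')) = ennreal (\<Sum>\<nu>\<in>N. \<Sum>\<nu>'\<in>N. g \<nu> \<nu>')"
      if "\<And>\<nu> \<nu>'. 0 \<le> g \<nu> \<nu>'" for g
      using that by (simp add: sum_ennreal sum_nonneg)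
    have eJv: "ennreal (?J \<nu> \<nu>') * (ennreal v * ennreal v) = ennreal (?J \<nu> \<nu>' * (v * v))" for \<nu> \<nu>'
      by (simp only: ennreal_mult[OF J0 mult_nonneg_nonneg] ennreal_mult less_imp_le[OF v(1)])
    have "ennreal ((b1 * b2)\<^sup>2 * b3 * v\<^sup>2 * (\<Sum>\<nu>\<in>N. \<Sum>\<nu>'\<in>N. if (\<Sum>j\<in>UNIV. \<nu> $ j) = (\<Sum>j\<in>UNIV. \<nu>' $ j) then ?h \<nu> * ?h \<nu>' else 0))
      = ennreal (\<Sum>\<nu>\<in>N. \<Sum>\<nu>'\<in>N. ?J \<nu> \<nu>' * (v * v))"
      unfolding sum_distrib_left
      by (intro arg_cong[where f=ennreal] sum.cong refl) (simp add: power2_eq_square)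
    also have "\<dots> = (\<Sum>\<nu>\<in>N. \<Sum>\<nu>'\<in>N. ennreal (?J \<nu> \<nu>') * (ennreal v * ennreal v))"
      unfolding eJv by (rule ennreal_double_sum[symmetric]) (intro mult_nonneg_nonneg J0 less_imp_le[OF v(1)])
    also have "\<dots> = (\<Sum>\<nu>\<in>N. \<Sum>\<nu>'\<in>N. \<integral>\<^sup>+\<xi>. (\<integral>\<^sup>+\<xi>'. ennreal (?J \<nu> \<nu>') * (ennreal (?I \<nu> \<xi>) * ennreal (?I \<nu>' \<xi>')) \<partial>lborel) \<partial>lborel)"
      by (intro sum.cong refl) (simp add: nn_integral_cmult nn_integral_multc vol)
    also have "\<dots> = (\<integral>\<^sup>+\<xi>. (\<integral>\<^sup>+\<xi>'. (\<Sum>\<nu>\<in>N. \<Sum>\<nu>'\<in>N. ennreal (?J \<nu> \<nu>') * (ennreal (?I \<nu> \<xi>) * ennreal (?I \<nu>' \<xi>'))) \<partial>lborel) \<partial>lborel)"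
      by (simp add: nn_integral_sum)
    also have "\<dots> = (\<integral>\<^sup>+\<xi>. (\<integral>\<^sup>+\<xi>'. ennreal (\<Sum>\<nu>\<in>N. \<Sum>\<nu>'\<in>N. ?J \<nu> \<nu>' * (?I \<nu> \<xi> * ?I \<nu>' \<xi>')) \<partial>lborel) \<partial>lborel)"
    proof (intro nn_integral_cong)
      fix \<xi> \<xi>'
      have "ennreal (?J \<nu> \<nu>') * (ennreal (?I \<nu> \<xi>) * ennreal (?I \<nu>' \<xi>')) = ennreal (?J \<nu> \<nu>' * (?I \<nu> \<xi> * ?I \<nu>' \<xi>'))" for \<nu> \<nu>'
        by (simp only: ennreal_mult[OF J0 mult_nonneg_nonneg] ennreal_mult indicator_pos_le)
      then show "(\<Sum>\<nu>\<in>N. \<Sum>\<nu>'\<in>N. ennreal (?J \<nu> \<nu>') * (ennreal (?I \<nu> \<xi>) * ennreal (?I \<nu>' \<xi>')))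
        = ennreal (\<Sum>\<nu>\<in>N. \<Sum>\<nu>'\<in>N. ?J \<nu> \<nu>' * (?I \<nu> \<xi> * ?I \<nu>' \<xi>'))"
        by (simp only:) (intro ennreal_double_sum mult_nonneg_nonneg J0 indicator_pos_le)
    qed
    also have "\<dots> \<le> (\<integral>\<^sup>+\<xi>. (\<integral>\<^sup>+\<xi>'. ennreal (R \<xi> * R \<xi>' * ?K \<xi> \<xi>') \<partial>lborel) \<partial>lborel)"
      by (intro nn_integral_mono ennreal_leI pw)
    finally show "ennreal ((b1 * b2)\<^sup>2 * b3 * v\<^sup>2 * (\<Sum>\<nu>\<in>N. \<Sum>\<nu>'\<in>N. if (\<Sum>j\<in>UNIV. \<nu> $ j) = (\<Sum>j\<in>UNIV. \<nu>' $ j) then ?h \<nu> * ?h \<nu>' else 0))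
      \<le> (\<integral>\<^sup>+x. ennreal (gauss 1 x * (norm (osc x (\<lambda>\<xi>. test_symbol V (x, \<xi>)) (\<lambda>j. packet_sum S (A j))))\<^sup>2) \<partial>lborel)"
      unfolding ext eq .
  qed
qed

text \<open>Each local norm is at most the whole l^r quasi-norm, and the Gaussian is summable over
  cells. This one-sided comparison works for every positive r.\<close>

lemma gauss_weighted_le_amalgam_norm:
  assumes r: "0 < r"
  obtains E :: real where "0 \<le> E"
    "\<And>f :: real ^ 'n \<Rightarrow> complex. f \<in> borel_measurable borel \<Longrightarrow>
      (\<integral>\<^sup>+x. ennreal (gauss 1 x * (norm (f x))\<^sup>2) \<partial>lborel) \<le> ennreal E * (amalgam_norm 2 r f)\<^sup>2"
proof -
  obtain S :: real where S: "1 \<le> S"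
    "\<And>\<mu> :: int ^ 'n. (\<integral>\<^sup>+t. ennreal (cauchy_weight (lattice_pt (t - \<mu>))) \<partial>count_space UNIV) \<le> ennreal S"
    using cauchy_weight_lattice_sum by metis
  define G :: real where "G = (2 ^ (1 + 1) * fact 1) ^ CARD('n) * 4 ^ CARD('n)"
  have G: "0 \<le> G" by (simp add: G_def)
  have g: "gauss 1 (x + lattice_pt \<kappa>) \<le> G * cauchy_weight (lattice_pt \<kappa>)" if "x \<in> unit_cube" for x :: "real ^ 'n" and \<kappa>
  proof -
    have "gauss 1 (x + lattice_pt \<kappa>) \<le> (2 ^ (1 + 1) * fact 1) ^ CARD('n) * cauchy_weight (x + lattice_pt \<kappa>)"
      using gauss_le_cauchy_weight[of "x + lattice_pt \<kappa>" 1] by simp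
    also have "\<dots> \<le> (2 ^ (1 + 1) * fact 1) ^ CARD('n) * (4 ^ CARD('n) * cauchy_weight (lattice_pt \<kappa>))"
    proof (intro mult_left_mono cauchy_weight_le)
      show "\<bar>(x + lattice_pt \<kappa>) $ i - lattice_pt \<kappa> $ i\<bar> \<le> 1 / 2" for i
        using that by (auto simp: unit_cube_def abs_le_iff less_imp_le dest: spec[of _ i])
    qed simp
    finally show ?thesis by (simp add: G_def mult.assoc)
  qed
  show thesis
  proof (rule that[of "G * S"])
    show "0 \<le> G * S" using G S by simp
    fix f :: "real ^ 'n \<Rightarrow> complex"
    assume fm [measurable]: "f \<in> borel_measurable borel"
    define l where "l \<nu> = Lp_norm (restrict_space lebesgue unit_cube) 2 (\<lambda>x. ennreal (norm (f (x + lattice_pt \<nu>))))" for \<nu>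
    have am: "amalgam_norm 2 r f = Lp_norm (count_space UNIV) r l" by (simp add: amalgam_norm_def l_def[abs_def])
    have l: "(\<integral>\<^sup>+x. indicator unit_cube x * ennreal ((norm (f (x + lattice_pt \<nu>)))\<^sup>2) \<partial>lborel) = (l \<nu>)\<^sup>2" for \<nu>
      using nn_integral_lborel_shift[of "\<lambda>x. indicator unit_cube (x - lattice_pt \<nu>) * ennreal ((norm (f x))\<^sup>2)" "lattice_pt \<nu>"]
        local_norm_power2[OF fm, of \<nu>] by (simp add: l_def)
    have "(\<integral>\<^sup>+x. ennreal (gauss 1 x * (norm (f x))\<^sup>2) \<partial>lborel)
      = (\<integral>\<^sup>+\<nu>. (\<integral>\<^sup>+x. indicator unit_cube x * ennreal (gauss 1 (x + lattice_pt \<nu>) * (norm (f (x + lattice_pt \<nu>)))\<^sup>2) \<partial>lborel) \<partial>count_space UNIV)"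
      by (rule nn_integral_tiling[where r=cell]) (simp_all add: mem_unit_cube_iff)
    also have "\<dots> \<le> (\<integral>\<^sup>+\<nu>. (\<integral>\<^sup>+x. ennreal (G * cauchy_weight (lattice_pt \<nu> :: real ^ 'n)) *
        (indicator unit_cube x * ennreal ((norm (f (x + lattice_pt \<nu>)))\<^sup>2)) \<partial>lborel) \<partial>count_space UNIV)"
    proof (intro nn_integral_mono)
      fix \<nu> and x :: "real ^ 'n"
      show "indicator unit_cube x * ennreal (gauss 1 (x + lattice_pt \<nu>) * (norm (f (x + lattice_pt \<nu>)))\<^sup>2)
        \<le> ennreal (G * cauchy_weight (lattice_pt \<nu> :: real ^ 'n)) * (indicator unit_cube x * ennreal ((norm (f (x + lattice_pt \<nu>)))\<^sup>2))"
      proof (cases "x \<in> unit_cube")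
        case True
        have "gauss 1 (x + lattice_pt \<nu>) * (norm (f (x + lattice_pt \<nu>)))\<^sup>2 \<le> G * cauchy_weight (lattice_pt \<nu>) * (norm (f (x + lattice_pt \<nu>)))\<^sup>2"
          by (intro mult_right_mono g True) simp
        then show ?thesis
          using True G by (simp add: ennreal_mult'' [symmetric] ennreal_leI)
      qed simp
    qed
    also have "\<dots> = (\<integral>\<^sup>+\<nu>. ennreal (G * cauchy_weight (lattice_pt \<nu> :: real ^ 'n)) * (l \<nu>)\<^sup>2 \<partial>count_space UNIV)"
      by (intro nn_integral_cong) (simp add: nn_integral_cmult l)
    also have "\<dots> \<le> (\<integral>\<^sup>+\<nu>. ennreal (cauchy_weight (lattice_pt \<nu> :: real ^ 'n)) * (ennreal G * (amalgam_norm 2 r f)\<^sup>2) \<partial>count_space UNIV)"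
    proof (intro nn_integral_mono)
      fix \<nu> :: "int ^ 'n"
      have "ennreal (G * cauchy_weight (lattice_pt \<nu> :: real ^ 'n)) * (l \<nu>)\<^sup>2 \<le> ennreal (G * cauchy_weight (lattice_pt \<nu> :: real ^ 'n)) * (amalgam_norm 2 r f)\<^sup>2"
        unfolding am by (intro mult_left_mono power_mono le_Lp_norm_count_space r) auto
      then show "ennreal (G * cauchy_weight (lattice_pt \<nu> :: real ^ 'n)) * (l \<nu>)\<^sup>2
        \<le> ennreal (cauchy_weight (lattice_pt \<nu> :: real ^ 'n)) * (ennreal G * (amalgam_norm 2 r f)\<^sup>2)"
        using G by (simp add: ennreal_mult' mult_ac)
    qed
    also have "\<dots> = (\<integral>\<^sup>+\<nu>. ennreal (cauchy_weight (lattice_pt \<nu> :: real ^ 'n)) \<partial>count_space UNIV) * (ennreal G * (amalgam_norm 2 r f)\<^sup>2)"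
      by (rule nn_integral_multc) simp
    also have "\<dots> \<le> ennreal S * (ennreal G * (amalgam_norm 2 r f)\<^sup>2)"
      using S(2)[of 0] by (intro mult_right_mono) auto
    also have "\<dots> = ennreal (G * S) * (amalgam_norm 2 r f)\<^sup>2"
      using G by (simp add: ennreal_mult' mult_ac)
    finally show "(\<integral>\<^sup>+x. ennreal (gauss 1 x * (norm (f x))\<^sup>2) \<partial>lborel) \<le> ennreal (G * S) * (amalgam_norm 2 r f)\<^sup>2" .
  qed
qed

lemma sum_squares_le_Lp_norm:
  assumes S: "finite S" and a: "\<And>\<mu>. 0 \<le> a \<mu>"
  shows "ennreal (\<Sum>\<mu>\<in>S. (a \<mu>)\<^sup>2) \<le> (Lp_norm (count_space UNIV) 2 (\<lambda>\<mu>. ennreal (a \<mu>)))\<^sup>2"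
proof -
  have "ennreal (\<Sum>\<mu>\<in>S. (a \<mu>)\<^sup>2) = (\<Sum>\<mu>\<in>S. (ennreal (a \<mu>))\<^sup>2)"
    using a by (simp add: sum_ennreal ennreal_power)
  also have "\<dots> = (\<integral>\<^sup>+\<mu>. (ennreal (a \<mu>))\<^sup>2 * indicator S \<mu> \<partial>count_space UNIV)"
    using S by (subst nn_integral_count_space_indicator[symmetric]) (auto simp: nn_integral_count_space_finite)
  also have "\<dots> \<le> (\<integral>\<^sup>+\<mu>. (ennreal (a \<mu>))\<^sup>2 \<partial>count_space UNIV)"
    by (intro nn_integral_mono) (auto simp: indicator_def)
  finally show ?thesis by (simp add: Lp_norm_two_power2)
qed

text \<open>The lower bound for the test symbol, the Gaussian comparison, the assumed boundedness
  and the norms of packet sums form a chain that bounds the quadratic form ?Q by L times the product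
  of the sums of (A_j)^2. \<open>sum_duality\<close> turns this into the defining inequality on
  finite sets of \<nu>.\<close>

lemma B_class_necessary:
  fixes V :: "(int ^ 'n) ^ 'm \<Rightarrow> real"
  assumes V: "\<And>\<nu>. 0 \<le> V \<nu>" and Vb: "\<And>\<nu>. V \<nu> \<le> B" and q: "\<And>j. 0 < q j" and r: "0 < r"
    and bd: "\<And>\<sigma>. \<sigma> \<in> symbol_class (extend_weight V) \<Longrightarrow> amalgam_bounded (pseudo_op \<sigma>) (\<lambda>_ :: 'm. 2) q 2 r"
  shows "V \<in> B_class"
proof -
  let ?Q = "\<lambda>N A. \<Sum>\<nu>\<in>N. \<Sum>\<nu>'\<in>N. if (\<Sum>j\<in>UNIV. \<nu> $ j) = (\<Sum>j\<in>UNIV. \<nu>' $ j)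
          then (V \<nu> * (\<Prod>j\<in>UNIV. A j (\<nu> $ j))) * (V \<nu>' * (\<Prod>j\<in>UNIV. A j (\<nu>' $ j))) else 0"
  obtain c where c: "0 < c" and low:
    "\<And>(S :: (int ^ 'n) set) (A :: 'm \<Rightarrow> int ^ 'n \<Rightarrow> real) N. finite S \<Longrightarrow> finite N \<Longrightarrow> (\<And>j \<mu>. 0 \<le> A j \<mu>) \<Longrightarrow>
      (\<And>\<nu> j. \<nu> \<in> N \<Longrightarrow> \<nu> $ j \<in> S) \<Longrightarrow> ennreal (c * ?Q N A)
      \<le> (\<integral>\<^sup>+x. ennreal (gauss 1 x * (norm (osc x (\<lambda>\<xi>. test_symbol V (x, \<xi>)) (\<lambda>j. packet_sum S (A j))))\<^sup>2) \<partial>lborel)"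
    by (fact test_symbol_lower_bound[of V, OF V Vb])
  obtain E where E: "0 \<le> E" and up: "\<And>f :: real ^ 'n \<Rightarrow> complex. f \<in> borel_measurable borel \<Longrightarrow>
      (\<integral>\<^sup>+x. ennreal (gauss 1 x * (norm (f x))\<^sup>2) \<partial>lborel) \<le> ennreal E * (amalgam_norm 2 r f)\<^sup>2"
    by (fact gauss_weighted_le_amalgam_norm[OF r])
  have "\<exists>D\<ge>0. \<forall>(S :: (int ^ 'n) set) A. finite S \<longrightarrow> amalgam_norm 2 (q j) (packet_sum S A) \<le> ennreal (D * sqrt (\<Sum>\<kappa>\<in>S. (A \<kappa>)\<^sup>2))" for j
    by (rule packet_sum_amalgam_norm[OF q[of j]]) blast
  then obtain D where D: "\<And>j. 0 \<le> D j"
    "\<And>j (S :: (int ^ 'n) set) A. finite S \<Longrightarrow> amalgam_norm 2 (q j) (packet_sum S A) \<le> ennreal (D j * sqrt (\<Sum>\<kappa>\<in>S. (A \<kappa>)\<^sup>2))"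
    by metis
  have sc: "test_symbol V \<in> symbol_class (extend_weight V)"
    by (intro bump_symbol_in_class V bumps.flat)
  have sm: "smooth (test_symbol V)" using sc by (simp add: symbol_class_def)
  obtain M where M: "\<And>f. (\<And>j. schwartz (f j) \<and> f j \<in> amalgam_space 2 (q j)) \<Longrightarrow>
      amalgam_norm 2 r (pseudo_op (test_symbol V) f) \<le> ennreal M * (\<Prod>j\<in>UNIV. amalgam_norm 2 (q j) (f j))"
    using bd[OF sc] unfolding amalgam_bounded_def by blast
  \<comment> \<open>The constant in \<open>amalgam_bounded\<close> may be negative, in which case
    \<open>ennreal M\<close> is 0; truncation at 0 keeps the real arithmetic valid.\<close>
  define M' where "M' = max 0 M"
  have M': "0 \<le> M'" "ennreal M \<le> ennreal M'" by (auto simp: M'_def intro: ennreal_leI)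
  define c0 where "c0 = norm (1 / (2 * complex_of_real pi) ^ (CARD('m) * CARD('n)))"
  have c0: "0 < c0" by (simp add: c0_def)
  \<comment> \<open>Solved from c0^2 c ?Q \<le> E (M' ?P)^2, where ?P is the product of the D_j
    times the l2 norms of the coefficients.\<close>
  define L where "L = E * (M' * (\<Prod>j\<in>UNIV. D j))\<^sup>2 / (c0\<^sup>2 * c)"
  have L: "0 \<le> L" using E c by (simp add: L_def)
  have Q: "?Q N A \<le> L * (\<Prod>j\<in>UNIV. \<Sum>\<kappa>\<in>S. (A j \<kappa>)\<^sup>2)"
    if S: "finite S" and N: "finite N" and A: "\<And>j \<mu>. 0 \<le> A j \<mu>" and NS: "\<And>\<nu> j. \<nu> \<in> N \<Longrightarrow> \<nu> $ j \<in> S"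
    for S :: "(int ^ 'n) set" and A :: "'m \<Rightarrow> int ^ 'n \<Rightarrow> real" and N
  proof -
    let ?f = "\<lambda>j. packet_sum S (A j)"
    let ?P = "\<Prod>j\<in>UNIV. D j * sqrt (\<Sum>\<kappa>\<in>S. (A j \<kappa>)\<^sup>2)"
    have f: "?f j \<in> derivs_in rapid" for j by (rule packet_sum_schwartz(1)[OF S])
    have fs: "?f j \<in> amalgam_space 2 (q j)" for j
    proof -
      have "?f j \<in> borel_measurable borel" by (intro smooth_measurable derivs_inD(1)[OF f])
      then have "?f j \<in> borel_measurable lebesgue" by (simp add: measurable_completion)
      moreover have "amalgam_norm 2 (q j) (?f j) < top"
        using D(2)[OF S] by (rule order.strict_trans1) simp
      ultimately show ?thesis by (simp add: amalgam_space_def)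
    qed
    have om: "(\<lambda>x. osc x (\<lambda>\<xi>. test_symbol V (x, \<xi>)) ?f) \<in> borel_measurable borel"
      by (rule osc_measurable[OF sm f])
    then have pm: "pseudo_op (test_symbol V) ?f \<in> borel_measurable borel"
      unfolding pseudo_op_eq_osc[abs_def] by measurable
    have P0: "0 \<le> ?P" by (intro prod_nonneg mult_nonneg_nonneg D real_sqrt_ge_zero sum_nonneg) auto
    have pn: "norm (pseudo_op (test_symbol V) ?f x) = c0 * norm (osc x (\<lambda>\<xi>. test_symbol V (x, \<xi>)) ?f)" for x
      unfolding pseudo_op_eq_osc norm_mult c0_def ..
    have "ennreal (c0\<^sup>2 * (c * ?Q N A)) = ennreal (c0\<^sup>2) * ennreal (c * ?Q N A)"
      by (simp add: ennreal_mult')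
    also have "\<dots> \<le> ennreal (c0\<^sup>2) * (\<integral>\<^sup>+x. ennreal (gauss 1 x * (norm (osc x (\<lambda>\<xi>. test_symbol V (x, \<xi>)) ?f))\<^sup>2) \<partial>lborel)"
      by (intro mult_left_mono low[OF S N A NS]) auto
    also have "\<dots> = (\<integral>\<^sup>+x. ennreal (c0\<^sup>2) * ennreal (gauss 1 x * (norm (osc x (\<lambda>\<xi>. test_symbol V (x, \<xi>)) ?f))\<^sup>2) \<partial>lborel)"
      using om by (intro nn_integral_cmult[symmetric]) measurable
    also have "\<dots> = (\<integral>\<^sup>+x. ennreal (gauss 1 x * (norm (pseudo_op (test_symbol V) ?f x))\<^sup>2) \<partial>lborel)"
      unfolding pn by (intro nn_integral_cong) (simp add: ennreal_mult'[symmetric] power_mult_distrib mult_ac)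
    also have "\<dots> \<le> ennreal E * (amalgam_norm 2 r (pseudo_op (test_symbol V) ?f))\<^sup>2"
      by (rule up[OF pm])
    also have "\<dots> \<le> ennreal E * (ennreal (M' * ?P))\<^sup>2"
    proof (intro mult_left_mono power_mono)
      have "amalgam_norm 2 r (pseudo_op (test_symbol V) ?f) \<le> ennreal M * (\<Prod>j\<in>UNIV. amalgam_norm 2 (q j) (?f j))"
        by (rule M) (simp add: schwartz_eq f fs)
      also have "\<dots> \<le> ennreal M' * (\<Prod>j\<in>UNIV. ennreal (D j * sqrt (\<Sum>\<kappa>\<in>S. (A j \<kappa>)\<^sup>2)))"
        by (intro mult_mono M' ennreal_prod_mono D(2)[OF S]) auto
      also have "\<dots> = ennreal M' * ennreal ?P"
        by (subst prod_ennreal) (auto intro!: mult_nonneg_nonneg D sum_nonneg)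
      also have "\<dots> = ennreal (M' * ?P)" using M' P0 by (simp only: ennreal_mult)
      finally show "amalgam_norm 2 r (pseudo_op (test_symbol V) ?f) \<le> ennreal (M' * ?P)" .
    qed auto
    also have "\<dots> = ennreal (E * (M' * ?P)\<^sup>2)"
      by (simp only: ennreal_power[OF mult_nonneg_nonneg[OF M'(1) P0]] ennreal_mult[OF E zero_le_power2])
    finally have "c0\<^sup>2 * (c * ?Q N A) \<le> E * (M' * ?P)\<^sup>2"
      using E by (subst (asm) ennreal_le_iff) auto
    also have "(M' * ?P)\<^sup>2 = (M' * (\<Prod>j\<in>UNIV. D j))\<^sup>2 * (\<Prod>j\<in>UNIV. \<Sum>\<kappa>\<in>S. (A j \<kappa>)\<^sup>2)"
      by (simp add: power_mult_distrib prod.distrib prod_power_distrib sum_nonneg)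
    finally show ?thesis using c c0 by (simp add: L_def field_simps)
  qed
  \<comment> \<open>The constant is \<open>sqrt L + 1\<close> because \<open>B_class\<close> asks
    for a positive constant and L may be 0.\<close>
  have main: "(\<integral>\<^sup>+ \<nu>. ennreal (V \<nu> * A0 (\<Sum>j\<in>UNIV. \<nu> $ j) * (\<Prod>j\<in>UNIV. A j (\<nu> $ j))) \<partial>count_space UNIV)
      \<le> ennreal (sqrt L + 1) * (Lp_norm (count_space UNIV) 2 (\<lambda>\<mu>. ennreal (A0 \<mu>)) *
          (\<Prod>j\<in>UNIV. Lp_norm (count_space UNIV) 2 (\<lambda>\<mu>. ennreal (A j \<mu>))))" (is "_ \<le> ?R")
    if A0: "\<And>\<mu>. 0 \<le> A0 \<mu>" and A: "\<And>j \<mu>. 0 \<le> A j \<mu>" for A0 :: "int ^ 'n \<Rightarrow> real" and A :: "'m \<Rightarrow> int ^ 'n \<Rightarrow> real"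
  proof (rule nn_integral_count_space_le_finite)
    fix N :: "((int ^ 'n) ^ 'm) set"
    assume N: "finite N"
    \<comment> \<open>All components of points of N, so that the packet sums contain a packet at
      each of them.\<close>
    define S where "S = (\<lambda>(\<nu>, j). \<nu> $ j) ` (N \<times> UNIV)"
    have S: "finite S" using N by (simp add: S_def)
    let ?s = "\<lambda>\<nu> :: (int ^ 'n) ^ 'm. \<Sum>j\<in>UNIV. \<nu> $ j"
    let ?h = "\<lambda>\<nu> :: (int ^ 'n) ^ 'm. V \<nu> * (\<Prod>j\<in>UNIV. A j (\<nu> $ j))"
    have X0: "0 \<le> V \<nu> * A0 (?s \<nu>) * (\<Prod>j\<in>UNIV. A j (\<nu> $ j))" for \<nu>
      by (intro mult_nonneg_nonneg V A0 prod_nonneg A)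
    have "(\<Sum>\<nu>\<in>N. V \<nu> * A0 (?s \<nu>) * (\<Prod>j\<in>UNIV. A j (\<nu> $ j)))\<^sup>2 = (\<Sum>\<nu>\<in>N. ?h \<nu> * A0 (?s \<nu>))\<^sup>2"
      by (simp add: mult_ac)
    also have "\<dots> \<le> (\<Sum>\<mu>\<in>?s ` N. (A0 \<mu>)\<^sup>2) * ?Q N A"
      by (rule sum_duality[OF N])
    also have "\<dots> \<le> (\<Sum>\<mu>\<in>?s ` N. (A0 \<mu>)\<^sup>2) * (L * (\<Prod>j\<in>UNIV. \<Sum>\<kappa>\<in>S. (A j \<kappa>)\<^sup>2))"
      by (intro mult_left_mono Q S N A sum_nonneg) (auto simp: S_def)
    also have "\<dots> \<le> (sqrt L + 1)\<^sup>2 * ((\<Sum>\<mu>\<in>?s ` N. (A0 \<mu>)\<^sup>2) * (\<Prod>j\<in>UNIV. \<Sum>\<kappa>\<in>S. (A j \<kappa>)\<^sup>2))"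
    proof -
      have "L \<le> (sqrt L + 1)\<^sup>2" using L by (simp add: power2_sum)
      then have "L * ((\<Sum>\<mu>\<in>?s ` N. (A0 \<mu>)\<^sup>2) * (\<Prod>j\<in>UNIV. \<Sum>\<kappa>\<in>S. (A j \<kappa>)\<^sup>2))
        \<le> (sqrt L + 1)\<^sup>2 * ((\<Sum>\<mu>\<in>?s ` N. (A0 \<mu>)\<^sup>2) * (\<Prod>j\<in>UNIV. \<Sum>\<kappa>\<in>S. (A j \<kappa>)\<^sup>2))"
        by (intro mult_right_mono mult_nonneg_nonneg prod_nonneg sum_nonneg) auto
      then show ?thesis by (simp only: mult_ac)
    qed
    finally have X: "(\<Sum>\<nu>\<in>N. V \<nu> * A0 (?s \<nu>) * (\<Prod>j\<in>UNIV. A j (\<nu> $ j)))\<^sup>2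
      \<le> (sqrt L + 1)\<^sup>2 * ((\<Sum>\<mu>\<in>?s ` N. (A0 \<mu>)\<^sup>2) * (\<Prod>j\<in>UNIV. \<Sum>\<kappa>\<in>S. (A j \<kappa>)\<^sup>2))" .
    show "(\<Sum>\<nu>\<in>N. ennreal (V \<nu> * A0 (?s \<nu>) * (\<Prod>j\<in>UNIV. A j (\<nu> $ j)))) \<le> ?R"
    proof (rule ennreal_power2_le_cancel)
      have "(\<Sum>\<nu>\<in>N. ennreal (V \<nu> * A0 (?s \<nu>) * (\<Prod>j\<in>UNIV. A j (\<nu> $ j))))\<^sup>2
        = ennreal ((\<Sum>\<nu>\<in>N. V \<nu> * A0 (?s \<nu>) * (\<Prod>j\<in>UNIV. A j (\<nu> $ j)))\<^sup>2)"
        using X0 by (simp only: sum_ennreal ennreal_power sum_nonneg)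
      also have "\<dots> \<le> ennreal ((sqrt L + 1)\<^sup>2 * ((\<Sum>\<mu>\<in>?s ` N. (A0 \<mu>)\<^sup>2) * (\<Prod>j\<in>UNIV. \<Sum>\<kappa>\<in>S. (A j \<kappa>)\<^sup>2)))"
        by (rule ennreal_leI[OF X])
      also have "\<dots> = (ennreal (sqrt L + 1))\<^sup>2 * (ennreal (\<Sum>\<mu>\<in>?s ` N. (A0 \<mu>)\<^sup>2) * (\<Prod>j\<in>UNIV. ennreal (\<Sum>\<kappa>\<in>S. (A j \<kappa>)\<^sup>2)))"
        using L by (simp add: ennreal_mult ennreal_power prod_ennreal sum_nonneg prod_nonneg del: ennreal_plus)
      also have "\<dots> \<le> (ennreal (sqrt L + 1))\<^sup>2 * ((Lp_norm (count_space UNIV) 2 (\<lambda>\<mu>. ennreal (A0 \<mu>)))\<^sup>2 *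
          (\<Prod>j\<in>UNIV. (Lp_norm (count_space UNIV) 2 (\<lambda>\<mu>. ennreal (A j \<mu>)))\<^sup>2))"
        using N S A A0 by (intro mult_mono order_refl ennreal_prod_mono sum_squares_le_Lp_norm) auto
      also have "\<dots> = ?R\<^sup>2" by (simp add: power_mult_distrib prod_power_distrib)
      finally show "(\<Sum>\<nu>\<in>N. ennreal (V \<nu> * A0 (?s \<nu>) * (\<Prod>j\<in>UNIV. A j (\<nu> $ j))))\<^sup>2 \<le> ?R\<^sup>2" .
    qed
  qed
  have "0 < sqrt L + 1" using L by (simp add: add_nonneg_pos)
  with main V show ?thesis unfolding B_class_def by blast
qed

theorem theorem1p3:
  fixes V :: "(int ^ 'n) ^ 'm \<Rightarrow> real"
  assumes "\<forall>\<nu>. 0 \<le> V \<nu>"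
    and "bounded (range V)"
  shows "((\<exists>(q :: 'm \<Rightarrow> ennreal) (r :: ennreal). (\<forall>j. 0 < q j) \<and> 0 < r \<and>
            (\<forall>\<sigma> \<in> symbol_class (extend_weight V).
               amalgam_bounded (pseudo_op \<sigma>) (\<lambda>_. 2) q 2 r))
          \<longrightarrow> V \<in> B_class)
       \<and> (V \<in> B_class \<longrightarrow>
            (\<forall>\<sigma> \<in> symbol_class (extend_weight V).
               \<forall>(q :: 'm \<Rightarrow> ennreal) (r :: ennreal).
                 (\<forall>j. 0 < q j) \<and> 0 < r \<and> (\<Sum>j\<in>UNIV. 1 / q j) \<ge> 1 / r \<longrightarrow>
                 amalgam_bounded (pseudo_op \<sigma>) (\<lambda>_. 2) q 2 r))"
proof -
  obtain B where "\<And>\<nu>. norm (V \<nu>) \<le> B" using assms(2) by (auto simp: bounded_iff)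
  then have B: "\<And>\<nu>. V \<nu> \<le> B" by (simp add: abs_le_iff)
  have V: "\<And>\<nu>. 0 \<le> V \<nu>" using assms(1) by blast
  show ?thesis
  proof (intro conjI impI ballI allI)
    assume "\<exists>(q :: 'm \<Rightarrow> ennreal) (r :: ennreal). (\<forall>j. 0 < q j) \<and> 0 < r \<and>
      (\<forall>\<sigma> \<in> symbol_class (extend_weight V). amalgam_bounded (pseudo_op \<sigma>) (\<lambda>_. 2) q 2 r)"
    then obtain q :: "'m \<Rightarrow> ennreal" and r where "\<And>j. 0 < q j" "0 < r"
      "\<And>\<sigma>. \<sigma> \<in> symbol_class (extend_weight V) \<Longrightarrow> amalgam_bounded (pseudo_op \<sigma>) (\<lambda>_. 2) q 2 r"
      by auto
    then show "V \<in> B_class" by (rule B_class_necessary[OF V B])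
  next
    fix \<sigma> and q :: "'m \<Rightarrow> ennreal" and r :: ennreal
    assume "V \<in> B_class" "\<sigma> \<in> symbol_class (extend_weight V)"
      and "(\<forall>j. 0 < q j) \<and> 0 < r \<and> (\<Sum>j\<in>UNIV. 1 / q j) \<ge> 1 / r"
    then show "amalgam_bounded (pseudo_op \<sigma>) (\<lambda>_. 2) q 2 r"
      by (intro B_class_sufficient[OF _ B]) auto
  qed
qed

end
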